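(* Let $G$ be a finite group. There is a $\mathbb{C}$-linear equivalence between the category of $\mathbb{C}R_{\mathbb{C},G}$-modules and the category of modules over the $\mathbb{C}$-algebra $\mathbb{C}R_{\mathbb{C}}(G)$.
   Context: For a finite group $H$, $R_{\mathbb{C}}(H)$ is the Grothendieck ring of finitely generated $\mathbb{C}H$-modules (product induced by $\otimes_{\mathbb{C}}$) and $\mathbb{C}R_{\mathbb{C}}(H)=\mathbb{C}\otimes_{\mathbb{Z}}R_{\mathbb{C}}(H)$. The shifted Green biset functor $\mathbb{C}R_{\mathbb{C},G}$ has values $\mathbb{C}R_{\mathbb{C},G}(H)=\mathbb{C}R_{\mathbb{C}}(H\times G)$. The category $\mathcal{P}_{\mathbb{C}R_{\mathbb{C},G}}$ has the finite groups as objects and $\mathrm{Hom}(H,K)=\mathbb{C}R_{\mathbb{C}}(K\times H\times G)$. The composite of the classes of a $\mathbb{C}[L\times K\times G]$-module $V$ and a $\mathbb{C}[K\times H\times G]$-module $W$ is $[V]\circ[W]=[(V\otimes_{\mathbb{C}}W)_K]$, the coinvariants under the diagonal action of $K$, with $G$ acting diagonally (on characters: $(\chi\circ\theta)(l,h,g)=\frac{1}{|K|}\sum_{x\in K}\chi(l,x,g)\theta(x,h,g)$), extended $\mathbb{C}$-bilinearly. The identity of $H$ is the class of $\mathbb{C}H$ with $(h_1,h_2,g)\cdot x=h_1xh_2^{-1}$. The category of modules over the Green biset functor $\mathbb{C}R_{\mathbb{C},G}$ is, up to a known $\mathbb{C}$-linear equivalence, the category of $\mathbb{C}$-linear functors from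 $\mathcal{P}_{\mathbb{C}R_{\mathbb{C},G}}$ to $\mathbb{C}$-vector spaces, with natural transformations as morphisms. *)

theory Defs
  imports
    "HOL-Algebra.Algebra"
    "HOL-Library.Infinite_Typeclass"
    "Jordan_Normal_Form.Matrix_Kernel"
begin

section \<open>Linear categories over the complex numbers\<close>

text \<open>Hom-sets carry a vector space structure, given as a \<open>module\<close> record whose ring fields
  \<open>mult\<close> and \<open>one\<close> are irrelevant. Arrows do not carry their source and target, so composition
  takes three objects: \<open>Comp C x y z g f\<close> is \<open>g \<circ> f\<close> for \<open>f : x \<rightarrow> y\<close> and \<open>g : y \<rightarrow> z\<close>.\<close>

record ('o, 'm) lcat =
  Ob :: "'o set"
  Hom :: "'o \<Rightarrow> 'o \<Rightarrow> (complex, 'm) module"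
  Comp :: "'o \<Rightarrow> 'o \<Rightarrow> 'o \<Rightarrow> 'm \<Rightarrow> 'm \<Rightarrow> 'm"
  Id :: "'o \<Rightarrow> 'm"

abbreviation Cfield :: "complex ring"
  where "Cfield \<equiv> class_ring"

locale linear_category =
  fixes C :: "('o, 'm) lcat"
  assumes Hom_vectorspace:
      "\<lbrakk>x \<in> Ob C; y \<in> Ob C\<rbrakk> \<Longrightarrow> vectorspace Cfield (Hom C x y)"
    and Id_closed: "x \<in> Ob C \<Longrightarrow> Id C x \<in> carrier (Hom C x x)"
    and Comp_linear_left:
      "\<lbrakk>x \<in> Ob C; y \<in> Ob C; z \<in> Ob C; f \<in> carrier (Hom C x y)\<rbrakk>
        \<Longrightarrow> (\<lambda>g. Comp C x y z g f) \<in> module_hom Cfield (Hom C y z) (Hom C x z)"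
    and Comp_linear_right:
      "\<lbrakk>x \<in> Ob C; y \<in> Ob C; z \<in> Ob C; g \<in> carrier (Hom C y z)\<rbrakk>
        \<Longrightarrow> (\<lambda>f. Comp C x y z g f) \<in> module_hom Cfield (Hom C x y) (Hom C x z)"
    and Comp_assoc:
      "\<lbrakk>w \<in> Ob C; x \<in> Ob C; y \<in> Ob C; z \<in> Ob C; f \<in> carrier (Hom C w x);
        g \<in> carrier (Hom C x y); h \<in> carrier (Hom C y z)\<rbrakk>
        \<Longrightarrow> Comp C w y z h (Comp C w x y g f) = Comp C w x z (Comp C x y z h g) f"
    and Id_left:
      "\<lbrakk>x \<in> Ob C; y \<in> Ob C; f \<in> carrier (Hom C x y)\<rbrakk> \<Longrightarrow> Comp C x y y (Id C y) f = f"
    and Id_right: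
      "\<lbrakk>x \<in> Ob C; y \<in> Ob C; f \<in> carrier (Hom C x y)\<rbrakk> \<Longrightarrow> Comp C x x y f (Id C x) = f"

record ('o, 'm, 'p, 'n) ftor =
  FOb :: "'o \<Rightarrow> 'p"
  FMap :: "'o \<Rightarrow> 'o \<Rightarrow> 'm \<Rightarrow> 'n"

locale linear_functor = C: linear_category C + D: linear_category D
  for C :: "('o, 'm) lcat" and D :: "('p, 'n) lcat" +
  fixes F :: "('o, 'm, 'p, 'n) ftor"
  assumes FOb_closed: "x \<in> Ob C \<Longrightarrow> FOb F x \<in> Ob D"
    and FMap_linear:
      "\<lbrakk>x \<in> Ob C; y \<in> Ob C\<rbrakk>
        \<Longrightarrow> FMap F x y \<in> module_hom Cfield (Hom C x y) (Hom D (FOb F x) (FOb F y))"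
    and FMap_Id: "x \<in> Ob C \<Longrightarrow> FMap F x x (Id C x) = Id D (FOb F x)"
    and FMap_Comp:
      "\<lbrakk>x \<in> Ob C; y \<in> Ob C; z \<in> Ob C; f \<in> carrier (Hom C x y); g \<in> carrier (Hom C y z)\<rbrakk>
        \<Longrightarrow> FMap F x z (Comp C x y z g f)
          = Comp D (FOb F x) (FOb F y) (FOb F z) (FMap F y z g) (FMap F x y f)"

definition id_ftor :: "('o, 'm, 'o, 'm) ftor"
  where "id_ftor = \<lparr>FOb = (\<lambda>x. x), FMap = (\<lambda>x y f. f)\<rparr>"

definition comp_ftor ::
    "('p, 'n, 'q, 'k) ftor \<Rightarrow> ('o, 'm, 'p, 'n) ftor \<Rightarrow> ('o, 'm, 'q, 'k) ftor"
  where "comp_ftor G F =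
    \<lparr>FOb = (\<lambda>x. FOb G (FOb F x)),
     FMap = (\<lambda>x y f. FMap G (FOb F x) (FOb F y) (FMap F x y f))\<rparr>"

text \<open>Natural transformations are made extensional on the objects, so that equality of
  families is equality of natural transformations.\<close>

definition nat_trans ::
    "('o, 'm) lcat \<Rightarrow> ('p, 'n) lcat \<Rightarrow> ('o, 'm, 'p, 'n) ftor \<Rightarrow> ('o, 'm, 'p, 'n) ftor
      \<Rightarrow> ('o \<Rightarrow> 'n) set"
  where "nat_trans C D F G =
    {\<eta> \<in> (\<Pi>\<^sub>E x\<in>Ob C. carrier (Hom D (FOb F x) (FOb G x))).
      \<forall>x\<in>Ob C. \<forall>y\<in>Ob C. \<forall>f\<in>carrier (Hom C x y).
        Comp D (FOb F x) (FOb F y) (FOb G y) (\<eta> y) (FMap F x y f)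
        = Comp D (FOb F x) (FOb G x) (FOb G y) (FMap G x y f) (\<eta> x)}"

definition is_iso :: "('o, 'm) lcat \<Rightarrow> 'o \<Rightarrow> 'o \<Rightarrow> 'm \<Rightarrow> bool"
  where "is_iso C x y f \<longleftrightarrow> f \<in> carrier (Hom C x y) \<and>
    (\<exists>g\<in>carrier (Hom C y x). Comp C x y x g f = Id C x \<and> Comp C y x y f g = Id C y)"

definition nat_isomorphic ::
    "('o, 'm) lcat \<Rightarrow> ('p, 'n) lcat \<Rightarrow> ('o, 'm, 'p, 'n) ftor \<Rightarrow> ('o, 'm, 'p, 'n) ftor \<Rightarrow> bool"
  where "nat_isomorphic C D F G \<longleftrightarrow>
    (\<exists>\<eta>\<in>nat_trans C D F G. \<forall>x\<in>Ob C. is_iso D (FOb F x) (FOb G x) (\<eta> x))"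

definition linearly_equivalent :: "('o, 'm) lcat \<Rightarrow> ('p, 'n) lcat \<Rightarrow> bool"
  where "linearly_equivalent C D \<longleftrightarrow>
    (\<exists>F G. linear_functor C D F \<and> linear_functor D C G
      \<and> nat_isomorphic C C (comp_ftor G F) id_ftor
      \<and> nat_isomorphic D D (comp_ftor F G) id_ftor)"

definition functor_category ::
    "('o, 'm) lcat \<Rightarrow> ('p, 'n) lcat \<Rightarrow> (('o, 'm, 'p, 'n) ftor, 'o \<Rightarrow> 'n) lcat"
  where "functor_category C D =
    \<lparr>Ob = {F. linear_functor C D F},
     Hom = (\<lambda>F G.
       \<lparr>carrier = nat_trans C D F G,
        monoid.mult = undefined,
        monoid.one = undefined,
        ring.zero = (\<lambda>x\<in>Ob C. \<zero>\<^bsub>Hom D (FOb F x) (FOb G x)\<^esub>),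
        ring.add = (\<lambda>\<eta> \<theta>. \<lambda>x\<in>Ob C. \<eta> x \<oplus>\<^bsub>Hom D (FOb F x) (FOb G x)\<^esub> \<theta> x),
        module.smult = (\<lambda>c \<eta>. \<lambda>x\<in>Ob C. c \<odot>\<^bsub>Hom D (FOb F x) (FOb G x)\<^esub> \<eta> x)\<rparr>),
     Comp = (\<lambda>F G H \<theta> \<eta>. \<lambda>x\<in>Ob C. Comp D (FOb F x) (FOb G x) (FOb H x) (\<theta> x) (\<eta> x)),
     Id = (\<lambda>F. \<lambda>x\<in>Ob C. Id D (FOb F x))\<rparr>"


section \<open>Modules over a commutative complex algebra\<close>

text \<open>Modules whose underlying set is contained in the type \<open>'v\<close>; arrows are made extensional
  on the source. The complex scalars act on a module through \<open>c \<mapsto> c \<cdot> 1\<close> in the algebra.\<close>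

definition module_category ::
    "(complex, 'a) module \<Rightarrow> (('a, 'v) module, 'v \<Rightarrow> 'v) lcat"
  where "module_category A =
    \<lparr>Ob = {M. Module.module A M},
     Hom = (\<lambda>M N.
       \<lparr>carrier = module_hom A M N \<inter> extensional (carrier M),
        monoid.mult = undefined,
        monoid.one = undefined,
        ring.zero = (\<lambda>m\<in>carrier M. \<zero>\<^bsub>N\<^esub>),
        ring.add = (\<lambda>f g. \<lambda>m\<in>carrier M. f m \<oplus>\<^bsub>N\<^esub> g m),
        module.smult = (\<lambda>c f. \<lambda>m\<in>carrier M. (c \<odot>\<^bsub>A\<^esub> \<one>\<^bsub>A\<^esub>) \<odot>\<^bsub>N\<^esub> f m)\<rparr>),
     Comp = (\<lambda>L M N g f. \<lambda>m\<in>carrier L. g (f m)),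
     Id = (\<lambda>M. \<lambda>m\<in>carrier M. m)\<rparr>"

definition vect_category :: "((complex, 'v) module, 'v \<Rightarrow> 'v) lcat"
  where "vect_category =
    \<lparr>Ob = {V. vectorspace Cfield V},
     Hom = (\<lambda>V W.
       \<lparr>carrier = module_hom Cfield V W \<inter> extensional (carrier V),
        monoid.mult = undefined,
        monoid.one = undefined,
        ring.zero = (\<lambda>v\<in>carrier V. \<zero>\<^bsub>W\<^esub>),
        ring.add = (\<lambda>f g. \<lambda>v\<in>carrier V. f v \<oplus>\<^bsub>W\<^esub> g v),
        module.smult = (\<lambda>c f. \<lambda>v\<in>carrier V. c \<odot>\<^bsub>W\<^esub> f v)\<rparr>),
     Comp = (\<lambda>U V W g f. \<lambda>u\<in>carrier U. g (f u)),
     Id = (\<lambda>V. \<lambda>v\<in>carrier V. v)\<rparr>"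


section \<open>The Grothendieck group of finitely generated modules over the group algebra\<close>

text \<open>A finitely generated \<open>\<complex>H\<close>-module is a finite-dimensional complex vector space with a linear
  action of \<open>H\<close>. It is given in coordinates: \<open>(n, \<rho>)\<close> is the space \<open>\<complex>\<^sup>n\<close> of column vectors, on which
  \<open>h\<close> acts by the matrix \<open>\<rho> h\<close>.\<close>

type_synonym 'a rep = "nat \<times> ('a \<Rightarrow> complex mat)"

abbreviation rdim :: "'a rep \<Rightarrow> nat"
  where "rdim \<equiv> fst"

abbreviation ract :: "'a rep \<Rightarrow> 'a \<Rightarrow> complex mat"
  where "ract \<equiv> snd"

definition reps :: "('a, 'b) monoid_scheme \<Rightarrow> 'a rep set"
  where "reps H =
    {V. (\<forall>h\<in>carrier H. ract V h \<in> carrier_mat (rdim V) (rdim V))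
      \<and> ract V \<one>\<^bsub>H\<^esub> = 1\<^sub>m (rdim V)
      \<and> (\<forall>x\<in>carrier H. \<forall>y\<in>carrier H. ract V (x \<otimes>\<^bsub>H\<^esub> y) = ract V x * ract V y)}"

definition rep_homs :: "('a, 'b) monoid_scheme \<Rightarrow> 'a rep \<Rightarrow> 'a rep \<Rightarrow> complex mat set"
  where "rep_homs H V W =
    {A \<in> carrier_mat (rdim W) (rdim V). \<forall>h\<in>carrier H. A * ract V h = ract W h * A}"

definition short_exact :: "('a, 'b) monoid_scheme \<Rightarrow> 'a rep \<Rightarrow> 'a rep \<Rightarrow> 'a rep \<Rightarrow> bool"
  where "short_exact H U V W \<longleftrightarrow>
    (\<exists>A\<in>rep_homs H U V. \<exists>B\<in>rep_homs H V W.
      inj_on (\<lambda>u. A *\<^sub>v u) (carrier_vec (rdim U))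
      \<and> (\<lambda>u. A *\<^sub>v u) ` carrier_vec (rdim U) = mat_kernel B
      \<and> (\<lambda>v. B *\<^sub>v v) ` carrier_vec (rdim V) = carrier_vec (rdim W))"

text \<open>\<open>R_C H\<close> is an abelian group in the multiplicative notation of \<open>monoid\<close>.\<close>

definition K0_relations :: "('a, 'b) monoid_scheme \<Rightarrow> ('a rep \<Rightarrow>\<^sub>0 int) set"
  where "K0_relations H =
    generate (free_Abelian_group (reps H))
      {frag_of V - frag_of U - frag_of W | U V W.
        U \<in> reps H \<and> V \<in> reps H \<and> W \<in> reps H \<and> short_exact H U V W}"

definition R_C :: "('a, 'b) monoid_scheme \<Rightarrow> ('a rep \<Rightarrow>\<^sub>0 int) set monoid"
  where "R_C H = free_Abelian_group (reps H) Mod K0_relations H"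

definition rep_class :: "('a, 'b) monoid_scheme \<Rightarrow> 'a rep \<Rightarrow> ('a rep \<Rightarrow>\<^sub>0 int) set"
  where "rep_class H V = K0_relations H #>\<^bsub>free_Abelian_group (reps H)\<^esub> frag_of V"


section \<open>Extension of scalars from the integers to the complex numbers\<close>

text \<open>For an abelian group \<open>A\<close>, written multiplicatively, \<open>\<complex> \<otimes>\<^sub>\<int> A\<close> is the free abelian group on
  \<open>\<complex> \<times> A\<close> modulo biadditivity. A scalar \<open>c\<close> acts by \<open>c (d \<otimes> a) = c d \<otimes> a\<close>; multiplying the image
  of a coset by the subgroup of relations makes it a coset again, also for \<open>c = 0\<close>.\<close>

definition tensor_relations :: "'a monoid \<Rightarrow> (complex \<times> 'a \<Rightarrow>\<^sub>0 int) set"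
  where "tensor_relations A =
    generate (free_Abelian_group (UNIV \<times> carrier A))
      ({frag_of (c + d, a) - frag_of (c, a) - frag_of (d, a) | c d a. a \<in> carrier A}
       \<union> {frag_of (c, a \<otimes>\<^bsub>A\<^esub> b) - frag_of (c, a) - frag_of (c, b) | c a b.
            a \<in> carrier A \<and> b \<in> carrier A})"

definition complex_tensor :: "'a monoid \<Rightarrow> (complex, (complex \<times> 'a \<Rightarrow>\<^sub>0 int) set) module"
  where "complex_tensor A =
    (let F = free_Abelian_group (UNIV \<times> carrier A); N = tensor_relations A in
      \<lparr>carrier = carrier (F Mod N),
       monoid.mult = undefined,
       monoid.one = undefined,
       ring.zero = \<one>\<^bsub>F Mod N\<^esub>,
       ring.add = monoid.mult (F Mod N),
       module.smult = (\<lambda>c S. set_mult F N (frag_extend (\<lambda>(d, a). frag_of (c * d, a)) ` S))\<rparr>)"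

definition pure_tensor :: "'a monoid \<Rightarrow> complex \<Rightarrow> 'a \<Rightarrow> (complex \<times> 'a \<Rightarrow>\<^sub>0 int) set"
  where "pure_tensor A c a =
    tensor_relations A #>\<^bsub>free_Abelian_group (UNIV \<times> carrier A)\<^esub> frag_of (c, a)"


section \<open>The algebra of the complexified representation ring\<close>

type_synonym 'a cr = "(complex \<times> ('a rep \<Rightarrow>\<^sub>0 int) set \<Rightarrow>\<^sub>0 int) set"

definition CR_space :: "('a, 'b) monoid_scheme \<Rightarrow> (complex, 'a cr) module"
  where "CR_space H = complex_tensor (R_C H)"

definition CR_class :: "('a, 'b) monoid_scheme \<Rightarrow> 'a rep \<Rightarrow> 'a cr"
  where "CR_class H V = pure_tensor (R_C H) 1 (rep_class H V)"

fun CR_lincomb :: "('a, 'b) monoid_scheme \<Rightarrow> (complex \<times> 'a rep) list \<Rightarrow> 'a cr"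
  where
    "CR_lincomb H [] = \<zero>\<^bsub>CR_space H\<^esub>"
  | "CR_lincomb H ((c, V) # xs) =
      (c \<odot>\<^bsub>CR_space H\<^esub> CR_class H V) \<oplus>\<^bsub>CR_space H\<^esub> CR_lincomb H xs"

text \<open>The classes of modules span \<open>CR_space\<close>, so an operation on modules that respects the
  relations of the Grothendieck groups determines a bilinear map; its value at \<open>(x, y)\<close> is read
  off from any way of writing \<open>x\<close> and \<open>y\<close> as linear combinations of classes.\<close>

definition bilinear_extension ::
    "('a, 'r) monoid_scheme \<Rightarrow> ('b, 's) monoid_scheme \<Rightarrow> ('c, 't) monoid_scheme
      \<Rightarrow> ('a rep \<Rightarrow> 'b rep \<Rightarrow> 'c rep) \<Rightarrow> 'a cr \<Rightarrow> 'b cr \<Rightarrow> 'c cr"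
  where "bilinear_extension H K L m x y =
    (THE z. \<exists>xs ys.
      set xs \<subseteq> UNIV \<times> reps H \<and> x = CR_lincomb H xs \<and>
      set ys \<subseteq> UNIV \<times> reps K \<and> y = CR_lincomb K ys \<and>
      z = CR_lincomb L [(c * d, m V W). (c, V) \<leftarrow> xs, (d, W) \<leftarrow> ys])"

text \<open>Kronecker product, with \<open>e\<^sub>i \<otimes> e\<^sub>j\<close> numbered \<open>i * n + j\<close>, where \<open>n\<close> is the dimension of the
  second factor.\<close>

definition kron :: "complex mat \<Rightarrow> complex mat \<Rightarrow> complex mat"
  where "kron A B =
    mat (dim_row A * dim_row B) (dim_col A * dim_col B)
      (\<lambda>(i, j). A $$ (i div dim_row B, j div dim_col B) * B $$ (i mod dim_row B, j mod dim_col B))"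

definition tensor_rep :: "'a rep \<Rightarrow> 'a rep \<Rightarrow> 'a rep"
  where "tensor_rep V W = (rdim V * rdim W, \<lambda>h. kron (ract V h) (ract W h))"

definition trivial_rep :: "'a rep"
  where "trivial_rep = (1, \<lambda>_. 1\<^sub>m 1)"

definition CR :: "('a, 'b) monoid_scheme \<Rightarrow> (complex, 'a cr) module"
  where "CR H = (CR_space H)
    \<lparr>monoid.mult := bilinear_extension H H H tensor_rep,
     monoid.one := CR_class H trivial_rep\<rparr>"


section \<open>The category associated with the shifted functor\<close>

text \<open>\<open>V \<otimes> W\<close> as a module over \<open>L \<times> K \<times> H \<times> G\<close>: the groups \<open>K\<close> and \<open>G\<close> act diagonally.\<close>

definition middle_tensor ::
    "'h monoid \<Rightarrow> 'h monoid \<Rightarrow> 'h monoid \<Rightarrow> 'g monoid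
      \<Rightarrow> ('h \<times> 'h \<times> 'g) rep \<Rightarrow> ('h \<times> 'h \<times> 'g) rep \<Rightarrow> ('h \<times> 'h \<times> 'h \<times> 'g) rep"
  where "middle_tensor L K H G V W =
    (rdim V * rdim W, \<lambda>(l, k, h, g). kron (ract V (l, k, g)) (ract W (k, h, g)))"

text \<open>\<open>U\<close> is the module of \<open>K\<close>-coinvariants of \<open>T\<close>: there is a surjection \<open>P : T \<rightarrow> U\<close> of
  \<open>L \<times> H \<times> G\<close>-modules whose kernel is spanned by the vectors \<open>k v - v\<close>.\<close>

definition is_coinvariants ::
    "'h monoid \<Rightarrow> 'h monoid \<Rightarrow> 'h monoid \<Rightarrow> 'g monoid
      \<Rightarrow> ('h \<times> 'h \<times> 'h \<times> 'g) rep \<Rightarrow> ('h \<times> 'h \<times> 'g) rep \<Rightarrow> bool"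
  where "is_coinvariants L K H G T U \<longleftrightarrow>
    U \<in> reps (L \<times>\<times> (H \<times>\<times> G)) \<and>
    (\<exists>P\<in>carrier_mat (rdim U) (rdim T).
      (\<lambda>v. P *\<^sub>v v) ` carrier_vec (rdim T) = carrier_vec (rdim U)
      \<and> mat_kernel P =
          LinearCombinations.module.span Cfield (module_vec TYPE(complex) (rdim T))
            {ract T (\<one>\<^bsub>L\<^esub>, k, \<one>\<^bsub>H\<^esub>, \<one>\<^bsub>G\<^esub>) *\<^sub>v v - v | k v.
              k \<in> carrier K \<and> v \<in> carrier_vec (rdim T)}
      \<and> (\<forall>l\<in>carrier L. \<forall>h\<in>carrier H. \<forall>g\<in>carrier G.
          P * ract T (l, \<one>\<^bsub>K\<^esub>, h, g) = ract U (l, h, g) * P))"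

definition comp_rep ::
    "'h monoid \<Rightarrow> 'h monoid \<Rightarrow> 'h monoid \<Rightarrow> 'g monoid
      \<Rightarrow> ('h \<times> 'h \<times> 'g) rep \<Rightarrow> ('h \<times> 'h \<times> 'g) rep \<Rightarrow> ('h \<times> 'h \<times> 'g) rep"
  where "comp_rep L K H G V W =
    (SOME U. is_coinvariants L K H G (middle_tensor L K H G V W) U)"

text \<open>\<open>\<complex>H\<close> with \<open>(h\<^sub>1, h\<^sub>2, g) \<cdot> x = h\<^sub>1 x h\<^sub>2\<^sup>-\<^sup>1\<close>, in coordinates with respect to an enumeration \<open>e\<close>
  of the basis \<open>H\<close>; another choice of \<open>e\<close> gives an isomorphic module.\<close>

definition regular_rep :: "'h monoid \<Rightarrow> ('h \<times> 'h \<times> 'g) rep"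
  where "regular_rep H =
    (let n = card (carrier H); e = (SOME e. bij_betw e {0..<n} (carrier H)) in
      (n, \<lambda>(h1, h2, g). mat n n
        (\<lambda>(i, j). if e i = h1 \<otimes>\<^bsub>H\<^esub> e j \<otimes>\<^bsub>H\<^esub> inv\<^bsub>H\<^esub> h2 then 1 else 0)))"

text \<open>The objects are the finite groups whose underlying set is contained in the type \<open>'h\<close>;
  if \<open>'h\<close> is infinite, these represent all isomorphism classes of finite groups.\<close>

definition P_CR :: "'g monoid \<Rightarrow> ('h monoid, ('h \<times> 'h \<times> 'g) cr) lcat"
  where "P_CR G =
    \<lparr>Ob = {H. group H \<and> finite (carrier H)},
     Hom = (\<lambda>H K. CR (K \<times>\<times> (H \<times>\<times> G))),
     Comp = (\<lambda>H K L.
       bilinear_extension (L \<times>\<times> (K \<times>\<times> G)) (K \<times>\<times> (H \<times>\<times> G)) (L \<times>\<times> (H \<times>\<times> G)) (comp_rep L K H G)),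
     Id = (\<lambda>H. CR_class (H \<times>\<times> (H \<times>\<times> G)) (regular_rep H))\<rparr>"

text \<open>Modules over the Green biset functor, as linear functors on \<open>P_CR G\<close>. The two type arguments
  are the types containing the finite groups and the vector spaces under consideration.\<close>

definition CRG_modules ::
    "'h itself \<Rightarrow> 'v itself \<Rightarrow> 'g monoid
      \<Rightarrow> (('h monoid, ('h \<times> 'h \<times> 'g) cr, (complex, 'v) module, 'v \<Rightarrow> 'v) ftor, 'h monoid \<Rightarrow> 'v \<Rightarrow> 'v) lcat"
  where "CRG_modules _ _ G = functor_category (P_CR G) vect_category"

end

theory Submission
  imports Defs "Jordan_Normal_Form.Spectral_Radius"
begin

text \<open>The theorem is an instance of Morita theory for linear functors. Suppose that a linear category
\<open>P\<close> has an object \<open>e\<close> such that every identity is a finite sum \<open>id\<^sub>x = \<Sum>i. a\<^sub>i b\<^sub>i\<close> of arrows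
\<open>x \<rightarrow> e \<rightarrow> x\<close>. Then a linear functor on \<open>P\<close> is determined, up to isomorphism, by its value at \<open>e\<close> as a
module over the algebra \<open>A\<close> of endomorphisms of \<open>e\<close>: a natural transformation is determined by its
component at \<open>e\<close>, every \<open>A\<close>-linear map occurs as such a component
(\<open>bij_betw_component_at_generator\<close>), and every \<open>A\<close>-module \<open>M\<close> is the value at \<open>e\<close> of the functor
\<open>x \<mapsto> Hom\<^sub>A(P(x, e), M)\<close> (\<open>ex_functor_with_value\<close>). So evaluation at \<open>e\<close> is an equivalence.

In the category of the shifted functor the trivial group \<open>1\<close> is such an object. Its endomorphism
algebra is the representation algebra of \<open>1 \<times> 1 \<times> G\<close>, which is that of \<open>G\<close>. The identity of \<open>H\<close> is the
class of \<open>\<complex>H\<close>, and \<open>\<complex>H \<cong> \<Oplus> S \<otimes> S*\<close> as a module over \<open>H \<times> H\<close>, the sum being over the irreducible \<open>S\<close>.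
Here \<open>S \<otimes> S*\<close> is the composite of \<open>S : 1 \<rightarrow> H\<close> and \<open>S* : H \<rightarrow> 1\<close>, which gives the factorization of the
identity (\<open>identity_factors\<close>).

All computations in this category take place in terms of characters. The character identifies the
complexified Grothendieck group of a finite group with its space of class functions
(\<open>CR_character_inj\<close>, \<open>CR_character_of_function\<close>). Composition then becomes the averaged product
\<open>(l, h, g) \<mapsto> 1/|K| \<Sum>k. \<chi>(l, k, g) \<theta>(k, h, g)\<close> (\<open>P_CR_comp\<close>), the axioms of a linear category become
identities between finite sums, and the factorization of the identity becomes the second
orthogonality relation (\<open>sum_irr_characters\<close>).

That the characters do identify the two spaces is shown as follows. The Grothendieck group imposes
the relations of short exact sequences. A module with an endomorphism that is not a scalar is an
extension of smaller modules, namely of the image of the endomorphism minus an eigenvalue by its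
kernel (\<open>decompose_non_brick\<close>), so the modules with only scalar endomorphisms, called bricks, generate.
By averaging over the group, the characters of bricks are orthonormal, and bricks with the same
character are isomorphic. A class function orthogonal to the characters of all bricks is orthogonal
to the translates of the regular character, hence zero.

One set-theoretic point remains: the modules and the vector spaces of the theorem have to lie in one
fixed type. Since a complex vector space is infinite or zero, a finite power \<open>M\<^sup>I\<close> injects into \<open>M\<close>, and
the values of the functor above, which embed into such powers, can be moved into the type of \<open>M\<close>
(\<open>ex_inj_on_PiE_module\<close>).\<close>

section \<open>Modules over complex algebras\<close>

text \<open>Negatives are obtained as \<open>(- 1) x\<close>, so \<open>0 x = 0\<close> replaces
  the existence of inverses. For carriers such as extensional functions or cosets this spares a
  construction of the negative.\<close>

lemma moduleI_zero:
  assumes R: "cring R"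
    and add_closed: "\<And>x y. \<lbrakk>x \<in> carrier M; y \<in> carrier M\<rbrakk> \<Longrightarrow> x \<oplus>\<^bsub>M\<^esub> y \<in> carrier M"
    and zero_closed: "\<zero>\<^bsub>M\<^esub> \<in> carrier M"
    and add_assoc: "\<And>x y z. \<lbrakk>x \<in> carrier M; y \<in> carrier M; z \<in> carrier M\<rbrakk>
      \<Longrightarrow> (x \<oplus>\<^bsub>M\<^esub> y) \<oplus>\<^bsub>M\<^esub> z = x \<oplus>\<^bsub>M\<^esub> (y \<oplus>\<^bsub>M\<^esub> z)"
    and add_comm: "\<And>x y. \<lbrakk>x \<in> carrier M; y \<in> carrier M\<rbrakk> \<Longrightarrow> x \<oplus>\<^bsub>M\<^esub> y = y \<oplus>\<^bsub>M\<^esub> x"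
    and zero_left: "\<And>x. x \<in> carrier M \<Longrightarrow> \<zero>\<^bsub>M\<^esub> \<oplus>\<^bsub>M\<^esub> x = x"
    and smult_closed: "\<And>a x. \<lbrakk>a \<in> carrier R; x \<in> carrier M\<rbrakk> \<Longrightarrow> a \<odot>\<^bsub>M\<^esub> x \<in> carrier M"
    and smult_l_distr: "\<And>a b x. \<lbrakk>a \<in> carrier R; b \<in> carrier R; x \<in> carrier M\<rbrakk>
      \<Longrightarrow> (a \<oplus>\<^bsub>R\<^esub> b) \<odot>\<^bsub>M\<^esub> x = a \<odot>\<^bsub>M\<^esub> x \<oplus>\<^bsub>M\<^esub> b \<odot>\<^bsub>M\<^esub> x"
    and smult_r_distr: "\<And>a x y. \<lbrakk>a \<in> carrier R; x \<in> carrier M; y \<in> carrier M\<rbrakk>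
      \<Longrightarrow> a \<odot>\<^bsub>M\<^esub> (x \<oplus>\<^bsub>M\<^esub> y) = a \<odot>\<^bsub>M\<^esub> x \<oplus>\<^bsub>M\<^esub> a \<odot>\<^bsub>M\<^esub> y"
    and smult_assoc: "\<And>a b x. \<lbrakk>a \<in> carrier R; b \<in> carrier R; x \<in> carrier M\<rbrakk>
      \<Longrightarrow> (a \<otimes>\<^bsub>R\<^esub> b) \<odot>\<^bsub>M\<^esub> x = a \<odot>\<^bsub>M\<^esub> (b \<odot>\<^bsub>M\<^esub> x)"
    and smult_one: "\<And>x. x \<in> carrier M \<Longrightarrow> \<one>\<^bsub>R\<^esub> \<odot>\<^bsub>M\<^esub> x = x"
    and smult_zero: "\<And>x. x \<in> carrier M \<Longrightarrow> \<zero>\<^bsub>R\<^esub> \<odot>\<^bsub>M\<^esub> x = \<zero>\<^bsub>M\<^esub>"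
  shows "Module.module R M"
proof -
  interpret R: cring R by (rule R)
  have inv: "\<exists>y\<in>carrier M. y \<oplus>\<^bsub>M\<^esub> x = \<zero>\<^bsub>M\<^esub>" if x: "x \<in> carrier M" for x
  proof (rule bexI)
    have "(\<ominus>\<^bsub>R\<^esub> \<one>\<^bsub>R\<^esub>) \<odot>\<^bsub>M\<^esub> x \<oplus>\<^bsub>M\<^esub> x = (\<ominus>\<^bsub>R\<^esub> \<one>\<^bsub>R\<^esub> \<oplus>\<^bsub>R\<^esub> \<one>\<^bsub>R\<^esub>) \<odot>\<^bsub>M\<^esub> x"
      using x by (simp add: smult_l_distr smult_one)
    also have "\<dots> = \<zero>\<^bsub>M\<^esub>" using x by (simp add: R.l_neg smult_zero)
    finally show "(\<ominus>\<^bsub>R\<^esub> \<one>\<^bsub>R\<^esub>) \<odot>\<^bsub>M\<^esub> x \<oplus>\<^bsub>M\<^esub> x = \<zero>\<^bsub>M\<^esub>" .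
    show "(\<ominus>\<^bsub>R\<^esub> \<one>\<^bsub>R\<^esub>) \<odot>\<^bsub>M\<^esub> x \<in> carrier M" using x by (simp add: smult_closed)
  qed
  have "abelian_group M"
    by (rule abelian_groupI) (fact add_closed zero_closed add_assoc add_comm zero_left inv)+
  with R show ?thesis
    by (rule moduleI) (fact smult_closed smult_l_distr smult_r_distr smult_assoc smult_one)+
qed

lemma vectorspace_iff_module: "vectorspace Cfield V \<longleftrightarrow> Module.module Cfield V"
proof
  assume "vectorspace Cfield V"
  then show "Module.module Cfield V" by (rule vectorspace.axioms(1))
next
  assume "Module.module Cfield V"
  then show "vectorspace Cfield V"
    by (rule vectorspace.intro) (rule class_field.field_axioms)
qed

lemma cring_Cfield: "cring Cfield"
  by (rule class_cring.cring_axioms)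

lemmas vectorspaceI = moduleI_zero[OF cring_Cfield, folded vectorspace_iff_module, simplified]

lemma module_homI:
  assumes "\<And>x. x \<in> carrier M \<Longrightarrow> f x \<in> carrier N"
    and "\<And>x y. \<lbrakk>x \<in> carrier M; y \<in> carrier M\<rbrakk> \<Longrightarrow> f (x \<oplus>\<^bsub>M\<^esub> y) = f x \<oplus>\<^bsub>N\<^esub> f y"
    and "\<And>a x. \<lbrakk>a \<in> carrier R; x \<in> carrier M\<rbrakk> \<Longrightarrow> f (a \<odot>\<^bsub>M\<^esub> x) = a \<odot>\<^bsub>N\<^esub> f x"
  shows "f \<in> module_hom R M N"
  using assms by (auto simp: module_hom_def)

lemma module_homD:
  assumes "f \<in> module_hom R M N"
  shows "x \<in> carrier M \<Longrightarrow> f x \<in> carrier N"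
    and "\<lbrakk>x \<in> carrier M; y \<in> carrier M\<rbrakk> \<Longrightarrow> f (x \<oplus>\<^bsub>M\<^esub> y) = f x \<oplus>\<^bsub>N\<^esub> f y"
    and "\<lbrakk>a \<in> carrier R; x \<in> carrier M\<rbrakk> \<Longrightarrow> f (a \<odot>\<^bsub>M\<^esub> x) = a \<odot>\<^bsub>N\<^esub> f x"
  using assms by (auto simp: module_hom_def)

lemma module_hom_zero:
  assumes M: "Module.module R M" and N: "Module.module R N" and f: "f \<in> module_hom R M N"
  shows "f \<zero>\<^bsub>M\<^esub> = \<zero>\<^bsub>N\<^esub>"
proof -
  interpret M: module R M by (rule M)
  interpret N: module R N by (rule N)
  have "f (\<zero>\<^bsub>R\<^esub> \<odot>\<^bsub>M\<^esub> \<zero>\<^bsub>M\<^esub>) = \<zero>\<^bsub>R\<^esub> \<odot>\<^bsub>N\<^esub> f \<zero>\<^bsub>M\<^esub>"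
    by (rule module_homD(3)[OF f]) auto
  then show ?thesis using module_homD(1)[OF f, of "\<zero>\<^bsub>M\<^esub>"] by simp
qed

lemma module_hom_finsum:
  assumes M: "Module.module R M" and N: "Module.module R N" and f: "f \<in> module_hom R M N"
    and fin: "finite I" and g: "\<And>i. i \<in> I \<Longrightarrow> g i \<in> carrier M"
  shows "f (finsum M g I) = finsum N (\<lambda>i. f (g i)) I"
proof -
  interpret M: module R M by (rule M)
  interpret N: module R N by (rule N)
  note fh = module_homD[OF f]
  from fin g show ?thesis
  proof (induction I)
    case empty
    then show ?case by (simp add: module_hom_zero[OF M N f])
  next
    case (insert i I)
    then have "g \<in> I \<rightarrow> carrier M" "(\<lambda>i. f (g i)) \<in> I \<rightarrow> carrier N" by (auto intro: fh(1))
    with insert show ?case by (simp add: fh M.finsum_closed)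
  qed
qed

lemma finsum_in_module:
  assumes "Module.module R M" and "\<And>i. i \<in> I \<Longrightarrow> g i \<in> carrier M"
  shows "finsum M g I \<in> carrier M"
proof -
  interpret M: module R M by (rule assms)
  show ?thesis using assms(2) by (intro M.finsum_closed) auto
qed

text \<open>The Hom-space of \<^const>\<open>module_category\<close>, but with source and target
  in different types: it is also needed when the source consists of the arrows of a
  category.\<close>

definition hom_module ::
    "(complex, 'a) module \<Rightarrow> ('a, 'u) module \<Rightarrow> ('a, 'v) module \<Rightarrow> (complex, 'u \<Rightarrow> 'v) module"
  where "hom_module A M N =
    \<lparr>carrier = module_hom A M N \<inter> extensional (carrier M),
     monoid.mult = undefined,
     monoid.one = undefined,
     ring.zero = (\<lambda>m\<in>carrier M. \<zero>\<^bsub>N\<^esub>),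
     ring.add = (\<lambda>f g. \<lambda>m\<in>carrier M. f m \<oplus>\<^bsub>N\<^esub> g m),
     module.smult = (\<lambda>c f. \<lambda>m\<in>carrier M. (c \<odot>\<^bsub>A\<^esub> \<one>\<^bsub>A\<^esub>) \<odot>\<^bsub>N\<^esub> f m)\<rparr>"

lemma hom_module_simps:
  "carrier (hom_module A M N) = module_hom A M N \<inter> extensional (carrier M)"
  "\<zero>\<^bsub>hom_module A M N\<^esub> = (\<lambda>m\<in>carrier M. \<zero>\<^bsub>N\<^esub>)"
  "f \<oplus>\<^bsub>hom_module A M N\<^esub> g = (\<lambda>m\<in>carrier M. f m \<oplus>\<^bsub>N\<^esub> g m)"
  "c \<odot>\<^bsub>hom_module A M N\<^esub> f = (\<lambda>m\<in>carrier M. (c \<odot>\<^bsub>A\<^esub> \<one>\<^bsub>A\<^esub>) \<odot>\<^bsub>N\<^esub> f m)"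
  by (simp_all add: hom_module_def)

lemma algebra_scalars:
  assumes A: "algebra Cfield A"
  shows "c \<odot>\<^bsub>A\<^esub> \<one>\<^bsub>A\<^esub> \<in> carrier A"
    and "(c + d) \<odot>\<^bsub>A\<^esub> \<one>\<^bsub>A\<^esub> = c \<odot>\<^bsub>A\<^esub> \<one>\<^bsub>A\<^esub> \<oplus>\<^bsub>A\<^esub> d \<odot>\<^bsub>A\<^esub> \<one>\<^bsub>A\<^esub>"
    and "(c * d) \<odot>\<^bsub>A\<^esub> \<one>\<^bsub>A\<^esub> = (c \<odot>\<^bsub>A\<^esub> \<one>\<^bsub>A\<^esub>) \<otimes>\<^bsub>A\<^esub> (d \<odot>\<^bsub>A\<^esub> \<one>\<^bsub>A\<^esub>)"
    and "1 \<odot>\<^bsub>A\<^esub> \<one>\<^bsub>A\<^esub> = \<one>\<^bsub>A\<^esub>"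
    and "0 \<odot>\<^bsub>A\<^esub> \<one>\<^bsub>A\<^esub> = \<zero>\<^bsub>A\<^esub>"
    and "x \<in> carrier A \<Longrightarrow> (c \<odot>\<^bsub>A\<^esub> \<one>\<^bsub>A\<^esub>) \<otimes>\<^bsub>A\<^esub> x = c \<odot>\<^bsub>A\<^esub> x"
proof -
  interpret algebra Cfield A by (rule A)
  show "c \<odot>\<^bsub>A\<^esub> \<one>\<^bsub>A\<^esub> \<in> carrier A" using smult_closed by simp
  show "(c + d) \<odot>\<^bsub>A\<^esub> \<one>\<^bsub>A\<^esub> = c \<odot>\<^bsub>A\<^esub> \<one>\<^bsub>A\<^esub> \<oplus>\<^bsub>A\<^esub> d \<odot>\<^bsub>A\<^esub> \<one>\<^bsub>A\<^esub>"
    using smult_l_distr by simp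
  show "(c * d) \<odot>\<^bsub>A\<^esub> \<one>\<^bsub>A\<^esub> = (c \<odot>\<^bsub>A\<^esub> \<one>\<^bsub>A\<^esub>) \<otimes>\<^bsub>A\<^esub> (d \<odot>\<^bsub>A\<^esub> \<one>\<^bsub>A\<^esub>)"
    using smult_assoc1 smult_assoc2 smult_closed by simp
  show "1 \<odot>\<^bsub>A\<^esub> \<one>\<^bsub>A\<^esub> = \<one>\<^bsub>A\<^esub>" using smult_one by simp
  show "0 \<odot>\<^bsub>A\<^esub> \<one>\<^bsub>A\<^esub> = \<zero>\<^bsub>A\<^esub>" using smult_l_null by simp
  show "(c \<odot>\<^bsub>A\<^esub> \<one>\<^bsub>A\<^esub>) \<otimes>\<^bsub>A\<^esub> x = c \<odot>\<^bsub>A\<^esub> x" if "x \<in> carrier A"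
    using smult_assoc2 that by simp
qed

text \<open>A scalar multiple of an \<open>A\<close>-linear map is \<open>A\<close>-linear because
  \<open>c 1\<close> commutes with \<open>A\<close>.\<close>

lemma hom_module_vectorspace:
  assumes A: "algebra Cfield A" and M: "Module.module A M" and N: "Module.module A N"
  shows "vectorspace Cfield (hom_module A M N)"
proof -
  interpret A: algebra Cfield A by (rule A)
  interpret M: module A M by (rule M)
  interpret N: module A N by (rule N)
  note sc = algebra_scalars[OF A]
  have ac: "f x \<in> carrier N" if "f \<in> module_hom A M N" "x \<in> carrier M" for f x
    using that by (rule module_homD)
  note hd = module_homD(2,3)
  show ?thesis
  proof (rule vectorspaceI, unfold hom_module_simps)
    show "(\<lambda>m\<in>carrier M. \<zero>\<^bsub>N\<^esub>) \<in> module_hom A M N \<inter> extensional (carrier M)"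
      by (auto intro!: module_homI)
    fix f g h assume f: "f \<in> module_hom A M N \<inter> extensional (carrier M)"
    have f': "f \<in> module_hom A M N" using f by auto
    show "(\<lambda>m\<in>carrier M. (\<lambda>m\<in>carrier M. \<zero>\<^bsub>N\<^esub>) m \<oplus>\<^bsub>N\<^esub> f m) = f"
      using f by (intro ext) (auto simp: extensional_def ac)
    show "(\<lambda>m\<in>carrier M. (1 \<odot>\<^bsub>A\<^esub> \<one>\<^bsub>A\<^esub>) \<odot>\<^bsub>N\<^esub> f m) = f"
      using f by (intro ext) (auto simp: extensional_def ac sc)
    show "(\<lambda>m\<in>carrier M. (0 \<odot>\<^bsub>A\<^esub> \<one>\<^bsub>A\<^esub>) \<odot>\<^bsub>N\<^esub> f m) = (\<lambda>m\<in>carrier M. \<zero>\<^bsub>N\<^esub>)"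
      using f by (intro ext) (auto simp: extensional_def ac sc)
    fix c d
    show "(\<lambda>m\<in>carrier M. (c \<odot>\<^bsub>A\<^esub> \<one>\<^bsub>A\<^esub>) \<odot>\<^bsub>N\<^esub> f m) \<in> module_hom A M N \<inter> extensional (carrier M)"
      using f' by (auto intro!: module_homI simp: hd ac sc(1) N.smult_r_distr
          simp flip: N.smult_assoc1) (simp add: A.m_comm sc(1))
    show "(\<lambda>m\<in>carrier M. ((c + d) \<odot>\<^bsub>A\<^esub> \<one>\<^bsub>A\<^esub>) \<odot>\<^bsub>N\<^esub> f m) =
       (\<lambda>m\<in>carrier M. (\<lambda>m\<in>carrier M. (c \<odot>\<^bsub>A\<^esub> \<one>\<^bsub>A\<^esub>) \<odot>\<^bsub>N\<^esub> f m) m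
          \<oplus>\<^bsub>N\<^esub> (\<lambda>m\<in>carrier M. (d \<odot>\<^bsub>A\<^esub> \<one>\<^bsub>A\<^esub>) \<odot>\<^bsub>N\<^esub> f m) m)"
      using f' by (intro ext) (auto simp: sc(1,2) ac N.smult_l_distr)
    show "(\<lambda>m\<in>carrier M. ((c * d) \<odot>\<^bsub>A\<^esub> \<one>\<^bsub>A\<^esub>) \<odot>\<^bsub>N\<^esub> f m) =
       (\<lambda>m\<in>carrier M. (c \<odot>\<^bsub>A\<^esub> \<one>\<^bsub>A\<^esub>) \<odot>\<^bsub>N\<^esub> (\<lambda>m\<in>carrier M. (d \<odot>\<^bsub>A\<^esub> \<one>\<^bsub>A\<^esub>) \<odot>\<^bsub>N\<^esub> f m) m)"
      using f' by (intro ext) (auto simp: sc(1,3) ac N.smult_assoc1)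
    assume g: "g \<in> module_hom A M N \<inter> extensional (carrier M)"
    then have g': "g \<in> module_hom A M N" by auto
    have aux: "(a \<oplus>\<^bsub>N\<^esub> b) \<oplus>\<^bsub>N\<^esub> (c \<oplus>\<^bsub>N\<^esub> d) = (a \<oplus>\<^bsub>N\<^esub> c) \<oplus>\<^bsub>N\<^esub> (b \<oplus>\<^bsub>N\<^esub> d)"
      if "a \<in> carrier N" "b \<in> carrier N" "c \<in> carrier N" "d \<in> carrier N" for a b c d
      using that by (simp add: N.a_ac)
    show "(\<lambda>m\<in>carrier M. f m \<oplus>\<^bsub>N\<^esub> g m) \<in> module_hom A M N \<inter> extensional (carrier M)"
      using f' g' by (auto intro!: module_homI simp: hd ac N.smult_r_distr aux)
    show "(\<lambda>m\<in>carrier M. f m \<oplus>\<^bsub>N\<^esub> g m) = (\<lambda>m\<in>carrier M. g m \<oplus>\<^bsub>N\<^esub> f m)"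
      using f' g' by (intro ext) (auto simp: ac N.a_comm)
    show "(\<lambda>m\<in>carrier M. (c \<odot>\<^bsub>A\<^esub> \<one>\<^bsub>A\<^esub>) \<odot>\<^bsub>N\<^esub> (\<lambda>m\<in>carrier M. f m \<oplus>\<^bsub>N\<^esub> g m) m) =
       (\<lambda>m\<in>carrier M. (\<lambda>m\<in>carrier M. (c \<odot>\<^bsub>A\<^esub> \<one>\<^bsub>A\<^esub>) \<odot>\<^bsub>N\<^esub> f m) m
          \<oplus>\<^bsub>N\<^esub> (\<lambda>m\<in>carrier M. (c \<odot>\<^bsub>A\<^esub> \<one>\<^bsub>A\<^esub>) \<odot>\<^bsub>N\<^esub> g m) m)"
      using f' g' by (intro ext) (auto simp: ac sc N.smult_r_distr)
    assume h: "h \<in> module_hom A M N \<inter> extensional (carrier M)"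
    then have h': "h \<in> module_hom A M N" by auto
    show "(\<lambda>m\<in>carrier M. (\<lambda>m\<in>carrier M. f m \<oplus>\<^bsub>N\<^esub> g m) m \<oplus>\<^bsub>N\<^esub> h m) =
       (\<lambda>m\<in>carrier M. f m \<oplus>\<^bsub>N\<^esub> (\<lambda>m\<in>carrier M. g m \<oplus>\<^bsub>N\<^esub> h m) m)"
      using f' g' h' by (intro ext) (auto simp: ac N.a_assoc)
  qed
qed

lemma module_category_simps:
  "Ob (module_category A) = {M. Module.module A M}"
  "Hom (module_category A) M N = hom_module A M N"
  "Comp (module_category A) L M N g f = (\<lambda>m\<in>carrier L. g (f m))"
  "Id (module_category A) M = (\<lambda>m\<in>carrier M. m)"
  by (simp_all add: module_category_def hom_module_def)

lemma linear_category_module_category: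
  fixes A :: "(complex, 'a) module"
  assumes A: "algebra Cfield A"
  shows "linear_category (module_category A :: (('a, 'b) module, 'b \<Rightarrow> 'b) lcat)"
proof -
  note sc = algebra_scalars[OF A]
  note hd = module_homD
  show ?thesis
  proof (rule linear_category.intro, unfold module_category_simps, unfold mem_Collect_eq)
    fix L M N :: "('a, 'b) module" assume L: "Module.module A L" and M: "Module.module A M"
    interpret L: module A L by (rule L)
    interpret M: module A M by (rule M)
    show "vectorspace Cfield (hom_module A L M)" using A L M by (rule hom_module_vectorspace)
    show "(\<lambda>m\<in>carrier L. m) \<in> carrier (hom_module A L L)"
      by (auto simp: hom_module_simps intro!: module_homI L.smult_closed L.a_closed)
    fix f assume f: "f \<in> carrier (hom_module A L M)"
    show "(\<lambda>m\<in>carrier L. (\<lambda>m\<in>carrier M. m) (f m)) = f"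
      using f by (intro ext) (auto simp: hom_module_simps extensional_def hd)
    show "(\<lambda>m\<in>carrier L. f ((\<lambda>m\<in>carrier L. m) m)) = f"
      using f by (intro ext) (auto simp: hom_module_simps extensional_def hd)
    assume N: "Module.module A N"
    interpret N: module A N by (rule N)
    have comp: "(\<lambda>m\<in>carrier L. h (f' m)) \<in> carrier (hom_module A L N)"
      if "f' \<in> carrier (hom_module A L M)" "h \<in> carrier (hom_module A M N)" for f' h
      using that by (auto simp: hom_module_simps hd intro!: module_homI)
    show "(\<lambda>g. \<lambda>m\<in>carrier L. g (f m)) \<in> module_hom Cfield (hom_module A M N) (hom_module A L N)"
      by (rule module_homI, rule comp[OF f])
        (use f in \<open>auto simp: hom_module_simps hd intro!: ext\<close>)
  next
    fix L M N :: "('a, 'b) module" and g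
    assume L: "Module.module A L" and M: "Module.module A M" and N: "Module.module A N"
    interpret L: module A L by (rule L)
    interpret M: module A M by (rule M)
    interpret N: module A N by (rule N)
    assume g: "g \<in> carrier (hom_module A M N)"
    have comp: "(\<lambda>m\<in>carrier L. g (f' m)) \<in> carrier (hom_module A L N)"
      if "f' \<in> carrier (hom_module A L M)" for f'
      using that g by (auto simp: hom_module_simps hd intro!: module_homI)
    show "(\<lambda>f. \<lambda>m\<in>carrier L. g (f m)) \<in> module_hom Cfield (hom_module A L M) (hom_module A L N)"
      by (rule module_homI, rule comp)
        (use g in \<open>auto simp: hom_module_simps hd sc intro!: ext\<close>)
  next
    fix K L M N :: "('a, 'b) module" and f g h
    assume "f \<in> carrier (hom_module A K L)" "g \<in> carrier (hom_module A L M)"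
      "h \<in> carrier (hom_module A M N)"
    then show "(\<lambda>m\<in>carrier K. h ((\<lambda>m\<in>carrier K. g (f m)) m)) =
         (\<lambda>m\<in>carrier K. (\<lambda>m\<in>carrier L. h (g m)) (f m))"
      by (intro ext) (auto simp: hom_module_simps hd)
  qed
qed

text \<open>Vector spaces are the modules over \<open>\<complex>\<close> as an algebra over
  itself, so the category of vector spaces is covered by the category of modules over an
  algebra.\<close>

definition complex_algebra :: "(complex, complex) module"
  where "complex_algebra = \<lparr>carrier = UNIV, monoid.mult = (*), monoid.one = 1,
    ring.zero = 0, ring.add = (+), module.smult = (*)\<rparr>"

lemma cring_complex_algebra: "cring complex_algebra"
proof (rule cringI)
  show "abelian_group complex_algebra"
    by (rule abelian_groupI) (auto simp: complex_algebra_def intro: exI[of _ "- x" for x])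
  show "comm_monoid complex_algebra"
    by (rule comm_monoidI) (auto simp: complex_algebra_def)
qed (auto simp: complex_algebra_def algebra_simps)

lemma module_complex_algebra: "Module.module complex_algebra V \<longleftrightarrow> vectorspace Cfield V"
  unfolding vectorspace_iff_module Module.module_def
  using cring_complex_algebra cring_Cfield by (simp add: module_axioms_def complex_algebra_def)

lemma algebra_complex_algebra: "algebra Cfield complex_algebra"
  by (rule algebraI[OF cring_Cfield cring_complex_algebra])
    (auto simp: complex_algebra_def algebra_simps)

lemma vect_category_eq: "vect_category = module_category complex_algebra"
proof -
  have eq: "module_hom complex_algebra V W = module_hom Cfield V W"
    for V W :: "(complex, 'v) module"
    by (simp add: module_hom_def complex_algebra_def)
  have sc: "c \<odot>\<^bsub>complex_algebra\<^esub> \<one>\<^bsub>complex_algebra\<^esub> = c" for c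
    by (simp add: complex_algebra_def)
  show ?thesis
    unfolding vect_category_def module_category_def module_complex_algebra eq sc ..
qed

lemma linear_category_vect_category: "linear_category vect_category"
  unfolding vect_category_eq
  by (rule linear_category_module_category[OF algebra_complex_algebra])

section \<open>Linear categories and functors\<close>

lemma vectorspaceD:
  assumes "vectorspace Cfield V"
  shows "\<lbrakk>x \<in> carrier V; y \<in> carrier V\<rbrakk> \<Longrightarrow> x \<oplus>\<^bsub>V\<^esub> y \<in> carrier V"
    and "\<zero>\<^bsub>V\<^esub> \<in> carrier V"
    and "\<lbrakk>x \<in> carrier V; y \<in> carrier V; z \<in> carrier V\<rbrakk> \<Longrightarrow> (x \<oplus>\<^bsub>V\<^esub> y) \<oplus>\<^bsub>V\<^esub> z = x \<oplus>\<^bsub>V\<^esub> (y \<oplus>\<^bsub>V\<^esub> z)"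
    and "\<lbrakk>x \<in> carrier V; y \<in> carrier V\<rbrakk> \<Longrightarrow> x \<oplus>\<^bsub>V\<^esub> y = y \<oplus>\<^bsub>V\<^esub> x"
    and "x \<in> carrier V \<Longrightarrow> \<zero>\<^bsub>V\<^esub> \<oplus>\<^bsub>V\<^esub> x = x"
    and "x \<in> carrier V \<Longrightarrow> c \<odot>\<^bsub>V\<^esub> x \<in> carrier V"
    and "x \<in> carrier V \<Longrightarrow> (c + d) \<odot>\<^bsub>V\<^esub> x = c \<odot>\<^bsub>V\<^esub> x \<oplus>\<^bsub>V\<^esub> d \<odot>\<^bsub>V\<^esub> x"
    and "\<lbrakk>x \<in> carrier V; y \<in> carrier V\<rbrakk> \<Longrightarrow> c \<odot>\<^bsub>V\<^esub> (x \<oplus>\<^bsub>V\<^esub> y) = c \<odot>\<^bsub>V\<^esub> x \<oplus>\<^bsub>V\<^esub> c \<odot>\<^bsub>V\<^esub> y"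
    and "x \<in> carrier V \<Longrightarrow> (c * d) \<odot>\<^bsub>V\<^esub> x = c \<odot>\<^bsub>V\<^esub> (d \<odot>\<^bsub>V\<^esub> x)"
    and "x \<in> carrier V \<Longrightarrow> 1 \<odot>\<^bsub>V\<^esub> x = x"
    and "x \<in> carrier V \<Longrightarrow> 0 \<odot>\<^bsub>V\<^esub> x = \<zero>\<^bsub>V\<^esub>"
proof -
  interpret module Cfield V using assms by (simp add: vectorspace_iff_module)
  show "\<lbrakk>x \<in> carrier V; y \<in> carrier V\<rbrakk> \<Longrightarrow> x \<oplus>\<^bsub>V\<^esub> y \<in> carrier V"
    and "\<zero>\<^bsub>V\<^esub> \<in> carrier V"
    and "\<lbrakk>x \<in> carrier V; y \<in> carrier V; z \<in> carrier V\<rbrakk> \<Longrightarrow> (x \<oplus>\<^bsub>V\<^esub> y) \<oplus>\<^bsub>V\<^esub> z = x \<oplus>\<^bsub>V\<^esub> (y \<oplus>\<^bsub>V\<^esub> z)"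
    and "x \<in> carrier V \<Longrightarrow> \<zero>\<^bsub>V\<^esub> \<oplus>\<^bsub>V\<^esub> x = x"
    by (auto simp: M.a_assoc)
  show "\<lbrakk>x \<in> carrier V; y \<in> carrier V\<rbrakk> \<Longrightarrow> x \<oplus>\<^bsub>V\<^esub> y = y \<oplus>\<^bsub>V\<^esub> x"
    by (rule M.a_comm)
  show "x \<in> carrier V \<Longrightarrow> c \<odot>\<^bsub>V\<^esub> x \<in> carrier V" using smult_closed by simp
  show "x \<in> carrier V \<Longrightarrow> (c + d) \<odot>\<^bsub>V\<^esub> x = c \<odot>\<^bsub>V\<^esub> x \<oplus>\<^bsub>V\<^esub> d \<odot>\<^bsub>V\<^esub> x" using smult_l_distr by simp
  show "\<lbrakk>x \<in> carrier V; y \<in> carrier V\<rbrakk> \<Longrightarrow> c \<odot>\<^bsub>V\<^esub> (x \<oplus>\<^bsub>V\<^esub> y) = c \<odot>\<^bsub>V\<^esub> x \<oplus>\<^bsub>V\<^esub> c \<odot>\<^bsub>V\<^esub> y"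
    using smult_r_distr by simp
  show "x \<in> carrier V \<Longrightarrow> (c * d) \<odot>\<^bsub>V\<^esub> x = c \<odot>\<^bsub>V\<^esub> (d \<odot>\<^bsub>V\<^esub> x)" using smult_assoc1 by simp
  show "x \<in> carrier V \<Longrightarrow> 1 \<odot>\<^bsub>V\<^esub> x = x" using smult_one by simp
  show "x \<in> carrier V \<Longrightarrow> 0 \<odot>\<^bsub>V\<^esub> x = \<zero>\<^bsub>V\<^esub>" using smult_l_null by simp
qed

context linear_category begin

lemma Comp_closed:
  "\<lbrakk>x \<in> Ob C; y \<in> Ob C; z \<in> Ob C; f \<in> carrier (Hom C x y); g \<in> carrier (Hom C y z)\<rbrakk>
    \<Longrightarrow> Comp C x y z g f \<in> carrier (Hom C x z)"
  using module_homD(1)[OF Comp_linear_left] by blast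

lemma Comp_add_left:
  "\<lbrakk>x \<in> Ob C; y \<in> Ob C; z \<in> Ob C; f \<in> carrier (Hom C x y); g \<in> carrier (Hom C y z);
    h \<in> carrier (Hom C y z)\<rbrakk>
    \<Longrightarrow> Comp C x y z (g \<oplus>\<^bsub>Hom C y z\<^esub> h) f = Comp C x y z g f \<oplus>\<^bsub>Hom C x z\<^esub> Comp C x y z h f"
  using module_homD(2)[OF Comp_linear_left] by blast

lemma Comp_add_right:
  "\<lbrakk>x \<in> Ob C; y \<in> Ob C; z \<in> Ob C; f \<in> carrier (Hom C x y); h \<in> carrier (Hom C x y);
    g \<in> carrier (Hom C y z)\<rbrakk>
    \<Longrightarrow> Comp C x y z g (f \<oplus>\<^bsub>Hom C x y\<^esub> h) = Comp C x y z g f \<oplus>\<^bsub>Hom C x z\<^esub> Comp C x y z g h"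
  using module_homD(2)[OF Comp_linear_right] by blast

lemma Comp_smult_left:
  "\<lbrakk>x \<in> Ob C; y \<in> Ob C; z \<in> Ob C; f \<in> carrier (Hom C x y); g \<in> carrier (Hom C y z)\<rbrakk>
    \<Longrightarrow> Comp C x y z (c \<odot>\<^bsub>Hom C y z\<^esub> g) f = c \<odot>\<^bsub>Hom C x z\<^esub> Comp C x y z g f"
  using module_homD(3)[OF Comp_linear_left] by simp

lemma Comp_smult_right:
  "\<lbrakk>x \<in> Ob C; y \<in> Ob C; z \<in> Ob C; f \<in> carrier (Hom C x y); g \<in> carrier (Hom C y z)\<rbrakk>
    \<Longrightarrow> Comp C x y z g (c \<odot>\<^bsub>Hom C x y\<^esub> f) = c \<odot>\<^bsub>Hom C x z\<^esub> Comp C x y z g f"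
  using module_homD(3)[OF Comp_linear_right] by simp

lemma Hom_module: "\<lbrakk>x \<in> Ob C; y \<in> Ob C\<rbrakk> \<Longrightarrow> Module.module Cfield (Hom C x y)"
  using Hom_vectorspace vectorspace_iff_module by blast

lemma Comp_zero_left:
  "\<lbrakk>x \<in> Ob C; y \<in> Ob C; z \<in> Ob C; f \<in> carrier (Hom C x y)\<rbrakk>
    \<Longrightarrow> Comp C x y z \<zero>\<^bsub>Hom C y z\<^esub> f = \<zero>\<^bsub>Hom C x z\<^esub>"
  by (rule module_hom_zero[OF Hom_module Hom_module Comp_linear_left])

lemma Comp_zero_right:
  "\<lbrakk>x \<in> Ob C; y \<in> Ob C; z \<in> Ob C; g \<in> carrier (Hom C y z)\<rbrakk>
    \<Longrightarrow> Comp C x y z g \<zero>\<^bsub>Hom C x y\<^esub> = \<zero>\<^bsub>Hom C x z\<^esub>"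
  by (rule module_hom_zero[OF Hom_module Hom_module Comp_linear_right])

lemma Comp_finsum_left:
  "\<lbrakk>x \<in> Ob C; y \<in> Ob C; z \<in> Ob C; f \<in> carrier (Hom C x y); finite I;
    \<And>i. i \<in> I \<Longrightarrow> g i \<in> carrier (Hom C y z)\<rbrakk>
    \<Longrightarrow> Comp C x y z (finsum (Hom C y z) g I) f = finsum (Hom C x z) (\<lambda>i. Comp C x y z (g i) f) I"
  by (rule module_hom_finsum[OF Hom_module Hom_module Comp_linear_left])

lemma Comp_finsum_right:
  "\<lbrakk>x \<in> Ob C; y \<in> Ob C; z \<in> Ob C; g \<in> carrier (Hom C y z); finite I;
    \<And>i. i \<in> I \<Longrightarrow> f i \<in> carrier (Hom C x y)\<rbrakk>
    \<Longrightarrow> Comp C x y z g (finsum (Hom C x y) f I) = finsum (Hom C x z) (\<lambda>i. Comp C x y z g (f i)) I"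
  by (rule module_hom_finsum[OF Hom_module Hom_module Comp_linear_right])

end

lemma finsum_cong_module:
  assumes "Module.module R M" and "\<And>i. i \<in> I \<Longrightarrow> g i = h i" and "\<And>i. i \<in> I \<Longrightarrow> h i \<in> carrier M"
  shows "finsum M g I = finsum M h I"
proof -
  interpret M: module R M by (rule assms)
  show ?thesis using assms(2,3) by (intro M.finsum_cong') auto
qed

lemma (in linear_functor) FMap_closed:
  "\<lbrakk>x \<in> Ob C; y \<in> Ob C; f \<in> carrier (Hom C x y)\<rbrakk>
    \<Longrightarrow> FMap F x y f \<in> carrier (Hom D (FOb F x) (FOb F y))"
  using module_homD(1)[OF FMap_linear] by blast

lemma nat_transI:
  assumes "\<And>x. x \<in> Ob C \<Longrightarrow> \<eta> x \<in> carrier (Hom D (FOb F x) (FOb G x))"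
    and "\<And>x. x \<notin> Ob C \<Longrightarrow> \<eta> x = undefined"
    and "\<And>x y f. \<lbrakk>x \<in> Ob C; y \<in> Ob C; f \<in> carrier (Hom C x y)\<rbrakk> \<Longrightarrow>
        Comp D (FOb F x) (FOb F y) (FOb G y) (\<eta> y) (FMap F x y f)
        = Comp D (FOb F x) (FOb G x) (FOb G y) (FMap G x y f) (\<eta> x)"
  shows "\<eta> \<in> nat_trans C D F G"
  using assms by (auto simp: nat_trans_def PiE_def extensional_def)

lemma nat_transD:
  assumes "\<eta> \<in> nat_trans C D F G"
  shows "x \<in> Ob C \<Longrightarrow> \<eta> x \<in> carrier (Hom D (FOb F x) (FOb G x))"
    and "x \<notin> Ob C \<Longrightarrow> \<eta> x = undefined"
    and "\<lbrakk>x \<in> Ob C; y \<in> Ob C; f \<in> carrier (Hom C x y)\<rbrakk> \<Longrightarrow>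
        Comp D (FOb F x) (FOb F y) (FOb G y) (\<eta> y) (FMap F x y f)
        = Comp D (FOb F x) (FOb G x) (FOb G y) (FMap G x y f) (\<eta> x)"
  using assms by (auto simp: nat_trans_def PiE_def extensional_def)

lemma functor_category_simps:
  "Ob (functor_category C D) = {F. linear_functor C D F}"
  "carrier (Hom (functor_category C D) F G) = nat_trans C D F G"
  "\<zero>\<^bsub>Hom (functor_category C D) F G\<^esub> = (\<lambda>x\<in>Ob C. \<zero>\<^bsub>Hom D (FOb F x) (FOb G x)\<^esub>)"
  "\<eta> \<oplus>\<^bsub>Hom (functor_category C D) F G\<^esub> \<theta> = (\<lambda>x\<in>Ob C. \<eta> x \<oplus>\<^bsub>Hom D (FOb F x) (FOb G x)\<^esub> \<theta> x)"
  "c \<odot>\<^bsub>Hom (functor_category C D) F G\<^esub> \<eta> = (\<lambda>x\<in>Ob C. c \<odot>\<^bsub>Hom D (FOb F x) (FOb G x)\<^esub> \<eta> x)"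
  "Comp (functor_category C D) F G H \<theta> \<eta>
    = (\<lambda>x\<in>Ob C. Comp D (FOb F x) (FOb G x) (FOb H x) (\<theta> x) (\<eta> x))"
  "Id (functor_category C D) F = (\<lambda>x\<in>Ob C. Id D (FOb F x))"
  by (simp_all add: functor_category_def)

lemma linear_category_functor_category:
  assumes C: "linear_category C" and D: "linear_category D"
  shows "linear_category (functor_category C D)"
proof -
  interpret C: linear_category C by (rule C)
  interpret D: linear_category D by (rule D)
  note fo = linear_functor.FOb_closed and fm = linear_functor.FMap_closed
  note dv = vectorspaceD[OF D.Hom_vectorspace]
  have cl: "\<eta> x \<in> carrier (Hom D (FOb F x) (FOb G x))"
    if "\<eta> \<in> nat_trans C D F G" "x \<in> Ob C" for \<eta> F G x
    using that by (rule nat_transD)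
  have undef: "\<eta> x = undefined" if "\<eta> \<in> nat_trans C D F G" "x \<notin> Ob C" for \<eta> F G x
    using that by (rule nat_transD)
  note nat = nat_transD(3)
  show ?thesis
  proof (rule linear_category.intro, unfold functor_category_simps, unfold mem_Collect_eq)
    fix F G assume F: "linear_functor C D F" and G: "linear_functor C D G"
    note FG = fo[OF F] fo[OF G] fm[OF F] fm[OF G]
    let ?H = "\<lambda>x. Hom D (FOb F x) (FOb G x)"
    show "vectorspace Cfield (Hom (functor_category C D) F G)"
    proof (rule vectorspaceI, unfold functor_category_simps)
      show "(\<lambda>x\<in>Ob C. \<zero>\<^bsub>?H x\<^esub>) \<in> nat_trans C D F G"
        by (rule nat_transI) (auto simp: FG dv D.Comp_zero_left D.Comp_zero_right)
      fix \<eta> c d assume e: "\<eta> \<in> nat_trans C D F G"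
      show "(\<lambda>x\<in>Ob C. (\<lambda>x\<in>Ob C. \<zero>\<^bsub>?H x\<^esub>) x
          \<oplus>\<^bsub>?H x\<^esub> \<eta> x) = \<eta>"
        using e by (intro ext) (auto simp: FG dv(5) cl undef)
      show "(\<lambda>x\<in>Ob C. c \<odot>\<^bsub>?H x\<^esub> \<eta> x) \<in> nat_trans C D F G"
        using e by (intro nat_transI)
          (auto simp: FG dv cl D.Comp_smult_left D.Comp_smult_right nat)
      show "(\<lambda>x\<in>Ob C. (c + d) \<odot>\<^bsub>?H x\<^esub> \<eta> x) =
         (\<lambda>x\<in>Ob C. (\<lambda>x\<in>Ob C. c \<odot>\<^bsub>?H x\<^esub> \<eta> x) x
              \<oplus>\<^bsub>?H x\<^esub> (\<lambda>x\<in>Ob C. d \<odot>\<^bsub>?H x\<^esub> \<eta> x) x)"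
        using e by (intro ext) (auto simp: FG dv cl)
      show "(\<lambda>x\<in>Ob C. (c * d) \<odot>\<^bsub>?H x\<^esub> \<eta> x) =
         (\<lambda>x\<in>Ob C. c \<odot>\<^bsub>?H x\<^esub> (\<lambda>x\<in>Ob C. d \<odot>\<^bsub>?H x\<^esub> \<eta> x) x)"
        using e by (intro ext) (auto simp: FG dv cl)
      show "(\<lambda>x\<in>Ob C. 1 \<odot>\<^bsub>?H x\<^esub> \<eta> x) = \<eta>"
        using e by (intro ext) (auto simp: FG dv cl undef)
      show "(\<lambda>x\<in>Ob C. 0 \<odot>\<^bsub>?H x\<^esub> \<eta> x) =
         (\<lambda>x\<in>Ob C. \<zero>\<^bsub>?H x\<^esub>)"
        using e by (intro ext) (auto simp: FG dv cl)
      fix \<theta> assume t: "\<theta> \<in> nat_trans C D F G"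
      show "(\<lambda>x\<in>Ob C. \<eta> x \<oplus>\<^bsub>?H x\<^esub> \<theta> x) \<in> nat_trans C D F G"
        using e t by (intro nat_transI)
          (auto simp: FG dv(1) cl D.Comp_add_left D.Comp_add_right nat)
      show "(\<lambda>x\<in>Ob C. \<eta> x \<oplus>\<^bsub>?H x\<^esub> \<theta> x) =
         (\<lambda>x\<in>Ob C. \<theta> x \<oplus>\<^bsub>?H x\<^esub> \<eta> x)"
        using e t by (intro ext) (auto simp: FG cl intro: dv(4))
      show "(\<lambda>x\<in>Ob C. c \<odot>\<^bsub>?H x\<^esub> (\<lambda>x\<in>Ob C. \<eta> x \<oplus>\<^bsub>?H x\<^esub> \<theta> x) x) =
         (\<lambda>x\<in>Ob C. (\<lambda>x\<in>Ob C. c \<odot>\<^bsub>?H x\<^esub> \<eta> x) x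
             \<oplus>\<^bsub>?H x\<^esub> (\<lambda>x\<in>Ob C. c \<odot>\<^bsub>?H x\<^esub> \<theta> x) x)"
        using e t by (intro ext) (auto simp: FG dv cl)
      fix \<zeta> assume z: "\<zeta> \<in> nat_trans C D F G"
      show "(\<lambda>x\<in>Ob C. (\<lambda>x\<in>Ob C. \<eta> x \<oplus>\<^bsub>?H x\<^esub> \<theta> x) x \<oplus>\<^bsub>?H x\<^esub> \<zeta> x) =
         (\<lambda>x\<in>Ob C. \<eta> x \<oplus>\<^bsub>?H x\<^esub> (\<lambda>x\<in>Ob C. \<theta> x \<oplus>\<^bsub>?H x\<^esub> \<zeta> x) x)"
        using e t z by (intro ext) (auto simp: FG cl intro: dv(3))
    qed
    show "(\<lambda>x\<in>Ob C. Id D (FOb F x)) \<in> nat_trans C D F F"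
      by (rule nat_transI) (auto simp: FG D.Id_closed D.Id_left D.Id_right)
    fix \<eta> assume e: "\<eta> \<in> nat_trans C D F G"
    show "(\<lambda>x\<in>Ob C. Comp D (FOb F x) (FOb G x) (FOb G x) ((\<lambda>x\<in>Ob C. Id D (FOb G x)) x) (\<eta> x)) = \<eta>"
      using e by (intro ext) (auto simp: FG cl undef D.Id_left)
    show "(\<lambda>x\<in>Ob C. Comp D (FOb F x) (FOb F x) (FOb G x) (\<eta> x) ((\<lambda>x\<in>Ob C. Id D (FOb F x)) x)) = \<eta>"
      using e by (intro ext) (auto simp: FG cl undef D.Id_right)
  next
    fix F G H assume F: "linear_functor C D F" and G: "linear_functor C D G" and H: "linear_functor C D H"
    note FG = fo[OF F] fo[OF G] fo[OF H] fm[OF F] fm[OF G] fm[OF H]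
    have comp: "(\<lambda>x\<in>Ob C. Comp D (FOb F x) (FOb G x) (FOb H x) (\<theta> x) (\<eta> x)) \<in> nat_trans C D F H"
      if e: "\<eta> \<in> nat_trans C D F G" and t: "\<theta> \<in> nat_trans C D G H" for \<eta> \<theta>
    proof (rule nat_transI)
      fix x y f assume x: "x \<in> Ob C" "y \<in> Ob C" "f \<in> carrier (Hom C x y)"
      note cls = FG x cl[OF e] cl[OF t]
      have "Comp D (FOb F x) (FOb F y) (FOb H y) (Comp D (FOb F y) (FOb G y) (FOb H y) (\<theta> y) (\<eta> y)) (FMap F x y f)
        = Comp D (FOb F x) (FOb G y) (FOb H y) (\<theta> y) (Comp D (FOb F x) (FOb F y) (FOb G y) (\<eta> y) (FMap F x y f))"
        by (rule D.Comp_assoc[symmetric]) (simp_all add: cls)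
      also have "\<dots> = Comp D (FOb F x) (FOb G y) (FOb H y) (\<theta> y) (Comp D (FOb F x) (FOb G x) (FOb G y) (FMap G x y f) (\<eta> x))"
        using nat[OF e x] by simp
      also have "\<dots> = Comp D (FOb F x) (FOb G x) (FOb H y) (Comp D (FOb G x) (FOb G y) (FOb H y) (\<theta> y) (FMap G x y f)) (\<eta> x)"
        by (rule D.Comp_assoc) (simp_all add: cls)
      also have "\<dots> = Comp D (FOb F x) (FOb G x) (FOb H y) (Comp D (FOb G x) (FOb H x) (FOb H y) (FMap H x y f) (\<theta> x)) (\<eta> x)"
        using nat[OF t x] by simp
      also have "\<dots> = Comp D (FOb F x) (FOb H x) (FOb H y) (FMap H x y f) (Comp D (FOb F x) (FOb G x) (FOb H x) (\<theta> x) (\<eta> x))"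
        by (rule D.Comp_assoc[symmetric]) (simp_all add: cls)
      finally show "Comp D (FOb F x) (FOb F y) (FOb H y) ((\<lambda>x\<in>Ob C. Comp D (FOb F x) (FOb G x) (FOb H x) (\<theta> x) (\<eta> x)) y) (FMap F x y f)
        = Comp D (FOb F x) (FOb H x) (FOb H y) (FMap H x y f) ((\<lambda>x\<in>Ob C. Comp D (FOb F x) (FOb G x) (FOb H x) (\<theta> x) (\<eta> x)) x)"
        using x by simp
    qed (use e t in \<open>auto simp: FG cl D.Comp_closed\<close>)
    show "(\<lambda>g. \<lambda>x\<in>Ob C. Comp D (FOb F x) (FOb G x) (FOb H x) (g x) (\<eta> x))
         \<in> module_hom Cfield (Hom (functor_category C D) G H) (Hom (functor_category C D) F H)"
      if e: "\<eta> \<in> nat_trans C D F G" for \<eta>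
      by (rule module_homI, unfold functor_category_simps, rule comp[OF e])
        (use e in \<open>auto simp: FG cl D.Comp_add_left D.Comp_smult_left intro!: ext\<close>)
    show "(\<lambda>f. \<lambda>x\<in>Ob C. Comp D (FOb F x) (FOb G x) (FOb H x) (\<theta> x) (f x))
         \<in> module_hom Cfield (Hom (functor_category C D) F G) (Hom (functor_category C D) F H)"
      if t: "\<theta> \<in> nat_trans C D G H" for \<theta>
      by (rule module_homI, unfold functor_category_simps, rule comp[OF _ t])
        (use t in \<open>auto simp: FG cl D.Comp_add_right D.Comp_smult_right intro!: ext\<close>)
  next
    fix E F G H \<eta> \<theta> \<zeta> assume E: "linear_functor C D E" and F: "linear_functor C D F" and G: "linear_functor C D G"
      and H: "linear_functor C D H"
      and e: "\<eta> \<in> nat_trans C D E F" and t: "\<theta> \<in> nat_trans C D F G" and z: "\<zeta> \<in> nat_trans C D G H"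
    note FG = fo[OF E] fo[OF F] fo[OF G] fo[OF H]
    show "(\<lambda>x\<in>Ob C. Comp D (FOb E x) (FOb G x) (FOb H x) (\<zeta> x) ((\<lambda>x\<in>Ob C. Comp D (FOb E x) (FOb F x) (FOb G x) (\<theta> x) (\<eta> x)) x))
      = (\<lambda>x\<in>Ob C. Comp D (FOb E x) (FOb F x) (FOb H x) ((\<lambda>x\<in>Ob C. Comp D (FOb F x) (FOb G x) (FOb H x) (\<zeta> x) (\<theta> x)) x) (\<eta> x))"
      by (rule ext) (simp add: FG cl[OF e] cl[OF t] cl[OF z] D.Comp_assoc)
  qed
qed

text \<open>A fully faithful and essentially surjective functor \<open>F\<close> is an
  equivalence. Choose isomorphisms \<open>\<epsilon>\<^sub>d : F(G d) \<rightarrow> d\<close>. The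
  action of \<open>G\<close> on an arrow \<open>g\<close> is forced by \<open>F(G g) =
  \<epsilon>\<^sup>-\<^sup>1 g \<epsilon>\<close>, and every identity about \<open>G\<close> may
  be checked after applying \<open>F\<close>, which is injective on arrows.\<close>

lemma linearly_equivalentI:
  fixes C :: "('o, 'm) lcat" and D :: "('p, 'n) lcat"
  assumes F: "linear_functor C D F"
    and ff: "\<And>x y. \<lbrakk>x \<in> Ob C; y \<in> Ob C\<rbrakk>
      \<Longrightarrow> bij_betw (FMap F x y) (carrier (Hom C x y)) (carrier (Hom D (FOb F x) (FOb F y)))"
    and es: "\<And>d. d \<in> Ob D \<Longrightarrow> \<exists>x\<in>Ob C. \<exists>f. is_iso D (FOb F x) d f"
  shows "linearly_equivalent C D"
proof -
  interpret F: linear_functor C D F by (rule F)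
  note C = F.C.linear_category_axioms and D = F.D.linear_category_axioms
  have "\<forall>d\<in>Ob D. \<exists>x f g. x \<in> Ob C \<and> f \<in> carrier (Hom D (FOb F x) d) \<and> g \<in> carrier (Hom D d (FOb F x))
     \<and> Comp D (FOb F x) d (FOb F x) g f = Id D (FOb F x) \<and> Comp D d (FOb F x) d f g = Id D d"
    using es by (force simp: is_iso_def)
  then obtain G0 \<epsilon> \<epsilon>' where GE: "\<And>d. d \<in> Ob D \<Longrightarrow> G0 d \<in> Ob C
      \<and> \<epsilon> d \<in> carrier (Hom D (FOb F (G0 d)) d) \<and> \<epsilon>' d \<in> carrier (Hom D d (FOb F (G0 d)))
      \<and> Comp D (FOb F (G0 d)) d (FOb F (G0 d)) (\<epsilon>' d) (\<epsilon> d) = Id D (FOb F (G0 d))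
      \<and> Comp D d (FOb F (G0 d)) d (\<epsilon> d) (\<epsilon>' d) = Id D d"
    by metis
  have G0: "G0 d \<in> Ob C" and e: "\<epsilon> d \<in> carrier (Hom D (FOb F (G0 d)) d)"
    and e': "\<epsilon>' d \<in> carrier (Hom D d (FOb F (G0 d)))"
    and e'e: "Comp D (FOb F (G0 d)) d (FOb F (G0 d)) (\<epsilon>' d) (\<epsilon> d) = Id D (FOb F (G0 d))"
    and ee': "Comp D d (FOb F (G0 d)) d (\<epsilon> d) (\<epsilon>' d) = Id D d"
    if "d \<in> Ob D" for d
    using GE[OF that] by auto
  \<comment> \<open>Cancellation of \<open>\<epsilon>\<^sup>-\<^sup>1 \<epsilon>\<close> and
    \<open>\<epsilon> \<epsilon>\<^sup>-\<^sup>1\<close> to the left of an arrow, as rewrite rules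
    for right-nested composites.\<close>
  have e'e_left: "Comp D w d (FOb F (G0 d)) (\<epsilon>' d) (Comp D w (FOb F (G0 d)) d (\<epsilon> d) f) = f"
    if "d \<in> Ob D" "w \<in> Ob D" "f \<in> carrier (Hom D w (FOb F (G0 d)))" for d w f
    using that by (simp add: F.D.Comp_assoc G0 F.FOb_closed e e' e'e F.D.Id_left)
  have ee'_left: "Comp D w (FOb F (G0 d)) d (\<epsilon> d) (Comp D w d (FOb F (G0 d)) (\<epsilon>' d) f) = f"
    if "d \<in> Ob D" "w \<in> Ob D" "f \<in> carrier (Hom D w d)" for d w f
    using that by (simp add: F.D.Comp_assoc G0 F.FOb_closed e e' ee' F.D.Id_left)
  define lift where "lift x y = the_inv_into (carrier (Hom C x y)) (FMap F x y)" for x y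
  have lift: "lift x y u \<in> carrier (Hom C x y)" "FMap F x y (lift x y u) = u"
    if "x \<in> Ob C" "y \<in> Ob C" "u \<in> carrier (Hom D (FOb F x) (FOb F y))" for x y u
    using ff[OF that(1,2)] that(3) unfolding lift_def bij_betw_def
    by (auto intro: the_inv_into_into f_the_inv_into_f)
  have inj: "u = v" if "FMap F x y u = FMap F x y v" "x \<in> Ob C" "y \<in> Ob C"
      "u \<in> carrier (Hom C x y)" "v \<in> carrier (Hom C x y)" for x y u v
    using ff[OF that(2,3)] that unfolding bij_betw_def inj_on_def by blast
  \<comment> \<open>The conjugate \<open>\<epsilon>\<^sup>-\<^sup>1 g \<epsilon>\<close>, which is
    to be \<open>F (G g)\<close>.\<close>
  define K where "K d d' g = Comp D (FOb F (G0 d)) d' (FOb F (G0 d')) (\<epsilon>' d')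
     (Comp D (FOb F (G0 d)) d d' g (\<epsilon> d))" for d d' g
  have K: "K d d' g \<in> carrier (Hom D (FOb F (G0 d)) (FOb F (G0 d')))"
    if "d \<in> Ob D" "d' \<in> Ob D" "g \<in> carrier (Hom D d d')" for d d' g
    using that by (simp add: K_def F.D.Comp_closed F.FOb_closed G0 e e')
  define G where "G = \<lparr>FOb = G0, FMap = (\<lambda>d d' g. lift (G0 d) (G0 d') (K d d' g))\<rparr>"
  have G_simps: "FOb G = G0" "FMap G d d' g = lift (G0 d) (G0 d') (K d d' g)" for d d' g
    by (simp_all add: G_def)
  note FD = module_homD[OF F.FMap_linear]
  note ob = F.FOb_closed G0
  have FG: "FMap F (G0 d) (G0 d') (FMap G d d' g) = K d d' g"
    if "d \<in> Ob D" "d' \<in> Ob D" "g \<in> carrier (Hom D d d')" for d d' g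
    using that by (simp add: G_simps lift K G0)
  have Gc: "FMap G d d' g \<in> carrier (Hom C (G0 d) (G0 d'))"
    if "d \<in> Ob D" "d' \<in> Ob D" "g \<in> carrier (Hom D d d')" for d d' g
    using that by (simp add: G_simps lift K G0)
  note Cv = vectorspaceD[OF F.C.Hom_vectorspace] and Dv = vectorspaceD[OF F.D.Hom_vectorspace]
  have G: "linear_functor D C G"
  proof (intro linear_functor.intro linear_functor_axioms.intro C D)
    fix d d' assume d: "d \<in> Ob D" "d' \<in> Ob D"
    show "FMap G d d' \<in> module_hom Cfield (Hom D d d') (Hom C (FOb G d) (FOb G d'))"
    proof (rule module_homI)
      fix g h c assume g: "g \<in> carrier (Hom D d d')"
      show "FMap G d d' g \<in> carrier (Hom C (FOb G d) (FOb G d'))"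
        using Gc[OF d g] by (simp add: G_simps(1))
      have Kc: "K d d' (c \<odot>\<^bsub>Hom D d d'\<^esub> g) = c \<odot>\<^bsub>Hom D (FOb F (G0 d)) (FOb F (G0 d'))\<^esub> K d d' g"
        unfolding K_def using d g
        by (simp add: F.D.Comp_smult_left F.D.Comp_smult_right F.D.Comp_closed ob e e')
      show "FMap G d d' (c \<odot>\<^bsub>Hom D d d'\<^esub> g) = c \<odot>\<^bsub>Hom C (FOb G d) (FOb G d')\<^esub> FMap G d d' g"
        unfolding G_simps(1)
        by (rule inj[of "G0 d" "G0 d'"]) (use d g in \<open>simp_all add: FG FD ob Gc Kc Dv Cv\<close>)
      assume h: "h \<in> carrier (Hom D d d')"
      have Ka: "K d d' (g \<oplus>\<^bsub>Hom D d d'\<^esub> h) = K d d' g \<oplus>\<^bsub>Hom D (FOb F (G0 d)) (FOb F (G0 d'))\<^esub> K d d' h"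
        unfolding K_def using d g h
        by (simp add: F.D.Comp_add_left F.D.Comp_add_right F.D.Comp_closed ob e e')
      show "FMap G d d' (g \<oplus>\<^bsub>Hom D d d'\<^esub> h) = FMap G d d' g \<oplus>\<^bsub>Hom C (FOb G d) (FOb G d')\<^esub> FMap G d d' h"
        unfolding G_simps(1)
        by (rule inj[of "G0 d" "G0 d'"]) (use d g h in \<open>simp_all add: FG FD ob Gc Ka Dv(1) Cv(1)\<close>)
    qed
  next
    fix d assume d: "d \<in> Ob D"
    show "FOb G d \<in> Ob C" using d by (simp add: G_simps G0)
    show "FMap G d d (Id D d) = Id C (FOb G d)"
      unfolding G_simps(1)
      by (rule inj[of "G0 d" "G0 d"])
        (use d in \<open>simp_all add: FG Gc ob F.D.Id_closed F.C.Id_closed F.FMap_Id,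
          simp add: K_def F.D.Id_left ob e e'e\<close>)
  next
    fix d d' d'' g h assume d: "d \<in> Ob D" "d' \<in> Ob D" "d'' \<in> Ob D"
      and g: "g \<in> carrier (Hom D d d')" and h: "h \<in> carrier (Hom D d' d'')"
    have KK: "K d d'' (Comp D d d' d'' h g)
        = Comp D (FOb F (G0 d)) (FOb F (G0 d')) (FOb F (G0 d'')) (K d' d'' h) (K d d' g)"
      unfolding K_def using d g h
      by (simp add: F.D.Comp_assoc[symmetric] F.D.Comp_closed ob e e' ee'_left)
    show "FMap G d d'' (Comp D d d' d'' h g) = Comp C (FOb G d) (FOb G d') (FOb G d'') (FMap G d' d'' h) (FMap G d d' g)"
      unfolding G_simps(1)
      by (rule inj[of "G0 d" "G0 d''"])
        (use d g h in \<open>simp_all add: FG KK F.FMap_Comp Gc ob F.D.Comp_closed F.C.Comp_closed\<close>)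
  qed
  interpret G: linear_functor D C G by (rule G)
  have "nat_isomorphic C C (comp_ftor G F) id_ftor"
    unfolding nat_isomorphic_def
  proof (intro bexI ballI)
    let ?\<eta> = "\<lambda>x\<in>Ob C. lift (G0 (FOb F x)) x (\<epsilon> (FOb F x))"
    show "?\<eta> \<in> nat_trans C C (comp_ftor G F) id_ftor"
    proof (rule nat_transI)
      fix x y f assume x: "x \<in> Ob C" "y \<in> Ob C" "f \<in> carrier (Hom C x y)"
      show "Comp C (FOb (comp_ftor G F) x) (FOb (comp_ftor G F) y) (FOb id_ftor y) (?\<eta> y) (FMap (comp_ftor G F) x y f)
        = Comp C (FOb (comp_ftor G F) x) (FOb id_ftor x) (FOb id_ftor y) (FMap id_ftor x y f) (?\<eta> x)"
        by (rule inj[of "G0 (FOb F x)" y])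
          (use x in \<open>simp_all add: comp_ftor_def id_ftor_def G_simps(1) F.FMap_Comp FG Gc ob lift e
            F.C.Comp_closed FD(1), simp add: K_def F.D.Comp_closed ob e e' FD(1) ee'_left\<close>)
    qed (auto simp: comp_ftor_def id_ftor_def G_simps(1) ob lift e)
    fix x assume x: "x \<in> Ob C"
    show "is_iso C (FOb (comp_ftor G F) x) (FOb id_ftor x) (?\<eta> x)"
      unfolding is_iso_def
    proof (intro conjI bexI[of _ "lift x (G0 (FOb F x)) (\<epsilon>' (FOb F x))"])
      show "Comp C (FOb (comp_ftor G F) x) (FOb id_ftor x) (FOb (comp_ftor G F) x)
         (lift x (G0 (FOb F x)) (\<epsilon>' (FOb F x))) (?\<eta> x) = Id C (FOb (comp_ftor G F) x)"
        by (rule inj[of "G0 (FOb F x)" "G0 (FOb F x)"])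
          (use x in \<open>simp_all add: comp_ftor_def id_ftor_def G_simps(1) F.FMap_Comp ob lift e e' e'e
            F.C.Comp_closed F.FMap_Id F.C.Id_closed\<close>)
      show "Comp C (FOb id_ftor x) (FOb (comp_ftor G F) x) (FOb id_ftor x) (?\<eta> x)
         (lift x (G0 (FOb F x)) (\<epsilon>' (FOb F x))) = Id C (FOb id_ftor x)"
        by (rule inj[of x x])
          (use x in \<open>simp_all add: comp_ftor_def id_ftor_def G_simps(1) F.FMap_Comp ob lift e e' ee'
            F.C.Comp_closed F.FMap_Id F.C.Id_closed\<close>)
    qed (use x in \<open>auto simp: comp_ftor_def id_ftor_def G_simps(1) ob lift e e'\<close>)
  qed
  moreover have "nat_isomorphic D D (comp_ftor F G) id_ftor"
    unfolding nat_isomorphic_def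
  proof (intro bexI ballI)
    show "(\<lambda>d\<in>Ob D. \<epsilon> d) \<in> nat_trans D D (comp_ftor F G) id_ftor"
    proof (rule nat_transI)
      fix d d' g assume d: "d \<in> Ob D" "d' \<in> Ob D" "g \<in> carrier (Hom D d d')"
      then show "Comp D (FOb (comp_ftor F G) d) (FOb (comp_ftor F G) d') (FOb id_ftor d') ((\<lambda>d\<in>Ob D. \<epsilon> d) d') (FMap (comp_ftor F G) d d' g)
        = Comp D (FOb (comp_ftor F G) d) (FOb id_ftor d) (FOb id_ftor d') (FMap id_ftor d d' g) ((\<lambda>d\<in>Ob D. \<epsilon> d) d)"
        by (simp add: comp_ftor_def id_ftor_def G_simps(1) FG)
          (simp add: K_def F.D.Comp_closed ob e e' ee'_left)
    qed (auto simp: comp_ftor_def id_ftor_def G_simps(1) e)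
    fix d assume d: "d \<in> Ob D"
    then show "is_iso D (FOb (comp_ftor F G) d) (FOb id_ftor d) ((\<lambda>d\<in>Ob D. \<epsilon> d) d)"
      using e[OF d] e'[OF d] e'e[OF d] ee'[OF d]
      by (auto simp: is_iso_def comp_ftor_def id_ftor_def G_simps(1))
  qed
  ultimately show ?thesis
    unfolding linearly_equivalent_def using F G by blast
qed

section \<open>Functors on a category generated by one object\<close>

text \<open>In the additive completion, every object is a direct summand of a finite power of
  \<open>e\<close>.\<close>

locale finitely_generating_object = linear_category P
  for P :: "('o, 'm) lcat" +
  fixes e :: 'o and I :: "'o \<Rightarrow> 'i set" and a b :: "'o \<Rightarrow> 'i \<Rightarrow> 'm"
  assumes e: "e \<in> Ob P"
    and finite_I: "x \<in> Ob P \<Longrightarrow> finite (I x)"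
    and a: "\<lbrakk>x \<in> Ob P; i \<in> I x\<rbrakk> \<Longrightarrow> a x i \<in> carrier (Hom P e x)"
    and b: "\<lbrakk>x \<in> Ob P; i \<in> I x\<rbrakk> \<Longrightarrow> b x i \<in> carrier (Hom P x e)"
    and sum_ab: "x \<in> Ob P \<Longrightarrow> (\<Oplus>\<^bsub>Hom P x x\<^esub>i\<in>I x. Comp P x e x (a x i) (b x i)) = Id P x"
begin

lemma factor_through_generator:
  assumes F: "linear_functor P D F" and x: "x \<in> Ob P" and z: "z \<in> Ob D"
    and u: "u \<in> carrier (Hom D (FOb F x) z)"
  shows "u = (\<Oplus>\<^bsub>Hom D (FOb F x) z\<^esub>i\<in>I x. Comp D (FOb F x) (FOb F e) z
    (Comp D (FOb F e) (FOb F x) z u (FMap F e x (a x i))) (FMap F x e (b x i)))"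
proof -
  interpret F: linear_functor P D F by (rule F)
  note ob = x z e F.FOb_closed and ab = a[OF x] b[OF x]
  have ab': "Comp P x e x (a x i) (b x i) \<in> carrier (Hom P x x)" if "i \<in> I x" for i
    using that by (simp add: Comp_closed ob ab)
  have "u = Comp D (FOb F x) (FOb F x) z u (FMap F x x (Id P x))"
    using u by (simp add: F.FMap_Id ob F.D.Id_right)
  also have "FMap F x x (Id P x)
      = (\<Oplus>\<^bsub>Hom D (FOb F x) (FOb F x)\<^esub>i\<in>I x. FMap F x x (Comp P x e x (a x i) (b x i)))"
    unfolding sum_ab[OF x, symmetric]
    by (rule module_hom_finsum[OF Hom_module F.D.Hom_module F.FMap_linear])
      (simp_all add: ob finite_I ab')
  also have "Comp D (FOb F x) (FOb F x) z u \<dots> = (\<Oplus>\<^bsub>Hom D (FOb F x) z\<^esub>i\<in>I x.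
      Comp D (FOb F x) (FOb F x) z u (FMap F x x (Comp P x e x (a x i) (b x i))))"
    by (rule F.D.Comp_finsum_right) (simp_all add: ob u finite_I F.FMap_closed ab')
  also have "\<dots> = (\<Oplus>\<^bsub>Hom D (FOb F x) z\<^esub>i\<in>I x. Comp D (FOb F x) (FOb F e) z
    (Comp D (FOb F e) (FOb F x) z u (FMap F e x (a x i))) (FMap F x e (b x i)))"
    by (rule finsum_cong_module[OF F.D.Hom_module])
      (simp_all add: ob u ab F.FMap_closed F.FMap_Comp F.D.Comp_assoc F.D.Comp_closed)
  finally show ?thesis .
qed

lemma eq_if_eq_on_generator:
  assumes F: "linear_functor P D F" and x: "x \<in> Ob P" and z: "z \<in> Ob D"
    and u: "u \<in> carrier (Hom D (FOb F x) z)" and v: "v \<in> carrier (Hom D (FOb F x) z)"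
    and eq: "\<And>s. s \<in> carrier (Hom P e x) \<Longrightarrow> Comp D (FOb F e) (FOb F x) z u (FMap F e x s)
      = Comp D (FOb F e) (FOb F x) z v (FMap F e x s)"
  shows "u = v"
proof -
  interpret F: linear_functor P D F by (rule F)
  show ?thesis
    apply (subst factor_through_generator[OF F x z u])
    apply (subst factor_through_generator[OF F x z v])
    by (rule finsum_cong_module[OF F.D.Hom_module])
      (simp_all add: a b x z v e eq F.FMap_closed F.D.Comp_closed F.FOb_closed)
qed

text \<open>If \<open>\<eta>\<close> extends \<open>f\<close>, then \<open>\<eta>\<^sub>x =
  \<Sum>i. \<eta>\<^sub>x F(a\<^sub>i) F(b\<^sub>i) = \<Sum>i. G(a\<^sub>i) f F(b\<^sub>i)\<close>
  by naturality along \<open>a\<^sub>i\<close>; this is the definition of \<open>\<eta>\<close>.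
  For an arrow \<open>s : e \<rightarrow> x\<close> the arrows \<open>b\<^sub>i s\<close> are
  endomorphisms of \<open>e\<close>, with which \<open>f\<close> commutes, so
  \<open>\<eta>\<^sub>x F(s) = G(s) f\<close>. Naturality follows because it can be tested on
  arrows from \<open>e\<close>.\<close>

lemma extend_from_generator:
  assumes F: "linear_functor P D F" and G: "linear_functor P D G"
    and f: "f \<in> carrier (Hom D (FOb F e) (FOb G e))"
    and comm: "\<And>r. r \<in> carrier (Hom P e e) \<Longrightarrow>
      Comp D (FOb F e) (FOb F e) (FOb G e) f (FMap F e e r)
      = Comp D (FOb F e) (FOb G e) (FOb G e) (FMap G e e r) f"
  shows "\<exists>\<eta>\<in>nat_trans P D F G. \<eta> e = f"
proof -
  interpret F: linear_functor P D F by (rule F)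
  interpret G: linear_functor P D G by (rule G)
  note ob = e F.FOb_closed G.FOb_closed
  note cl = F.FMap_closed G.FMap_closed F.D.Comp_closed Comp_closed
  let ?fa = "\<lambda>x i. Comp D (FOb F e) (FOb G e) (FOb G x) (FMap G e x (a x i)) f"
  define \<eta> where "\<eta> = (\<lambda>x\<in>Ob P. \<Oplus>\<^bsub>Hom D (FOb F x) (FOb G x)\<^esub>i\<in>I x.
    Comp D (FOb F x) (FOb F e) (FOb G x) (?fa x i)
      (FMap F x e (b x i)))"
  have \<eta>: "\<eta> x \<in> carrier (Hom D (FOb F x) (FOb G x))" if "x \<in> Ob P" for x
    using that by (auto simp: \<eta>_def intro!: finsum_in_module F.D.Hom_module simp: ob cl a b f)
  \<comment> \<open>Slide \<open>f\<close> past the endomorphism \<open>b\<^sub>i s\<close> of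
    \<open>e\<close> in every summand, then sum up \<open>a\<^sub>i b\<^sub>i\<close> to the
    identity.\<close>
  have gen: "Comp D (FOb F e) (FOb F x) (FOb G x) (\<eta> x) (FMap F e x s)
      = Comp D (FOb F e) (FOb G e) (FOb G x) (FMap G e x s) f"
    if x: "x \<in> Ob P" and s: "s \<in> carrier (Hom P e x)" for x s
  proof -
    note ab = a[OF x] b[OF x]
    let ?bs = "\<lambda>i. Comp P e x e (b x i) s" and ?abs = "\<lambda>i. Comp P e x x (Comp P x e x (a x i) (b x i)) s"
    let ?l = "\<lambda>i. Comp D (FOb F e) (FOb F x) (FOb G x) (Comp D (FOb F x) (FOb F e) (FOb G x) (?fa x i) (FMap F x e (b x i))) (FMap F e x s)"
      and ?r = "\<lambda>i. Comp D (FOb F e) (FOb G e) (FOb G x) (FMap G e x (?abs i)) f"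
    let ?c = "\<lambda>i. Comp D (FOb F e) (FOb F e) (FOb G x) (?fa x i)
      (FMap F e e (?bs i))"
    have "Comp D (FOb F e) (FOb F x) (FOb G x) (\<eta> x) (FMap F e x s)
      = (\<Oplus>\<^bsub>Hom D (FOb F e) (FOb G x)\<^esub>i\<in>I x. ?l i)"
      unfolding \<eta>_def using x
      by (simp, intro F.D.Comp_finsum_left) (simp_all add: ob x s ab cl f finite_I)
    also have "\<dots> = (\<Oplus>\<^bsub>Hom D (FOb F e) (FOb G x)\<^esub>i\<in>I x. ?r i)"
    proof (rule finsum_cong_module[OF F.D.Hom_module])
      fix i assume i: "i \<in> I x"
      have "?l i = ?c i"
        using x s i by (simp add: F.D.Comp_assoc[symmetric] ob cl f ab F.FMap_Comp)
      also have "\<dots> = Comp D (FOb F e) (FOb G e) (FOb G x) (FMap G e x (a x i))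
          (Comp D (FOb F e) (FOb F e) (FOb G e) f (FMap F e e (?bs i)))"
        using x s i by (simp add: F.D.Comp_assoc ob cl f ab)
      also have "Comp D (FOb F e) (FOb F e) (FOb G e) f (FMap F e e (?bs i))
          = Comp D (FOb F e) (FOb G e) (FOb G e) (FMap G e e (?bs i)) f"
        using x s i by (intro comm) (simp add: ob cl ab)
      also have "Comp D (FOb F e) (FOb G e) (FOb G x) (FMap G e x (a x i)) \<dots>
        = ?r i"
        using x s i by (simp add: F.D.Comp_assoc ob cl f ab G.FMap_Comp)
      finally show "?l i = ?r i" .
    qed (use x s in \<open>simp_all add: ob cl f ab\<close>)
    also have "\<dots> = Comp D (FOb F e) (FOb G e) (FOb G x) (\<Oplus>\<^bsub>Hom D (FOb G e) (FOb G x)\<^esub>i\<in>I x.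
        FMap G e x (?abs i)) f"
      by (rule F.D.Comp_finsum_left[symmetric]) (simp_all add: ob x s ab cl f finite_I)
    also have "(\<Oplus>\<^bsub>Hom D (FOb G e) (FOb G x)\<^esub>i\<in>I x. FMap G e x (?abs i))
        = FMap G e x (\<Oplus>\<^bsub>Hom P e x\<^esub>i\<in>I x. ?abs i)"
      by (rule module_hom_finsum[OF Hom_module F.D.Hom_module G.FMap_linear, symmetric])
        (simp_all add: ob x s ab cl finite_I)
    also have "(\<Oplus>\<^bsub>Hom P e x\<^esub>i\<in>I x. ?abs i) = Comp P e x x (Id P x) s"
      unfolding sum_ab[OF x, symmetric]
      by (rule Comp_finsum_left[symmetric]) (simp_all add: ob x s ab cl finite_I)
    also have "\<dots> = s" using x s e by (simp add: Id_left)
    finally show ?thesis .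
  qed
  have "\<eta> e = f"
  proof (rule eq_if_eq_on_generator[OF F e])
    fix s assume "s \<in> carrier (Hom P e e)"
    then show "Comp D (FOb F e) (FOb F e) (FOb G e) (\<eta> e) (FMap F e e s)
        = Comp D (FOb F e) (FOb F e) (FOb G e) f (FMap F e e s)"
      by (simp add: gen comm e)
  qed (auto simp: ob \<eta> f)
  moreover have "\<eta> \<in> nat_trans P D F G"
  proof (rule nat_transI)
    fix x y p assume x: "x \<in> Ob P" "y \<in> Ob P" and p: "p \<in> carrier (Hom P x y)"
    show "Comp D (FOb F x) (FOb F y) (FOb G y) (\<eta> y) (FMap F x y p)
        = Comp D (FOb F x) (FOb G x) (FOb G y) (FMap G x y p) (\<eta> x)"
    proof (rule eq_if_eq_on_generator[OF F x(1)])
      fix s assume s: "s \<in> carrier (Hom P e x)"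
      have "Comp D (FOb F e) (FOb F x) (FOb G y) (Comp D (FOb F x) (FOb F y) (FOb G y) (\<eta> y) (FMap F x y p)) (FMap F e x s)
        = Comp D (FOb F e) (FOb F y) (FOb G y) (\<eta> y) (FMap F e y (Comp P e x y p s))"
        by (simp add: F.FMap_Comp F.D.Comp_assoc ob x p s cl \<eta>)
      also have "\<dots> = Comp D (FOb F e) (FOb G x) (FOb G y) (FMap G x y p)
          (Comp D (FOb F e) (FOb G e) (FOb G x) (FMap G e x s) f)"
        by (simp add: gen G.FMap_Comp F.D.Comp_assoc ob x p s cl f)
      also have "\<dots> = Comp D (FOb F e) (FOb F x) (FOb G y)
          (Comp D (FOb F x) (FOb G x) (FOb G y) (FMap G x y p) (\<eta> x)) (FMap F e x s)"
        by (simp add: gen[symmetric] F.D.Comp_assoc ob x p s cl \<eta>)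
      finally show "Comp D (FOb F e) (FOb F x) (FOb G y) (Comp D (FOb F x) (FOb F y) (FOb G y) (\<eta> y) (FMap F x y p)) (FMap F e x s)
        = Comp D (FOb F e) (FOb F x) (FOb G y)
          (Comp D (FOb F x) (FOb G x) (FOb G y) (FMap G x y p) (\<eta> x)) (FMap F e x s)" .
    qed (use x p in \<open>simp_all add: ob cl \<eta>\<close>)
  qed (use \<eta> in \<open>auto simp: \<eta>_def\<close>)
  ultimately show ?thesis by blast
qed

lemma bij_betw_component_at_generator:
  assumes F: "linear_functor P D F" and G: "linear_functor P D G"
  shows "bij_betw (\<lambda>\<eta>. \<eta> e) (nat_trans P D F G)
    {f \<in> carrier (Hom D (FOb F e) (FOb G e)). \<forall>r\<in>carrier (Hom P e e).
      Comp D (FOb F e) (FOb F e) (FOb G e) f (FMap F e e r)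
      = Comp D (FOb F e) (FOb G e) (FOb G e) (FMap G e e r) f}"
  unfolding bij_betw_def
proof (intro conjI subset_antisym subsetI)
  interpret F: linear_functor P D F by (rule F)
  interpret G: linear_functor P D G by (rule G)
  show "inj_on (\<lambda>\<eta>. \<eta> e) (nat_trans P D F G)"
  proof (rule inj_onI, rule ext)
    fix \<eta> \<theta> x assume e': "\<eta> \<in> nat_trans P D F G" and t: "\<theta> \<in> nat_trans P D F G" and eq: "\<eta> e = \<theta> e"
    show "\<eta> x = \<theta> x"
    proof (cases "x \<in> Ob P")
      case True
      show ?thesis
        by (rule eq_if_eq_on_generator[OF F True G.FOb_closed[OF True]])
          (simp_all add: nat_transD(1,3)[OF e'] nat_transD(1,3)[OF t] True e eq)
    qed (simp add: nat_transD(2)[OF e'] nat_transD(2)[OF t])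
  qed
next
  fix f assume "f \<in> (\<lambda>\<eta>. \<eta> e) ` nat_trans P D F G"
  then show "f \<in> {f \<in> carrier (Hom D (FOb F e) (FOb G e)). \<forall>r\<in>carrier (Hom P e e).
      Comp D (FOb F e) (FOb F e) (FOb G e) f (FMap F e e r)
      = Comp D (FOb F e) (FOb G e) (FOb G e) (FMap G e e r) f}"
    using e by (auto intro: nat_transD(1) nat_transD(3))
next
  fix f assume "f \<in> {f \<in> carrier (Hom D (FOb F e) (FOb G e)). \<forall>r\<in>carrier (Hom P e e).
      Comp D (FOb F e) (FOb F e) (FOb G e) f (FMap F e e r)
      = Comp D (FOb F e) (FOb G e) (FOb G e) (FMap G e e r) f}"
  then obtain \<eta> where "\<eta> \<in> nat_trans P D F G" "\<eta> e = f"
    using extend_from_generator[OF F G] by blast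
  then show "f \<in> (\<lambda>\<eta>. \<eta> e) ` nat_trans P D F G" by blast
qed

end

section \<open>Evaluation at a progenerator\<close>

lemma vect_category_simps:
  "Ob vect_category = {V. vectorspace Cfield V}"
  "carrier (Hom vect_category V W) = module_hom Cfield V W \<inter> extensional (carrier V)"
  "\<zero>\<^bsub>Hom vect_category V W\<^esub> = (\<lambda>v\<in>carrier V. \<zero>\<^bsub>W\<^esub>)"
  "f \<oplus>\<^bsub>Hom vect_category V W\<^esub> g = (\<lambda>v\<in>carrier V. f v \<oplus>\<^bsub>W\<^esub> g v)"
  "c \<odot>\<^bsub>Hom vect_category V W\<^esub> f = (\<lambda>v\<in>carrier V. c \<odot>\<^bsub>W\<^esub> f v)"
  "Comp vect_category U V W g f = (\<lambda>u\<in>carrier U. g (f u))"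
  "Id vect_category V = (\<lambda>v\<in>carrier V. v)"
  by (simp_all add: vect_category_def)

text \<open>The endomorphism algebra of the generator is given by an isomorphic copy: in the
  application, the representation algebra of \<open>G\<close> stands for that of \<open>1 \<times>
  1 \<times> G\<close>.\<close>

locale progenerator = finitely_generating_object P e I a b + A: algebra Cfield A
  for P :: "('o, 'm) lcat" and e and I :: "'o \<Rightarrow> 'i set" and a b
    and A :: "(complex, 'a) module" +
  fixes \<phi> :: "'a \<Rightarrow> 'm"
  assumes \<phi>_bij: "bij_betw \<phi> (carrier A) (carrier (Hom P e e))"
    and \<phi>_linear: "\<phi> \<in> module_hom Cfield A (Hom P e e)"
    and \<phi>_mult: "\<lbrakk>r \<in> carrier A; s \<in> carrier A\<rbrakk> \<Longrightarrow> \<phi> (r \<otimes>\<^bsub>A\<^esub> s) = Comp P e e e (\<phi> r) (\<phi> s)"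
    and \<phi>_one: "\<phi> \<one>\<^bsub>A\<^esub> = Id P e"
begin

lemma \<phi>_closed: "r \<in> carrier A \<Longrightarrow> \<phi> r \<in> carrier (Hom P e e)"
  using module_homD(1)[OF \<phi>_linear] .

lemma \<phi>_scalar: "\<phi> (c \<odot>\<^bsub>A\<^esub> \<one>\<^bsub>A\<^esub>) = c \<odot>\<^bsub>Hom P e e\<^esub> Id P e"
  using module_homD(3)[OF \<phi>_linear, of c "\<one>\<^bsub>A\<^esub>"] by (simp add: \<phi>_one)

definition \<psi> :: "'m \<Rightarrow> 'a" where "\<psi> = the_inv_into (carrier A) \<phi>"

lemma \<psi>_closed: "q \<in> carrier (Hom P e e) \<Longrightarrow> \<psi> q \<in> carrier A"
  and \<phi>_\<psi>: "q \<in> carrier (Hom P e e) \<Longrightarrow> \<phi> (\<psi> q) = q"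
  and \<psi>_\<phi>: "r \<in> carrier A \<Longrightarrow> \<psi> (\<phi> r) = r"
  using \<phi>_bij unfolding \<psi>_def bij_betw_def
  by (auto intro: f_the_inv_into_f the_inv_into_into[OF _ _ subset_refl] the_inv_into_f_f)

lemma \<psi>_eqI: "\<lbrakk>r \<in> carrier A; \<phi> r = q\<rbrakk> \<Longrightarrow> \<psi> q = r"
  using \<psi>_\<phi> by auto

lemma \<psi>_add: "\<lbrakk>p \<in> carrier (Hom P e e); q \<in> carrier (Hom P e e)\<rbrakk>
    \<Longrightarrow> \<psi> (p \<oplus>\<^bsub>Hom P e e\<^esub> q) = \<psi> p \<oplus>\<^bsub>A\<^esub> \<psi> q"
  by (rule \<psi>_eqI) (simp_all add: \<psi>_closed \<phi>_\<psi> module_homD(2)[OF \<phi>_linear])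

lemma \<psi>_comp: "\<lbrakk>p \<in> carrier (Hom P e e); q \<in> carrier (Hom P e e)\<rbrakk>
    \<Longrightarrow> \<psi> (Comp P e e e p q) = \<psi> p \<otimes>\<^bsub>A\<^esub> \<psi> q"
  by (rule \<psi>_eqI) (simp_all add: \<psi>_closed \<phi>_\<psi> \<phi>_mult)

lemma \<psi>_id: "\<psi> (Id P e) = \<one>\<^bsub>A\<^esub>"
  by (rule \<psi>_eqI) (simp_all add: \<phi>_one)

definition eval_module :: "('o, 'm, (complex, 'v) module, 'v \<Rightarrow> 'v) ftor \<Rightarrow> ('a, 'v) module"
  where "eval_module F =
    \<lparr>carrier = carrier (FOb F e),
     monoid.mult = undefined,
     monoid.one = undefined,
     ring.zero = \<zero>\<^bsub>FOb F e\<^esub>,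
     ring.add = ring.add (FOb F e),
     module.smult = (\<lambda>r. FMap F e e (\<phi> r))\<rparr>"

lemma eval_module_simps:
  "carrier (eval_module F) = carrier (FOb F e)"
  "\<zero>\<^bsub>eval_module F\<^esub> = \<zero>\<^bsub>FOb F e\<^esub>"
  "v \<oplus>\<^bsub>eval_module F\<^esub> w = v \<oplus>\<^bsub>FOb F e\<^esub> w"
  "r \<odot>\<^bsub>eval_module F\<^esub> v = FMap F e e (\<phi> r) v"
  by (simp_all add: eval_module_def)

definition eval_functor ::
    "(('o, 'm, (complex, 'v) module, 'v \<Rightarrow> 'v) ftor, 'o \<Rightarrow> 'v \<Rightarrow> 'v, ('a, 'v) module, 'v \<Rightarrow> 'v) ftor"
  where "eval_functor = \<lparr>FOb = eval_module, FMap = (\<lambda>F G \<eta>. \<eta> e)\<rparr>"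

context
  fixes F :: "('o, 'm, (complex, 'v) module, 'v \<Rightarrow> 'v) ftor"
  assumes F: "linear_functor P vect_category F"
begin

interpretation F: linear_functor P vect_category F by (rule F)

lemma value_vectorspace: "x \<in> Ob P \<Longrightarrow> vectorspace Cfield (FOb F x)"
  using F.FOb_closed[of x] by (simp add: vect_category_simps)

lemma map_hom: "\<lbrakk>x \<in> Ob P; y \<in> Ob P; p \<in> carrier (Hom P x y)\<rbrakk>
    \<Longrightarrow> FMap F x y p \<in> module_hom Cfield (FOb F x) (FOb F y)"
  using F.FMap_closed[of x y p] by (simp add: vect_category_simps)

lemma map_linear:
  assumes "x \<in> Ob P" "y \<in> Ob P" "p \<in> carrier (Hom P x y)" "q \<in> carrier (Hom P x y)" "v \<in> carrier (FOb F x)"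
  shows "FMap F x y (p \<oplus>\<^bsub>Hom P x y\<^esub> q) v = FMap F x y p v \<oplus>\<^bsub>FOb F y\<^esub> FMap F x y q v"
    and "FMap F x y (c \<odot>\<^bsub>Hom P x y\<^esub> p) v = c \<odot>\<^bsub>FOb F y\<^esub> FMap F x y p v"
  using module_homD(2,3)[OF F.FMap_linear[of x y]] assms by (simp_all add: vect_category_simps)

lemma map_comp:
  assumes "x \<in> Ob P" "y \<in> Ob P" "z \<in> Ob P" "p \<in> carrier (Hom P x y)" "q \<in> carrier (Hom P y z)" "v \<in> carrier (FOb F x)"
  shows "FMap F x z (Comp P x y z q p) v = FMap F y z q (FMap F x y p v)"
  using assms by (simp add: F.FMap_Comp vect_category_simps)

lemma map_id: "\<lbrakk>x \<in> Ob P; v \<in> carrier (FOb F x)\<rbrakk> \<Longrightarrow> FMap F x x (Id P x) v = v"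
  by (simp add: F.FMap_Id vect_category_simps)

lemma map_scalar: "v \<in> carrier (FOb F e) \<Longrightarrow> FMap F e e (\<phi> (c \<odot>\<^bsub>A\<^esub> \<one>\<^bsub>A\<^esub>)) v = c \<odot>\<^bsub>FOb F e\<^esub> v"
  using e by (simp add: \<phi>_scalar map_linear(2)[OF e e Id_closed Id_closed] map_id)

lemma eval_module_module: "Module.module A (eval_module F)"
proof -
  note V = vectorspaceD[OF value_vectorspace[OF e]]
  note H = module_homD[OF map_hom[OF e e \<phi>_closed]]
  have zero: "FMap F e e (\<phi> \<zero>\<^bsub>A\<^esub>) v = \<zero>\<^bsub>FOb F e\<^esub>" if "v \<in> carrier (FOb F e)" for v
    using map_scalar[OF that, of 0] V that by (simp add: algebra_scalars[OF A.algebra_axioms])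
  show ?thesis
  proof (rule moduleI_zero[OF A.M_cring], unfold eval_module_simps)
    fix r s v assume "r \<in> carrier A" "s \<in> carrier A" "v \<in> carrier (FOb F e)"
    then show "FMap F e e (\<phi> (r \<oplus>\<^bsub>A\<^esub> s)) v = FMap F e e (\<phi> r) v \<oplus>\<^bsub>FOb F e\<^esub> FMap F e e (\<phi> s) v"
      by (simp add: module_homD(2)[OF \<phi>_linear] map_linear e \<phi>_closed)
  qed (auto simp: V(1,2,3,5) H \<phi>_mult \<phi>_one map_id map_comp e \<phi>_closed zero intro: V(4))
qed

end

text \<open>An \<open>A\<close>-linear map is \<open>\<complex>\<close>-linear because complex
  scalars act through \<open>c 1\<close>; and commuting with the action of \<open>A\<close> means
  commuting with all endomorphisms of \<open>e\<close> because \<open>\<phi>\<close> is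
  onto.\<close>

lemma eval_hom_iff:
  fixes F G :: "('o, 'm, (complex, 'v) module, 'v \<Rightarrow> 'v) ftor"
  assumes F: "linear_functor P vect_category F" and G: "linear_functor P vect_category G"
  shows "carrier (hom_module A (eval_module F) (eval_module G)) =
    {f \<in> carrier (Hom vect_category (FOb F e) (FOb G e)). \<forall>r\<in>carrier (Hom P e e).
      Comp vect_category (FOb F e) (FOb F e) (FOb G e) f (FMap F e e r)
      = Comp vect_category (FOb F e) (FOb G e) (FOb G e) (FMap G e e r) f}" (is "?L = ?R")
proof (intro subset_antisym subsetI)
  note FH = module_homD[OF map_hom[OF F e e]] and GH = module_homD[OF map_hom[OF G e e]]
  have R: "carrier (Hom P e e) = \<phi> ` carrier A" using \<phi>_bij by (simp add: bij_betw_def)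
  fix f
  show "f \<in> ?R" if f: "f \<in> ?L"
  proof -
    have f': "f \<in> module_hom A (eval_module F) (eval_module G)" "f \<in> extensional (carrier (FOb F e))"
      using f by (auto simp: hom_module_simps eval_module_simps)
    note fd = module_homD[OF f'(1), unfolded eval_module_simps]
    have sm: "f (c \<odot>\<^bsub>FOb F e\<^esub> v) = c \<odot>\<^bsub>FOb G e\<^esub> f v" if "v \<in> carrier (FOb F e)" for c v
      using fd(3)[of "c \<odot>\<^bsub>A\<^esub> \<one>\<^bsub>A\<^esub>" v] that
      by (simp add: algebra_scalars(1)[OF A.algebra_axioms] map_scalar[OF F] map_scalar[OF G] fd(1))
    show ?thesis
      using f' fd(1,2) sm by (auto simp: vect_category_simps R fd(3) intro!: module_homI ext)
  qed
  show "f \<in> ?L" if f: "f \<in> ?R"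
  proof -
    have f': "f \<in> module_hom Cfield (FOb F e) (FOb G e)" "f \<in> extensional (carrier (FOb F e))"
      using f by (auto simp: vect_category_simps)
    have "f (FMap F e e (\<phi> r) v) = FMap G e e (\<phi> r) (f v)" if "r \<in> carrier A" "v \<in> carrier (FOb F e)" for r v
    proof -
      have "(\<lambda>u\<in>carrier (FOb F e). f (FMap F e e (\<phi> r) u)) = (\<lambda>u\<in>carrier (FOb F e). FMap G e e (\<phi> r) (f u))"
        using f that by (auto simp: vect_category_simps R)
      from fun_cong[OF this, of v] show ?thesis using that by simp
    qed
    then show ?thesis
      using f' by (auto simp: hom_module_simps eval_module_simps module_homD[OF f'(1)] intro!: module_homI)
  qed
qed

lemma linear_functor_eval_functor:
  "linear_functor (functor_category P vect_category) (module_category A :: (('a, 'v) module, 'v \<Rightarrow> 'v) lcat) eval_functor"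
proof (intro linear_functor.intro linear_functor_axioms.intro)
  show "linear_category (functor_category P (vect_category :: ((complex, 'v) module, 'v \<Rightarrow> 'v) lcat))"
    by (rule linear_category_functor_category[OF linear_category_axioms linear_category_vect_category])
  show "linear_category (module_category A :: (('a, 'v) module, 'v \<Rightarrow> 'v) lcat)"
    by (rule linear_category_module_category[OF A.algebra_axioms])
  fix F G H :: "('o, 'm, (complex, 'v) module, 'v \<Rightarrow> 'v) ftor"
  assume "F \<in> Ob (functor_category P vect_category)"
  then have F: "linear_functor P vect_category F" by (simp add: functor_category_simps)
  show "FOb eval_functor F \<in> Ob (module_category A)"
    by (simp add: eval_functor_def module_category_simps eval_module_module[OF F])
  show "FMap eval_functor F F (Id (functor_category P vect_category) F) = Id (module_category A) (FOb eval_functor F)"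
    using e by (simp add: eval_functor_def module_category_simps functor_category_simps vect_category_simps eval_module_simps)
  assume "G \<in> Ob (functor_category P vect_category)"
  then have G: "linear_functor P vect_category G" by (simp add: functor_category_simps)
  have val: "\<eta> e v \<in> carrier (FOb G e)" if "\<eta> \<in> nat_trans P vect_category F G" "v \<in> carrier (FOb F e)" for \<eta> v
    using nat_transD(1)[OF that(1) e] that(2) by (auto simp: vect_category_simps dest: module_homD)
  show "FMap eval_functor F G \<in> module_hom Cfield (Hom (functor_category P vect_category) F G)
      (Hom (module_category A) (FOb eval_functor F) (FOb eval_functor G))"
  proof (rule module_homI, unfold functor_category_simps)
    fix \<eta> \<theta> c assume n: "\<eta> \<in> nat_trans P vect_category F G"
    show "FMap eval_functor F G \<eta> \<in> carrier (Hom (module_category A) (FOb eval_functor F) (FOb eval_functor G))"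
      using bij_betwE[OF bij_betw_component_at_generator[OF F G]] n
      by (simp add: eval_functor_def module_category_simps eval_hom_iff[OF F G])
    show "FMap eval_functor F G (\<lambda>x\<in>Ob P. c \<odot>\<^bsub>Hom vect_category (FOb F x) (FOb G x)\<^esub> \<eta> x)
      = c \<odot>\<^bsub>Hom (module_category A) (FOb eval_functor F) (FOb eval_functor G)\<^esub> FMap eval_functor F G \<eta>"
      using e val[OF n] by (auto simp: eval_functor_def module_category_simps vect_category_simps
          hom_module_simps eval_module_simps map_scalar[OF G])
    show "FMap eval_functor F G (\<lambda>x\<in>Ob P. \<eta> x \<oplus>\<^bsub>Hom vect_category (FOb F x) (FOb G x)\<^esub> \<theta> x)
      = FMap eval_functor F G \<eta> \<oplus>\<^bsub>Hom (module_category A) (FOb eval_functor F) (FOb eval_functor G)\<^esub> FMap eval_functor F G \<theta>"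
      using e by (auto simp: eval_functor_def module_category_simps vect_category_simps
          hom_module_simps eval_module_simps)
  qed
  fix \<eta> \<theta>
  show "FMap eval_functor F H (Comp (functor_category P vect_category) F G H \<theta> \<eta>)
    = Comp (module_category A) (FOb eval_functor F) (FOb eval_functor G) (FOb eval_functor H)
      (FMap eval_functor G H \<theta>) (FMap eval_functor F G \<eta>)"
    using e by (simp add: eval_functor_def module_category_simps functor_category_simps vect_category_simps eval_module_simps)
qed

text \<open>The representable functor at \<open>x\<close>, evaluated at \<open>e\<close>, with
  endomorphisms of \<open>e\<close> acting by composition.\<close>

definition row_module :: "'o \<Rightarrow> ('a, 'm) module"
  where "row_module x =
    \<lparr>carrier = carrier (Hom P x e),
     monoid.mult = undefined,
     monoid.one = undefined,
     ring.zero = \<zero>\<^bsub>Hom P x e\<^esub>,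
     ring.add = ring.add (Hom P x e),
     module.smult = (\<lambda>r. Comp P x e e (\<phi> r))\<rparr>"

lemma row_module_simps:
  "carrier (row_module x) = carrier (Hom P x e)"
  "\<zero>\<^bsub>row_module x\<^esub> = \<zero>\<^bsub>Hom P x e\<^esub>"
  "p \<oplus>\<^bsub>row_module x\<^esub> q = p \<oplus>\<^bsub>Hom P x e\<^esub> q"
  "r \<odot>\<^bsub>row_module x\<^esub> q = Comp P x e e (\<phi> r) q"
  by (simp_all add: row_module_def)

lemma row_module_module:
  assumes x: "x \<in> Ob P"
  shows "Module.module A (row_module x)"
proof -
  note V = vectorspaceD[OF Hom_vectorspace[OF x e]]
  have z: "\<phi> \<zero>\<^bsub>A\<^esub> = \<zero>\<^bsub>Hom P e e\<^esub>"
    using module_hom_zero[OF A.module Hom_module[OF e e] \<phi>_linear] .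
  show ?thesis
    by (rule moduleI_zero[OF A.M_cring], unfold row_module_simps)
      (auto simp: V(1,2,3,5) x e \<phi>_closed Comp_closed Comp_add_left Comp_add_right \<phi>_mult \<phi>_one
        Comp_assoc Id_left module_homD(2)[OF \<phi>_linear] z Comp_zero_left intro: V(4))
qed

lemma finsum_row_module: "finsum (row_module x) f S = finsum (Hom P x e) f S"
  by (simp add: finsum_def finprod_def row_module_def)

text \<open>The arrows \<open>b\<^sub>i\<close> generate the module of arrows \<open>x
  \<rightarrow> e\<close>, since \<open>q = \<Sum>i. (q a\<^sub>i) b\<^sub>i\<close>.\<close>

lemma row_hom_eqI:
  assumes x: "x \<in> Ob P" and M: "Module.module A M"
    and u: "u \<in> carrier (hom_module A (row_module x) M)" and v: "v \<in> carrier (hom_module A (row_module x) M)"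
    and eq: "\<And>i. i \<in> I x \<Longrightarrow> u (b x i) = v (b x i)"
  shows "u = v"
proof (rule ext)
  fix q
  show "u q = v q"
  proof (cases "q \<in> carrier (Hom P x e)")
    case q: True
    define r where "r i = \<psi> (Comp P e x e q (a x i))" for i
    have r: "r i \<in> carrier A" "\<phi> (r i) = Comp P e x e q (a x i)" if "i \<in> I x" for i
      unfolding r_def using x e q a that by (simp_all add: \<psi>_closed \<phi>_\<psi> Comp_closed)
    have "q = Comp P x x e q (\<Oplus>\<^bsub>Hom P x x\<^esub>i\<in>I x. Comp P x e x (a x i) (b x i))"
      using x e q by (simp add: sum_ab Id_right)
    also have "\<dots> = (\<Oplus>\<^bsub>Hom P x e\<^esub>i\<in>I x. Comp P x x e q (Comp P x e x (a x i) (b x i)))"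
      by (rule Comp_finsum_right) (simp_all add: x e q a b Comp_closed finite_I)
    also have "\<dots> = (\<Oplus>\<^bsub>Hom P x e\<^esub>i\<in>I x. r i \<odot>\<^bsub>row_module x\<^esub> b x i)"
      by (rule finsum_cong_module[OF Hom_module])
        (simp_all add: x e q a b Comp_closed Comp_assoc row_module_simps r)
    finally have q_eq: "q = finsum (row_module x) (\<lambda>i. r i \<odot>\<^bsub>row_module x\<^esub> b x i) (I x)"
      by (simp add: finsum_row_module)
    have sum: "w q = (\<Oplus>\<^bsub>M\<^esub>i\<in>I x. r i \<odot>\<^bsub>M\<^esub> w (b x i))" if "w \<in> carrier (hom_module A (row_module x) M)" for w
    proof -
      have w: "w \<in> module_hom A (row_module x) M" using that by (simp add: hom_module_simps)
      have "w q = (\<Oplus>\<^bsub>M\<^esub>i\<in>I x. w (r i \<odot>\<^bsub>row_module x\<^esub> b x i))"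
        by (subst q_eq, rule module_hom_finsum[OF row_module_module[OF x] M w])
          (simp_all add: x e b r(1) \<phi>_closed Comp_closed row_module_simps finite_I)
      also have "\<dots> = (\<Oplus>\<^bsub>M\<^esub>i\<in>I x. r i \<odot>\<^bsub>M\<^esub> w (b x i))"
      proof (rule finsum_cong_module[OF M])
        interpret M: module A M by (rule M)
        fix i assume i: "i \<in> I x"
        have "b x i \<in> carrier (row_module x)" using b x i by (simp add: row_module_simps)
        then show "w (r i \<odot>\<^bsub>row_module x\<^esub> b x i) = r i \<odot>\<^bsub>M\<^esub> w (b x i)" "r i \<odot>\<^bsub>M\<^esub> w (b x i) \<in> carrier M"
          using module_homD[OF w] r(1)[OF i] by auto
      qed
      finally show ?thesis .
    qed
    show ?thesis
      unfolding sum[OF u] sum[OF v]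
    proof (rule finsum_cong_module[OF M])
      interpret M: module A M by (rule M)
      fix i assume i: "i \<in> I x"
      have "b x i \<in> carrier (row_module x)" using b x i by (simp add: row_module_simps)
      then show "r i \<odot>\<^bsub>M\<^esub> v (b x i) \<in> carrier M"
        using v r(1)[OF i] by (auto simp: hom_module_simps dest: module_homD(1))
    qed (simp add: eq)
  qed (use u v in \<open>auto simp: hom_module_simps row_module_simps extensional_def\<close>)
qed

end

section \<open>Moving modules into a prescribed type\<close>

definition transport_module :: "('u \<Rightarrow> 'v) \<Rightarrow> ('a, 'u) module \<Rightarrow> ('a, 'v) module"
  where "transport_module enc V =
    (let dec = the_inv_into (carrier V) enc in
      \<lparr>carrier = enc ` carrier V,
       monoid.mult = undefined,
       monoid.one = undefined,
       ring.zero = enc \<zero>\<^bsub>V\<^esub>,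
       ring.add = (\<lambda>u v. enc (dec u \<oplus>\<^bsub>V\<^esub> dec v)),
       module.smult = (\<lambda>c u. enc (c \<odot>\<^bsub>V\<^esub> dec u))\<rparr>)"

lemma vectorspace_transport_module:
  assumes V: "vectorspace Cfield V" and inj: "inj_on enc (carrier V)"
  shows "vectorspace Cfield (transport_module enc V)"
    and "enc \<in> module_hom Cfield V (transport_module enc V)"
    and "the_inv_into (carrier V) enc \<in> module_hom Cfield (transport_module enc V) V"
    and "carrier (transport_module enc V) = enc ` carrier V"
proof -
  note Xv = vectorspaceD[OF V]
  have dec: "the_inv_into (carrier V) enc (enc x) = x" if "x \<in> carrier V" for x
    using inj that by (rule the_inv_into_f_f)
  show "carrier (transport_module enc V) = enc ` carrier V"
    by (simp add: transport_module_def Let_def)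
  show "enc \<in> module_hom Cfield V (transport_module enc V)"
    by (rule module_homI) (auto simp: transport_module_def Let_def dec)
  show "the_inv_into (carrier V) enc \<in> module_hom Cfield (transport_module enc V) V"
    by (rule module_homI) (auto simp: transport_module_def Let_def dec Xv(1,6))
  show "vectorspace Cfield (transport_module enc V)"
    by (rule vectorspaceI)
      (auto simp: transport_module_def Let_def dec Xv(1,2,3,5-) intro!: arg_cong[of _ _ enc] Xv(4))
qed

text \<open>A nonzero element has infinitely many complex multiples.\<close>

lemma infinite_carrier_module:
  assumes A: "algebra Cfield A" and M: "Module.module A M"
    and m: "m \<in> carrier M" "m \<noteq> \<zero>\<^bsub>M\<^esub>"
  shows "infinite (carrier M)"
proof -
  interpret M: module A M by (rule M)
  note sc = algebra_scalars[OF A]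
  let ?f = "\<lambda>c. (c \<odot>\<^bsub>A\<^esub> \<one>\<^bsub>A\<^esub>) \<odot>\<^bsub>M\<^esub> m"
  have "inj ?f"
  proof (rule injI, rule ccontr)
    fix c d assume eq: "?f c = ?f d" and ne: "c \<noteq> d"
    have mult: "((x * y) \<odot>\<^bsub>A\<^esub> \<one>\<^bsub>A\<^esub>) \<odot>\<^bsub>M\<^esub> m = (x \<odot>\<^bsub>A\<^esub> \<one>\<^bsub>A\<^esub>) \<odot>\<^bsub>M\<^esub> ?f y" for x y
      using m by (simp add: sc(1,3) M.smult_assoc1)
    have add: "?f (x + y) = ?f x \<oplus>\<^bsub>M\<^esub> ?f y" for x y
      using m by (simp add: sc(1,2) M.smult_l_distr)
    have f0: "?f 0 = \<zero>\<^bsub>M\<^esub>" using m by (simp add: sc(5))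
    have "?f (c - d) = ?f c \<oplus>\<^bsub>M\<^esub> ?f (- d)" using add[of c "- d"] by simp
    also have "\<dots> = ?f d \<oplus>\<^bsub>M\<^esub> ?f (- d)" by (simp only: eq)
    also have "\<dots> = \<zero>\<^bsub>M\<^esub>" using add[of d "- d"] f0 by simp
    finally have "?f (inverse (c - d) * (c - d)) = \<zero>\<^bsub>M\<^esub>" unfolding mult by (simp add: sc(1))
    then show False using ne m by (simp add: sc(4))
  qed
  then have "infinite (range ?f)" using infinite_UNIV_char_0 finite_imageD by blast
  moreover have "range ?f \<subseteq> carrier M" using m by (auto simp: sc)
  ultimately show ?thesis using finite_subset by blast
qed

text \<open>Induction on \<open>J\<close>, using an injection \<open>S \<times> S \<rightarrow>
  S\<close>.\<close>

lemma ex_inj_on_PiE_infinite: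
  assumes S: "infinite S" and J: "finite J"
  shows "\<exists>f. inj_on f (J \<rightarrow>\<^sub>E S) \<and> f ` (J \<rightarrow>\<^sub>E S) \<subseteq> S"
  using J
proof induction
  case empty
  obtain s where "s \<in> S" using S by (metis ex_in_conv finite.emptyI)
  then show ?case by (intro exI[of _ "\<lambda>_. s"]) auto
next
  case (insert j J)
  then obtain f where f: "inj_on f (J \<rightarrow>\<^sub>E S)" "f ` (J \<rightarrow>\<^sub>E S) \<subseteq> S" by blast
  have "|S \<times> S| \<le>o |S|" using card_of_Times_same_infinite[OF S] ordIso_imp_ordLeq by blast
  then obtain g where g: "inj_on g (S \<times> S)" "g ` (S \<times> S) \<subseteq> S"
    using card_of_ordLeq[of "S \<times> S" S] by blast
  have r: "restrict u J \<in> J \<rightarrow>\<^sub>E S" "u j \<in> S" if "u \<in> insert j J \<rightarrow>\<^sub>E S" for u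
    using that by auto
  have fr: "f (restrict u J) \<in> S" if "u \<in> insert j J \<rightarrow>\<^sub>E S" for u using r(1)[OF that] f(2) by blast
  let ?h = "\<lambda>u. g (u j, f (restrict u J))"
  have "inj_on ?h (insert j J \<rightarrow>\<^sub>E S)"
  proof (rule inj_onI)
    fix u v assume u: "u \<in> insert j J \<rightarrow>\<^sub>E S" and v: "v \<in> insert j J \<rightarrow>\<^sub>E S" and eq: "?h u = ?h v"
    have "(u j, f (restrict u J)) = (v j, f (restrict v J))"
      using g(1) eq by (rule inj_onD) (use u v in \<open>auto simp: r fr\<close>)
    then have "u j = v j" and "restrict u J = restrict v J"
      using inj_onD[OF f(1) _ r(1)[OF u] r(1)[OF v]] by auto
    have "u x = v x" if "x \<in> insert j J" for x
    proof (cases "x = j")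
      case False
      then have "restrict u J x = u x" "restrict v J x = v x" using that by auto
      then show ?thesis using \<open>restrict u J = restrict v J\<close> by metis
    qed (use \<open>u j = v j\<close> in simp)
    then show "u = v" by (rule PiE_ext[OF u v])
  qed
  moreover have "?h u \<in> S" if "u \<in> insert j J \<rightarrow>\<^sub>E S" for u
    using g(2) r(2)[OF that] fr[OF that] by auto
  then have "?h ` (insert j J \<rightarrow>\<^sub>E S) \<subseteq> S" by auto
  ultimately show ?case by blast
qed

text \<open>The carrier of \<open>M\<close> is infinite unless \<open>M = 0\<close>, in which case
  the power is a single point.\<close>

lemma ex_inj_on_PiE_module:
  assumes A: "algebra Cfield A" and M: "Module.module A (M :: ('a, 'v) module)" and J: "finite J"
  shows "\<exists>f :: ('j \<Rightarrow> 'v) \<Rightarrow> 'v. inj_on f (J \<rightarrow>\<^sub>E carrier M)"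
proof (cases "\<exists>m\<in>carrier M. m \<noteq> \<zero>\<^bsub>M\<^esub>")
  case True
  then have "infinite (carrier M)" using infinite_carrier_module[OF A M] by blast
  then show ?thesis using ex_inj_on_PiE_infinite[OF _ J] by blast
next
  case False
  have "u = v" if "u \<in> J \<rightarrow>\<^sub>E carrier M" "v \<in> J \<rightarrow>\<^sub>E carrier M" for u v
  proof (rule PiE_ext[OF that])
    fix x assume "x \<in> J"
    then have "u x \<in> carrier M" "v x \<in> carrier M" using that by auto
    then show "u x = v x" using False by metis
  qed
  then have "inj_on (\<lambda>_. undefined) (J \<rightarrow>\<^sub>E carrier M)" by (auto intro!: inj_onI)
  then show ?thesis by blast
qed

section \<open>Functors with a prescribed value\<close>

context progenerator begin

definition precomp :: "'o \<Rightarrow> 'o \<Rightarrow> 'm \<Rightarrow> ('m \<Rightarrow> 'v) \<Rightarrow> ('m \<Rightarrow> 'v)"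
  where "precomp x y p u = (\<lambda>q\<in>carrier (Hom P y e). u (Comp P x y e q p))"

text \<open>The functor is \<open>x \<mapsto> Hom\<^sub>A(P(x, e), M)\<close>, acting by
  precomposition; evaluation at the identity of \<open>e\<close> identifies its value at
  \<open>e\<close> with \<open>M\<close>. A homomorphism is determined by its values at the
  finitely many generators \<open>b\<^sub>i\<close>, which embeds the value at \<open>x\<close>
  into a finite power of \<open>M\<close> and then into the type of \<open>M\<close>.\<close>

lemma ex_functor_with_value:
  fixes M :: "('a, 'v) module"
  assumes M: "Module.module A M"
  shows "\<exists>F \<in> Ob (functor_category P vect_category).
    \<exists>f. is_iso (module_category A) (FOb eval_functor F) M f"
proof -
  interpret M: module A M by (rule M)
  note sc = algebra_scalars[OF A.algebra_axioms]
  \<comment> \<open>The functor with values in the type of functions on arrows.\<close>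
  define H where "H x = hom_module A (row_module x) M" for x
  have H: "vectorspace Cfield (H x)" if "x \<in> Ob P" for x
    unfolding H_def by (rule hom_module_vectorspace[OF A.algebra_axioms row_module_module[OF that] M])
  have H_simps: "carrier (H x) = module_hom A (row_module x) M \<inter> extensional (carrier (Hom P x e))"
    "u \<oplus>\<^bsub>H x\<^esub> v = (\<lambda>m\<in>carrier (Hom P x e). u m \<oplus>\<^bsub>M\<^esub> v m)"
    "c \<odot>\<^bsub>H x\<^esub> u = (\<lambda>m\<in>carrier (Hom P x e). (c \<odot>\<^bsub>A\<^esub> \<one>\<^bsub>A\<^esub>) \<odot>\<^bsub>M\<^esub> u m)" for x c u v
    by (simp_all add: H_def hom_module_simps row_module_simps)
  have HD: "\<lbrakk>u \<in> carrier (H x); q \<in> carrier (Hom P x e)\<rbrakk> \<Longrightarrow> u q \<in> carrier M"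
      "\<lbrakk>u \<in> carrier (H x); q \<in> carrier (Hom P x e); q' \<in> carrier (Hom P x e)\<rbrakk>
        \<Longrightarrow> u (q \<oplus>\<^bsub>Hom P x e\<^esub> q') = u q \<oplus>\<^bsub>M\<^esub> u q'"
      "\<lbrakk>u \<in> carrier (H x); q \<in> carrier (Hom P x e); r \<in> carrier A\<rbrakk>
        \<Longrightarrow> u (Comp P x e e (\<phi> r) q) = r \<odot>\<^bsub>M\<^esub> u q" for u q q' x r
    using module_homD[of u A "row_module x" M, unfolded row_module_simps]
    by (auto simp: H_simps)
  have HI: "u \<in> carrier (H x)" if "u \<in> extensional (carrier (Hom P x e))"
      "\<And>q. q \<in> carrier (Hom P x e) \<Longrightarrow> u q \<in> carrier M"
      "\<And>q q'. \<lbrakk>q \<in> carrier (Hom P x e); q' \<in> carrier (Hom P x e)\<rbrakk> \<Longrightarrow> u (q \<oplus>\<^bsub>Hom P x e\<^esub> q') = u q \<oplus>\<^bsub>M\<^esub> u q'"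
      "\<And>r q. \<lbrakk>r \<in> carrier A; q \<in> carrier (Hom P x e)\<rbrakk> \<Longrightarrow> u (Comp P x e e (\<phi> r) q) = r \<odot>\<^bsub>M\<^esub> u q"
    for u x
    using that by (auto simp: H_simps row_module_simps intro!: module_homI)
  \<comment> \<open>The values at the generators \<open>b\<^sub>i\<close> form a tuple in
    \<open>M\<^sup>I\<close>, which \<open>code\<close> injects into the type of
    \<open>M\<close>.\<close>
  have "\<exists>f :: ('i \<Rightarrow> 'v) \<Rightarrow> 'v. inj_on f (I x \<rightarrow>\<^sub>E carrier M)" if "x \<in> Ob P" for x
    by (rule ex_inj_on_PiE_module[OF A.algebra_axioms M finite_I[OF that]])
  then obtain code :: "'o \<Rightarrow> ('i \<Rightarrow> 'v) \<Rightarrow> 'v"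
    where code: "\<And>x. x \<in> Ob P \<Longrightarrow> inj_on (code x) (I x \<rightarrow>\<^sub>E carrier M)" by metis
  define enc where "enc x u = code x (\<lambda>i\<in>I x. u (b x i))" for x u
  have inj: "inj_on (enc x) (carrier (H x))" if x: "x \<in> Ob P" for x
  proof (rule inj_onI)
    fix u v assume u: "u \<in> carrier (H x)" and v: "v \<in> carrier (H x)" and eq: "enc x u = enc x v"
    have "(\<lambda>i\<in>I x. u (b x i)) = (\<lambda>i\<in>I x. v (b x i))"
      using eq unfolding enc_def
      by (rule inj_onD[OF code[OF x]]) (use u v x b HD(1) in auto)
    then have "u (b x i) = v (b x i)" if "i \<in> I x" for i
      using that by (metis restrict_apply')
    then show "u = v"
      by (rule row_hom_eqI[OF x M u[unfolded H_def] v[unfolded H_def]])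
  qed
  define V where "V x = transport_module (enc x) (H x)" for x
  define dec where "dec x = the_inv_into (carrier (H x)) (enc x)" for x
  note tr = vectorspace_transport_module[OF H inj, folded V_def dec_def]
  have V: "vectorspace Cfield (V x)" if "x \<in> Ob P" for x using tr(1)[OF that that] .
  have enc: "enc x \<in> module_hom Cfield (H x) (V x)" if "x \<in> Ob P" for x using tr(2)[OF that that] .
  have dec: "dec x \<in> module_hom Cfield (V x) (H x)" if "x \<in> Ob P" for x using tr(3)[OF that that] .
  have cV: "carrier (V x) = enc x ` carrier (H x)" if "x \<in> Ob P" for x using tr(4)[OF that that] .
  have dec_enc: "dec x (enc x u) = u" if "x \<in> Ob P" "u \<in> carrier (H x)" for x u
    unfolding dec_def by (rule the_inv_into_f_f[OF inj[OF that(1)] that(2)])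
  have enc_dec: "enc x (dec x v) = v" if "x \<in> Ob P" "v \<in> carrier (V x)" for x v
    using that dec_enc by (auto simp: cV)
  note encD = module_homD[OF enc] and decD = module_homD[OF dec]
  \<comment> \<open>Precomposition makes \<open>H\<close> a linear functor.\<close>
  have pre_cl: "precomp x y p u \<in> carrier (H y)"
    if "x \<in> Ob P" "y \<in> Ob P" "p \<in> carrier (Hom P x y)" "u \<in> carrier (H x)" for x y p u
  proof (rule HI)
    fix q q' r assume q: "q \<in> carrier (Hom P y e)"
    note cl = that e q Comp_closed \<phi>_closed
    show "precomp x y p u q \<in> carrier M" using q by (simp add: precomp_def cl HD(1)[OF that(4)])
    show "precomp x y p u (Comp P y e e (\<phi> r) q) = r \<odot>\<^bsub>M\<^esub> precomp x y p u q" if "r \<in> carrier A"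
      using q that by (simp add: precomp_def cl Comp_assoc[symmetric] HD(3))
    assume "q' \<in> carrier (Hom P y e)"
    with q show "precomp x y p u (q \<oplus>\<^bsub>Hom P y e\<^esub> q') = precomp x y p u q \<oplus>\<^bsub>M\<^esub> precomp x y p u q'"
      using vectorspaceD(1)[OF Hom_vectorspace[OF that(2) e]]
      by (simp add: precomp_def cl Comp_add_left HD(2)[OF that(4)])
  qed (simp add: precomp_def)
  have pre_lin: "precomp x y p (u \<oplus>\<^bsub>H x\<^esub> v) = precomp x y p u \<oplus>\<^bsub>H y\<^esub> precomp x y p v"
      "precomp x y p (c \<odot>\<^bsub>H x\<^esub> u) = c \<odot>\<^bsub>H y\<^esub> precomp x y p u"
    if "x \<in> Ob P" "y \<in> Ob P" "p \<in> carrier (Hom P x y)" for x y p u v c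
    using that e by (auto simp: precomp_def H_simps Comp_closed)
  have pre_add: "precomp x y (p \<oplus>\<^bsub>Hom P x y\<^esub> p') u = precomp x y p u \<oplus>\<^bsub>H y\<^esub> precomp x y p' u"
    if "x \<in> Ob P" "y \<in> Ob P" "p \<in> carrier (Hom P x y)" "p' \<in> carrier (Hom P x y)" "u \<in> carrier (H x)" for x y p p' u
    using that e by (auto simp: precomp_def H_simps(2) Comp_add_right Comp_closed HD(2)[OF that(5)])
  have pre_smult: "precomp x y (c \<odot>\<^bsub>Hom P x y\<^esub> p) u = c \<odot>\<^bsub>H y\<^esub> precomp x y p u"
    if "x \<in> Ob P" "y \<in> Ob P" "p \<in> carrier (Hom P x y)" "u \<in> carrier (H x)" for x y p c u
  proof -
    have "u (c \<odot>\<^bsub>Hom P x e\<^esub> q) = (c \<odot>\<^bsub>A\<^esub> \<one>\<^bsub>A\<^esub>) \<odot>\<^bsub>M\<^esub> u q" if q: "q \<in> carrier (Hom P x e)" for q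
      using HD(3)[OF \<open>u \<in> carrier (H x)\<close> q sc(1)[of c]] q \<open>x \<in> Ob P\<close> e
      by (simp add: \<phi>_scalar Comp_smult_left Id_closed Id_left)
    then show ?thesis using that e by (auto simp: precomp_def H_simps(3) Comp_smult_right Comp_closed)
  qed
  have pre_comp: "precomp x z (Comp P x y z q p) u = precomp y z q (precomp x y p u)"
    if "x \<in> Ob P" "y \<in> Ob P" "z \<in> Ob P" "p \<in> carrier (Hom P x y)" "q \<in> carrier (Hom P y z)" for x y z p q u
    using that e by (auto simp: precomp_def Comp_assoc Comp_closed)
  have pre_id: "precomp x x (Id P x) u = u" if "x \<in> Ob P" "u \<in> carrier (H x)" for x u
    using that e by (intro ext) (auto simp: precomp_def Id_right H_simps extensional_def)
  \<comment> \<open>The same functor, moved along \<open>enc\<close>.\<close>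
  define F where "F = \<lparr>FOb = V, FMap = (\<lambda>x y p. \<lambda>v\<in>carrier (V x). enc y (precomp x y p (dec x v)))\<rparr>"
  have F_simps: "FOb F x = V x" "FMap F x y p = (\<lambda>v\<in>carrier (V x). enc y (precomp x y p (dec x v)))" for x y p
    by (simp_all add: F_def)
  note Vv = vectorspaceD[OF V]
  have Fcl: "FMap F x y p \<in> carrier (Hom vect_category (V x) (V y))"
    if "x \<in> Ob P" "y \<in> Ob P" "p \<in> carrier (Hom P x y)" for x y p
    unfolding vect_category_simps using that
    by (auto intro!: module_homI simp: F_simps encD decD pre_cl pre_lin Vv(1,6))
  have F: "linear_functor P vect_category F"
  proof (intro linear_functor.intro linear_functor_axioms.intro linear_category_axioms linear_category_vect_category)
    fix x y assume x: "x \<in> Ob P" and y: "y \<in> Ob P"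
    show "FOb F x \<in> Ob vect_category" using x by (simp add: F_simps vect_category_simps V)
    show "FMap F x y \<in> module_hom Cfield (Hom P x y) (Hom vect_category (FOb F x) (FOb F y))"
      by (rule module_homI, unfold F_simps(1), rule Fcl[OF x y])
        (use x y in \<open>auto simp: F_simps vect_category_simps encD(2,3) decD(1) pre_cl pre_add pre_smult intro!: ext\<close>)
  next
    fix x assume x: "x \<in> Ob P"
    show "FMap F x x (Id P x) = Id vect_category (FOb F x)"
      using x by (auto simp: F_simps vect_category_simps pre_id decD(1) enc_dec intro!: ext)
  next
    fix x y z p q assume x: "x \<in> Ob P" "y \<in> Ob P" "z \<in> Ob P" "p \<in> carrier (Hom P x y)" "q \<in> carrier (Hom P y z)"
    then show "FMap F x z (Comp P x y z q p) = Comp vect_category (FOb F x) (FOb F y) (FOb F z) (FMap F y z q) (FMap F x y p)"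
      by (auto simp: F_simps vect_category_simps pre_comp decD(1) encD(1) dec_enc pre_cl intro!: ext)
  qed
  \<comment> \<open>Evaluation at the identity of \<open>e\<close>, and its inverse \<open>m
    \<mapsto> (q \<mapsto> \<psi>(q) m)\<close>.\<close>
  define ev where "ev = (\<lambda>v\<in>carrier (V e). dec e v (Id P e))"
  define row where "row m = (\<lambda>q\<in>carrier (Hom P e e). \<psi> q \<odot>\<^bsub>M\<^esub> m)" for m
  have row: "row m \<in> carrier (H e)" if "m \<in> carrier M" for m
    by (rule HI) (use that e vectorspaceD(1)[OF Hom_vectorspace[OF e e]] in
        \<open>auto simp: row_def \<psi>_closed \<psi>_add \<psi>_comp \<phi>_closed Comp_closed \<psi>_\<phi> M.smult_l_distr M.smult_assoc1\<close>)
  have row_lin: "row (m \<oplus>\<^bsub>M\<^esub> m') = row m \<oplus>\<^bsub>H e\<^esub> row m'" if "m \<in> carrier M" "m' \<in> carrier M" for m m'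
    using that by (auto simp: row_def H_simps M.smult_r_distr \<psi>_closed intro!: ext)
  have row_smult: "row (r \<odot>\<^bsub>M\<^esub> m) = precomp e e (\<phi> r) (row m)" if "r \<in> carrier A" "m \<in> carrier M" for r m
    using that e by (auto simp: row_def precomp_def Comp_closed \<phi>_closed \<psi>_comp \<psi>_\<phi> \<psi>_closed M.smult_assoc1 intro!: ext)
  have row_ev: "row (u (Id P e)) = u" if u: "u \<in> carrier (H e)" for u
  proof (rule ext)
    fix q
    show "row (u (Id P e)) q = u q"
    proof (cases "q \<in> carrier (Hom P e e)")
      case True
      then show ?thesis
        using HD(3)[OF u Id_closed[OF e] \<psi>_closed[OF True]] e
        by (simp add: row_def \<phi>_\<psi> Id_right)
    qed (use u in \<open>auto simp: row_def H_simps extensional_def\<close>)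
  qed
  have act: "r \<odot>\<^bsub>eval_module F\<^esub> v = enc e (precomp e e (\<phi> r) (dec e v))" if "v \<in> carrier (V e)" for r v
    using that by (simp add: eval_module_simps F_simps)
  have ev_act: "dec e (enc e (precomp e e (\<phi> r) (dec e v))) (Id P e) = r \<odot>\<^bsub>M\<^esub> dec e v (Id P e)"
    if "r \<in> carrier A" "v \<in> carrier (V e)" for r v
  proof -
    have d: "dec e v \<in> carrier (H e)" using that e by (simp add: decD)
    have "dec e (enc e (precomp e e (\<phi> r) (dec e v))) (Id P e) = dec e v (\<phi> r)"
      using that e d by (simp add: dec_enc[OF e pre_cl[OF e e \<phi>_closed d]])
         (simp add: precomp_def Id_closed Id_left \<phi>_closed)
    also have "\<dots> = dec e v (Comp P e e e (\<phi> r) (Id P e))" using that e by (simp add: Id_right \<phi>_closed)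
    also have "\<dots> = r \<odot>\<^bsub>M\<^esub> dec e v (Id P e)" using HD(3)[OF d Id_closed] that e by simp
    finally show ?thesis .
  qed
  have "is_iso (module_category A) (FOb eval_functor F) M ev"
    unfolding is_iso_def
  proof (intro conjI bexI[of _ "\<lambda>m\<in>carrier M. enc e (row m)"])
    have acl: "enc e (precomp e e (\<phi> r) (dec e v)) \<in> carrier (V e)" if "r \<in> carrier A" "v \<in> carrier (V e)" for r v
      using that e by (simp add: encD pre_cl \<phi>_closed decD)
    show "ev \<in> carrier (Hom (module_category A) (FOb eval_functor F) M)"
      using e by (auto simp: module_category_simps eval_functor_def hom_module_simps eval_module_simps(1,3) act acl
          F_simps ev_def ev_act Vv(1) decD(1,2) Id_closed HD(1)[OF decD(1)] H_simps(2) intro!: module_homI)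
    show "(\<lambda>m\<in>carrier M. enc e (row m)) \<in> carrier (Hom (module_category A) M (FOb eval_functor F))"
      using e by (auto simp: module_category_simps eval_functor_def hom_module_simps eval_module_simps(1,3) act
          F_simps encD(1,2) row row_lin row_smult dec_enc intro!: module_homI)
    show "Comp (module_category A) (FOb eval_functor F) M (FOb eval_functor F) (\<lambda>m\<in>carrier M. enc e (row m)) ev
      = Id (module_category A) (FOb eval_functor F)"
      using e by (auto simp: module_category_simps eval_functor_def eval_module_simps(1) F_simps ev_def
          HD(1)[OF decD(1)] Id_closed row_ev decD(1) enc_dec intro!: ext)
    show "Comp (module_category A) M (FOb eval_functor F) M ev (\<lambda>m\<in>carrier M. enc e (row m)) = Id (module_category A) M"
      using e by (auto simp: module_category_simps eval_functor_def eval_module_simps(1) F_simps ev_def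
          encD(1) row dec_enc intro!: ext) (simp add: row_def Id_closed \<psi>_id)
  qed
  moreover have "F \<in> Ob (functor_category P vect_category)" using F by (simp add: functor_category_simps)
  ultimately show ?thesis by blast
qed

theorem functor_category_equivalent_module_category:
  "linearly_equivalent (functor_category P (vect_category :: ((complex, 'v) module, 'v \<Rightarrow> 'v) lcat))
    (module_category A :: (('a, 'v) module, 'v \<Rightarrow> 'v) lcat)"
proof (rule linearly_equivalentI, rule linear_functor_eval_functor)
  fix F G :: "('o, 'm, (complex, 'v) module, 'v \<Rightarrow> 'v) ftor"
  assume "F \<in> Ob (functor_category P vect_category)" "G \<in> Ob (functor_category P vect_category)"
  then have "linear_functor P vect_category F" "linear_functor P vect_category G"
    by (simp_all add: functor_category_simps)
  from bij_betw_component_at_generator[OF this]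
  show "bij_betw (FMap eval_functor F G) (carrier (Hom (functor_category P vect_category) F G))
      (carrier (Hom (module_category A) (FOb eval_functor F) (FOb eval_functor G)))"
    unfolding eval_hom_iff[OF \<open>linear_functor P vect_category F\<close> \<open>linear_functor P vect_category G\<close>, symmetric]
    by (simp add: eval_functor_def functor_category_simps module_category_simps)
next
  fix M :: "('a, 'v) module" assume "M \<in> Ob (module_category A)"
  then show "\<exists>F\<in>Ob (functor_category P vect_category). \<exists>f. is_iso (module_category A) (FOb eval_functor F) M f"
    by (intro ex_functor_with_value) (simp add: module_category_simps)
qed

end

section \<open>Matrices: traces, sums and factorizations\<close>

lemma mat_assoc:
  "\<lbrakk>dim_col A = dim_row B; dim_col B = dim_row C\<rbrakk> \<Longrightarrow> (A * B) * C = A * (B * (C :: complex mat))"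
  by (rule assoc_mult_mat[of A "dim_row A" "dim_row B" B "dim_row C" C "dim_col C"]) auto

lemma mat_mult_entry:
  assumes "A \<in> carrier_mat n k" "B \<in> carrier_mat k m" "i < n" "j < m"
  shows "(A * B) $$ (i, j) = (\<Sum>l<k. A $$ (i, l) * B $$ (l, j))"
  using assms by (auto simp: scalar_prod_def atLeast0LessThan intro!: sum.cong)

definition mtrace :: "complex mat \<Rightarrow> complex"
  where "mtrace A = (\<Sum>i<dim_row A. A $$ (i, i))"

lemma mtrace_mult:
  assumes A: "A \<in> carrier_mat n m" and B: "B \<in> carrier_mat m n"
  shows "mtrace (A * B) = (\<Sum>i<n. \<Sum>j<m. A $$ (i, j) * B $$ (j, i))"
  using A by (auto simp: mtrace_def mat_mult_entry[OF A B] intro!: sum.cong)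

lemma mtrace_commute:
  assumes A: "A \<in> carrier_mat n m" and B: "B \<in> carrier_mat m n"
  shows "mtrace (A * B) = mtrace (B * A)"
  unfolding mtrace_mult[OF A B] mtrace_mult[OF B A]
  by (subst sum.swap) (simp add: mult.commute)

lemma mtrace_one [simp]: "mtrace (1\<^sub>m n) = of_nat n"
  by (simp add: mtrace_def)

lemma mtrace_add:
  assumes "A \<in> carrier_mat n n" and "B \<in> carrier_mat n n"
  shows "mtrace (A + B) = mtrace A + mtrace B"
  using assms by (auto simp: mtrace_def sum.distrib)

lemma mtrace_smult:
  assumes "A \<in> carrier_mat n n"
  shows "mtrace (c \<cdot>\<^sub>m A) = c * mtrace A"
  using assms by (auto simp: mtrace_def sum_distrib_left intro!: sum.cong)

text \<open>The format is part of the sum because matrices of all formats share a type, which has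
  no single zero.\<close>

definition msum :: "nat \<Rightarrow> nat \<Rightarrow> ('h \<Rightarrow> complex mat) \<Rightarrow> 'h set \<Rightarrow> complex mat"
  where "msum n m f S = mat n m (\<lambda>(i, j). \<Sum>h\<in>S. f h $$ (i, j))"

lemma msum_carrier [simp]: "msum n m f S \<in> carrier_mat n m"
  by (simp add: msum_def)

lemma msum_entry: "\<lbrakk>i < n; j < m\<rbrakk> \<Longrightarrow> msum n m f S $$ (i, j) = (\<Sum>h\<in>S. f h $$ (i, j))"
  by (simp add: msum_def)

lemma msum_cong: "(\<And>h. h \<in> S \<Longrightarrow> f h = g h) \<Longrightarrow> msum n m f S = msum n m g S"
  by (auto simp: msum_def intro!: eq_matI)

lemma msum_reindex: "bij_betw \<pi> S T \<Longrightarrow> msum n m f T = msum n m (\<lambda>h. f (\<pi> h)) S"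
  by (auto simp: msum_def intro!: eq_matI sum.reindex_bij_betw[symmetric])

lemma mult_msum:
  assumes A: "A \<in> carrier_mat k n" and f: "\<And>h. h \<in> S \<Longrightarrow> f h \<in> carrier_mat n m"
  shows "A * msum n m f S = msum k m (\<lambda>h. A * f h) S"
proof (rule eq_matI)
  fix i j assume "i < dim_row (msum k m (\<lambda>h. A * f h) S)" "j < dim_col (msum k m (\<lambda>h. A * f h) S)"
  then have ij: "i < k" "j < m" by (auto simp: msum_def)
  have "(A * msum n m f S) $$ (i, j) = (\<Sum>l<n. A $$ (i, l) * (\<Sum>h\<in>S. f h $$ (l, j)))"
    using ij by (subst mat_mult_entry[OF A]) (auto simp: msum_entry)
  also have "\<dots> = (\<Sum>h\<in>S. \<Sum>l<n. A $$ (i, l) * f h $$ (l, j))"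
    by (subst sum.swap) (simp add: sum_distrib_left)
  also have "\<dots> = (\<Sum>h\<in>S. (A * f h) $$ (i, j))"
    by (rule sum.cong) (use ij mat_mult_entry[OF A f] in auto)
  finally show "(A * msum n m f S) $$ (i, j) = msum k m (\<lambda>h. A * f h) S $$ (i, j)"
    using ij by (simp add: msum_entry)
qed (use A in \<open>auto simp: msum_def\<close>)

lemma msum_mult:
  assumes A: "A \<in> carrier_mat m k" and f: "\<And>h. h \<in> S \<Longrightarrow> f h \<in> carrier_mat n m"
  shows "msum n m f S * A = msum n k (\<lambda>h. f h * A) S"
proof (rule eq_matI)
  fix i j assume "i < dim_row (msum n k (\<lambda>h. f h * A) S)" "j < dim_col (msum n k (\<lambda>h. f h * A) S)"
  then have ij: "i < n" "j < k" by (auto simp: msum_def)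
  have "(msum n m f S * A) $$ (i, j) = (\<Sum>l<m. (\<Sum>h\<in>S. f h $$ (i, l)) * A $$ (l, j))"
    using ij by (subst mat_mult_entry[OF _ A]) (auto simp: msum_entry)
  also have "\<dots> = (\<Sum>h\<in>S. \<Sum>l<m. f h $$ (i, l) * A $$ (l, j))"
    by (subst sum.swap) (simp add: sum_distrib_right)
  also have "\<dots> = (\<Sum>h\<in>S. (f h * A) $$ (i, j))"
    by (rule sum.cong) (use ij mat_mult_entry[OF f A] in auto)
  finally show "(msum n m f S * A) $$ (i, j) = msum n k (\<lambda>h. f h * A) S $$ (i, j)"
    using ij by (simp add: msum_entry)
qed (use A in \<open>auto simp: msum_def\<close>)

lemma mtrace_msum:
  assumes "\<And>h. h \<in> S \<Longrightarrow> f h \<in> carrier_mat n n"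
  shows "mtrace (msum n n f S) = (\<Sum>h\<in>S. mtrace (f h))"
proof -
  have "mtrace (msum n n f S) = (\<Sum>i<n. \<Sum>h\<in>S. f h $$ (i, i))"
    by (simp add: mtrace_def msum_def)
  also have "\<dots> = (\<Sum>h\<in>S. mtrace (f h))"
    by (subst sum.swap) (use assms in \<open>auto simp: mtrace_def intro!: sum.cong\<close>)
  finally show ?thesis .
qed

lemma msum_const:
  "A \<in> carrier_mat n m \<Longrightarrow> msum n m (\<lambda>_. A) S = of_nat (card S) \<cdot>\<^sub>m A"
  by (auto simp: msum_def intro!: eq_matI)

lemma mult_msum_vec:
  assumes f: "\<And>h. h \<in> S \<Longrightarrow> f h \<in> carrier_mat n m" and v: "v \<in> carrier_vec m" and i: "i < n"
  shows "(msum n m f S *\<^sub>v v) $ i = (\<Sum>h\<in>S. (f h *\<^sub>v v) $ i)"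
proof -
  have "(msum n m f S *\<^sub>v v) $ i = (\<Sum>l<m. (\<Sum>h\<in>S. f h $$ (i, l)) * v $ l)"
    using v i by (auto simp: msum_def scalar_prod_def atLeast0LessThan)
  also have "\<dots> = (\<Sum>h\<in>S. \<Sum>l<m. f h $$ (i, l) * v $ l)"
    by (subst sum.swap) (simp add: sum_distrib_right)
  also have "\<dots> = (\<Sum>h\<in>S. (f h *\<^sub>v v) $ i)"
  proof (rule sum.cong)
    fix h assume "h \<in> S"
    from f[OF this] show "(\<Sum>l<m. f h $$ (i, l) * v $ l) = (f h *\<^sub>v v) $ i"
      using v i by (auto simp: scalar_prod_def atLeast0LessThan intro!: sum.cong)
  qed simp
  finally show ?thesis .
qed

lemma mat_eqI_vec:
  assumes A: "A \<in> carrier_mat n m" and B: "B \<in> carrier_mat n m"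
    and eq: "\<And>v. v \<in> carrier_vec m \<Longrightarrow> A *\<^sub>v v = B *\<^sub>v (v :: complex vec)"
  shows "A = B"
proof (rule eq_matI)
  fix i j assume "i < dim_row B" "j < dim_col B"
  then have ij: "i < n" "j < m" using B by auto
  have "(A *\<^sub>v unit_vec m j) $ i = (B *\<^sub>v unit_vec m j) $ i" by (simp add: eq)
  then show "A $$ (i, j) = B $$ (i, j)"
    using A B ij by (simp add: scalar_prod_right_unit)
qed (use A B in auto)

lemma solve_columnwise:
  assumes A: "A \<in> carrier_mat n m" and B: "B \<in> carrier_mat n k"
    and col: "\<And>j. j < k \<Longrightarrow> \<exists>v\<in>carrier_vec m. A *\<^sub>v v = col B j"
  shows "\<exists>C\<in>carrier_mat m k. A * C = B"
proof -
  obtain v where v: "\<And>j. j < k \<Longrightarrow> v j \<in> carrier_vec m \<and> A *\<^sub>v v j = col B j"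
    using col by metis
  let ?C = "mat m k (\<lambda>(i, j). v j $ i)"
  have c: "col ?C j = v j" if "j < k" for j
    using v[OF that] that by (intro eq_vecI) auto
  have "A * ?C = B"
  proof (rule eq_matI)
    fix i j assume "i < dim_row B" "j < dim_col B"
    then have ij: "i < n" "j < k" using B by auto
    have "(A * ?C) $$ (i, j) = row A i \<bullet> col ?C j" using A ij by simp
    also have "\<dots> = (A *\<^sub>v v j) $ i" unfolding c[OF ij(2)] using A ij by simp
    also have "\<dots> = B $$ (i, j)" using v[OF ij(2)] ij B by simp
    finally show "(A * ?C) $$ (i, j) = B $$ (i, j)" .
  qed (use A B in auto)
  then show ?thesis by (intro bexI[of _ ?C]) auto
qed

lemma surjective_right_inverse:
  assumes A: "A \<in> carrier_mat n m"
    and surj: "(\<lambda>v. A *\<^sub>v v) ` carrier_vec m = carrier_vec n"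
  shows "\<exists>B\<in>carrier_mat m n. A * B = 1\<^sub>m n"
proof (rule solve_columnwise[OF A])
  fix j assume "j < n"
  have "col (1\<^sub>m n) j \<in> carrier_vec n" using col_dim[of "1\<^sub>m n" j] by simp
  then show "\<exists>v\<in>carrier_vec m. A *\<^sub>v v = col (1\<^sub>m n) j" using surj by (metis (mono_tags, lifting) imageE)
qed simp

text \<open>If \<open>A\<close> is injective, the Gram matrix \<open>A\<^sup>* A\<close> is
  invertible, because \<open>v\<^sup>* A\<^sup>* A v\<close> is the squared norm of \<open>A
  v\<close>.\<close>

lemma injective_left_inverse:
  assumes A: "(A :: complex mat) \<in> carrier_mat n r"
    and ker: "\<And>v. \<lbrakk>v \<in> carrier_vec r; A *\<^sub>v v = 0\<^sub>v n\<rbrakk> \<Longrightarrow> v = 0\<^sub>v r"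
  shows "\<exists>B\<in>carrier_mat r n. B * A = 1\<^sub>m r"
proof -
  define A' where "A' = mat r n (\<lambda>(i, j). cnj (A $$ (j, i)))"
  have A': "A' \<in> carrier_mat r n" by (simp add: A'_def)
  have G: "A' * A \<in> carrier_mat r r" using A A' by simp
  have "det (A' * A) \<noteq> 0"
  proof
    assume "det (A' * A) = 0"
    then obtain v where v: "v \<in> carrier_vec r" "v \<noteq> 0\<^sub>v r" and Gv: "(A' * A) *\<^sub>v v = 0\<^sub>v r"
      using det_0_iff_vec_prod_zero_field[OF G] by blast
    define w where "w = A *\<^sub>v v"
    have w: "w \<in> carrier_vec n" using A v by (simp add: w_def)
    have "A' *\<^sub>v w = 0\<^sub>v r" using Gv A A' v by (simp add: w_def)
    then have "(A' *\<^sub>v w) $ i = 0" if "i < r" for i using that by simp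
    then have z: "(\<Sum>j<n. cnj (A $$ (j, i)) * w $ j) = 0" if "i < r" for i
      using w that by (simp add: A'_def scalar_prod_def atLeast0LessThan)
    have wj: "w $ j = (\<Sum>i<r. A $$ (j, i) * v $ i)" if "j < n" for j
      using that A v by (auto simp: w_def scalar_prod_def atLeast0LessThan intro!: sum.cong)
    have cw: "cnj (w $ j) = (\<Sum>i<r. cnj (v $ i) * cnj (A $$ (j, i)))" if "j < n" for j
      by (simp add: wj[OF that] mult.commute)
    have "(\<Sum>j<n. cnj (w $ j) * w $ j) = (\<Sum>j<n. \<Sum>i<r. cnj (v $ i) * (cnj (A $$ (j, i)) * w $ j))"
      by (simp add: cw sum_distrib_right mult.assoc)
    also have "\<dots> = (\<Sum>i<r. cnj (v $ i) * (\<Sum>j<n. cnj (A $$ (j, i)) * w $ j))"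
      by (subst sum.swap) (simp add: sum_distrib_left)
    also have "\<dots> = 0" using z by simp
    finally have "(\<Sum>j<n. cnj (w $ j) * w $ j) = 0" .
    then have "complex_of_real (\<Sum>j<n. (cmod (w $ j))\<^sup>2) = 0"
      by (simp add: complex_norm_square mult.commute del: of_real_power)
    then have "(\<Sum>j<n. (cmod (w $ j))\<^sup>2) = 0" using of_real_eq_0_iff by blast
    then have "\<forall>j<n. w $ j = 0" by (simp add: sum_nonneg_eq_0_iff)
    then have "w = 0\<^sub>v n" using w by (intro eq_vecI) auto
    then show False using ker[OF v(1)] v(2) by (simp add: w_def)
  qed
  then obtain B where B: "B \<in> carrier_mat r r" "B * (A' * A) = 1\<^sub>m r"
    using det_non_zero_imp_unit[OF G, of "()"] G
    by (auto simp: Units_def ring_mat_simps)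
  show ?thesis
    by (rule bexI[of _ "B * A'"]) (use A A' B in auto)
qed

text \<open>A linear relation between the columns of \<open>S\<close> expresses one of them
  through the others; that column can be dropped from \<open>S\<close> if the corresponding row of
  \<open>P\<close> is distributed over the other rows.\<close>

lemma reduce_factorization:
  assumes S: "(S :: complex mat) \<in> carrier_mat n (Suc r)" and P: "P \<in> carrier_mat (Suc r) m"
    and v: "v \<in> carrier_vec (Suc r)" "v \<noteq> 0\<^sub>v (Suc r)" and Sv: "S *\<^sub>v v = 0\<^sub>v n"
  shows "\<exists>S1\<in>carrier_mat n r. \<exists>P1\<in>carrier_mat r m. S1 * P1 = S * P"
proof -
  \<comment> \<open>Column \<open>j\<close> is the one to be removed; \<open>\<sigma>\<close>
    enumerates the others.\<close>
  obtain j where j: "j < Suc r" and vj: "v $ j \<noteq> 0"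
    using v by (metis carrier_vecD eq_vecI index_zero_vec(1) index_zero_vec(2))
  define \<sigma> where "\<sigma> k = (if k < j then k else Suc k)" for k
  have bij: "bij_betw \<sigma> {..<r} ({..<Suc r} - {j})"
    unfolding bij_betw_def
  proof
    show "inj_on \<sigma> {..<r}" by (auto simp: inj_on_def \<sigma>_def split: if_splits)
    show "\<sigma> ` {..<r} = {..<Suc r} - {j}"
    proof (intro subset_antisym subsetI)
      fix k assume "k \<in> {..<Suc r} - {j}"
      then have "k = \<sigma> (if k < j then k else k - 1)" "(if k < j then k else k - 1) < r"
        using j by (auto simp: \<sigma>_def)
      then show "k \<in> \<sigma> ` {..<r}" by blast
    qed (auto simp: \<sigma>_def)
  qed
  have \<sigma>: "\<sigma> k < Suc r" if "k < r" for k using that by (auto simp: \<sigma>_def)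
  define S1 where "S1 = mat n r (\<lambda>(i, k). S $$ (i, \<sigma> k))"
  define P1 where "P1 = mat r m (\<lambda>(k, l). P $$ (\<sigma> k, l) - v $ \<sigma> k / v $ j * P $$ (j, l))"
  have S1: "S1 \<in> carrier_mat n r" and P1: "P1 \<in> carrier_mat r m" by (auto simp: S1_def P1_def)
  have "S1 * P1 = S * P"
  proof (rule eq_matI)
    fix i l assume "i < dim_row (S * P)" "l < dim_col (S * P)"
    then have il: "i < n" "l < m" using S P by auto
    have rel: "(\<Sum>k<Suc r. S $$ (i, k) * v $ k) = 0"
      using arg_cong[OF Sv, of "\<lambda>x. x $ i"] S v il by (auto simp: scalar_prod_def atLeast0LessThan)
    have split: "(\<Sum>k<Suc r. f k) = f j + (\<Sum>k<r. f (\<sigma> k))" for f :: "nat \<Rightarrow> complex"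
      using j by (subst sum.reindex_bij_betw[OF bij]) (simp add: sum.remove[of _ j] del: sum.lessThan_Suc)
    have "(S1 * P1) $$ (i, l) = (\<Sum>k<r. S $$ (i, \<sigma> k) * (P $$ (\<sigma> k, l) - v $ \<sigma> k / v $ j * P $$ (j, l)))"
      using il by (subst mat_mult_entry[OF S1 P1]) (auto simp: S1_def P1_def)
    also have "\<dots> = (\<Sum>k<r. S $$ (i, \<sigma> k) * P $$ (\<sigma> k, l))
        - (\<Sum>k<r. S $$ (i, \<sigma> k) * v $ \<sigma> k) / v $ j * P $$ (j, l)"
      by (simp add: sum_subtractf sum_distrib_left sum_distrib_right sum_divide_distrib algebra_simps)
    also have "(\<Sum>k<r. S $$ (i, \<sigma> k) * v $ \<sigma> k) = - (S $$ (i, j) * v $ j)"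
      using rel split[of "\<lambda>k. S $$ (i, k) * v $ k"] by (simp add: eq_neg_iff_add_eq_0 add.commute del: sum.lessThan_Suc)
    also have "(\<Sum>k<r. S $$ (i, \<sigma> k) * P $$ (\<sigma> k, l)) - - (S $$ (i, j) * v $ j) / v $ j * P $$ (j, l)
        = (\<Sum>k<Suc r. S $$ (i, k) * P $$ (k, l))"
      using vj split[of "\<lambda>k. S $$ (i, k) * P $$ (k, l)"] by (simp del: sum.lessThan_Suc)
    also have "\<dots> = (S * P) $$ (i, l)" using il by (simp only: mat_mult_entry[OF S P])
    finally show "(S1 * P1) $$ (i, l) = (S * P) $$ (i, l)" .
  qed (use S1 P1 S P in auto)
  then show ?thesis using S1 P1 by blast
qed

text \<open>Take the inner dimension \<open>r\<close> as small as possible. Then \<open>S\<close>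
  is injective and \<open>P\<close> is surjective, since otherwise
  \<open>reduce_factorization\<close> shortens the factorization \<open>A = S P\<close> or its
  transpose.\<close>

lemma full_rank_factorization:
  assumes A: "(A :: complex mat) \<in> carrier_mat n m"
  obtains r S P S' P' where "S \<in> carrier_mat n r" "P \<in> carrier_mat r m" "S' \<in> carrier_mat r n" "P' \<in> carrier_mat m r"
    "A = S * P" "S' * S = 1\<^sub>m r" "P * P' = 1\<^sub>m r"
proof -
  let ?Q = "\<lambda>r. \<exists>S\<in>carrier_mat n r. \<exists>P\<in>carrier_mat r m. S * P = A"
  define r where "r = (LEAST r. ?Q r)"
  have "?Q n" using A by (intro bexI[of _ "1\<^sub>m n"] bexI[of _ A]) auto
  then have "?Q r" unfolding r_def by (rule LeastI)
  then obtain S P where S: "S \<in> carrier_mat n r" and P: "P \<in> carrier_mat r m" and SP: "S * P = A" by blast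
  have min: "\<not> ?Q k" if "k < r" for k using that unfolding r_def by (rule not_less_Least)
  have r0: "v = 0\<^sub>v r" if "r = 0" "v \<in> carrier_vec r" for v :: "complex vec"
    using that by (intro eq_vecI) auto
  have "\<exists>S'\<in>carrier_mat r n. S' * S = 1\<^sub>m r"
  proof (rule injective_left_inverse[OF S], rule ccontr)
    fix v assume v: "v \<in> carrier_vec r" "S *\<^sub>v v = 0\<^sub>v n" and ne: "v \<noteq> 0\<^sub>v r"
    obtain k where k: "r = Suc k" using r0[OF _ v(1)] ne not0_implies_Suc by blast
    show False using reduce_factorization[OF S[unfolded k] P[unfolded k] v(1)[unfolded k] ne[unfolded k] v(2)] min[of k]
      by (auto simp: k SP)
  qed
  then obtain S' where S': "S' \<in> carrier_mat r n" "S' * S = 1\<^sub>m r" by blast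
  \<comment> \<open>The transposes factorize the transpose of \<open>A\<close>, so the same
    argument applies to \<open>P\<close>.\<close>
  have "\<exists>Q\<in>carrier_mat r m. Q * transpose_mat P = 1\<^sub>m r"
  proof (rule injective_left_inverse, rule transpose_carrier_mat[THEN iffD2, OF P], rule ccontr)
    fix v assume v: "v \<in> carrier_vec r" "transpose_mat P *\<^sub>v v = 0\<^sub>v m" and ne: "v \<noteq> 0\<^sub>v r"
    obtain k where k: "r = Suc k" using r0[OF _ v(1)] ne not0_implies_Suc by blast
    have T: "transpose_mat P \<in> carrier_mat m (Suc k)" "transpose_mat S \<in> carrier_mat (Suc k) n" using S P k by auto
    obtain S1 P1 where 1: "S1 \<in> carrier_mat m k" "P1 \<in> carrier_mat k n" "S1 * P1 = transpose_mat P * transpose_mat S"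
      using reduce_factorization[OF T v(1)[unfolded k] ne[unfolded k] v(2)] by blast
    have "transpose_mat P1 * transpose_mat S1 = transpose_mat (S1 * P1)"
      using transpose_mult[OF 1(1,2)] by simp
    also have "\<dots> = A" unfolding 1(3) using S P by (simp add: transpose_mult SP)
    finally have "transpose_mat P1 * transpose_mat S1 = A" .
    then have "?Q k" using 1 by (intro bexI[of _ "transpose_mat P1"] bexI[of _ "transpose_mat S1"]) auto
    then show False using min[of k] k by simp
  qed
  then obtain Q where Q: "Q \<in> carrier_mat r m" "Q * transpose_mat P = 1\<^sub>m r" by blast
  have "P * transpose_mat Q = transpose_mat (Q * transpose_mat P)"
    using P Q by (subst transpose_mult[of _ r m _ r]) auto
  also have "\<dots> = 1\<^sub>m r" by (simp add: Q)
  finally have "P * transpose_mat Q = 1\<^sub>m r" .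
  moreover have "transpose_mat Q \<in> carrier_mat m r" using Q by simp
  ultimately show ?thesis using that[OF S P S'(1) _ SP[symmetric] S'(2)] by blast
qed

text \<open>In a factorization of full rank, \<open>S (P S) P = S P\<close> may be cancelled on
  both sides.\<close>

lemma idempotent_splitting:
  assumes E: "(E :: complex mat) \<in> carrier_mat n n" and EE: "E * E = E"
  obtains r S P where "S \<in> carrier_mat n r" "P \<in> carrier_mat r n" "E = S * P" "P * S = 1\<^sub>m r"
proof -
  obtain r S P S' P' where S: "S \<in> carrier_mat n r" and P: "P \<in> carrier_mat r n" and S': "S' \<in> carrier_mat r n"
    and P': "P' \<in> carrier_mat n r" and ESP: "E = S * P" and S'S: "S' * S = 1\<^sub>m r" and PP': "P * P' = 1\<^sub>m r"
    by (rule full_rank_factorization[OF E])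
  note d = carrier_matD[OF S] carrier_matD[OF P] carrier_matD[OF S'] carrier_matD[OF P']
  have "P * S = S' * S * (P * S) * (P * P')" using S'S PP' S P by simp
  also have "\<dots> = S' * ((S * P) * (S * P)) * P'" by (simp add: mat_assoc d)
  also have "\<dots> = S' * (S * P) * P'" using EE by (simp add: ESP)
  also have "\<dots> = S' * S * (P * P')" by (simp add: mat_assoc d)
  finally have "P * S = 1\<^sub>m r" using S'S PP' by simp
  then show ?thesis using that S P ESP by blast
qed

section \<open>Representations and short exact sequences\<close>

lemma repsD:
  assumes "V \<in> reps H"
  shows "h \<in> carrier H \<Longrightarrow> ract V h \<in> carrier_mat (rdim V) (rdim V)"
    and "ract V \<one>\<^bsub>H\<^esub> = 1\<^sub>m (rdim V)"
    and "\<lbrakk>x \<in> carrier H; y \<in> carrier H\<rbrakk> \<Longrightarrow> ract V (x \<otimes>\<^bsub>H\<^esub> y) = ract V x * ract V y"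
  using assms by (auto simp: reps_def)

lemma repsI:
  assumes "\<And>h. h \<in> carrier H \<Longrightarrow> \<rho> h \<in> carrier_mat n n"
    and "\<rho> \<one>\<^bsub>H\<^esub> = 1\<^sub>m n"
    and "\<And>x y. \<lbrakk>x \<in> carrier H; y \<in> carrier H\<rbrakk> \<Longrightarrow> \<rho> (x \<otimes>\<^bsub>H\<^esub> y) = \<rho> x * \<rho> y"
  shows "(n, \<rho>) \<in> reps H"
  using assms by (auto simp: reps_def)

lemma rep_homsD:
  assumes "A \<in> rep_homs H V W"
  shows "A \<in> carrier_mat (rdim W) (rdim V)"
    and "h \<in> carrier H \<Longrightarrow> A * ract V h = ract W h * A"
  using assms by (auto simp: rep_homs_def)

lemma rep_homsI:
  assumes "A \<in> carrier_mat (rdim W) (rdim V)"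
    and "\<And>h. h \<in> carrier H \<Longrightarrow> A * ract V h = ract W h * A"
  shows "A \<in> rep_homs H V W"
  using assms by (auto simp: rep_homs_def)

definition character :: "('a, 'b) monoid_scheme \<Rightarrow> 'a rep \<Rightarrow> 'a \<Rightarrow> complex"
  where "character H V h = (if h \<in> carrier H then mtrace (ract V h) else 0)"

text \<open>With \<open>P'\<close> a linear section of \<open>P\<close>, the assumption
  \<open>ker\<close> says that the action preserves the kernel of \<open>P\<close>, which is the
  image of \<open>1 - P' P\<close>; so the action descends to the image of
  \<open>P\<close>.\<close>

lemma quotient_rep:
  assumes H: "monoid H" and V: "V \<in> reps H"
    and P: "P \<in> carrier_mat r (rdim V)" and P': "P' \<in> carrier_mat (rdim V) r" and PP': "P * P' = 1\<^sub>m r"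
    and ker: "\<And>h. h \<in> carrier H \<Longrightarrow> P * (ract V h * (P' * P)) = P * ract V h"
  shows "(r, \<lambda>h. P * (ract V h * P')) \<in> reps H"
    and "P \<in> rep_homs H V (r, \<lambda>h. P * (ract V h * P'))"
proof -
  interpret monoid H by (rule H)
  note \<rho> = repsD[OF V]
  note dims = carrier_matD[OF P] carrier_matD[OF P']
  have d: "dim_row (ract V h) = rdim V" "dim_col (ract V h) = rdim V" if "h \<in> carrier H" for h
    using carrier_matD[OF \<rho>(1)[OF that]] .
  show "(r, \<lambda>h. P * (ract V h * P')) \<in> reps H"
  proof (rule repsI)
    fix x y assume x: "x \<in> carrier H" and y: "y \<in> carrier H"
    have "(P * (ract V x * P')) * (P * (ract V y * P')) = (P * (ract V x * (P' * P))) * (ract V y * P')"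
      using x y by (simp add: mat_assoc d dims)
    also have "\<dots> = P * ((ract V x * ract V y) * P')"
      unfolding ker[OF x] using x y by (simp add: mat_assoc d dims)
    finally show "P * (ract V (x \<otimes>\<^bsub>H\<^esub> y) * P') = (P * (ract V x * P')) * (P * (ract V y * P'))"
      using x y \<rho>(3) by simp
  qed (use P P' PP' \<rho>(1,2) in auto)
  show "P \<in> rep_homs H V (r, \<lambda>h. P * (ract V h * P'))"
  proof (rule rep_homsI)
    fix h assume h: "h \<in> carrier H"
    have "(P * (ract V h * P')) * P = P * (ract V h * (P' * P))" using h by (simp add: mat_assoc d dims)
    then show "P * ract V h = ract (r, \<lambda>h. P * (ract V h * P')) h * P" using ker[OF h] by simp
  qed (use P in simp)
qed

text \<open>Dual to the previous lemma: the image of \<open>S\<close> is preserved by the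
  action.\<close>

lemma sub_rep:
  assumes H: "monoid H" and V: "V \<in> reps H"
    and S: "S \<in> carrier_mat (rdim V) k" and S': "S' \<in> carrier_mat k (rdim V)" and S'S: "S' * S = 1\<^sub>m k"
    and im: "\<And>h. h \<in> carrier H \<Longrightarrow> S * (S' * (ract V h * S)) = ract V h * S"
  shows "(k, \<lambda>h. S' * (ract V h * S)) \<in> reps H"
    and "S \<in> rep_homs H (k, \<lambda>h. S' * (ract V h * S)) V"
proof -
  interpret monoid H by (rule H)
  note \<rho> = repsD[OF V]
  note dims = carrier_matD[OF S] carrier_matD[OF S']
  have d: "dim_row (ract V h) = rdim V" "dim_col (ract V h) = rdim V" if "h \<in> carrier H" for h
    using carrier_matD[OF \<rho>(1)[OF that]] .
  show "(k, \<lambda>h. S' * (ract V h * S)) \<in> reps H"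
  proof (rule repsI)
    fix x y assume x: "x \<in> carrier H" and y: "y \<in> carrier H"
    have "(S' * (ract V x * S)) * (S' * (ract V y * S)) = S' * (ract V x * (S * (S' * (ract V y * S))))"
      using x y by (simp add: mat_assoc d dims)
    also have "\<dots> = S' * ((ract V x * ract V y) * S)"
      unfolding im[OF y] using x y by (simp add: mat_assoc d dims)
    finally show "S' * (ract V (x \<otimes>\<^bsub>H\<^esub> y) * S) = (S' * (ract V x * S)) * (S' * (ract V y * S))"
      using x y \<rho>(3) by simp
  qed (use S S' S'S \<rho>(1,2) in auto)
  show "S \<in> rep_homs H (k, \<lambda>h. S' * (ract V h * S)) V"
    using S im by (auto intro!: rep_homsI)
qed

text \<open>A short exact sequence splits linearly (not equivariantly): given a linear section
  \<open>B'\<close> of \<open>B\<close>, the matrix \<open>1 - B' B\<close> maps into the kernel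
  of \<open>B\<close>, that is, into the image of \<open>A\<close>.\<close>

lemma short_exact_split:
  assumes U: "U \<in> reps H" and V: "V \<in> reps H" and W: "W \<in> reps H" and ex: "short_exact H U V W"
  obtains A A' B B' where "A \<in> rep_homs H U V" "B \<in> rep_homs H V W"
    "A' \<in> carrier_mat (rdim U) (rdim V)" "B' \<in> carrier_mat (rdim V) (rdim W)"
    "A' * A = 1\<^sub>m (rdim U)" "B * B' = 1\<^sub>m (rdim W)" "A * A' + B' * B = 1\<^sub>m (rdim V)"
proof -
  obtain A B where A: "A \<in> rep_homs H U V" and B: "B \<in> rep_homs H V W"
    and inj: "inj_on (\<lambda>u. A *\<^sub>v u) (carrier_vec (rdim U))"
    and im: "(\<lambda>u. A *\<^sub>v u) ` carrier_vec (rdim U) = mat_kernel B"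
    and surj: "(\<lambda>v. B *\<^sub>v v) ` carrier_vec (rdim V) = carrier_vec (rdim W)"
    using ex by (auto simp: short_exact_def)
  note cA = rep_homsD(1)[OF A] and cB = rep_homsD(1)[OF B]
  obtain B' where B': "B' \<in> carrier_mat (rdim V) (rdim W)" "B * B' = 1\<^sub>m (rdim W)"
    using surjective_right_inverse[OF cB surj] by blast
  let ?E = "1\<^sub>m (rdim V) - B' * B"
  have E: "?E \<in> carrier_mat (rdim V) (rdim V)" using B' cB by auto
  have BE: "B * ?E = 0\<^sub>m (rdim W) (rdim V)"
  proof -
    have "B * ?E = B * 1\<^sub>m (rdim V) - B * (B' * B)"
      by (rule mult_minus_distrib_mat[OF cB]) (use B' cB in auto)
    also have "B * (B' * B) = B" using assoc_mult_mat[OF cB B'(1) cB] B'(2) cB by simp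
    finally show ?thesis using cB by (auto intro!: eq_matI)
  qed
  have "\<exists>A'\<in>carrier_mat (rdim U) (rdim V). A * A' = ?E"
  proof (rule solve_columnwise[OF cA E])
    fix j assume j: "j < rdim V"
    have "B *\<^sub>v col ?E j = col (B * ?E) j" by (rule col_mult2[OF cB E j, symmetric])
    also have "\<dots> = 0\<^sub>v (rdim W)" unfolding BE using j by (intro eq_vecI) auto
    finally have "B *\<^sub>v col ?E j = 0\<^sub>v (rdim W)" .
    then have "col ?E j \<in> mat_kernel B" using cB col_dim[of ?E j] E by (auto simp: mat_kernel_def)
    then show "\<exists>v\<in>carrier_vec (rdim U). A *\<^sub>v v = col ?E j" unfolding im[symmetric] by auto
  qed
  then obtain A' where A': "A' \<in> carrier_mat (rdim U) (rdim V)" "A * A' = ?E" by blast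
  have sum: "A * A' + B' * B = 1\<^sub>m (rdim V)" unfolding A'(2) using B' cB by (auto intro!: eq_matI)
  have "A' * A = 1\<^sub>m (rdim U)"
  proof (rule mat_eqI_vec)
    fix u :: "complex vec" assume u: "u \<in> carrier_vec (rdim U)"
    have Au: "A *\<^sub>v u \<in> carrier_vec (rdim V)" and A'Au: "A' *\<^sub>v (A *\<^sub>v u) \<in> carrier_vec (rdim U)" using cA A' u by auto
    have "A *\<^sub>v u \<in> mat_kernel B" using im u by blast
    then have BAu: "B *\<^sub>v (A *\<^sub>v u) = 0\<^sub>v (rdim W)" using cB by (auto simp: mat_kernel_def)
    have "A *\<^sub>v u = (A * A' + B' * B) *\<^sub>v (A *\<^sub>v u)" unfolding sum using Au by simp
    also have "\<dots> = (A * A') *\<^sub>v (A *\<^sub>v u) + (B' * B) *\<^sub>v (A *\<^sub>v u)"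
      by (rule add_mult_distrib_mat_vec) (use cA cB A' B' Au in auto)
    also have "(B' * B) *\<^sub>v (A *\<^sub>v u) = B' *\<^sub>v (B *\<^sub>v (A *\<^sub>v u))" by (rule assoc_mult_mat_vec[OF B'(1) cB Au])
    also have "\<dots> = 0\<^sub>v (rdim V)" unfolding BAu using B' by auto
    also have "(A * A') *\<^sub>v (A *\<^sub>v u) = A *\<^sub>v (A' *\<^sub>v (A *\<^sub>v u))" by (rule assoc_mult_mat_vec[OF cA A'(1) Au])
    finally have "A *\<^sub>v (A' *\<^sub>v (A *\<^sub>v u)) = A *\<^sub>v u" using A'Au cA by simp
    then have "A' *\<^sub>v (A *\<^sub>v u) = u" by (rule inj_onD[OF inj]) (use u A'Au in auto)
    then show "(A' * A) *\<^sub>v u = 1\<^sub>m (rdim U) *\<^sub>v u" using assoc_mult_mat_vec[OF A'(1) cA u] u by simp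
  qed (use A' cA in auto)
  then show ?thesis using that[OF A B A'(1) B'(1) _ B'(2) sum] by blast
qed

lemma short_exactI:
  assumes A: "A \<in> rep_homs H U V" and B: "B \<in> rep_homs H V W"
    and A': "A' \<in> carrier_mat (rdim U) (rdim V)" and B': "B' \<in> carrier_mat (rdim V) (rdim W)"
    and A'A: "A' * A = 1\<^sub>m (rdim U)" and BB': "B * B' = 1\<^sub>m (rdim W)"
    and BA: "B * A = 0\<^sub>m (rdim W) (rdim U)" and sum: "A * A' + B' * B = 1\<^sub>m (rdim V)"
  shows "short_exact H U V W"
  unfolding short_exact_def
proof (intro bexI[OF _ A] bexI[OF _ B] conjI subset_antisym subsetI)
  note cA = rep_homsD(1)[OF A] and cB = rep_homsD(1)[OF B]
  have A'Au: "A' *\<^sub>v (A *\<^sub>v u) = u" if "u \<in> carrier_vec (rdim U)" for u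
    using assoc_mult_mat_vec[OF A' cA that] A'A that by simp
  show "inj_on (\<lambda>u. A *\<^sub>v u) (carrier_vec (rdim U))"
    by (rule inj_on_inverseI[of _ "\<lambda>v. A' *\<^sub>v v"]) (rule A'Au)
  fix v
  show "v \<in> mat_kernel B" if v: "v \<in> (\<lambda>u. A *\<^sub>v u) ` carrier_vec (rdim U)"
  proof -
    obtain u where u: "u \<in> carrier_vec (rdim U)" "v = A *\<^sub>v u" using v by blast
    have "B *\<^sub>v (A *\<^sub>v u) = (B * A) *\<^sub>v u" using assoc_mult_mat_vec[OF cB cA u(1)] by simp
    also have "\<dots> = 0\<^sub>v (rdim W)" unfolding BA using u by (intro eq_vecI) auto
    finally show ?thesis using u cA cB by (auto simp: mat_kernel_def)
  qed
  show "v \<in> (\<lambda>u. A *\<^sub>v u) ` carrier_vec (rdim U)" if "v \<in> mat_kernel B"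
  proof -
    have v: "v \<in> carrier_vec (rdim V)" "B *\<^sub>v v = 0\<^sub>v (rdim W)" using that cB by (auto simp: mat_kernel_def)
    have "v = (A * A' + B' * B) *\<^sub>v v" using sum v by simp
    also have "\<dots> = (A * A') *\<^sub>v v + (B' * B) *\<^sub>v v"
      by (rule add_mult_distrib_mat_vec) (use cA cB A' B' v in auto)
    also have "(A * A') *\<^sub>v v = A *\<^sub>v (A' *\<^sub>v v)" by (rule assoc_mult_mat_vec[OF cA A' v(1)])
    also have "(B' * B) *\<^sub>v v = B' *\<^sub>v (B *\<^sub>v v)" by (rule assoc_mult_mat_vec[OF B' cB v(1)])
    also have "\<dots> = 0\<^sub>v (rdim V)" unfolding v(2) using B' by auto
    finally have "v = A *\<^sub>v (A' *\<^sub>v v)" using cA A' v by simp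
    then show ?thesis using A' v by (intro image_eqI[of _ _ "A' *\<^sub>v v"]) auto
  qed
  show "v \<in> carrier_vec (rdim W)" if "v \<in> (\<lambda>v. B *\<^sub>v v) ` carrier_vec (rdim V)"
    using that cB by auto
  show "v \<in> (\<lambda>v. B *\<^sub>v v) ` carrier_vec (rdim V)" if "v \<in> carrier_vec (rdim W)"
    using assoc_mult_mat_vec[OF cB B' that] BB' that B' by (intro image_eqI[of _ _ "B' *\<^sub>v v"]) auto
qed

text \<open>Insert \<open>1 = A A' + B' B\<close> into the trace, move the equivariant
  \<open>A\<close> and \<open>B\<close> past the action, and rotate.\<close>

lemma character_short_exact:
  assumes "U \<in> reps H" and "V \<in> reps H" and "W \<in> reps H" and "short_exact H U V W"
  shows "character H V h = character H U h + character H W h"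
proof (cases "h \<in> carrier H")
  case h: True
  from assms obtain A A' B B' where A: "A \<in> rep_homs H U V" and B: "B \<in> rep_homs H V W"
    and A': "A' \<in> carrier_mat (rdim U) (rdim V)" and B': "B' \<in> carrier_mat (rdim V) (rdim W)"
    and A'A: "A' * A = 1\<^sub>m (rdim U)" and BB': "B * B' = 1\<^sub>m (rdim W)"
    and sum: "A * A' + B' * B = 1\<^sub>m (rdim V)"
    by (rule short_exact_split)
  note cA = rep_homsD(1)[OF A] and cB = rep_homsD(1)[OF B]
  note U = repsD(1)[OF assms(1) h] and V = repsD(1)[OF assms(2) h] and W = repsD(1)[OF assms(3) h]
  note d = carrier_matD[OF cA] carrier_matD[OF cB] carrier_matD[OF A'] carrier_matD[OF B']
    carrier_matD[OF U] carrier_matD[OF V] carrier_matD[OF W]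
  have "ract V h = ract V h * (A * A' + B' * B)" unfolding sum using V by simp
  also have "\<dots> = ract V h * (A * A') + ract V h * (B' * B)"
    by (rule mult_add_distrib_mat[OF V]) (use cA cB A' B' in auto)
  finally have "mtrace (ract V h) = mtrace (ract V h * (A * A')) + mtrace (ract V h * (B' * B))"
    using mtrace_add[of "ract V h * (A * A')" "rdim V" "ract V h * (B' * B)"] V cA cB A' B' by auto
  also have "mtrace (ract V h * (A * A')) = mtrace (A * (ract U h * A'))"
    using rep_homsD(2)[OF A h] by (simp add: mat_assoc[symmetric] d)
  also have "\<dots> = mtrace (ract U h * A' * A)"
    by (rule mtrace_commute[OF cA]) (use U A' in auto)
  also have "\<dots> = mtrace (ract U h)" using A'A U by (simp add: mat_assoc d)
  also have "mtrace (ract V h * (B' * B)) = mtrace (ract V h * B' * B)" by (simp add: mat_assoc d)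
  also have "\<dots> = mtrace (B * (ract V h * B'))"
    by (rule mtrace_commute[OF _ cB]) (use V B' in auto)
  also have "\<dots> = mtrace (ract W h * (B * B'))"
    using rep_homsD(2)[OF B h] by (simp add: mat_assoc[symmetric] d)
  also have "\<dots> = mtrace (ract W h)" using BB' W by simp
  finally show ?thesis using h by (simp add: character_def)
qed (simp add: character_def)

section \<open>Schur's lemma and orthogonality of characters\<close>

locale finite_group = group H for H :: "'a monoid" (structure) +
  assumes finite_carrier: "finite (carrier H)"
begin

lemma card_pos: "0 < card (carrier H)"
  using finite_carrier one_closed by (auto simp: card_gt_0_iff)

lemma inverse_card_mult [simp]:
  "inverse (of_nat (card (carrier H))) * (of_nat (card (carrier H)) * c) = (c :: complex)"
  using card_pos by (simp flip: mult.assoc)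

lemma bij_mult_left: "g \<in> carrier H \<Longrightarrow> bij_betw (\<lambda>h. g \<otimes> h) (carrier H) (carrier H)"
  by (rule bij_betw_byWitness[where f' = "\<lambda>h. inv g \<otimes> h"]) (auto simp flip: m_assoc)

lemma bij_inv: "bij_betw (\<lambda>h. inv h) (carrier H) (carrier H)"
  by (rule bij_betw_byWitness[where f' = "\<lambda>h. inv h"]) auto

lemma sum_mult_left: "g \<in> carrier H \<Longrightarrow> (\<Sum>h\<in>carrier H. f (g \<otimes> h)) = (\<Sum>h\<in>carrier H. f h)"
  by (rule sum.reindex_bij_betw[OF bij_mult_left])

lemma sum_inv: "(\<Sum>h\<in>carrier H. f (inv h)) = (\<Sum>h\<in>carrier H. f h)"
  by (rule sum.reindex_bij_betw[OF bij_inv])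

lemma rep_inv:
  assumes V: "V \<in> reps H" and h: "h \<in> carrier H"
  shows "ract V (inv h) * ract V h = 1\<^sub>m (rdim V)" "ract V h * ract V (inv h) = 1\<^sub>m (rdim V)"
  using repsD(2,3)[OF V] h by (metis inv_closed l_inv, metis inv_closed r_inv)

lemma character_conj:
  assumes V: "V \<in> reps H" and g: "g \<in> carrier H" and h: "h \<in> carrier H"
  shows "character H V (g \<otimes> h \<otimes> inv g) = character H V h"
proof -
  note \<rho> = repsD[OF V]
  have d: "dim_row (ract V x) = rdim V" "dim_col (ract V x) = rdim V" if "x \<in> carrier H" for x
    using carrier_matD[OF \<rho>(1)[OF that]] .
  have "mtrace (ract V g * ract V h * ract V (inv g)) = mtrace (ract V (inv g) * (ract V g * ract V h))"
    by (rule mtrace_commute[OF mult_carrier_mat[OF \<rho>(1)[OF g] \<rho>(1)[OF h]] \<rho>(1)[OF inv_closed[OF g]]])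
  also have "ract V (inv g) * (ract V g * ract V h) = (ract V (inv g) * ract V g) * ract V h"
    using g h by (simp add: mat_assoc d)
  also have "\<dots> = ract V h" unfolding rep_inv(1)[OF V g] using \<rho>(1)[OF h] by simp
  finally show ?thesis using g h by (simp add: character_def \<rho>(3))
qed

lemma character_one: "V \<in> reps H \<Longrightarrow> character H V \<one> = of_nat (rdim V)"
  by (simp add: character_def repsD(2))

text \<open>The projection of the linear maps \<open>V \<rightarrow> W\<close> onto the
  equivariant ones.\<close>

definition average :: "'a rep \<Rightarrow> 'a rep \<Rightarrow> complex mat \<Rightarrow> complex mat"
  where "average V W A = inverse (of_nat (card (carrier H))) \<cdot>\<^sub>m
    msum (rdim W) (rdim V) (\<lambda>h. ract W h * (A * ract V (inv h))) (carrier H)"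

lemma average_closed:
  assumes V: "V \<in> reps H" and W: "W \<in> reps H" and A: "A \<in> carrier_mat (rdim W) (rdim V)"
  shows "average V W A \<in> rep_homs H V W"
proof (rule rep_homsI)
  let ?s = "msum (rdim W) (rdim V) (\<lambda>h. ract W h * (A * ract V (inv h))) (carrier H)"
  show "average V W A \<in> carrier_mat (rdim W) (rdim V)" by (simp add: average_def)
  fix g assume g: "g \<in> carrier H"
  note \<rho> = repsD[OF V] and \<sigma> = repsD[OF W]
  have d: "dim_row (ract V x) = rdim V" "dim_col (ract V x) = rdim V"
    "dim_row (ract W x) = rdim W" "dim_col (ract W x) = rdim W" if "x \<in> carrier H" for x
    using carrier_matD[OF \<rho>(1)[OF that]] carrier_matD[OF \<sigma>(1)[OF that]] by auto
  note dA = carrier_matD[OF A]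
  have cl: "ract W h * (A * ract V (inv h)) \<in> carrier_mat (rdim W) (rdim V)" if "h \<in> carrier H" for h
    by (rule mult_carrier_mat[OF \<sigma>(1)[OF that] mult_carrier_mat[OF A \<rho>(1)[OF inv_closed[OF that]]]])
  have "ract W g * ?s = msum (rdim W) (rdim V) (\<lambda>h. ract W g * (ract W h * (A * ract V (inv h)))) (carrier H)"
    by (rule mult_msum[OF \<sigma>(1)[OF g] cl])
  also have "\<dots> = msum (rdim W) (rdim V) (\<lambda>h. ract W (g \<otimes> h) * (A * ract V (inv (g \<otimes> h) \<otimes> g))) (carrier H)"
  proof (rule msum_cong)
    fix h assume h: "h \<in> carrier H"
    have "inv (g \<otimes> h) \<otimes> g = inv h" using g h by (simp add: inv_mult_group m_assoc)
    then show "ract W g * (ract W h * (A * ract V (inv h))) = ract W (g \<otimes> h) * (A * ract V (inv (g \<otimes> h) \<otimes> g))"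
      using g h by (simp add: \<sigma>(3) mat_assoc d dA)
  qed
  also have "\<dots> = msum (rdim W) (rdim V) (\<lambda>h. ract W h * (A * ract V (inv h \<otimes> g))) (carrier H)"
    by (rule msum_reindex[OF bij_mult_left[OF g], symmetric])
  also have "\<dots> = msum (rdim W) (rdim V) (\<lambda>h. ract W h * (A * ract V (inv h)) * ract V g) (carrier H)"
    by (rule msum_cong) (use g in \<open>simp add: \<rho>(3) mat_assoc d dA\<close>)
  also have "\<dots> = ?s * ract V g" by (rule msum_mult[OF \<rho>(1)[OF g] cl, symmetric])
  finally have eq: "ract W g * ?s = ?s * ract V g" .
  show "average V W A * ract V g = ract W g * average V W A"
    unfolding average_def mult_smult_distrib[OF \<sigma>(1)[OF g] msum_carrier]
      mult_smult_assoc_mat[OF msum_carrier \<rho>(1)[OF g]] eq ..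
qed

text \<open>Every conjugate \<open>\<sigma>(h) A \<rho>(h)\<^sup>-\<^sup>1\<close> has the same
  trace against the equivariant \<open>B\<close> as \<open>A\<close> itself. So an average is
  nonzero as soon as some \<open>trace (A B)\<close> is nonzero.\<close>

lemma mtrace_average_mult:
  assumes V: "V \<in> reps H" and W: "W \<in> reps H" and A: "A \<in> carrier_mat (rdim W) (rdim V)"
    and B: "B \<in> rep_homs H W V"
  shows "mtrace (average V W A * B) = mtrace (A * B)"
proof -
  note \<rho> = repsD[OF V] and \<sigma> = repsD[OF W]
  note cB = rep_homsD(1)[OF B]
  have d: "dim_row (ract V x) = rdim V" "dim_col (ract V x) = rdim V"
    "dim_row (ract W x) = rdim W" "dim_col (ract W x) = rdim W" if "x \<in> carrier H" for x
    using carrier_matD[OF \<rho>(1)[OF that]] carrier_matD[OF \<sigma>(1)[OF that]] by auto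
  note dA = carrier_matD[OF A] carrier_matD[OF cB]
  have cl: "ract W h * (A * ract V (inv h)) \<in> carrier_mat (rdim W) (rdim V)" if "h \<in> carrier H" for h
    by (rule mult_carrier_mat[OF \<sigma>(1)[OF that] mult_carrier_mat[OF A \<rho>(1)[OF inv_closed[OF that]]]])
  have tr: "mtrace (ract W h * (A * ract V (inv h)) * B) = mtrace (A * B)" if h: "h \<in> carrier H" for h
  proof -
    have "ract W h * (A * ract V (inv h)) * B = ract W h * (A * (ract V (inv h) * B))"
      using h by (simp add: mat_assoc d dA)
    also have "ract V (inv h) * B = B * ract W (inv h)" using rep_homsD(2)[OF B, of "inv h"] h by simp
    also have "mtrace (ract W h * (A * (B * ract W (inv h)))) = mtrace ((A * (B * ract W (inv h))) * ract W h)"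
      by (rule mtrace_commute[OF \<sigma>(1)[OF h] mult_carrier_mat[OF A mult_carrier_mat[OF cB \<sigma>(1)[OF inv_closed[OF h]]]]])
    also have "(A * (B * ract W (inv h))) * ract W h = A * (B * (ract W (inv h) * ract W h))"
      using h by (simp add: mat_assoc d dA)
    also have "\<dots> = A * B" unfolding rep_inv(1)[OF W h] using cB by simp
    finally show ?thesis .
  qed
  have "average V W A * B = inverse (of_nat (card (carrier H))) \<cdot>\<^sub>m
      (msum (rdim W) (rdim V) (\<lambda>h. ract W h * (A * ract V (inv h))) (carrier H) * B)"
    unfolding average_def by (rule mult_smult_assoc_mat[OF msum_carrier cB])
  also have "\<dots> = inverse (of_nat (card (carrier H))) \<cdot>\<^sub>m
      msum (rdim W) (rdim W) (\<lambda>h. ract W h * (A * ract V (inv h)) * B) (carrier H)"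
    by (subst msum_mult[OF cB cl]) auto
  also have "mtrace \<dots> = inverse (of_nat (card (carrier H))) * (\<Sum>h\<in>carrier H. mtrace (A * B))"
    by (subst mtrace_smult[OF msum_carrier], subst mtrace_msum) (simp_all add: tr mult_carrier_mat[OF cl cB])
  finally show ?thesis by simp
qed

text \<open>The bilinear form with the inverse in place of complex conjugation. On characters it
  agrees with the Hermitian inner product.\<close>

definition inner_prod :: "('a \<Rightarrow> complex) \<Rightarrow> ('a \<Rightarrow> complex) \<Rightarrow> complex"
  where "inner_prod \<phi> \<psi> = inverse (of_nat (card (carrier H))) * (\<Sum>h\<in>carrier H. \<phi> h * \<psi> (inv h))"

text \<open>For the matrix unit at \<open>(i, j)\<close>, the \<open>(i, j)\<close> entry of
  \<open>\<sigma>(h) E \<rho>(h\<^sup>-\<^sup>1)\<close> is \<open>\<sigma>(h)\<^sub>i\<^sub>i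
  \<rho>(h\<^sup>-\<^sup>1)\<^sub>j\<^sub>j\<close>; the sum of these over \<open>i\<close> and
  \<open>j\<close> is a product of traces.\<close>

lemma inner_prod_characters:
  assumes V: "V \<in> reps H" and W: "W \<in> reps H"
  shows "inner_prod (character H W) (character H V)
    = (\<Sum>i<rdim W. \<Sum>j<rdim V. average V W (mat (rdim W) (rdim V) (\<lambda>p. if p = (i, j) then 1 else 0)) $$ (i, j))"
proof -
  note \<rho> = repsD[OF V] and \<sigma> = repsD[OF W]
  define E where "E i j = mat (rdim W) (rdim V) (\<lambda>p. if p = (i, j) then 1 else (0::complex))" for i j
  have E: "E i j \<in> carrier_mat (rdim W) (rdim V)" for i j by (simp add: E_def)
  have entry: "(ract W h * (E i j * ract V (inv h))) $$ (i, j) = ract W h $$ (i, i) * ract V (inv h) $$ (j, j)"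
    if h: "h \<in> carrier H" and ij: "i < rdim W" "j < rdim V" for h i j
  proof -
    have Ev: "(E i j * ract V (inv h)) $$ (k, j) = (if k = i then ract V (inv h) $$ (j, j) else 0)" if "k < rdim W" for k
    proof -
      have "(E i j * ract V (inv h)) $$ (k, j) = (\<Sum>l<rdim V. E i j $$ (k, l) * ract V (inv h) $$ (l, j))"
        by (rule mat_mult_entry[OF E \<rho>(1)]) (use h ij that in auto)
      also have "\<dots> = (\<Sum>l<rdim V. if l = j then (if k = i then ract V (inv h) $$ (j, j) else 0) else 0)"
        by (rule sum.cong) (use that in \<open>auto simp: E_def\<close>)
      finally show ?thesis using ij by simp
    qed
    have "(ract W h * (E i j * ract V (inv h))) $$ (i, j)
        = (\<Sum>k<rdim W. ract W h $$ (i, k) * (E i j * ract V (inv h)) $$ (k, j))"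
      by (rule mat_mult_entry[OF \<sigma>(1)[OF h] mult_carrier_mat[OF E \<rho>(1)[OF inv_closed[OF h]]] ij])
    also have "\<dots> = (\<Sum>k<rdim W. if k = i then ract W h $$ (i, i) * ract V (inv h) $$ (j, j) else 0)"
      by (rule sum.cong) (auto simp: Ev)
    finally show ?thesis using ij by simp
  qed
  have "(\<Sum>i<rdim W. \<Sum>j<rdim V. average V W (E i j) $$ (i, j))
    = (\<Sum>i<rdim W. \<Sum>j<rdim V. inverse (of_nat (card (carrier H))) *
      (\<Sum>h\<in>carrier H. ract W h $$ (i, i) * ract V (inv h) $$ (j, j)))"
    by (intro sum.cong refl) (auto simp: average_def msum_def entry)
  also have "\<dots> = inverse (of_nat (card (carrier H))) *
      (\<Sum>i<rdim W. \<Sum>j<rdim V. \<Sum>h\<in>carrier H. ract W h $$ (i, i) * ract V (inv h) $$ (j, j))"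
    by (simp add: sum_distrib_left)
  also have "(\<Sum>i<rdim W. \<Sum>j<rdim V. \<Sum>h\<in>carrier H. ract W h $$ (i, i) * ract V (inv h) $$ (j, j))
    = (\<Sum>i<rdim W. \<Sum>h\<in>carrier H. \<Sum>j<rdim V. ract W h $$ (i, i) * ract V (inv h) $$ (j, j))"
    by (intro sum.cong refl sum.swap)
  also have "\<dots> = (\<Sum>h\<in>carrier H. \<Sum>i<rdim W. \<Sum>j<rdim V. ract W h $$ (i, i) * ract V (inv h) $$ (j, j))"
    by (rule sum.swap)
  also have "\<dots> = (\<Sum>h\<in>carrier H. character H W h * character H V (inv h))"
  proof (rule sum.cong)
    fix h assume h: "h \<in> carrier H"
    have "character H W h * character H V (inv h) = (\<Sum>i<rdim W. ract W h $$ (i, i)) * (\<Sum>j<rdim V. ract V (inv h) $$ (j, j))"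
      using h carrier_matD[OF \<sigma>(1)[OF h]] carrier_matD[OF \<rho>(1)[OF inv_closed[OF h]]]
      by (simp add: character_def mtrace_def)
    then show "(\<Sum>i<rdim W. \<Sum>j<rdim V. ract W h $$ (i, i) * ract V (inv h) $$ (j, j))
        = character H W h * character H V (inv h)"
      by (simp add: sum_product)
  qed simp
  finally show ?thesis by (simp add: inner_prod_def E_def)
qed

text \<open>By Schur's lemma and Maschke's theorem the bricks are the irreducible modules. The
  definition by endomorphisms fits the arguments below, which produce and use endomorphisms and
  never submodules.\<close>

definition brick :: "'a rep \<Rightarrow> bool"
  where "brick V \<longleftrightarrow> V \<in> reps H \<and> 0 < rdim V \<and> (\<forall>A\<in>rep_homs H V V. \<exists>c. A = c \<cdot>\<^sub>m 1\<^sub>m (rdim V))"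

lemma brickD:
  assumes "brick V"
  shows "V \<in> reps H" "0 < rdim V" "A \<in> rep_homs H V V \<Longrightarrow> \<exists>c. A = c \<cdot>\<^sub>m 1\<^sub>m (rdim V)"
  using assms by (auto simp: brick_def)

lemma brick_endo_trace:
  assumes V: "brick V" and A: "A \<in> rep_homs H V V"
  shows "A = (mtrace A / of_nat (rdim V)) \<cdot>\<^sub>m 1\<^sub>m (rdim V)"
proof -
  obtain c where c: "A = c \<cdot>\<^sub>m 1\<^sub>m (rdim V)" using brickD(3)[OF V A] by blast
  have "mtrace A = c * of_nat (rdim V)" unfolding c by (subst mtrace_smult[of _ "rdim V"]) auto
  then show ?thesis using c brickD(2)[OF V] by simp
qed

text \<open>The average of a matrix unit is a scalar matrix, and averaging preserves the
  trace.\<close>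

lemma inner_prod_brick_self:
  assumes V: "brick V"
  shows "inner_prod (character H V) (character H V) = 1"
proof -
  let ?n = "rdim V"
  have e: "average V V (mat ?n ?n (\<lambda>p. if p = (i, j) then 1 else 0)) $$ (i, j) = (if i = j then 1 / of_nat ?n else 0)"
    if ij: "i < ?n" "j < ?n" for i j
  proof -
    let ?E = "mat ?n ?n (\<lambda>p. if p = (i, j) then 1 else (0::complex))"
    have E: "?E \<in> carrier_mat ?n ?n" by simp
    have one: "1\<^sub>m ?n \<in> rep_homs H V V"
      by (rule rep_homsI)
        (simp_all add: left_mult_one_mat[OF repsD(1)[OF brickD(1)[OF V]]] right_mult_one_mat[OF repsD(1)[OF brickD(1)[OF V]]])
    have av: "average V V ?E \<in> rep_homs H V V"
      by (rule average_closed[OF brickD(1)[OF V] brickD(1)[OF V] E])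
    have "mtrace (average V V ?E) = mtrace (average V V ?E * 1\<^sub>m ?n)"
      using rep_homsD(1)[OF av] by simp
    also have "\<dots> = mtrace (?E * 1\<^sub>m ?n)"
      by (rule mtrace_average_mult[OF brickD(1)[OF V] brickD(1)[OF V] E one])
    also have "\<dots> = mtrace ?E" by (simp add: right_mult_one_mat[OF E])
    also have "\<dots> = (if i = j then 1 else 0)" using ij by (auto simp: mtrace_def)
    finally have "mtrace (average V V ?E) = (if i = j then 1 else 0)" .
    then show ?thesis using brick_endo_trace[OF V av] ij
      by (metis (no_types, lifting) div_0 index_one_mat(1) index_one_mat(2,3) index_smult_mat(1) mult.right_neutral mult_zero_right)
  qed
  have "inner_prod (character H V) (character H V) = (\<Sum>i<?n. \<Sum>j<?n. if i = j then 1 / of_nat ?n else 0)"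
    unfolding inner_prod_characters[OF brickD(1)[OF V] brickD(1)[OF V]]
    by (intro sum.cong refl) (simp add: e)
  also have "\<dots> = (\<Sum>i<?n. 1 / of_nat ?n)" by (intro sum.cong refl) simp
  finally show ?thesis using brickD(2)[OF V] by simp
qed

lemma inner_prod_no_homs:
  assumes V: "V \<in> reps H" and W: "W \<in> reps H"
    and no: "\<And>A. A \<in> rep_homs H V W \<Longrightarrow> A = 0\<^sub>m (rdim W) (rdim V)"
  shows "inner_prod (character H W) (character H V) = 0"
  unfolding inner_prod_characters[OF V W]
  by (intro sum.neutral ballI) (subst no[OF average_closed[OF V W]], auto)

text \<open>Schur's lemma. Averaging a suitable matrix unit gives an equivariant \<open>B : W
  \<rightarrow> V\<close> with \<open>trace (B A) \<noteq> 0\<close>. Both \<open>B A\<close> and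
  \<open>A B\<close> are scalars, equal because \<open>A (B A) = (A B) A\<close>.\<close>

lemma brick_iso:
  assumes V: "brick V" and W: "brick W" and A: "A \<in> rep_homs H V W" and A0: "A \<noteq> 0\<^sub>m (rdim W) (rdim V)"
  obtains B where "B \<in> rep_homs H W V" "B * A = 1\<^sub>m (rdim V)" "A * B = 1\<^sub>m (rdim W)"
proof -
  note cA = rep_homsD(1)[OF A]
  note VH = brickD(1)[OF V] and WH = brickD(1)[OF W]
  obtain k l where kl: "k < rdim W" "l < rdim V" "A $$ (k, l) \<noteq> 0"
    using A0 cA by (metis carrier_matD eq_matI index_zero_mat)
  define E where "E = mat (rdim V) (rdim W) (\<lambda>p. if p = (l, k) then 1 else (0::complex))"
  have E: "E \<in> carrier_mat (rdim V) (rdim W)" by (simp add: E_def)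
  have "mtrace (E * A) = (\<Sum>i<rdim V. \<Sum>j<rdim W. E $$ (i, j) * A $$ (j, i))"
    by (rule mtrace_mult[OF E cA])
  also have "\<dots> = (\<Sum>i<rdim V. \<Sum>j<rdim W. if i = l \<and> j = k then A $$ (k, l) else 0)"
    by (intro sum.cong refl) (auto simp: E_def)
  also have "\<dots> = (\<Sum>i<rdim V. if i = l then A $$ (k, l) else 0)"
    using kl by (intro sum.cong refl) (auto simp: sum.delta)
  also have "\<dots> = A $$ (k, l)" using kl by simp
  finally have tr: "mtrace (E * A) = A $$ (k, l)" .
  define B where "B = average W V E"
  have B: "B \<in> rep_homs H W V" unfolding B_def by (rule average_closed[OF WH VH E])
  note cB = rep_homsD(1)[OF B]
  have comp: "Y * Z \<in> rep_homs H V1 V1" if Z: "Z \<in> rep_homs H V1 W1" and Y: "Y \<in> rep_homs H W1 V1"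
    and V1: "V1 \<in> reps H" and W1: "W1 \<in> reps H" for Z Y V1 W1
  proof (rule rep_homsI)
    note cX = rep_homsD(1)[OF Z] and cY = rep_homsD(1)[OF Y]
    show "Y * Z \<in> carrier_mat (rdim V1) (rdim V1)" using cX cY by simp
    fix h assume h: "h \<in> carrier H"
    note d = carrier_matD[OF cX] carrier_matD[OF cY] carrier_matD[OF repsD(1)[OF V1 h]] carrier_matD[OF repsD(1)[OF W1 h]]
    have "Y * Z * ract V1 h = Y * (ract W1 h * Z)" using rep_homsD(2)[OF Z h] by (simp add: mat_assoc d)
    also have "\<dots> = ract V1 h * (Y * Z)" using rep_homsD(2)[OF Y h] by (simp add: d flip: mat_assoc)
    finally show "Y * Z * ract V1 h = ract V1 h * (Y * Z)" .
  qed
  define c where "c = mtrace (B * A) / of_nat (rdim V)"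
  have BA: "B * A = c \<cdot>\<^sub>m 1\<^sub>m (rdim V)"
    unfolding c_def by (rule brick_endo_trace[OF V comp[OF A B VH WH]])
  have c: "c \<noteq> 0"
    using mtrace_average_mult[OF WH VH E A] brickD(2)[OF V] kl tr by (simp add: c_def B_def)
  obtain d where AB: "A * B = d \<cdot>\<^sub>m 1\<^sub>m (rdim W)" using brickD(3)[OF W comp[OF B A WH VH]] by blast
  have "A * (B * A) = A * B * A" using cA cB by (simp add: mat_assoc)
  then have "c \<cdot>\<^sub>m A = d \<cdot>\<^sub>m A"
    unfolding BA AB using cA
    by (simp add: mult_smult_distrib[OF cA one_carrier_mat] mult_smult_assoc_mat[of "1\<^sub>m (rdim W)" "rdim W" "rdim W" A])
  from arg_cong[OF this, of "\<lambda>Z. Z $$ (k, l)"] have dc: "d = c" using kl cA by simp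
  show ?thesis
  proof (rule that[of "inverse c \<cdot>\<^sub>m B"])
    show "inverse c \<cdot>\<^sub>m B \<in> rep_homs H W V"
    proof (rule rep_homsI)
      fix h assume h: "h \<in> carrier H"
      show "inverse c \<cdot>\<^sub>m B * ract W h = ract V h * (inverse c \<cdot>\<^sub>m B)"
        using mult_smult_assoc_mat[OF cB repsD(1)[OF WH h]] mult_smult_distrib[OF repsD(1)[OF VH h] cB] rep_homsD(2)[OF B h]
        by simp
    qed (use cB in simp)
    show "inverse c \<cdot>\<^sub>m B * A = 1\<^sub>m (rdim V)"
      using mult_smult_assoc_mat[OF cB cA] c by (simp add: BA) (auto intro!: eq_matI)
    show "A * (inverse c \<cdot>\<^sub>m B) = 1\<^sub>m (rdim W)"
      using mult_smult_distrib[OF cA cB] c by (simp add: AB dc) (auto intro!: eq_matI)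
  qed
qed

lemma character_iso:
  assumes V: "V \<in> reps H" and W: "W \<in> reps H"
    and A: "A \<in> rep_homs H V W" and B: "B \<in> rep_homs H W V" and BA: "B * A = 1\<^sub>m (rdim V)" and AB: "A * B = 1\<^sub>m (rdim W)"
  shows "character H V = character H W"
proof (rule ext)
  fix h
  show "character H V h = character H W h"
  proof (cases "h \<in> carrier H")
    case h: True
    note cA = rep_homsD(1)[OF A] and cB = rep_homsD(1)[OF B]
    note rV = repsD(1)[OF V h] and rW = repsD(1)[OF W h]
    note d = carrier_matD[OF cA] carrier_matD[OF cB] carrier_matD[OF rV] carrier_matD[OF rW]
    have "mtrace (ract W h) = mtrace (ract W h * (A * B))" using AB rW by simp
    also have "ract W h * (A * B) = A * (ract V h * B)"
      using rep_homsD(2)[OF A h] by (simp add: d flip: mat_assoc)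
    also have "mtrace \<dots> = mtrace (ract V h * B * A)" by (rule mtrace_commute[OF cA]) (use rV cB in simp)
    also have "ract V h * B * A = ract V h" using BA rV by (simp add: mat_assoc d)
    finally show ?thesis using h by (simp add: character_def)
  qed (simp add: character_def)
qed

lemma inner_prod_bricks:
  assumes V: "brick V" and W: "brick W"
  shows "inner_prod (character H W) (character H V) = (if character H V = character H W then 1 else 0)"
proof (cases "character H V = character H W")
  case False
  have "A = 0\<^sub>m (rdim W) (rdim V)" if A: "A \<in> rep_homs H V W" for A
    using brick_iso[OF V W A] character_iso[OF brickD(1)[OF V] brickD(1)[OF W] A] False by metis
  then show ?thesis using inner_prod_no_homs[OF brickD(1)[OF V] brickD(1)[OF W]] False by simp
qed (use inner_prod_brick_self[OF W] in simp)

text \<open>The characters are not orthogonal, so there is a nonzero map \<open>V \<rightarrow>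
  W\<close>, an isomorphism. It is written as a short exact sequence because these are the
  relations of the Grothendieck group.\<close>

lemma short_exact_if_same_character:
  assumes V: "brick V" and W: "brick W" and eq: "character H V = character H W"
  shows "short_exact H V W (0, \<lambda>_. 1\<^sub>m 0)" and "(0, \<lambda>_. 1\<^sub>m 0) \<in> reps H"
proof -
  have "\<exists>A. A \<in> rep_homs H V W \<and> A \<noteq> 0\<^sub>m (rdim W) (rdim V)"
    using inner_prod_no_homs[OF brickD(1)[OF V] brickD(1)[OF W]] inner_prod_bricks[OF V W] eq by auto
  then obtain A where A: "A \<in> rep_homs H V W" "A \<noteq> 0\<^sub>m (rdim W) (rdim V)" by blast
  obtain B where B: "B \<in> rep_homs H W V" "B * A = 1\<^sub>m (rdim V)" "A * B = 1\<^sub>m (rdim W)"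
    using brick_iso[OF V W A] .
  note cA = rep_homsD(1)[OF A(1)] and cB = rep_homsD(1)[OF B(1)]
  have "A * B + 0\<^sub>m (rdim W) 0 * 0\<^sub>m 0 (rdim W) = 1\<^sub>m (rdim W)"
    unfolding B(3) by (intro eq_matI) (auto simp: scalar_prod_def)
  moreover have "(0\<^sub>m 0 (rdim W) :: complex mat) \<in> rep_homs H W (0, \<lambda>_. 1\<^sub>m 0)"
    by (rule rep_homsI) (simp_all add: left_mult_zero_mat[OF repsD(1)[OF brickD(1)[OF W]]])
  ultimately show "short_exact H V W (0, \<lambda>_. 1\<^sub>m 0)"
    using cA cB B(2) by (intro short_exactI[OF A(1), where A' = B and B = "0\<^sub>m 0 (rdim W)" and B' = "0\<^sub>m (rdim W) 0"]) auto
  show "(0, \<lambda>_. 1\<^sub>m 0) \<in> reps H" by (intro repsI) auto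
qed

text \<open>The kernel and the image of an equivariant endomorphism. In a factorization \<open>B =
  S P\<close> of full rank, \<open>P\<close> has the kernel of \<open>B\<close> and is onto a copy
  of the image of \<open>B\<close>; the idempotent \<open>1 - P' P\<close> projects onto the
  kernel.\<close>

lemma endomorphism_short_exact:
  assumes V: "V \<in> reps H" and B: "B \<in> rep_homs H V V"
  obtains U W where "U \<in> reps H" "W \<in> reps H" "short_exact H U V W" "rdim V = rdim W + rdim U"
    "rdim W = 0 \<Longrightarrow> B = 0\<^sub>m (rdim V) (rdim V)"
    "\<And>v. \<lbrakk>rdim U = 0; v \<in> carrier_vec (rdim V); B *\<^sub>v v = 0\<^sub>v (rdim V)\<rbrakk> \<Longrightarrow> v = 0\<^sub>v (rdim V)"
proof -
  let ?n = "rdim V"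
  note cB = rep_homsD(1)[OF B]
  obtain r S P S' P' where S: "S \<in> carrier_mat ?n r" and P: "P \<in> carrier_mat r ?n" and S': "S' \<in> carrier_mat r ?n"
    and P': "P' \<in> carrier_mat ?n r" and BSP: "B = S * P" and S'S: "S' * S = 1\<^sub>m r" and PP': "P * P' = 1\<^sub>m r"
    by (rule full_rank_factorization[OF cB])
  define E where "E = 1\<^sub>m ?n - P' * P"
  have E: "E \<in> carrier_mat ?n ?n" using P P' by (auto simp: E_def)
  note d = carrier_matD[OF S] carrier_matD[OF P] carrier_matD[OF S'] carrier_matD[OF P'] carrier_matD[OF E] carrier_matD[OF cB]
  have PE: "P * E = 0\<^sub>m r ?n"
  proof -
    have "P * E = P * 1\<^sub>m ?n - P * (P' * P)"
      unfolding E_def by (rule mult_minus_distrib_mat[OF P]) (use P P' in auto)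
    also have "P * (P' * P) = P" using PP' P by (simp add: d flip: mat_assoc)
    finally show ?thesis using P by (auto intro!: eq_matI)
  qed
  have EE: "E * E = E"
  proof -
    have "E * E = 1\<^sub>m ?n * E - P' * P * E"
      unfolding E_def[of] by (rule minus_mult_distrib_mat) (use P P' E[unfolded E_def] in auto)
    also have "P' * P * E = 0\<^sub>m ?n ?n" using PE P' by (simp add: mat_assoc d)
    finally show ?thesis using E by (auto intro!: eq_matI)
  qed
  have rV: "ract V h \<in> carrier_mat ?n ?n" if "h \<in> carrier H" for h using repsD(1)[OF V that] .
  \<comment> \<open>The kernel of \<open>B\<close> is preserved: \<open>B\<close> commutes with
    the action, and \<open>S\<close> can be cancelled from \<open>B = S P\<close>.\<close>
  have PrE: "P * (ract V h * E) = 0\<^sub>m r ?n" if h: "h \<in> carrier H" for h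
  proof -
    note dh = carrier_matD[OF rV[OF h]]
    have "P * (ract V h * E) = S' * S * (P * (ract V h * E))" using S'S P rV[OF h] E by simp
    also have "\<dots> = S' * (S * P * ract V h * E)" by (simp add: mat_assoc d dh)
    also have "S * P * ract V h = ract V h * (S * P)" using rep_homsD(2)[OF B h] by (simp add: BSP)
    also have "S' * (ract V h * (S * P) * E) = S' * (ract V h * (S * (P * E)))" by (simp add: mat_assoc d dh)
    also have "\<dots> = 0\<^sub>m r ?n" unfolding PE using S S' rV[OF h] by simp
    finally show ?thesis .
  qed
  have PrP: "P * (ract V h * (P' * P)) = P * ract V h" if h: "h \<in> carrier H" for h
  proof -
    note dh = carrier_matD[OF rV[OF h]]
    have "P * (ract V h * E) = P * (ract V h - ract V h * (P' * P))"
      unfolding E_def using mult_minus_distrib_mat[OF rV[OF h], of "1\<^sub>m ?n" ?n "P' * P"] P P' rV[OF h] by simp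
    also have "\<dots> = P * ract V h - P * (ract V h * (P' * P))"
      by (rule mult_minus_distrib_mat[OF P rV[OF h]]) (use P P' rV[OF h] in auto)
    finally have z: "P * ract V h - P * (ract V h * (P' * P)) = 0\<^sub>m r ?n" using PrE[OF h] by simp
    show ?thesis
    proof (rule eq_matI)
      fix i j assume "i < dim_row (P * ract V h)" "j < dim_col (P * ract V h)"
      then show "(P * (ract V h * (P' * P))) $$ (i, j) = (P * ract V h) $$ (i, j)"
        using arg_cong[OF z, of "\<lambda>Z. Z $$ (i, j)"] d dh by (simp del: index_mult_mat(1))
    qed (simp_all add: d dh)
  qed
  obtain k S2 P2 where S2: "S2 \<in> carrier_mat ?n k" and P2: "P2 \<in> carrier_mat k ?n"
    and ESP: "E = S2 * P2" and PS2: "P2 * S2 = 1\<^sub>m k"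
    by (rule idempotent_splitting[OF E EE])
  note d2 = carrier_matD[OF S2] carrier_matD[OF P2]
  have ES2: "E * S2 = S2" unfolding ESP using PS2 S2 by (simp add: mat_assoc d2)
  have Erel: "P' * P + E = 1\<^sub>m ?n" unfolding E_def using P P' by (auto intro!: eq_matI)
  have im: "S2 * (P2 * (ract V h * S2)) = ract V h * S2" if h: "h \<in> carrier H" for h
  proof -
    note dh = carrier_matD[OF rV[OF h]]
    have cS: "ract V h * S2 \<in> carrier_mat ?n k" using rV[OF h] S2 by simp
    have "ract V h * S2 = (P' * P + E) * (ract V h * S2)" unfolding Erel by (rule left_mult_one_mat[OF cS, symmetric])
    also have "\<dots> = P' * P * (ract V h * S2) + E * (ract V h * S2)"
      by (rule add_mult_distrib_mat[OF _ E cS]) (use P P' in auto)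
    also have "P' * P * (ract V h * S2) = P' * P * (ract V h * (E * S2))" by (simp only: ES2)
    also have "\<dots> = P' * ((P * (ract V h * E)) * S2)" by (simp add: mat_assoc d d2 dh)
    also have "\<dots> = 0\<^sub>m ?n k" unfolding PrE[OF h] using P' S2 by simp
    also have "0\<^sub>m ?n k + E * (ract V h * S2) = E * (ract V h * S2)" using E cS by simp
    also have "\<dots> = S2 * (P2 * (ract V h * S2))" unfolding ESP by (simp add: mat_assoc d2 dh)
    finally show ?thesis ..
  qed
  let ?W = "(r, \<lambda>h. P * (ract V h * P'))" and ?U = "(k, \<lambda>h. P2 * (ract V h * S2))"
  note W = quotient_rep[OF monoid_axioms V P P' PP' PrP]
  note U = sub_rep[OF monoid_axioms V S2 P2 PS2 im]
  have BA: "P * S2 = 0\<^sub>m r k"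
  proof -
    have "P * S2 = P * (E * S2)" by (simp only: ES2)
    also have "\<dots> = P * E * S2" by (simp add: mat_assoc d d2)
    finally show ?thesis unfolding PE using S2 by simp
  qed
  have ex: "short_exact H ?U V ?W"
    by (rule short_exactI[OF U(2) W(2), of P2 P'])
      (use P2 P' PS2 PP' BA Erel in \<open>auto simp: ESP[symmetric] comm_add_mat[OF E, of "P' * P"] P\<close>)
  \<comment> \<open>The dimensions are the traces of the complementary idempotents \<open>P'
    P\<close> and \<open>E\<close>.\<close>
  have "of_nat ?n = (mtrace (P' * P + E) :: complex)" by (simp add: Erel)
  also have "\<dots> = mtrace (P' * P) + mtrace E" by (rule mtrace_add) (use P P' E in auto)
  also have "mtrace (P' * P) = of_nat r" using mtrace_commute[OF P' P] PP' by simp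
  also have "mtrace E = of_nat k" unfolding ESP using mtrace_commute[OF S2 P2] PS2 by simp
  finally have "(of_nat ?n :: complex) = of_nat (r + k)" by simp
  then have nrk: "?n = r + k" using of_nat_eq_iff by blast
  have r0: "B = 0\<^sub>m ?n ?n" if "r = 0"
    unfolding BSP using S P that by (intro eq_matI) (auto simp: scalar_prod_def)
  have k0: "v = 0\<^sub>v ?n" if k: "k = 0" and v: "v \<in> carrier_vec ?n" and Bv: "B *\<^sub>v v = 0\<^sub>v ?n" for v
  proof -
    have E0: "E = 0\<^sub>m ?n ?n" unfolding ESP using S2 P2 k by (intro eq_matI) (auto simp: scalar_prod_def)
    have "P *\<^sub>v v = S' * S *\<^sub>v (P *\<^sub>v v)" unfolding S'S using P v by simp
    also have "\<dots> = S' *\<^sub>v (S *\<^sub>v (P *\<^sub>v v))" by (rule assoc_mult_mat_vec[OF S' S]) (use P v in simp)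
    also have "S *\<^sub>v (P *\<^sub>v v) = B *\<^sub>v v" unfolding BSP by (rule assoc_mult_mat_vec[OF S P v, symmetric])
    finally have Pv: "P *\<^sub>v v = 0\<^sub>v r" unfolding Bv using S' by (auto intro!: eq_vecI)
    have "v = (P' * P + E) *\<^sub>v v" unfolding Erel using v by simp
    also have "P' * P + E = P' * P" unfolding E0 using P P' by (auto intro!: eq_matI)
    also have "(P' * P) *\<^sub>v v = P' *\<^sub>v (P *\<^sub>v v)" by (rule assoc_mult_mat_vec[OF P' P v])
    also have "\<dots> = 0\<^sub>v ?n" unfolding Pv using P' by (auto intro!: eq_vecI)
    finally show ?thesis .
  qed
  show ?thesis by (rule that[OF U(1) W(1) ex]) (use nrk r0 k0 in simp_all)
qed

text \<open>Let \<open>A\<close> be an endomorphism that is not a scalar and \<open>c\<close> an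
  eigenvalue of it. Then \<open>A - c\<close> is neither zero nor injective, so that its kernel
  and its image are both smaller.\<close>

lemma decompose_non_brick:
  assumes V: "V \<in> reps H" and n: "0 < rdim V" and nb: "\<not> brick V"
  obtains U W where "U \<in> reps H" "W \<in> reps H" "short_exact H U V W" "rdim U < rdim V" "rdim W < rdim V"
proof -
  let ?n = "rdim V"
  obtain A where A: "A \<in> rep_homs H V V" and nsc: "\<And>c. A \<noteq> c \<cdot>\<^sub>m 1\<^sub>m ?n" using V n nb by (auto simp: brick_def)
  note cA = rep_homsD(1)[OF A]
  obtain c where "c \<in> spectrum A" using spectrum_non_empty[OF cA n] by blast
  then obtain v where v: "v \<in> carrier_vec ?n" "v \<noteq> 0\<^sub>v ?n" "A *\<^sub>v v = c \<cdot>\<^sub>v v"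
    using cA by (auto simp: spectrum_def eigenvalue_def eigenvector_def)
  define B where "B = A - c \<cdot>\<^sub>m 1\<^sub>m ?n"
  have cB: "B \<in> carrier_mat ?n ?n" using cA by (auto simp: B_def)
  have Bv: "B *\<^sub>v v = 0\<^sub>v ?n"
  proof -
    have "B *\<^sub>v v = A *\<^sub>v v - (c \<cdot>\<^sub>m 1\<^sub>m ?n) *\<^sub>v v"
      unfolding B_def by (rule minus_mult_distrib_mat_vec[OF cA _ v(1)]) simp
    also have "(c \<cdot>\<^sub>m 1\<^sub>m ?n) *\<^sub>v v = c \<cdot>\<^sub>v v" using v(1) by (intro eq_vecI) (auto simp: scalar_prod_smult_left)
    finally show ?thesis using v by (auto intro!: eq_vecI)
  qed
  have B0: "B \<noteq> 0\<^sub>m ?n ?n"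
  proof
    assume B0: "B = 0\<^sub>m ?n ?n"
    have "A = c \<cdot>\<^sub>m 1\<^sub>m ?n"
    proof (rule eq_matI)
      fix i j assume "i < dim_row (c \<cdot>\<^sub>m 1\<^sub>m ?n)" "j < dim_col (c \<cdot>\<^sub>m 1\<^sub>m ?n)"
      then show "A $$ (i, j) = (c \<cdot>\<^sub>m 1\<^sub>m ?n) $$ (i, j)"
        using arg_cong[OF B0, of "\<lambda>Z. Z $$ (i, j)"] cA by (simp add: B_def)
    qed (use cA in auto)
    with nsc show False by blast
  qed
  have "B \<in> rep_homs H V V"
  proof (rule rep_homsI[OF cB])
    fix h assume h: "h \<in> carrier H"
    note rV = repsD(1)[OF V h]
    have "B * ract V h = A * ract V h - c \<cdot>\<^sub>m 1\<^sub>m ?n * ract V h"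
      unfolding B_def by (rule minus_mult_distrib_mat[OF cA _ rV]) simp
    also have "\<dots> = ract V h * A - ract V h * (c \<cdot>\<^sub>m 1\<^sub>m ?n)"
      using rep_homsD(2)[OF A h] mult_smult_assoc_mat[of "1\<^sub>m ?n" ?n ?n "ract V h" ?n c] mult_smult_distrib[OF rV, of "1\<^sub>m ?n" ?n c] rV by simp
    also have "\<dots> = ract V h * B"
      unfolding B_def by (rule mult_minus_distrib_mat[symmetric, OF rV cA]) simp
    finally show "B * ract V h = ract V h * B" .
  qed
  then obtain U W where UW: "U \<in> reps H" "W \<in> reps H" "short_exact H U V W" "?n = rdim W + rdim U"
      "rdim W = 0 \<Longrightarrow> B = 0\<^sub>m ?n ?n" "\<And>v. \<lbrakk>rdim U = 0; v \<in> carrier_vec ?n; B *\<^sub>v v = 0\<^sub>v ?n\<rbrakk> \<Longrightarrow> v = 0\<^sub>v ?n"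
    using endomorphism_short_exact[OF V] by metis
  moreover have "rdim W \<noteq> 0" using UW(5) B0 by blast
  moreover have "rdim U \<noteq> 0" using UW(6)[OF _ v(1) Bv] v(2) by blast
  ultimately show ?thesis using that[OF UW(1-3)] by simp
qed

end

section \<open>The regular representation and completeness of characters\<close>

text \<open>The matrices permute the basis; the trace counts the basis elements \<open>x\<close>
  with \<open>h\<^sub>1 x h\<^sub>2\<^sup>-\<^sup>1 = x\<close>.\<close>

lemma regular_rep:
  fixes H :: "'h monoid" and G :: "'g monoid"
  assumes H: "group H" and fin: "finite (carrier H)" and G: "group G"
  shows regular_rep_reps: "regular_rep H \<in> reps (H \<times>\<times> (H \<times>\<times> G))"
    and character_regular_rep: "\<lbrakk>h1 \<in> carrier H; h2 \<in> carrier H; g \<in> carrier G\<rbrakk> \<Longrightarrow>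
      character (H \<times>\<times> (H \<times>\<times> G)) (regular_rep H) (h1, h2, g)
        = of_nat (card {x \<in> carrier H. h1 \<otimes>\<^bsub>H\<^esub> x = x \<otimes>\<^bsub>H\<^esub> h2})"
proof -
  interpret H: group H by (rule H)
  interpret G: group G by (rule G)
  define n where "n = card (carrier H)"
  define e where "e = (SOME e. bij_betw e {0..<n} (carrier H))"
  have e: "bij_betw e {0..<n} (carrier H)"
    unfolding e_def n_def by (rule someI_ex[OF ex_bij_betw_nat_finite[OF fin]])
  define M where "M h1 h2 = mat n n (\<lambda>(i, j). if e i = h1 \<otimes>\<^bsub>H\<^esub> e j \<otimes>\<^bsub>H\<^esub> inv\<^bsub>H\<^esub> h2 then 1 else 0 :: complex)" for h1 h2
  have reg: "regular_rep H = (n, \<lambda>(h1, h2, g). M h1 h2)"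
    by (simp add: regular_rep_def Let_def n_def e_def M_def)
  have ecl: "e i \<in> carrier H" if "i < n" for i
    using e that by (auto simp: bij_betw_def)
  have einj: "e i = e j \<longleftrightarrow> i = j" if "i < n" "j < n" for i j
    using e that by (auto simp: bij_betw_def inj_on_def)
  have esurj: "\<exists>k<n. e k = x" if "x \<in> carrier H" for x
  proof -
    have "x \<in> e ` {0..<n}" using e that by (simp add: bij_betw_def)
    then show ?thesis by auto
  qed
  show "regular_rep H \<in> reps (H \<times>\<times> (H \<times>\<times> G))"
    unfolding reg
  proof (rule repsI)
    show "(case \<one>\<^bsub>H \<times>\<times> (H \<times>\<times> G)\<^esub> of (h1, h2, g) \<Rightarrow> M h1 h2) = 1\<^sub>m n"
      by (auto simp: M_def ecl einj intro!: eq_matI)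
  next
    fix x y assume x: "x \<in> carrier (H \<times>\<times> (H \<times>\<times> G))" and y: "y \<in> carrier (H \<times>\<times> (H \<times>\<times> G))"
    obtain a1 a2 g where xs: "x = (a1, a2, g)" by (metis prod.exhaust)
    obtain b1 b2 g' where ys: "y = (b1, b2, g')" by (metis prod.exhaust)
    have ab: "a1 \<in> carrier H" "a2 \<in> carrier H" "b1 \<in> carrier H" "b2 \<in> carrier H"
      using x y by (auto simp: xs ys)
    have "M (a1 \<otimes>\<^bsub>H\<^esub> b1) (a2 \<otimes>\<^bsub>H\<^esub> b2) = M a1 a2 * M b1 b2"
    proof (rule eq_matI)
      fix i j assume "i < dim_row (M a1 a2 * M b1 b2)" "j < dim_col (M a1 a2 * M b1 b2)"
      then have ij: "i < n" "j < n" by (auto simp: M_def)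
      let ?y = "b1 \<otimes>\<^bsub>H\<^esub> e j \<otimes>\<^bsub>H\<^esub> inv\<^bsub>H\<^esub> b2"
      obtain k where k: "k < n" "e k = ?y" using esurj[of ?y] ab ecl[OF ij(2)] by auto
      have "(M a1 a2 * M b1 b2) $$ (i, j) = (\<Sum>l<n. M a1 a2 $$ (i, l) * M b1 b2 $$ (l, j))"
        by (rule mat_mult_entry) (use ij in \<open>auto simp: M_def\<close>)
      also have "\<dots> = (\<Sum>l<n. if l = k then M a1 a2 $$ (i, k) else 0)"
        by (rule sum.cong) (use ij k(1) einj in \<open>auto simp: M_def k(2)[symmetric]\<close>)
      also have "\<dots> = M a1 a2 $$ (i, k)" using k by simp
      also have "\<dots> = M (a1 \<otimes>\<^bsub>H\<^esub> b1) (a2 \<otimes>\<^bsub>H\<^esub> b2) $$ (i, j)"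
        using ij k ab ecl[OF ij(2)] by (simp add: M_def k(2) H.inv_mult_group H.m_assoc)
      finally show "M (a1 \<otimes>\<^bsub>H\<^esub> b1) (a2 \<otimes>\<^bsub>H\<^esub> b2) $$ (i, j) = (M a1 a2 * M b1 b2) $$ (i, j)" ..
    qed (auto simp: M_def)
    then show "(case x \<otimes>\<^bsub>H \<times>\<times> (H \<times>\<times> G)\<^esub> y of (h1, h2, g) \<Rightarrow> M h1 h2)
        = (case x of (h1, h2, g) \<Rightarrow> M h1 h2) * (case y of (h1, h2, g) \<Rightarrow> M h1 h2)"
      by (simp add: xs ys)
  qed (auto simp: M_def)
  show "character (H \<times>\<times> (H \<times>\<times> G)) (regular_rep H) (h1, h2, g)
        = of_nat (card {x \<in> carrier H. h1 \<otimes>\<^bsub>H\<^esub> x = x \<otimes>\<^bsub>H\<^esub> h2})"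
    if h: "h1 \<in> carrier H" "h2 \<in> carrier H" "g \<in> carrier G"
  proof -
    have eq: "x = h1 \<otimes>\<^bsub>H\<^esub> x \<otimes>\<^bsub>H\<^esub> inv\<^bsub>H\<^esub> h2 \<longleftrightarrow> h1 \<otimes>\<^bsub>H\<^esub> x = x \<otimes>\<^bsub>H\<^esub> h2" if "x \<in> carrier H" for x
      using h that by (metis H.inv_solve_right H.m_closed)
    have "character (H \<times>\<times> (H \<times>\<times> G)) (regular_rep H) (h1, h2, g)
        = (\<Sum>i<n. if h1 \<otimes>\<^bsub>H\<^esub> e i = e i \<otimes>\<^bsub>H\<^esub> h2 then 1 else 0)"
      using h by (auto simp: character_def reg mtrace_def M_def eq ecl intro!: sum.cong)
    also have "\<dots> = (\<Sum>x\<in>carrier H. if h1 \<otimes>\<^bsub>H\<^esub> x = x \<otimes>\<^bsub>H\<^esub> h2 then 1 else 0)"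
      by (rule sum.reindex_bij_betw) (use e in \<open>simp add: atLeast0LessThan\<close>)
    also have "\<dots> = of_nat (card {x \<in> carrier H. h1 \<otimes>\<^bsub>H\<^esub> x = x \<otimes>\<^bsub>H\<^esub> h2})"
      using fin by (simp add: sum.If_cases Int_def conj_commute)
    finally show ?thesis .
  qed
qed

text \<open>Restriction of the bimodule \<open>\<complex>H\<close> to the left action.\<close>

lemma (in finite_group) ex_left_regular_rep:
  "\<exists>R\<in>reps H. \<forall>h\<in>carrier H. character H R h = (if h = \<one> then of_nat (card (carrier H)) else 0)"
proof -
  define T :: "unit monoid" where "T = \<lparr>carrier = {()}, monoid.mult = (\<lambda>_ _. ()), one = ()\<rparr>"
  have T: "group T" by (rule groupI) (auto simp: T_def)
  let ?R = "(rdim (regular_rep H :: ('a \<times> 'a \<times> unit) rep), \<lambda>h. ract (regular_rep H :: ('a \<times> 'a \<times> unit) rep) (h, \<one>, ()))"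
  note reg = repsD[OF regular_rep_reps[OF is_group finite_carrier T]]
  have "?R \<in> reps H"
  proof (rule repsI)
    fix x y assume "x \<in> carrier H" "y \<in> carrier H"
    then show "ract (regular_rep H :: ('a \<times> 'a \<times> unit) rep) (x \<otimes> y, \<one>, ())
      = ract (regular_rep H) (x, \<one>, ()) * ract (regular_rep H) (y, \<one>, ())"
      using reg(3)[of "(x, \<one>, ())" "(y, \<one>, ())"] by (simp add: T_def)
  qed (use reg(1,2) in \<open>auto simp: T_def\<close>)
  moreover have "character H ?R h = (if h = \<one> then of_nat (card (carrier H)) else 0)" if h: "h \<in> carrier H" for h
  proof -
    have "character H ?R h = character (H \<times>\<times> (H \<times>\<times> T)) (regular_rep H) (h, \<one>, ())"
      using h by (simp add: character_def T_def)
    also have "\<dots> = of_nat (card {x \<in> carrier H. h \<otimes> x = x \<otimes> \<one>})"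
      by (rule character_regular_rep[OF is_group finite_carrier T]) (use h in \<open>auto simp: T_def\<close>)
    also have "{x \<in> carrier H. h \<otimes> x = x \<otimes> \<one>} = (if h = \<one> then carrier H else {})"
      using h by auto
    finally show ?thesis by simp
  qed
  ultimately show ?thesis by blast
qed

lemma character_dim_0: "rdim V = 0 \<Longrightarrow> V \<in> reps H \<Longrightarrow> character H V h = 0"
  using repsD(1)[of V H h] by (auto simp: character_def mtrace_def)

context finite_group begin

lemma cancel_left:
  assumes "g \<in> carrier H" "h \<in> carrier H"
  shows "g \<otimes> (inv g \<otimes> h) = h" "inv g \<otimes> (g \<otimes> h) = h"
  using assms by (simp_all flip: m_assoc)

text \<open>Every module is obtained from bricks by repeated extensions.\<close>

lemma reps_brick_induct [consumes 1, case_names zero brick extension]: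
  assumes "V \<in> reps H"
    and zero: "\<And>V. \<lbrakk>V \<in> reps H; rdim V = 0\<rbrakk> \<Longrightarrow> Q V"
    and brick: "\<And>V. brick V \<Longrightarrow> Q V"
    and ext: "\<And>U V W. \<lbrakk>U \<in> reps H; V \<in> reps H; W \<in> reps H; short_exact H U V W; Q U; Q W\<rbrakk> \<Longrightarrow> Q V"
  shows "Q V"
  using assms(1)
proof (induction "rdim V" arbitrary: V rule: less_induct)
  case less
  show ?case
  proof (cases "rdim V = 0 \<or> brick V")
    case True
    then show ?thesis using zero brick less.prems by blast
  next
    case False
    then obtain U W where "U \<in> reps H" "W \<in> reps H" "short_exact H U V W" "rdim U < rdim V" "rdim W < rdim V"
      using decompose_non_brick[OF less.prems] by (metis gr0I)
    then show ?thesis using ext less by blast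
  qed
qed

definition class_functions :: "('a \<Rightarrow> complex) set"
  where "class_functions = {f. (\<forall>h. h \<notin> carrier H \<longrightarrow> f h = 0) \<and>
    (\<forall>g\<in>carrier H. \<forall>h\<in>carrier H. f (g \<otimes> h \<otimes> inv g) = f h)}"

lemma class_functionsD:
  assumes "f \<in> class_functions"
  shows "h \<notin> carrier H \<Longrightarrow> f h = 0"
    and "\<lbrakk>g \<in> carrier H; h \<in> carrier H\<rbrakk> \<Longrightarrow> f (g \<otimes> h \<otimes> inv g) = f h"
  using assms by (auto simp: class_functions_def)

lemma character_class_function: "V \<in> reps H \<Longrightarrow> character H V \<in> class_functions"
  by (auto simp: class_functions_def character_conj) (simp add: character_def)

text \<open>The character of \<open>\<complex>H\<close> under left and right multiplication: the
  order of the centralizer on pairs of conjugate elements, and zero on all other pairs.\<close>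

definition conj_count :: "'a \<Rightarrow> 'a \<Rightarrow> complex"
  where "conj_count x y = (\<Sum>z\<in>carrier H. if x \<otimes> z = z \<otimes> y then 1 else 0)"

lemma conj_count_commute:
  assumes x: "x \<in> carrier H" and y: "y \<in> carrier H"
  shows "conj_count x y = conj_count y x"
proof -
  have "y \<otimes> inv z = inv z \<otimes> x \<longleftrightarrow> x \<otimes> z = z \<otimes> y" if "z \<in> carrier H" for z
    using x y that by (metis inv_closed inv_solve_left inv_solve_right m_assoc m_closed)
  then show ?thesis
    unfolding conj_count_def by (subst (2) sum_inv[symmetric]) (auto intro!: sum.cong)
qed

text \<open>As an integral kernel on class functions, \<open>conj_count\<close> is
  \<open>|H|\<close> times the identity. This is why \<open>\<complex>H\<close> is a two-sided
  unit for composition.\<close>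

lemma sum_conj_count:
  assumes x: "x \<in> carrier H"
    and f: "\<And>z y. \<lbrakk>z \<in> carrier H; y \<in> carrier H\<rbrakk> \<Longrightarrow> f (z \<otimes> y \<otimes> inv z) = f y"
  shows "(\<Sum>y\<in>carrier H. conj_count y x * f y) = of_nat (card (carrier H)) * f x"
    and "(\<Sum>y\<in>carrier H. conj_count x y * f y) = of_nat (card (carrier H)) * f x"
proof -
  have "(\<Sum>y\<in>carrier H. conj_count y x * f y)
      = (\<Sum>y\<in>carrier H. \<Sum>z\<in>carrier H. if y \<otimes> z = z \<otimes> x then f y else 0)"
    by (auto simp: conj_count_def sum_distrib_right intro!: sum.cong)
  also have "\<dots> = (\<Sum>z\<in>carrier H. \<Sum>y\<in>carrier H. if y \<otimes> z = z \<otimes> x then f y else 0)"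
    by (rule sum.swap)
  also have "\<dots> = (\<Sum>z\<in>carrier H. f x)"
  proof (rule sum.cong)
    fix z assume z: "z \<in> carrier H"
    have "y \<otimes> z = z \<otimes> x \<longleftrightarrow> y = z \<otimes> x \<otimes> inv z" if "y \<in> carrier H" for y
      using x z that by (metis inv_solve_right m_closed)
    then have "(\<Sum>y\<in>carrier H. if y \<otimes> z = z \<otimes> x then f y else 0)
        = (\<Sum>y\<in>carrier H. if y = z \<otimes> x \<otimes> inv z then f y else 0)"
      by (intro sum.cong) auto
    also have "\<dots> = f x" using finite_carrier x z f by simp
    finally show "(\<Sum>y\<in>carrier H. if y \<otimes> z = z \<otimes> x then f y else 0) = f x" .
  qed simp
  finally show 1: "(\<Sum>y\<in>carrier H. conj_count y x * f y) = of_nat (card (carrier H)) * f x" by simp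
  then show "(\<Sum>y\<in>carrier H. conj_count x y * f y) = of_nat (card (carrier H)) * f x"
    using conj_count_commute[OF x] by (simp cong: sum.cong)
qed

definition irr_characters :: "('a \<Rightarrow> complex) set"
  where "irr_characters = {character H V | V. brick V}"

lemma irrI: "brick V \<Longrightarrow> character H V \<in> irr_characters"
  unfolding irr_characters_def by blast

lemma irr_class_functions: "\<chi> \<in> irr_characters \<Longrightarrow> \<chi> \<in> class_functions"
  using character_class_function brickD(1) by (auto simp: irr_characters_def)

lemma irr_orthonormal:
  "\<lbrakk>\<phi> \<in> irr_characters; \<psi> \<in> irr_characters\<rbrakk> \<Longrightarrow> inner_prod \<phi> \<psi> = (if \<phi> = \<psi> then 1 else 0)"
  using inner_prod_bricks by (auto simp: irr_characters_def)

lemma inner_prod_sum_left: "inner_prod (\<lambda>h. \<Sum>i\<in>I. f i h) \<psi> = (\<Sum>i\<in>I. inner_prod (f i) \<psi>)"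
  unfolding inner_prod_def sum_distrib_right
  by (subst sum.swap) (simp add: sum_distrib_left)

lemma inner_prod_scale_left: "inner_prod (\<lambda>h. c * \<phi> h) \<psi> = c * inner_prod \<phi> \<psi>"
  by (simp add: inner_prod_def sum_distrib_left mult_ac)

lemma inner_prod_diff_left: "inner_prod (\<lambda>h. \<phi> h - \<phi>' h) \<psi> = inner_prod \<phi> \<psi> - inner_prod \<phi>' \<psi>"
  by (simp add: inner_prod_def sum_subtractf algebra_simps)

lemma character_sum_of_irr:
  assumes "V \<in> reps H"
  shows "\<exists>\<chi>s. set \<chi>s \<subseteq> irr_characters \<and> (\<forall>h. character H V h = (\<Sum>\<chi>\<leftarrow>\<chi>s. \<chi> h))"
  using assms
proof (induction rule: reps_brick_induct)
  case (zero V)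
  then show ?case by (intro exI[of _ "[]"]) (simp add: character_dim_0)
next
  case (brick V)
  then show ?case by (intro exI[of _ "[character H V]"]) (simp add: irrI)
next
  case (extension U V W)
  then obtain us ws where "set us \<subseteq> irr_characters" "\<forall>h. character H U h = (\<Sum>\<chi>\<leftarrow>us. \<chi> h)"
    "set ws \<subseteq> irr_characters" "\<forall>h. character H W h = (\<Sum>\<chi>\<leftarrow>ws. \<chi> h)" by blast
  then show ?case
    using character_short_exact[OF extension(1-4)] by (intro exI[of _ "us @ ws"]) auto
qed

text \<open>The inner product of the regular character with \<open>\<psi>\<close> is
  \<open>\<psi>(1)\<close>, hence nonzero. By orthogonality \<open>\<psi>\<close> is one of the
  finitely many summands of the regular character.\<close>

lemma finite_irr_characters: "finite irr_characters"
proof -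
  obtain R where R: "R \<in> reps H"
    "\<And>h. h \<in> carrier H \<Longrightarrow> character H R h = (if h = \<one> then of_nat (card (carrier H)) else 0)"
    using ex_left_regular_rep by blast
  obtain \<chi>s where \<chi>s: "set \<chi>s \<subseteq> irr_characters" "\<And>h. character H R h = (\<Sum>\<chi>\<leftarrow>\<chi>s. \<chi> h)"
    using character_sum_of_irr[OF R(1)] by blast
  have "irr_characters \<subseteq> set \<chi>s"
  proof
    fix \<psi> assume \<psi>: "\<psi> \<in> irr_characters"
    then obtain V where V: "brick V" "\<psi> = character H V" by (auto simp: irr_characters_def)
    have "inner_prod (character H R) \<psi> = \<psi> (inv \<one>)"
    proof -
      have "(\<Sum>h\<in>carrier H. character H R h * \<psi> (inv h))
          = (\<Sum>h\<in>carrier H. if h = \<one> then of_nat (card (carrier H)) * \<psi> (inv \<one>) else 0)"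
        by (rule sum.cong) (auto simp: R(2))
      then show ?thesis using finite_carrier by (simp add: inner_prod_def)
    qed
    then have ne: "inner_prod (character H R) \<psi> \<noteq> 0"
      using brickD(1,2)[OF V(1)] by (simp add: V(2) character_one)
    have "inner_prod (character H R) \<psi> = (\<Sum>\<chi>\<leftarrow>\<chi>s. inner_prod \<chi> \<psi>)"
      unfolding \<chi>s(2)
    proof (induction \<chi>s)
      case (Cons \<chi> \<chi>s)
      have "inner_prod (\<lambda>h. \<chi> h + (\<Sum>\<chi>\<leftarrow>\<chi>s. \<chi> h)) \<psi> = inner_prod \<chi> \<psi> + inner_prod (\<lambda>h. \<Sum>\<chi>\<leftarrow>\<chi>s. \<chi> h) \<psi>"
        by (simp add: inner_prod_def sum.distrib algebra_simps)
      then show ?case using Cons by simp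
    qed (simp add: inner_prod_def)
    with ne have "\<exists>\<chi>\<in>set \<chi>s. inner_prod \<chi> \<psi> \<noteq> 0"
      by (metis (mono_tags, lifting) map_eq_conv sum_list_0)
    then obtain \<chi> where "\<chi> \<in> set \<chi>s" "inner_prod \<chi> \<psi> \<noteq> 0" by blast
    then show "\<psi> \<in> set \<chi>s" using irr_orthonormal[of \<chi> \<psi>] \<chi>s(1) \<psi> by (auto split: if_splits)
  qed
  then show ?thesis using finite_subset by blast
qed

text \<open>On a brick \<open>V\<close>, the operator \<open>\<Sum>h. f(h)
  \<rho>(h\<^sup>-\<^sup>1)\<close> is an endomorphism because \<open>f\<close> is a class
  function, so it is a scalar; its trace is \<open>|H|\<close> times the inner product of
  \<open>f\<close> with the character of \<open>V\<close>, so it is zero. Hence \<open>\<Sum>h.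
  f(h) \<chi>\<^sub>V(h\<^sup>-\<^sup>1 x) = 0\<close>, first for bricks and then by additivity
  for all \<open>V\<close>. For the regular character this sum is \<open>|H| f(x)\<close>.\<close>

lemma class_function_orthogonal_zero:
  assumes f: "f \<in> class_functions" and orth: "\<And>\<chi>. \<chi> \<in> irr_characters \<Longrightarrow> inner_prod f \<chi> = 0"
  shows "f x = 0"
proof (cases "x \<in> carrier H")
  case x: True
  have sum0: "(\<Sum>h\<in>carrier H. f h * character H V (inv h \<otimes> x)) = 0" if "V \<in> reps H" for V
    using that
  proof (induction rule: reps_brick_induct)
    case (zero V)
    then show ?case by (simp add: character_dim_0)
  next
    case (extension U V W)
    then show ?case
      by (simp add: character_short_exact[OF extension(1-4)] distrib_left sum.distrib)
  next
    case (brick V)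
    note V = brickD(1)[OF brick]
    note \<rho> = repsD[OF V]
    define T where "T = msum (rdim V) (rdim V) (\<lambda>h. f h \<cdot>\<^sub>m ract V (inv h)) (carrier H)"
    have cl: "f h \<cdot>\<^sub>m ract V (inv h) \<in> carrier_mat (rdim V) (rdim V)" if "h \<in> carrier H" for h
      using \<rho>(1)[OF inv_closed[OF that]] by simp
    have "T \<in> rep_homs H V V"
    proof (rule rep_homsI)
      fix g assume g: "g \<in> carrier H"
      have bij: "bij_betw (\<lambda>h. inv g \<otimes> h \<otimes> g) (carrier H) (carrier H)"
        by (rule bij_betw_byWitness[where f' = "\<lambda>h. g \<otimes> h \<otimes> inv g"])
          (use g in \<open>auto simp: m_assoc cancel_left\<close>)
      have "ract V g * T = msum (rdim V) (rdim V) (\<lambda>h. ract V g * (f h \<cdot>\<^sub>m ract V (inv h))) (carrier H)"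
        unfolding T_def by (rule mult_msum[OF \<rho>(1)[OF g] cl])
      also have "\<dots> = msum (rdim V) (rdim V) (\<lambda>h. f h \<cdot>\<^sub>m ract V (g \<otimes> inv h)) (carrier H)"
        by (rule msum_cong) (use g mult_smult_distrib[OF \<rho>(1)[OF g] \<rho>(1)] in \<open>simp add: \<rho>(3)\<close>)
      also have "\<dots> = msum (rdim V) (rdim V)
          (\<lambda>h. f (inv g \<otimes> h \<otimes> g) \<cdot>\<^sub>m ract V (g \<otimes> inv (inv g \<otimes> h \<otimes> g))) (carrier H)"
        by (rule msum_reindex[OF bij])
      also have "\<dots> = msum (rdim V) (rdim V) (\<lambda>h. f h \<cdot>\<^sub>m ract V (inv h) * ract V g) (carrier H)"
      proof (rule msum_cong)
        fix h assume h: "h \<in> carrier H"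
        have "f (inv g \<otimes> h \<otimes> g) = f h" using class_functionsD(2)[OF f, of "inv g" h] g h by simp
        moreover have "g \<otimes> inv (inv g \<otimes> h \<otimes> g) = inv h \<otimes> g"
          using g h by (simp add: inv_mult_group flip: m_assoc)
        ultimately show "f (inv g \<otimes> h \<otimes> g) \<cdot>\<^sub>m ract V (g \<otimes> inv (inv g \<otimes> h \<otimes> g)) = f h \<cdot>\<^sub>m ract V (inv h) * ract V g"
          using g h mult_smult_assoc_mat[OF \<rho>(1)[OF inv_closed[OF h]] \<rho>(1)[OF g]] by (simp add: \<rho>(3))
      qed
      also have "\<dots> = T * ract V g" unfolding T_def by (rule msum_mult[OF \<rho>(1)[OF g] cl, symmetric])
      finally show "T * ract V g = ract V g * T" ..
    qed (simp add: T_def)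
    then have T: "T = (mtrace T / of_nat (rdim V)) \<cdot>\<^sub>m 1\<^sub>m (rdim V)" by (rule brick_endo_trace[OF brick])
    have "mtrace T = (\<Sum>h\<in>carrier H. f h * character H V (inv h))"
      unfolding T_def by (subst mtrace_msum[OF cl]) (auto simp: character_def mtrace_smult[OF \<rho>(1)] intro!: sum.cong)
    also have "\<dots> = 0"
      using orth[OF irrI[OF brick]] card_pos by (auto simp: inner_prod_def)
    finally have T0: "T = 0\<^sub>m (rdim V) (rdim V)" by (subst T) (auto intro!: eq_matI)
    have "(\<Sum>h\<in>carrier H. f h * character H V (inv h \<otimes> x)) = (\<Sum>h\<in>carrier H. mtrace (f h \<cdot>\<^sub>m ract V (inv h) * ract V x))"
    proof (rule sum.cong)
      fix h assume h: "h \<in> carrier H"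
      have "f h \<cdot>\<^sub>m ract V (inv h) * ract V x = f h \<cdot>\<^sub>m ract V (inv h \<otimes> x)"
        using h x mult_smult_assoc_mat[OF \<rho>(1)[OF inv_closed[OF h]] \<rho>(1)[OF x]] by (simp add: \<rho>(3))
      then show "f h * character H V (inv h \<otimes> x) = mtrace (f h \<cdot>\<^sub>m ract V (inv h) * ract V x)"
        using h x mtrace_smult[OF \<rho>(1)] by (simp add: character_def)
    qed simp
    also have "\<dots> = mtrace (T * ract V x)"
    proof -
      have "T * ract V x = msum (rdim V) (rdim V) (\<lambda>h. f h \<cdot>\<^sub>m ract V (inv h) * ract V x) (carrier H)"
        unfolding T_def by (rule msum_mult[OF \<rho>(1)[OF x] cl])
      then show ?thesis
        by (simp only:) (rule mtrace_msum[symmetric], rule mult_carrier_mat[OF cl \<rho>(1)[OF x]])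
    qed
    also have "\<dots> = 0" unfolding T0 using \<rho>(1)[OF x] by (simp add: mtrace_def)
    finally show ?case .
  qed
  obtain R where R: "R \<in> reps H"
    "\<And>h. h \<in> carrier H \<Longrightarrow> character H R h = (if h = \<one> then of_nat (card (carrier H)) else 0)"
    using ex_left_regular_rep by blast
  have "(\<Sum>h\<in>carrier H. f h * character H R (inv h \<otimes> x)) = (\<Sum>h\<in>carrier H. if h = x then f x * of_nat (card (carrier H)) else 0)"
  proof (rule sum.cong)
    fix h assume h: "h \<in> carrier H"
    have "inv h \<otimes> x = \<one> \<longleftrightarrow> h = x" using h x by (metis inv_solve_left l_inv r_one one_closed)
    then show "f h * character H R (inv h \<otimes> x) = (if h = x then f x * of_nat (card (carrier H)) else 0)"
      using h x by (simp add: R(2))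
  qed simp
  then show ?thesis using sum0[OF R(1)] x finite_carrier by auto
qed (use class_functionsD(1)[OF f] in simp)

lemma class_function_expansion:
  assumes f: "f \<in> class_functions"
  shows "f h = (\<Sum>\<chi>\<in>irr_characters. inner_prod f \<chi> * \<chi> h)"
proof -
  let ?f = "\<lambda>h. f h - (\<Sum>\<chi>\<in>irr_characters. inner_prod f \<chi> * \<chi> h)"
  have "?f \<in> class_functions"
    unfolding class_functions_def
  proof (intro CollectI conjI ballI allI impI)
    fix g h assume "g \<in> carrier H" "h \<in> carrier H"
    then show "?f (g \<otimes> h \<otimes> inv g) = ?f h"
      by (simp add: class_functionsD(2)[OF f] class_functionsD(2)[OF irr_class_functions] cong: sum.cong)
  next
    fix h assume "h \<notin> carrier H"
    then show "?f h = 0"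
      by (simp add: class_functionsD(1)[OF f] class_functionsD(1)[OF irr_class_functions] cong: sum.cong)
  qed
  moreover have "inner_prod ?f \<psi> = 0" if \<psi>: "\<psi> \<in> irr_characters" for \<psi>
  proof -
    have "inner_prod (\<lambda>h. \<Sum>\<chi>\<in>irr_characters. inner_prod f \<chi> * \<chi> h) \<psi> = (\<Sum>\<chi>\<in>irr_characters. inner_prod f \<chi> * inner_prod \<chi> \<psi>)"
      by (simp add: inner_prod_sum_left inner_prod_scale_left)
    also have "\<dots> = (\<Sum>\<chi>\<in>irr_characters. if \<chi> = \<psi> then inner_prod f \<psi> else 0)"
      by (rule sum.cong) (use \<psi> irr_orthonormal in auto)
    also have "\<dots> = inner_prod f \<psi>" using \<psi> finite_irr_characters by simp
    finally show ?thesis by (simp add: inner_prod_diff_left)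
  qed
  ultimately have "?f h = 0" by (rule class_function_orthogonal_zero)
  then show ?thesis by simp
qed

text \<open>The second orthogonality relation: the expansion of the class function \<open>x
  \<mapsto> conj_count x h\<^sub>2\<close>, whose coefficients are
  \<open>\<chi>(h\<^sub>2\<^sup>-\<^sup>1)\<close> by \<open>sum_conj_count\<close>.\<close>

lemma sum_irr_characters:
  assumes h1: "h1 \<in> carrier H" and h2: "h2 \<in> carrier H"
  shows "(\<Sum>\<chi>\<in>irr_characters. \<chi> h1 * \<chi> (inv h2)) = conj_count h1 h2"
proof -
  \<comment> \<open>Zero outside the group, as class functions are by definition.\<close>
  define f where "f x = (if x \<in> carrier H then conj_count x h2 else 0)" for x
  have "f \<in> class_functions"
    unfolding class_functions_def
  proof (intro CollectI conjI ballI allI impI)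
    fix a x assume a: "a \<in> carrier H" and x: "x \<in> carrier H"
    have "(a \<otimes> x \<otimes> inv a) \<otimes> (a \<otimes> z) = (a \<otimes> z) \<otimes> h2 \<longleftrightarrow> x \<otimes> z = z \<otimes> h2" if "z \<in> carrier H" for z
      using a x that h2 by (simp add: m_assoc cancel_left)
    then have "conj_count (a \<otimes> x \<otimes> inv a) h2 = conj_count x h2"
      unfolding conj_count_def by (subst sum_mult_left[OF a, symmetric]) (auto intro!: sum.cong)
    then show "f (a \<otimes> x \<otimes> inv a) = f x" using a x by (simp add: f_def)
  qed (simp add: f_def)
  then have "f h1 = (\<Sum>\<chi>\<in>irr_characters. inner_prod f \<chi> * \<chi> h1)" by (rule class_function_expansion)
  also have "\<dots> = (\<Sum>\<chi>\<in>irr_characters. \<chi> h1 * \<chi> (inv h2))"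
  proof (rule sum.cong)
    fix \<chi> assume \<chi>: "\<chi> \<in> irr_characters"
    have "\<chi> (inv (z \<otimes> y \<otimes> inv z)) = \<chi> (inv y)" if "z \<in> carrier H" "y \<in> carrier H" for y z
      using class_functionsD(2)[OF irr_class_functions[OF \<chi>], of z "inv y"] that by (simp add: inv_mult_group m_assoc)
    from sum_conj_count(1)[OF h2, of "\<lambda>y. \<chi> (inv y)", OF this]
    have "inner_prod f \<chi> = \<chi> (inv h2)" by (simp add: inner_prod_def f_def cong: sum.cong)
    then show "inner_prod f \<chi> * \<chi> h1 = \<chi> h1 * \<chi> (inv h2)" by simp
  qed simp
  finally show ?thesis using h1 by (simp add: f_def)
qed

end

section \<open>Kronecker products\<close>

lemma sum_div_mod:
  fixes f :: "nat \<Rightarrow> nat \<Rightarrow> complex"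
  shows "(\<Sum>l<a * b. f (l div b) (l mod b)) = (\<Sum>p<a. \<Sum>q<b. f p q)"
proof (cases "b = 0")
  case False
  have "(\<Sum>p<a. \<Sum>q<b. f p q) = (\<Sum>(p, q)\<in>{..<a} \<times> {..<b}. f p q)" by (rule sum.cartesian_product)
  also have "\<dots> = (\<Sum>l<a * b. f (l div b) (l mod b))"
  proof (rule sum.reindex_bij_witness[of _ "\<lambda>l. (l div b, l mod b)" "\<lambda>(p, q). p * b + q"])
    fix pq assume "pq \<in> {..<a} \<times> {..<b}"
    then obtain p q where pq: "pq = (p, q)" "p < a" "q < b" by auto
    have "p * b + q < Suc p * b" using pq by simp
    also have "\<dots> \<le> a * b" using pq by (intro mult_le_mono1) simp
    finally show "(case pq of (p, q) \<Rightarrow> p * b + q) \<in> {..<a * b}" by (simp add: pq)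
  qed (use False in \<open>auto simp: less_mult_imp_div_less\<close>)
  finally show ?thesis ..
qed simp

lemma kron_carrier:
  "\<lbrakk>A \<in> carrier_mat n m; B \<in> carrier_mat k l\<rbrakk> \<Longrightarrow> kron A B \<in> carrier_mat (n * k) (m * l)"
  by (auto simp: kron_def)

lemma kron_entry:
  "\<lbrakk>A \<in> carrier_mat n m; B \<in> carrier_mat k l; i < n * k; j < m * l\<rbrakk>
    \<Longrightarrow> kron A B $$ (i, j) = A $$ (i div k, j div l) * B $$ (i mod k, j mod l)"
  by (auto simp: kron_def)

lemma div_mod_less: "i < n * k \<Longrightarrow> i div k < n \<and> i mod k < (k :: nat)"
  by (metis less_mult_imp_div_less mod_less_divisor mult_0_right neq0_conv not_less0)

lemma kron_one: "kron (1\<^sub>m n) (1\<^sub>m k) = 1\<^sub>m (n * k)"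
proof (rule eq_matI)
  fix i j assume "i < dim_row (1\<^sub>m (n * k))" "j < dim_col (1\<^sub>m (n * k))"
  then have ij: "i < n * k" "j < n * k" by auto
  have "i = j \<longleftrightarrow> i div k = j div k \<and> i mod k = j mod k" by (metis div_mult_mod_eq)
  then show "kron (1\<^sub>m n) (1\<^sub>m k) $$ (i, j) = 1\<^sub>m (n * k) $$ (i, j)"
    using ij div_mod_less[OF ij(1)] div_mod_less[OF ij(2)]
    by (auto simp: kron_entry[OF one_carrier_mat one_carrier_mat])
qed (auto simp: kron_def)

lemma kron_mult:
  assumes A: "A \<in> carrier_mat n m" and C: "C \<in> carrier_mat m p"
    and B: "B \<in> carrier_mat k l" and D: "D \<in> carrier_mat l q"
  shows "kron (A * C) (B * D) = kron A B * kron C D"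
proof (rule eq_matI)
  fix i j assume "i < dim_row (kron A B * kron C D)" "j < dim_col (kron A B * kron C D)"
  then have ij: "i < n * k" "j < p * q" using A B C D by (auto simp: kron_def)
  note i = div_mod_less[OF ij(1)] and j = div_mod_less[OF ij(2)]
  have "(kron A B * kron C D) $$ (i, j) = (\<Sum>r<m * l. kron A B $$ (i, r) * kron C D $$ (r, j))"
    by (rule mat_mult_entry[OF kron_carrier[OF A B] kron_carrier[OF C D] ij])
  also have "\<dots> = (\<Sum>r<m * l. (A $$ (i div k, r div l) * C $$ (r div l, j div q)) * (B $$ (i mod k, r mod l) * D $$ (r mod l, j mod q)))"
    by (rule sum.cong) (auto simp: kron_entry[OF A B ij(1)] kron_entry[OF C D _ ij(2)])
  also have "\<dots> = (\<Sum>s<m. \<Sum>t<l. (A $$ (i div k, s) * C $$ (s, j div q)) * (B $$ (i mod k, t) * D $$ (t, j mod q)))"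
    by (rule sum_div_mod)
  also have "\<dots> = (A * C) $$ (i div k, j div q) * (B * D) $$ (i mod k, j mod q)"
    using i j by (simp only: mat_mult_entry[OF A C] mat_mult_entry[OF B D] sum_product)
  also have "\<dots> = kron (A * C) (B * D) $$ (i, j)"
    by (rule kron_entry[OF mult_carrier_mat[OF A C] mult_carrier_mat[OF B D] ij, symmetric])
  finally show "kron (A * C) (B * D) $$ (i, j) = (kron A B * kron C D) $$ (i, j)" ..
qed (use A B C D in \<open>auto simp: kron_def\<close>)

lemma mtrace_kron:
  assumes A: "A \<in> carrier_mat n n" and B: "B \<in> carrier_mat k k"
  shows "mtrace (kron A B) = mtrace A * mtrace B"
proof -
  have "mtrace (kron A B) = (\<Sum>i<n * k. A $$ (i div k, i div k) * B $$ (i mod k, i mod k))"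
    using kron_carrier[OF A B] by (auto simp: mtrace_def kron_entry[OF A B] intro!: sum.cong)
  also have "\<dots> = (\<Sum>p<n. \<Sum>q<k. A $$ (p, p) * B $$ (q, q))" by (rule sum_div_mod)
  also have "\<dots> = mtrace A * mtrace B" using A B by (simp add: mtrace_def sum_product)
  finally show ?thesis .
qed

section \<open>Coinvariants\<close>

lemma vec_span:
  assumes S: "S \<subseteq> carrier_vec n"
  shows "S \<subseteq> LinearCombinations.module.span Cfield (module_vec TYPE(complex) n) S"
    and "0\<^sub>v n \<in> LinearCombinations.module.span Cfield (module_vec TYPE(complex) n) S"
    and "\<lbrakk>u \<in> LinearCombinations.module.span Cfield (module_vec TYPE(complex) n) S;
        v \<in> LinearCombinations.module.span Cfield (module_vec TYPE(complex) n) S\<rbrakk>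
      \<Longrightarrow> u + v \<in> LinearCombinations.module.span Cfield (module_vec TYPE(complex) n) S"
    and "v \<in> LinearCombinations.module.span Cfield (module_vec TYPE(complex) n) S
      \<Longrightarrow> c \<cdot>\<^sub>v v \<in> LinearCombinations.module.span Cfield (module_vec TYPE(complex) n) S"
    and "LinearCombinations.module.span Cfield (module_vec TYPE(complex) n) S \<subseteq> carrier_vec n"
    and "\<lbrakk>A \<in> carrier_mat m n; \<And>v. v \<in> S \<Longrightarrow> A *\<^sub>v v = 0\<^sub>v m;
        v \<in> LinearCombinations.module.span Cfield (module_vec TYPE(complex) n) S\<rbrakk> \<Longrightarrow> A *\<^sub>v v = 0\<^sub>v m"
proof -
  interpret VS: vec_space "TYPE(complex)" n .
  let ?V = "module_vec TYPE(complex) n"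
  let ?s = "LinearCombinations.module.span Cfield ?V S"
  have M: "Module.module Cfield ?V" by (rule VS.module_axioms)
  have S': "S \<subseteq> carrier ?V" using S by (simp add: module_vec_simps)
  note sub = LinearCombinations.module.span_is_submodule[OF M S']
  show "S \<subseteq> ?s" by (rule LinearCombinations.module.in_own_span[OF M S'])
  show "0\<^sub>v n \<in> ?s" using submodule.zero_closed[OF sub] by (simp add: module_vec_simps)
  show "\<lbrakk>u \<in> ?s; v \<in> ?s\<rbrakk> \<Longrightarrow> u + v \<in> ?s" using submodule.m_closed[OF sub] by (simp add: module_vec_simps)
  show "v \<in> ?s \<Longrightarrow> c \<cdot>\<^sub>v v \<in> ?s" using submodule.smult_closed[OF sub, of c v] by (simp add: module_vec_simps)
  show "?s \<subseteq> carrier_vec n" using submodule.subset[OF sub] by (simp add: module_vec_simps)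
  show "A *\<^sub>v v = 0\<^sub>v m" if A: "A \<in> carrier_mat m n" and 0: "\<And>v. v \<in> S \<Longrightarrow> A *\<^sub>v v = 0\<^sub>v m" and v: "v \<in> ?s"
  proof -
    have "submodule Cfield {v \<in> carrier_vec n. A *\<^sub>v v = 0\<^sub>v m} ?V"
    proof (rule submodule.intro)
      show "Module.module Cfield ?V" by (rule M)
      fix u w assume "u \<in> {v \<in> carrier_vec n. A *\<^sub>v v = 0\<^sub>v m}" "w \<in> {v \<in> carrier_vec n. A *\<^sub>v v = 0\<^sub>v m}"
      then show "u \<oplus>\<^bsub>?V\<^esub> w \<in> {v \<in> carrier_vec n. A *\<^sub>v v = 0\<^sub>v m}"
        using A by (auto simp: module_vec_simps mult_add_distrib_mat_vec)
    next
      show "\<zero>\<^bsub>?V\<^esub> \<in> {v \<in> carrier_vec n. A *\<^sub>v v = 0\<^sub>v m}"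
        using A by (auto simp: module_vec_simps intro!: eq_vecI)
    next
      fix c w assume "w \<in> {v \<in> carrier_vec n. A *\<^sub>v v = 0\<^sub>v m}"
      then show "c \<odot>\<^bsub>?V\<^esub> w \<in> {v \<in> carrier_vec n. A *\<^sub>v v = 0\<^sub>v m}"
        using A by (auto simp: module_vec_simps mult_mat_vec)
    qed (simp add: module_vec_simps)
    then have "?s \<subseteq> {v \<in> carrier_vec n. A *\<^sub>v v = 0\<^sub>v m}"
      by (rule LinearCombinations.module.span_is_subset[OF M, rotated]) (use S 0 in auto)
    then show ?thesis using v by blast
  qed
qed

context finite_group begin

text \<open>The projection onto the invariants. Its kernel defines the coinvariants, so its image
  is a model of them.\<close>

definition projector :: "'a rep \<Rightarrow> complex mat"
  where "projector V = inverse (of_nat (card (carrier H))) \<cdot>\<^sub>m msum (rdim V) (rdim V) (ract V) (carrier H)"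

lemma projector_carrier [simp]: "projector V \<in> carrier_mat (rdim V) (rdim V)"
  by (simp add: projector_def)

lemma average_const:
  assumes "A \<in> carrier_mat n m"
  shows "inverse (of_nat (card (carrier H))) \<cdot>\<^sub>m msum n m (\<lambda>_. A) (carrier H) = A"
  unfolding msum_const[OF assms] using card_pos by (intro eq_matI) (auto simp flip: mult.assoc)

lemma mult_projector:
  assumes V: "V \<in> reps H" and A: "A \<in> carrier_mat m (rdim V)"
  shows "A * projector V = inverse (of_nat (card (carrier H))) \<cdot>\<^sub>m msum m (rdim V) (\<lambda>h. A * ract V h) (carrier H)"
  unfolding projector_def mult_smult_distrib[OF A msum_carrier] by (subst mult_msum[OF A repsD(1)[OF V]]) auto

lemma projector_mult:
  assumes V: "V \<in> reps H" and A: "A \<in> carrier_mat (rdim V) m"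
  shows "projector V * A = inverse (of_nat (card (carrier H))) \<cdot>\<^sub>m msum (rdim V) m (\<lambda>h. ract V h * A) (carrier H)"
  unfolding projector_def mult_smult_assoc_mat[OF msum_carrier A] by (subst msum_mult[OF A repsD(1)[OF V]]) auto

lemma projector_ract:
  assumes V: "V \<in> reps H" and k: "k \<in> carrier H"
  shows "projector V * ract V k = projector V"
proof -
  have "bij_betw (\<lambda>h. h \<otimes> k) (carrier H) (carrier H)"
    by (rule bij_betw_byWitness[where f' = "\<lambda>h. h \<otimes> inv k"]) (use k in \<open>auto simp: m_assoc\<close>)
  note r = msum_reindex[OF this, of "rdim V" "rdim V" "ract V"]
  show ?thesis
    unfolding projector_mult[OF V repsD(1)[OF V k]] unfolding projector_def r
    using repsD(3)[OF V _ k] by (simp cong: msum_cong)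
qed

lemma projector_idem:
  assumes V: "V \<in> reps H"
  shows "projector V * projector V = projector V"
  unfolding mult_projector[OF V projector_carrier]
  using average_const[OF projector_carrier, of V] projector_ract[OF V] by (simp cong: msum_cong)

lemma projector_commute:
  assumes V: "V \<in> reps H" and A: "A \<in> carrier_mat (rdim V) (rdim V)"
    and comm: "\<And>h. h \<in> carrier H \<Longrightarrow> A * ract V h = ract V h * A"
  shows "A * projector V = projector V * A"
  unfolding mult_projector[OF V A] projector_mult[OF V A] using comm by (simp cong: msum_cong)

lemma mtrace_mult_projector:
  assumes V: "V \<in> reps H" and A: "A \<in> carrier_mat (rdim V) (rdim V)"
  shows "mtrace (A * projector V) = inverse (of_nat (card (carrier H))) * (\<Sum>h\<in>carrier H. mtrace (A * ract V h))"
  unfolding mult_projector[OF V A] mtrace_smult[OF msum_carrier]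
  by (subst mtrace_msum) (rule mult_carrier_mat[OF A repsD(1)[OF V]], auto)

text \<open>The projector kills \<open>h v - v\<close>. Conversely, if it kills \<open>v\<close>,
  then \<open>v\<close> is \<open>- 1/|H|\<close> times the sum of all \<open>h v -
  v\<close>.\<close>

lemma projector_kernel:
  assumes V: "V \<in> reps H"
  shows "mat_kernel (projector V) = LinearCombinations.module.span Cfield (module_vec TYPE(complex) (rdim V))
    {ract V h *\<^sub>v v - v | h v. h \<in> carrier H \<and> v \<in> carrier_vec (rdim V)}" (is "_ = ?span")
proof -
  let ?n = "rdim V" and ?c = "inverse (of_nat (card (carrier H))) :: complex"
  let ?S = "{ract V h *\<^sub>v v - v | h v. h \<in> carrier H \<and> v \<in> carrier_vec ?n}"
  note \<rho> = repsD(1)[OF V] and E = projector_carrier[of V]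
  have S: "?S \<subseteq> carrier_vec ?n" using mult_mat_vec_carrier[OF \<rho>] by auto
  note sp = vec_span[OF S]
  have kill: "projector V *\<^sub>v s = 0\<^sub>v ?n" if "s \<in> ?S" for s
  proof -
    obtain h w where s: "s = ract V h *\<^sub>v w - w" and h: "h \<in> carrier H" and w: "w \<in> carrier_vec ?n" using \<open>s \<in> ?S\<close> by blast
    have "projector V *\<^sub>v s = projector V *\<^sub>v (ract V h *\<^sub>v w) - projector V *\<^sub>v w"
      unfolding s by (rule mult_minus_distrib_mat_vec[OF E mult_mat_vec_carrier[OF \<rho>[OF h] w] w])
    also have "projector V *\<^sub>v (ract V h *\<^sub>v w) = projector V *\<^sub>v w"
      unfolding assoc_mult_mat_vec[OF E \<rho>[OF h] w, symmetric] projector_ract[OF V h] ..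
    finally show ?thesis using mult_mat_vec_carrier[OF E w] by simp
  qed
  show ?thesis
  proof (intro subset_antisym subsetI)
    fix v assume v: "v \<in> ?span"
    have "projector V *\<^sub>v v = 0\<^sub>v ?n" by (rule sp(6)[OF E kill v])
    then show "v \<in> mat_kernel (projector V)" using sp(5) v by (intro mat_kernelI[OF E]) auto
  next
    fix v assume "v \<in> mat_kernel (projector V)"
    then have v: "v \<in> carrier_vec ?n" and Ev: "projector V *\<^sub>v v = 0\<^sub>v ?n" using mat_kernelD[OF E] by auto
    have "\<exists>s\<in>?span. \<forall>i<?n. s $ i = (\<Sum>h\<in>F. (ract V h *\<^sub>v v) $ i - v $ i)" if "finite F" "F \<subseteq> carrier H" for F
      using that
    proof induction
      case empty
      show ?case using sp(2) by (intro bexI[of _ "0\<^sub>v ?n"]) auto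
    next
      case (insert h F)
      then obtain s where s: "s \<in> ?span" "\<forall>i<?n. s $ i = (\<Sum>h\<in>F. (ract V h *\<^sub>v v) $ i - v $ i)" by auto
      have "ract V h *\<^sub>v v - v \<in> ?S" using insert.prems v by blast
      then have "(ract V h *\<^sub>v v - v) + s \<in> ?span" using sp(1) s(1) by (intro sp(3)) auto
      moreover have "s \<in> carrier_vec ?n" using sp(5) s(1) by blast
      ultimately show ?case using s(2) insert v by (intro bexI[of _ "(ract V h *\<^sub>v v - v) + s"]) auto
    qed
    from this[OF finite_carrier subset_refl] obtain s where s: "s \<in> ?span"
      "\<forall>i<?n. s $ i = (\<Sum>h\<in>carrier H. (ract V h *\<^sub>v v) $ i - v $ i)" by blast
    have sc: "s \<in> carrier_vec ?n" using sp(5) s(1) by blast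
    have "v = (- ?c) \<cdot>\<^sub>v s"
    proof (rule eq_vecI)
      fix i assume "i < dim_vec ((- ?c) \<cdot>\<^sub>v s)"
      then have i: "i < ?n" using sc by auto
      have "(projector V *\<^sub>v v) $ i = ?c * (msum ?n ?n (ract V) (carrier H) *\<^sub>v v) $ i"
        using i v by (simp add: projector_def msum_def scalar_prod_def mult.assoc flip: sum_distrib_left)
      then have "?c * (\<Sum>h\<in>carrier H. (ract V h *\<^sub>v v) $ i) = 0" using i by (simp add: mult_msum_vec[OF \<rho> v i] Ev)
      moreover have "s $ i = (\<Sum>h\<in>carrier H. (ract V h *\<^sub>v v) $ i) - of_nat (card (carrier H)) * v $ i"
        using i s(2) by (simp add: sum_subtractf)
      ultimately show "v $ i = ((- ?c) \<cdot>\<^sub>v s) $ i" using i sc by (simp add: right_diff_distrib)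
    qed (use v sc in auto)
    then show "v \<in> ?span" using sp(4)[OF s(1)] by simp
  qed
qed

end

lemma commuting_actions:
  fixes L K H :: "'h monoid" and G :: "'g monoid"
  assumes gr: "group L" "group K" "group H" "group G" and T: "T \<in> reps (L \<times>\<times> (K \<times>\<times> (H \<times>\<times> G)))"
  shows "(rdim T, \<lambda>k. ract T (\<one>\<^bsub>L\<^esub>, k, \<one>\<^bsub>H\<^esub>, \<one>\<^bsub>G\<^esub>)) \<in> reps K"
    and "(rdim T, \<lambda>(l, h, g). ract T (l, \<one>\<^bsub>K\<^esub>, h, g)) \<in> reps (L \<times>\<times> (H \<times>\<times> G))"
    and "\<lbrakk>l \<in> carrier L; k \<in> carrier K; h \<in> carrier H; g \<in> carrier G\<rbrakk>
      \<Longrightarrow> ract T (l, \<one>\<^bsub>K\<^esub>, h, g) * ract T (\<one>\<^bsub>L\<^esub>, k, \<one>\<^bsub>H\<^esub>, \<one>\<^bsub>G\<^esub>) = ract T (l, k, h, g)"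
    and "\<lbrakk>l \<in> carrier L; k \<in> carrier K; h \<in> carrier H; g \<in> carrier G\<rbrakk>
      \<Longrightarrow> ract T (\<one>\<^bsub>L\<^esub>, k, \<one>\<^bsub>H\<^esub>, \<one>\<^bsub>G\<^esub>) * ract T (l, \<one>\<^bsub>K\<^esub>, h, g) = ract T (l, k, h, g)"
proof -
  interpret L: group L by (rule gr)
  interpret K: group K by (rule gr)
  interpret H: group H by (rule gr)
  interpret G: group G by (rule gr)
  note \<tau> = repsD[OF T]
  have mult: "ract T (l, k, h, g) * ract T (l', k', h', g')
      = ract T (l \<otimes>\<^bsub>L\<^esub> l', k \<otimes>\<^bsub>K\<^esub> k', h \<otimes>\<^bsub>H\<^esub> h', g \<otimes>\<^bsub>G\<^esub> g')"
    if "l \<in> carrier L" "k \<in> carrier K" "h \<in> carrier H" "g \<in> carrier G"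
      "l' \<in> carrier L" "k' \<in> carrier K" "h' \<in> carrier H" "g' \<in> carrier G" for l k h g l' k' h' g'
    using \<tau>(3)[of "(l, k, h, g)" "(l', k', h', g')"] that by simp
  show "(rdim T, \<lambda>k. ract T (\<one>\<^bsub>L\<^esub>, k, \<one>\<^bsub>H\<^esub>, \<one>\<^bsub>G\<^esub>)) \<in> reps K"
    using \<tau>(1,2) by (intro repsI) (auto simp: mult)
  show "(rdim T, \<lambda>(l, h, g). ract T (l, \<one>\<^bsub>K\<^esub>, h, g)) \<in> reps (L \<times>\<times> (H \<times>\<times> G))"
    using \<tau>(1,2) by (intro repsI) (auto simp: mult)
qed (use repsD(3)[OF T, of "(l, \<one>\<^bsub>K\<^esub>, h, g)" "(\<one>\<^bsub>L\<^esub>, k, \<one>\<^bsub>H\<^esub>, \<one>\<^bsub>G\<^esub>)"]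
    repsD(3)[OF T, of "(\<one>\<^bsub>L\<^esub>, k, \<one>\<^bsub>H\<^esub>, \<one>\<^bsub>G\<^esub>)" "(l, \<one>\<^bsub>K\<^esub>, h, g)"] gr
    in \<open>simp_all add: group.is_monoid monoid.l_one monoid.r_one monoid.one_closed\<close>)

text \<open>Splitting the projector \<open>E\<close> of the group \<open>K\<close> as \<open>E = S
  P\<close> gives a module of coinvariants. For an arbitrary one, with quotient map
  \<open>P\<close> and linear section \<open>S\<close>, equality of the kernels of
  \<open>P\<close> and \<open>E\<close> implies \<open>P E = P\<close> and \<open>E S P =
  E\<close>, so the trace of \<open>(l, h, g)\<close> on the coinvariants is the trace on
  \<open>T\<close> of its action followed by \<open>E\<close>. Thus the character does not depend
  on the choice.\<close>

lemma coinvariants: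
  fixes L K H :: "'h monoid" and G :: "'g monoid"
  assumes gr: "group L" "group K" "group H" "group G" and fin: "finite (carrier K)"
    and T: "T \<in> reps (L \<times>\<times> (K \<times>\<times> (H \<times>\<times> G)))"
  shows ex_coinvariants: "\<exists>U. is_coinvariants L K H G T U"
    and character_coinvariants:
      "\<lbrakk>is_coinvariants L K H G T U; l \<in> carrier L; h \<in> carrier H; g \<in> carrier G\<rbrakk> \<Longrightarrow>
      character (L \<times>\<times> (H \<times>\<times> G)) U (l, h, g)
      = inverse (of_nat (card (carrier K))) * (\<Sum>k\<in>carrier K. mtrace (ract T (l, k, h, g)))"
proof -
  interpret L: group L by (rule gr)
  interpret K: finite_group K using gr fin by (simp add: finite_group_def finite_group_axioms_def)
  interpret H: group H by (rule gr)
  interpret G: group G by (rule gr)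
  let ?n = "rdim T" and ?\<kappa> = "\<lambda>k. ract T (\<one>\<^bsub>L\<^esub>, k, \<one>\<^bsub>H\<^esub>, \<one>\<^bsub>G\<^esub>)"
  define \<mu> where "\<mu> = (\<lambda>(l, h, g). ract T (l, \<one>\<^bsub>K\<^esub>, h, g))"
  note act = commuting_actions[OF gr T]
  note \<mu>V = act(2)[folded \<mu>_def]
  have \<mu>: "\<mu> x \<in> carrier_mat ?n ?n" if "x \<in> carrier (L \<times>\<times> (H \<times>\<times> G))" for x
    using repsD(1)[OF \<mu>V that] by simp
  define E where "E = K.projector (?n, ?\<kappa>)"
  have E: "E \<in> carrier_mat ?n ?n" using K.projector_carrier[of "(?n, ?\<kappa>)"] by (simp add: E_def)
  have EE: "E * E = E" unfolding E_def by (rule K.projector_idem[OF act(1)])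
  have kerE: "mat_kernel E = LinearCombinations.module.span Cfield (module_vec TYPE(complex) ?n)
      {?\<kappa> k *\<^sub>v v - v | k v. k \<in> carrier K \<and> v \<in> carrier_vec ?n}"
    using K.projector_kernel[OF act(1)] by (simp add: E_def)
  have \<mu>E: "\<mu> x * E = E * \<mu> x" if "x \<in> carrier (L \<times>\<times> (H \<times>\<times> G))" for x
    unfolding E_def by (rule K.projector_commute[OF act(1)]) (use that \<mu>[OF that] act(3,4) in \<open>auto simp: \<mu>_def\<close>)
  have EEv: "E *\<^sub>v (E *\<^sub>v v) = E *\<^sub>v v" if "v \<in> carrier_vec ?n" for v
    using assoc_mult_mat_vec[OF E E that] EE by simp
  show "\<exists>U. is_coinvariants L K H G T U"
  proof -
    obtain r S P where S: "S \<in> carrier_mat ?n r" and P: "P \<in> carrier_mat r ?n"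
      and ESP: "E = S * P" and PS: "P * S = 1\<^sub>m r"
      by (rule idempotent_splitting[OF E EE])
    note d = carrier_matD[OF S] carrier_matD[OF P]
    have PE: "P * E = P" unfolding ESP using PS P by (simp add: d flip: mat_assoc)
    have ker: "P * (\<mu> x * (S * P)) = P * \<mu> x" if x: "x \<in> carrier (L \<times>\<times> (H \<times>\<times> G))" for x
    proof -
      have "P * (\<mu> x * (S * P)) = P * (E * \<mu> x)" by (simp only: ESP[symmetric] \<mu>E[OF x])
      also have "\<dots> = P * E * \<mu> x" using carrier_matD[OF \<mu>[OF x]] carrier_matD[OF E] by (simp add: mat_assoc d)
      finally show ?thesis by (simp only: PE)
    qed
    let ?U = "(r, \<lambda>x. P * (\<mu> x * S))"
    have mon: "monoid (L \<times>\<times> (H \<times>\<times> G))"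
      by (intro DirProd_monoid L.monoid_axioms H.monoid_axioms G.monoid_axioms)
    have P1: "P \<in> carrier_mat r (rdim (?n, \<mu>))" and S1: "S \<in> carrier_mat (rdim (?n, \<mu>)) r" using P S by auto
    note U = quotient_rep[OF mon \<mu>V P1 S1 PS, simplified, OF ker]
    have PSv: "P *\<^sub>v (S *\<^sub>v v) = v" if "v \<in> carrier_vec r" for v
      using assoc_mult_mat_vec[OF P S that] PS that by simp
    have surj: "(\<lambda>v. P *\<^sub>v v) ` carrier_vec ?n = carrier_vec r"
    proof (intro subset_antisym subsetI)
      fix v :: "complex vec" assume "v \<in> carrier_vec r"
      then show "v \<in> (\<lambda>v. P *\<^sub>v v) ` carrier_vec ?n" using S PSv[symmetric] by (intro image_eqI[of _ _ "S *\<^sub>v v"]) auto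
    qed (use P in auto)
    have Ev: "E *\<^sub>v v = S *\<^sub>v (P *\<^sub>v v)" if "v \<in> carrier_vec ?n" for v
      unfolding ESP by (rule assoc_mult_mat_vec[OF S P that])
    have "mat_kernel P = mat_kernel E"
    proof (intro subset_antisym subsetI)
      fix v assume "v \<in> mat_kernel P"
      then have v: "v \<in> carrier_vec ?n" "P *\<^sub>v v = 0\<^sub>v r" using mat_kernelD[OF P] by auto
      then show "v \<in> mat_kernel E" using S by (intro mat_kernelI[OF E]) (auto simp: Ev intro!: eq_vecI)
    next
      fix v assume "v \<in> mat_kernel E"
      then have v: "v \<in> carrier_vec ?n" "E *\<^sub>v v = 0\<^sub>v ?n" using mat_kernelD[OF E] by auto
      have "P *\<^sub>v v = P *\<^sub>v (E *\<^sub>v v)" using PSv[of "P *\<^sub>v v"] P v by (simp add: Ev)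
      then show "v \<in> mat_kernel P" using v P by (intro mat_kernelI[OF P]) (auto intro!: eq_vecI)
    qed
    then have "is_coinvariants L K H G T ?U"
      unfolding is_coinvariants_def
    proof (intro conjI bexI[of _ P] ballI)
      fix l h g assume "l \<in> carrier L" "h \<in> carrier H" "g \<in> carrier G"
      then show "P * ract T (l, \<one>\<^bsub>K\<^esub>, h, g) = ract ?U (l, h, g) * P"
        using rep_homsD(2)[OF U(2), of "(l, h, g)"] by (simp add: \<mu>_def)
    qed (use U(1) P surj kerE in simp_all)
    then show ?thesis by blast
  qed
  show "character (L \<times>\<times> (H \<times>\<times> G)) U (l, h, g)
      = inverse (of_nat (card (carrier K))) * (\<Sum>k\<in>carrier K. mtrace (ract T (l, k, h, g)))"
    if co: "is_coinvariants L K H G T U" and l: "l \<in> carrier L" and h: "h \<in> carrier H" and g: "g \<in> carrier G"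
  proof -
    let ?r = "rdim U" and ?x = "(l, h, g)"
    have U: "U \<in> reps (L \<times>\<times> (H \<times>\<times> G))" using co by (simp add: is_coinvariants_def)
    obtain P where P: "P \<in> carrier_mat ?r ?n" and surj: "(\<lambda>v. P *\<^sub>v v) ` carrier_vec ?n = carrier_vec ?r"
      and kerP: "mat_kernel P = mat_kernel E" and hom: "P * \<mu> ?x = ract U ?x * P"
      using co l h g unfolding is_coinvariants_def kerE \<mu>_def prod.case by blast
    have x: "?x \<in> carrier (L \<times>\<times> (H \<times>\<times> G))" using l h g by simp
    obtain S where S: "S \<in> carrier_mat ?n ?r" "P * S = 1\<^sub>m ?r" using surjective_right_inverse[OF P surj] by blast
    note rU = repsD(1)[OF U x]
    note d = carrier_matD[OF P] carrier_matD[OF S(1)] carrier_matD[OF E] carrier_matD[OF \<mu>[OF x]] carrier_matD[OF rU]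
    \<comment> \<open>Both matrices identify the same vectors because their kernels agree.\<close>
    have eq_iff: "P *\<^sub>v v = P *\<^sub>v w \<longleftrightarrow> E *\<^sub>v v = E *\<^sub>v w" if v: "v \<in> carrier_vec ?n" and w: "w \<in> carrier_vec ?n" for v w
    proof -
      have vw: "v - w \<in> carrier_vec ?n" using v w by simp
      have zero: "a - b = 0\<^sub>v m \<longleftrightarrow> a = b" if a: "a \<in> carrier_vec m" and b: "b \<in> carrier_vec m" for a b :: "complex vec" and m
      proof
        assume eq: "a - b = 0\<^sub>v m"
        have "a $ i = b $ i" if "i < m" for i using arg_cong[OF eq, of "\<lambda>u. u $ i"] a b that by simp
        then show "a = b" using a b by (intro eq_vecI) auto
      qed (use b in simp)
      have "P *\<^sub>v v = P *\<^sub>v w \<longleftrightarrow> v - w \<in> mat_kernel P"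
        using mult_minus_distrib_mat_vec[OF P v w] zero[of "P *\<^sub>v v" ?r "P *\<^sub>v w"] mult_mat_vec_carrier[OF P v] mult_mat_vec_carrier[OF P w]
          mat_kernelD(2)[OF P] mat_kernelI[OF P vw] by auto
      moreover have "E *\<^sub>v v = E *\<^sub>v w \<longleftrightarrow> v - w \<in> mat_kernel E"
        using mult_minus_distrib_mat_vec[OF E v w] zero[of "E *\<^sub>v v" ?n "E *\<^sub>v w"] mult_mat_vec_carrier[OF E v] mult_mat_vec_carrier[OF E w]
          mat_kernelD(2)[OF E] mat_kernelI[OF E vw] by auto
      ultimately show ?thesis by (simp only: kerP)
    qed
    have PE: "P * E = P"
      by (rule mat_eqI_vec) (use P E eq_iff EEv in \<open>auto simp: assoc_mult_mat_vec[OF P E]\<close>)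
    have ESP: "E * (S * P) = E"
    proof (rule mat_eqI_vec)
      fix v :: "complex vec" assume v: "v \<in> carrier_vec ?n"
      have Pv: "P *\<^sub>v v \<in> carrier_vec ?r" using P v by simp
      have "P *\<^sub>v (S *\<^sub>v (P *\<^sub>v v)) = P *\<^sub>v v" using assoc_mult_mat_vec[OF P S(1) Pv] S(2) Pv by simp
      then have "E *\<^sub>v (S *\<^sub>v (P *\<^sub>v v)) = E *\<^sub>v v" using S(1) Pv v by (subst eq_iff[symmetric]) auto
      then show "E * (S * P) *\<^sub>v v = E *\<^sub>v v"
        using assoc_mult_mat_vec[OF E mult_carrier_mat[OF S(1) P] v] assoc_mult_mat_vec[OF S(1) P v] by simp
    qed (use E S P in auto)
    have "ract U ?x = ract U ?x * (P * (E * S))" using S rU PE by (simp add: d flip: mat_assoc)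
    also have "\<dots> = P * (\<mu> ?x * (E * S))" using hom by (simp add: d flip: mat_assoc)
    finally have "mtrace (ract U ?x) = mtrace (P * (\<mu> ?x * (E * S)))" by simp
    also have "\<dots> = mtrace (\<mu> ?x * (E * S) * P)"
      by (rule mtrace_commute[OF P]) (use \<mu>[OF x] E S in auto)
    also have "\<mu> ?x * (E * S) * P = \<mu> ?x * E" using ESP by (simp add: mat_assoc d)
    also have "mtrace (\<mu> ?x * E) = inverse (of_nat (card (carrier K))) * (\<Sum>k\<in>carrier K. mtrace (\<mu> ?x * ?\<kappa> k))"
      unfolding E_def using K.mtrace_mult_projector[OF act(1), of "\<mu> ?x"] \<mu>[OF x] by simp
    also have "(\<Sum>k\<in>carrier K. mtrace (\<mu> ?x * ?\<kappa> k)) = (\<Sum>k\<in>carrier K. mtrace (ract T (l, k, h, g)))"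
      by (rule sum.cong) (use act(3) l h g in \<open>auto simp: \<mu>_def\<close>)
    finally show ?thesis using x by (simp add: character_def)
  qed
qed

lemma middle_tensor_reps:
  assumes gr: "group L" "group K" "group H" "group G"
    and V: "V \<in> reps (L \<times>\<times> (K \<times>\<times> G))" and W: "W \<in> reps (K \<times>\<times> (H \<times>\<times> G))"
  shows "middle_tensor L K H G V W \<in> reps (L \<times>\<times> (K \<times>\<times> (H \<times>\<times> G)))"
  unfolding middle_tensor_def
proof (rule repsI)
  note \<rho> = repsD[OF V] and \<sigma> = repsD[OF W]
  show "(case x of (l, k, h, g) \<Rightarrow> kron (ract V (l, k, g)) (ract W (k, h, g)))
      \<in> carrier_mat (rdim V * rdim W) (rdim V * rdim W)" if "x \<in> carrier (L \<times>\<times> (K \<times>\<times> (H \<times>\<times> G)))" for x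
    using that by (auto intro!: kron_carrier \<rho>(1) \<sigma>(1))
  show "(case \<one>\<^bsub>L \<times>\<times> (K \<times>\<times> (H \<times>\<times> G))\<^esub> of (l, k, h, g) \<Rightarrow> kron (ract V (l, k, g)) (ract W (k, h, g)))
      = 1\<^sub>m (rdim V * rdim W)"
    using \<rho>(2) \<sigma>(2) by (simp add: kron_one)
  fix x y assume x: "x \<in> carrier (L \<times>\<times> (K \<times>\<times> (H \<times>\<times> G)))" and y: "y \<in> carrier (L \<times>\<times> (K \<times>\<times> (H \<times>\<times> G)))"
  obtain l k h g l' k' h' g' where xy: "x = (l, k, h, g)" "y = (l', k', h', g')" by (metis prod.exhaust)
  have c: "(l, k, g) \<in> carrier (L \<times>\<times> (K \<times>\<times> G))" "(l', k', g') \<in> carrier (L \<times>\<times> (K \<times>\<times> G))"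
    "(k, h, g) \<in> carrier (K \<times>\<times> (H \<times>\<times> G))" "(k', h', g') \<in> carrier (K \<times>\<times> (H \<times>\<times> G))"
    using x y by (auto simp: xy)
  show "(case x \<otimes>\<^bsub>L \<times>\<times> (K \<times>\<times> (H \<times>\<times> G))\<^esub> y of (l, k, h, g) \<Rightarrow> kron (ract V (l, k, g)) (ract W (k, h, g)))
      = (case x of (l, k, h, g) \<Rightarrow> kron (ract V (l, k, g)) (ract W (k, h, g)))
      * (case y of (l, k, h, g) \<Rightarrow> kron (ract V (l, k, g)) (ract W (k, h, g)))"
    using \<rho>(3)[OF c(1,2)] \<sigma>(3)[OF c(3,4)] kron_mult[OF \<rho>(1)[OF c(1)] \<rho>(1)[OF c(2)] \<sigma>(1)[OF c(3)] \<sigma>(1)[OF c(4)]]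
    by (simp add: xy)
qed

lemma comp_rep_reps_character:
  assumes gr: "group L" "group K" "group H" "group G" and fin: "finite (carrier K)"
    and V: "V \<in> reps (L \<times>\<times> (K \<times>\<times> G))" and W: "W \<in> reps (K \<times>\<times> (H \<times>\<times> G))"
  shows "comp_rep L K H G V W \<in> reps (L \<times>\<times> (H \<times>\<times> G))"
    and "\<lbrakk>l \<in> carrier L; h \<in> carrier H; g \<in> carrier G\<rbrakk> \<Longrightarrow>
      character (L \<times>\<times> (H \<times>\<times> G)) (comp_rep L K H G V W) (l, h, g)
      = inverse (of_nat (card (carrier K))) * (\<Sum>k\<in>carrier K.
        character (L \<times>\<times> (K \<times>\<times> G)) V (l, k, g) * character (K \<times>\<times> (H \<times>\<times> G)) W (k, h, g))"
proof -
  note T = middle_tensor_reps[OF gr V W]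
  have co: "is_coinvariants L K H G (middle_tensor L K H G V W) (comp_rep L K H G V W)"
    unfolding comp_rep_def by (rule someI_ex[OF ex_coinvariants[OF gr fin T]])
  then show "comp_rep L K H G V W \<in> reps (L \<times>\<times> (H \<times>\<times> G))" by (simp add: is_coinvariants_def)
  assume lhg: "l \<in> carrier L" "h \<in> carrier H" "g \<in> carrier G"
  have "mtrace (ract (middle_tensor L K H G V W) (l, k, h, g))
    = character (L \<times>\<times> (K \<times>\<times> G)) V (l, k, g) * character (K \<times>\<times> (H \<times>\<times> G)) W (k, h, g)" if "k \<in> carrier K" for k
    using lhg that mtrace_kron[OF repsD(1)[OF V, of "(l, k, g)"] repsD(1)[OF W, of "(k, h, g)"]]
    by (simp add: middle_tensor_def character_def)
  then show "character (L \<times>\<times> (H \<times>\<times> G)) (comp_rep L K H G V W) (l, h, g)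
      = inverse (of_nat (card (carrier K))) * (\<Sum>k\<in>carrier K.
        character (L \<times>\<times> (K \<times>\<times> G)) V (l, k, g) * character (K \<times>\<times> (H \<times>\<times> G)) W (k, h, g))"
    using character_coinvariants[OF gr fin T co lhg] by (simp cong: sum.cong)
qed

lemma tensor_rep_reps:
  assumes V: "V \<in> reps H" and W: "W \<in> reps H"
  shows "tensor_rep V W \<in> reps H" and "character H (tensor_rep V W) h = character H V h * character H W h"
proof -
  note \<rho> = repsD[OF V] and \<sigma> = repsD[OF W]
  show "tensor_rep V W \<in> reps H"
    unfolding tensor_rep_def
    by (rule repsI) (auto simp: kron_carrier \<rho> \<sigma> kron_one kron_mult[OF \<rho>(1) \<rho>(1) \<sigma>(1) \<sigma>(1)])
  show "character H (tensor_rep V W) h = character H V h * character H W h"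
    using mtrace_kron[OF \<rho>(1) \<sigma>(1)] by (simp add: tensor_rep_def character_def)
qed

lemma trivial_rep_reps: "trivial_rep \<in> reps H" "h \<in> carrier H \<Longrightarrow> character H trivial_rep h = 1"
  by (auto simp: trivial_rep_def character_def intro!: repsI)

section \<open>Extension of scalars for quotients of free abelian groups\<close>

definition frag_eval :: "('k \<Rightarrow> complex) \<Rightarrow> ('k \<Rightarrow>\<^sub>0 int) \<Rightarrow> complex"
  where "frag_eval f x = (\<Sum>k\<in>Poly_Mapping.keys x. of_int (Poly_Mapping.lookup x k) * f k)"

lemma frag_eval_superset:
  assumes "finite K" "Poly_Mapping.keys x \<subseteq> K"
  shows "frag_eval f x = (\<Sum>k\<in>K. of_int (Poly_Mapping.lookup x k) * f k)"
  unfolding frag_eval_def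
  by (rule sum.mono_neutral_left[OF assms]) (simp add: in_keys_iff)

lemma frag_eval_diff: "frag_eval f (x - y) = frag_eval f x - frag_eval f y"
proof -
  let ?K = "Poly_Mapping.keys x \<union> Poly_Mapping.keys y"
  have "Poly_Mapping.keys (x - y) \<subseteq> ?K" by (rule keys_diff)
  then show ?thesis
    by (simp add: frag_eval_superset[of ?K] lookup_minus left_diff_distrib sum_subtractf)
qed

lemma frag_eval_0 [simp]: "frag_eval f 0 = 0"
  by (simp add: frag_eval_def)

lemma frag_eval_of [simp]: "frag_eval f (frag_of k) = f k"
  by (simp add: frag_eval_def)

lemma frag_eval_add: "frag_eval f (x + y) = frag_eval f x + frag_eval f y"
  using frag_eval_diff[of f "x + y" y] by simp

text \<open>An abelian group presented by generators \<open>S\<close> and relators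
  \<open>R\<close>. The Grothendieck group and its extension of scalars are both of this
  form.\<close>

locale frag_quotient =
  fixes S :: "'k set" and R :: "('k \<Rightarrow>\<^sub>0 int) set"
  assumes relations: "R \<subseteq> carrier (free_Abelian_group S)"
begin

abbreviation F where "F \<equiv> free_Abelian_group S"
abbreviation N where "N \<equiv> generate F R"
abbreviation coset where "coset x \<equiv> N #>\<^bsub>F\<^esub> x"

interpretation F: comm_group F by (rule abelian_free_Abelian_group)

lemma N_subgroup: "subgroup N F"
  by (rule F.generate_is_subgroup[OF relations])

lemma N_closed: "n \<in> N \<Longrightarrow> n \<in> carrier F"
  using subgroup.subset[OF N_subgroup] by blast

lemma N_zero: "0 \<in> N"
  using subgroup.one_closed[OF N_subgroup] by simp

lemma N_add: "\<lbrakk>m \<in> N; n \<in> N\<rbrakk> \<Longrightarrow> m + n \<in> N"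
  using subgroup.m_closed[OF N_subgroup] by simp

lemma N_minus: "n \<in> N \<Longrightarrow> - n \<in> N"
  using subgroup.m_inv_closed[OF N_subgroup] N_closed by fastforce

lemma N_generator: "r \<in> R \<Longrightarrow> r \<in> N"
  by (rule generate.incl)

lemma N_induct [consumes 1, case_names zero generator diff]:
  assumes n: "n \<in> N" and 0: "P 0" and gen: "\<And>r. r \<in> R \<Longrightarrow> P r"
    and diff: "\<And>m n. \<lbrakk>m \<in> N; n \<in> N; P m; P n\<rbrakk> \<Longrightarrow> P (m - n)"
  shows "P n"
  using n
proof (induction rule: generate.induct)
  case (inv h)
  have "P (0 - h)" by (rule diff[OF N_zero]) (use inv 0 gen N_generator in auto)
  then show ?case using relations inv by auto
next
  case (eng h1 h2)
  have "P (0 - h2)" by (rule diff[OF N_zero]) (use eng 0 in auto)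
  then have "P (h1 - (- h2))" by (intro diff[of h1 "- h2"]) (use eng N_minus in auto)
  then show ?case by simp
qed (use 0 gen in auto)

lemma coset_eq: "coset x = (\<lambda>n. n + x) ` N"
  by (auto simp: r_coset_def)

lemma coset_eq_iff: "coset x = coset y \<longleftrightarrow> x - y \<in> N"
proof
  assume "coset x = coset y"
  then have "x \<in> (\<lambda>n. n + y) ` N" using N_zero unfolding coset_eq by (metis add_0 imageI)
  then show "x - y \<in> N" by auto
next
  assume d: "x - y \<in> N"
  have "n + x \<in> (\<lambda>n. n + y) ` N" if "n \<in> N" for n
    using N_add[OF that d] by (intro image_eqI[of _ _ "n + (x - y)"]) auto
  moreover have "n + y \<in> (\<lambda>n. n + x) ` N" if "n \<in> N" for n
    using N_add[OF that N_minus[OF d]] by (intro image_eqI[of _ _ "n + - (x - y)"]) auto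
  ultimately show "coset x = coset y" unfolding coset_eq by blast
qed

lemma self_in_coset: "x \<in> coset x"
  unfolding coset_eq using N_zero by (metis add_0 imageI)

lemma coset_zero: "coset 0 = N"
  by (simp add: coset_eq)

lemma carrier_quotient: "carrier (F Mod N) = coset ` carrier F"
  by (simp add: carrier_FactGroup)

lemma add_quotient: "coset x \<otimes>\<^bsub>F Mod N\<^esub> coset y = coset (x + y)"
proof -
  have "\<exists>k\<in>N. (m + x) + (n + y) = k + (x + y)" if "m \<in> N" "n \<in> N" for m n
    using N_add[OF that] by (intro bexI[of _ "m + n"]) (auto simp: algebra_simps)
  moreover have "\<exists>m\<in>N. \<exists>k\<in>N. n + (x + y) = (m + x) + (k + y)" if "n \<in> N" for n
    using that N_zero by (intro bexI[of _ n] bexI[of _ 0]) (auto simp: algebra_simps)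
  ultimately show ?thesis
    unfolding mult_FactGroup set_mult_def coset_eq by fastforce
qed

lemma comm_group_quotient: "comm_group (F Mod N)"
  by (rule F.abelian_FactGroup[OF N_subgroup])

text \<open>A function on the generators extends to the quotient if it vanishes on the
  relators.\<close>

definition coset_eval :: "('k \<Rightarrow> complex) \<Rightarrow> ('k \<Rightarrow>\<^sub>0 int) set \<Rightarrow> complex"
  where "coset_eval f U = frag_eval f (SOME x. x \<in> U)"

lemma coset_eval:
  assumes "\<And>r. r \<in> R \<Longrightarrow> frag_eval f r = 0"
  shows "coset_eval f (coset x) = frag_eval f x"
proof -
  have "frag_eval f n = 0" if "n \<in> N" for n
    using that by (induction rule: N_induct) (auto simp: assms frag_eval_diff)
  then have "frag_eval f y = frag_eval f x" if "y \<in> coset x" for y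
    using that by (auto simp: coset_eq frag_eval_add)
  then show ?thesis unfolding coset_eval_def using self_in_coset by (metis someI)
qed

end

locale tensor_quotient = A: comm_group A for A :: "'a monoid" (structure)
begin

definition relators :: "(complex \<times> 'a \<Rightarrow>\<^sub>0 int) set"
  where "relators = {frag_of (c + d, a) - frag_of (c, a) - frag_of (d, a) | c d a. a \<in> carrier A}
       \<union> {frag_of (c, a \<otimes> b) - frag_of (c, a) - frag_of (c, b) | c a b. a \<in> carrier A \<and> b \<in> carrier A}"

sublocale Q: frag_quotient "UNIV \<times> carrier A" relators
proof
  have k: "Poly_Mapping.keys (x - y - z) \<subseteq> UNIV \<times> carrier A"
    if "Poly_Mapping.keys x \<subseteq> UNIV \<times> carrier A" "Poly_Mapping.keys y \<subseteq> UNIV \<times> carrier A"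
      "Poly_Mapping.keys z \<subseteq> UNIV \<times> carrier A" for x y z :: "complex \<times> 'a \<Rightarrow>\<^sub>0 int"
    using that keys_diff[of "x - y" z] keys_diff[of x y] by blast
  show "relators \<subseteq> carrier (free_Abelian_group (UNIV \<times> carrier A))"
    unfolding relators_def
    by (intro subsetI; elim UnE CollectE exE conjE) (simp_all add: k)
qed

definition scale :: "complex \<Rightarrow> (complex \<times> 'a \<Rightarrow>\<^sub>0 int) \<Rightarrow> (complex \<times> 'a \<Rightarrow>\<^sub>0 int)"
  where "scale c = frag_extend (\<lambda>(d, a). frag_of (c * d, a))"

lemma scale_simps [simp]:
  "scale c 0 = 0" "scale c (frag_of (d, a)) = frag_of (c * d, a)"
  "scale c (x + y) = scale c x + scale c y" "scale c (x - y) = scale c x - scale c y"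
  by (simp_all add: scale_def frag_extend_add frag_extend_diff)

lemma scale_closed:
  assumes "x \<in> carrier Q.F" shows "scale c x \<in> carrier Q.F"
  using assms unfolding carrier_free_Abelian_group_iff
proof (induction x rule: frag_induction)
  case (one x)
  then show ?case by (cases x) auto
next
  case (diff a b)
  then show ?case using keys_diff[of "scale c a" "scale c b"] by auto
qed auto

lemma scale_N: "n \<in> Q.N \<Longrightarrow> scale c n \<in> Q.N"
proof (induction rule: Q.N_induct)
  case (generator r)
  then have "scale c r \<in> relators"
    unfolding relators_def by (auto simp: distrib_left)
  then show ?case by (rule Q.N_generator)
next
  case (diff m n)
  then show ?case using Q.N_add[of "scale c m" "- scale c n"] Q.N_minus by simp
qed (simp add: Q.N_zero)

text \<open>Scaling maps the relations into themselves, so a scaled coset, multiplied by the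
  relations, is the coset of the scaled representative.\<close>

lemma complex_tensor_simps:
  "carrier (complex_tensor A) = Q.coset ` carrier Q.F"
  "\<zero>\<^bsub>complex_tensor A\<^esub> = Q.coset 0"
  "Q.coset x \<oplus>\<^bsub>complex_tensor A\<^esub> Q.coset y = Q.coset (x + y)"
  "c \<odot>\<^bsub>complex_tensor A\<^esub> Q.coset x = Q.coset (scale c x)"
proof -
  have N: "tensor_relations A = Q.N" by (simp add: tensor_relations_def relators_def)
  show "carrier (complex_tensor A) = Q.coset ` carrier Q.F"
    by (simp add: complex_tensor_def Let_def N Q.carrier_quotient)
  show "\<zero>\<^bsub>complex_tensor A\<^esub> = Q.coset 0" by (simp add: complex_tensor_def Let_def N Q.coset_zero)
  show "Q.coset x \<oplus>\<^bsub>complex_tensor A\<^esub> Q.coset y = Q.coset (x + y)"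
    using Q.add_quotient[of x y] by (simp add: complex_tensor_def Let_def N)
  have "Q.N <#>\<^bsub>Q.F\<^esub> (scale c ` Q.coset x) = Q.coset (scale c x)"
  proof (intro subset_antisym subsetI)
    fix y assume "y \<in> Q.N <#>\<^bsub>Q.F\<^esub> (scale c ` Q.coset x)"
    then obtain m n where "m \<in> Q.N" "n \<in> Q.N" "y = m + scale c (n + x)"
      by (auto simp: set_mult_def Q.coset_eq)
    then show "y \<in> Q.coset (scale c x)"
      using Q.N_add[OF _ scale_N, of m n c] by (auto simp: Q.coset_eq intro!: image_eqI[of _ _ "m + scale c n"])
  next
    fix y assume "y \<in> Q.coset (scale c x)"
    then obtain n where "n \<in> Q.N" "y = n + scale c x" by (auto simp: Q.coset_eq)
    then show "y \<in> Q.N <#>\<^bsub>Q.F\<^esub> (scale c ` Q.coset x)"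
      using Q.self_in_coset[of x] unfolding set_mult_def by auto
  qed
  then show "c \<odot>\<^bsub>complex_tensor A\<^esub> Q.coset x = Q.coset (scale c x)"
    by (simp add: complex_tensor_def Let_def N scale_def[symmetric])
qed

lemma pure_tensor_eq: "pure_tensor A c a = Q.coset (frag_of (c, a))"
  by (simp add: pure_tensor_def tensor_relations_def relators_def)

lemma complex_tensor_vectorspace: "vectorspace Cfield (complex_tensor A)"
proof (rule vectorspaceI, unfold complex_tensor_simps(1,2))
  have scale_add: "scale (c + d) x - (scale c x + scale d x) \<in> Q.N" if "x \<in> carrier Q.F" for c d x
    using that unfolding carrier_free_Abelian_group_iff
  proof (induction x rule: frag_induction)
    case (one x)
    then obtain e a where x: "x = (e, a)" "a \<in> carrier A" by auto
    have "frag_of (c * e + d * e, a) - frag_of (c * e, a) - frag_of (d * e, a) \<in> relators"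
      using x unfolding relators_def by blast
    then show ?case using Q.N_generator by (simp add: x distrib_right diff_diff_eq)
  next
    case (diff a b)
    then show ?case using Q.N_add[OF diff(1) Q.N_minus[OF diff(2)]] by (simp add: algebra_simps)
  qed (simp add: Q.N_zero)
  have scale_mult: "scale (c * d) x = scale c (scale d x)" if "x \<in> carrier Q.F" for c d x
    using that unfolding carrier_free_Abelian_group_iff
    by (induction x rule: frag_induction) (auto simp: mult.assoc)
  have scale_1: "scale 1 x = x" if "x \<in> carrier Q.F" for x
    using that unfolding carrier_free_Abelian_group_iff
    by (induction x rule: frag_induction) auto
  have scale_0: "scale 0 x \<in> Q.N" if "x \<in> carrier Q.F" for x
    using scale_add[OF that, of 0 0] Q.N_minus by fastforce
  have add_closed: "x + y \<in> carrier Q.F" if "x \<in> carrier Q.F" "y \<in> carrier Q.F" for x y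
    using that keys_add[of x y] by auto
  fix U c d assume U: "U \<in> Q.coset ` carrier Q.F"
  then obtain x where x: "U = Q.coset x" "x \<in> carrier Q.F" by blast
  show "Q.coset 0 \<oplus>\<^bsub>complex_tensor A\<^esub> U = U" by (simp add: x complex_tensor_simps)
  show "c \<odot>\<^bsub>complex_tensor A\<^esub> U \<in> Q.coset ` carrier Q.F"
    using scale_closed x by (simp add: complex_tensor_simps)
  show "(c + d) \<odot>\<^bsub>complex_tensor A\<^esub> U = c \<odot>\<^bsub>complex_tensor A\<^esub> U \<oplus>\<^bsub>complex_tensor A\<^esub> d \<odot>\<^bsub>complex_tensor A\<^esub> U"
    unfolding x(1) complex_tensor_simps Q.coset_eq_iff by (rule scale_add[OF x(2)])
  show "(c * d) \<odot>\<^bsub>complex_tensor A\<^esub> U = c \<odot>\<^bsub>complex_tensor A\<^esub> (d \<odot>\<^bsub>complex_tensor A\<^esub> U)"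
    using x by (simp add: complex_tensor_simps scale_mult)
  show "1 \<odot>\<^bsub>complex_tensor A\<^esub> U = U" using x by (simp add: complex_tensor_simps scale_1)
  show "0 \<odot>\<^bsub>complex_tensor A\<^esub> U = Q.coset 0"
    unfolding x(1) complex_tensor_simps Q.coset_eq_iff using scale_0[OF x(2)] by simp
  fix Y assume "Y \<in> Q.coset ` carrier Q.F"
  then obtain y where y: "Y = Q.coset y" "y \<in> carrier Q.F" by blast
  show "U \<oplus>\<^bsub>complex_tensor A\<^esub> Y \<in> Q.coset ` carrier Q.F"
    using add_closed[OF x(2) y(2)] by (simp add: x(1) y(1) complex_tensor_simps)
  show "U \<oplus>\<^bsub>complex_tensor A\<^esub> Y = Y \<oplus>\<^bsub>complex_tensor A\<^esub> U"
    by (simp add: x(1) y(1) complex_tensor_simps add.commute)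
  show "c \<odot>\<^bsub>complex_tensor A\<^esub> (U \<oplus>\<^bsub>complex_tensor A\<^esub> Y)
    = c \<odot>\<^bsub>complex_tensor A\<^esub> U \<oplus>\<^bsub>complex_tensor A\<^esub> c \<odot>\<^bsub>complex_tensor A\<^esub> Y"
    by (simp add: x(1) y(1) complex_tensor_simps)
  fix Z assume "Z \<in> Q.coset ` carrier Q.F"
  then obtain z where z: "Z = Q.coset z" by blast
  show "(U \<oplus>\<^bsub>complex_tensor A\<^esub> Y) \<oplus>\<^bsub>complex_tensor A\<^esub> Z = U \<oplus>\<^bsub>complex_tensor A\<^esub> (Y \<oplus>\<^bsub>complex_tensor A\<^esub> Z)"
    by (simp add: x(1) y(1) z complex_tensor_simps add.assoc)
qed (use Q.N_zero in \<open>auto intro!: image_eqI[of _ _ 0]\<close>)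

lemma pure_tensor_closed: "a \<in> carrier A \<Longrightarrow> pure_tensor A c a \<in> carrier (complex_tensor A)"
  unfolding pure_tensor_eq complex_tensor_simps by (intro imageI) simp

lemma pure_tensor_scale: "a \<in> carrier A \<Longrightarrow> c \<odot>\<^bsub>complex_tensor A\<^esub> pure_tensor A d a = pure_tensor A (c * d) a"
  by (simp add: pure_tensor_eq complex_tensor_simps)

lemma pure_tensor_mult:
  "\<lbrakk>a \<in> carrier A; b \<in> carrier A\<rbrakk>
    \<Longrightarrow> pure_tensor A c (a \<otimes> b) = pure_tensor A c a \<oplus>\<^bsub>complex_tensor A\<^esub> pure_tensor A c b"
  unfolding pure_tensor_eq complex_tensor_simps Q.coset_eq_iff
  by (rule Q.N_generator) (auto simp: relators_def diff_diff_eq)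

text \<open>Subtraction is expressed by addition and the scalar \<open>- 1\<close>.\<close>

lemma complex_tensor_induct [consumes 1, case_names zero pure add scale]:
  assumes U: "U \<in> carrier (complex_tensor A)" and zero: "P \<zero>\<^bsub>complex_tensor A\<^esub>"
    and pure: "\<And>c a. a \<in> carrier A \<Longrightarrow> P (pure_tensor A c a)"
    and add: "\<And>U Y. \<lbrakk>U \<in> carrier (complex_tensor A); Y \<in> carrier (complex_tensor A); P U; P Y\<rbrakk>
      \<Longrightarrow> P (U \<oplus>\<^bsub>complex_tensor A\<^esub> Y)"
    and scale: "\<And>U. \<lbrakk>U \<in> carrier (complex_tensor A); P U\<rbrakk> \<Longrightarrow> P ((- 1) \<odot>\<^bsub>complex_tensor A\<^esub> U)"
  shows "P U"
proof -
  note V = vectorspaceD[OF complex_tensor_vectorspace]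
  obtain x where x: "Poly_Mapping.keys x \<subseteq> UNIV \<times> carrier A" "U = Q.coset x"
    using U by (auto simp: complex_tensor_simps)
  have c: "Q.coset x \<in> carrier (complex_tensor A)" if "Poly_Mapping.keys x \<subseteq> UNIV \<times> carrier A" for x
    using that unfolding complex_tensor_simps by auto
  from x(1) have "P (Q.coset x)"
  proof (rule free_Abelian_group_induct)
    show "P (Q.coset 0)" using zero by (simp add: complex_tensor_simps)
    fix a :: "complex \<times> 'a" assume "a \<in> UNIV \<times> carrier A"
    then show "P (Q.coset (frag_of a))" using pure[of "snd a" "fst a"] by (auto simp: pure_tensor_eq)
  next
    fix x y :: "complex \<times> 'a \<Rightarrow>\<^sub>0 int"
    assume xy: "Poly_Mapping.keys x \<subseteq> UNIV \<times> carrier A" "Poly_Mapping.keys y \<subseteq> UNIV \<times> carrier A"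
      and P: "P (Q.coset x)" "P (Q.coset y)"
    let ?m = "(- 1) \<odot>\<^bsub>complex_tensor A\<^esub> Q.coset y"
    have sub: "Q.coset (x - y) \<in> carrier (complex_tensor A)" using keys_diff[of x y] xy by (intro c) auto
    have m: "?m \<in> carrier (complex_tensor A)" by (rule V(6)[OF c[OF xy(2)]])
    have "Q.coset y \<oplus>\<^bsub>complex_tensor A\<^esub> ?m = \<zero>\<^bsub>complex_tensor A\<^esub>"
      using V(7)[OF c[OF xy(2)], of 1 "- 1"] V(10,11)[OF c[OF xy(2)]] by simp
    moreover have "Q.coset x = Q.coset (x - y) \<oplus>\<^bsub>complex_tensor A\<^esub> Q.coset y"
      by (simp add: complex_tensor_simps)
    ultimately have "Q.coset x \<oplus>\<^bsub>complex_tensor A\<^esub> ?m = Q.coset (x - y)"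
      using V(3)[OF sub c[OF xy(2)] m] V(4)[OF sub V(2)] V(5)[OF sub] by simp
    then show "P (Q.coset (x - y))"
      using add[OF c[OF xy(1)] m P(1) scale[OF c[OF xy(2)] P(2)]] by simp
  qed
  then show ?thesis using x by simp
qed

end

section \<open>The representation ring as the space of class functions\<close>

definition ses_relators :: "('a, 'b) monoid_scheme \<Rightarrow> ('a rep \<Rightarrow>\<^sub>0 int) set"
  where "ses_relators H = {frag_of V - frag_of U - frag_of W | U V W.
        U \<in> reps H \<and> V \<in> reps H \<and> W \<in> reps H \<and> short_exact H U V W}"

lemma frag_quotient_ses: "frag_quotient (reps H) (ses_relators H)"
proof
  have k: "Poly_Mapping.keys (frag_of V - frag_of U - frag_of W) \<subseteq> reps H"
    if "V \<in> reps H" "U \<in> reps H" "W \<in> reps H" for U V W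
    using that keys_diff[of "frag_of V - frag_of U" "frag_of W"] keys_diff[of "frag_of V" "frag_of U"] by auto
  show "ses_relators H \<subseteq> carrier (free_Abelian_group (reps H))"
    unfolding ses_relators_def by (intro subsetI; elim CollectE exE conjE) (simp add: k)
qed

context finite_group begin

sublocale K0: frag_quotient "reps H" "ses_relators H"
  by (rule frag_quotient_ses)

lemma K0_relations_eq: "K0_relations H = K0.N"
  by (simp add: K0_relations_def ses_relators_def)

lemma R_C_eq: "R_C H = K0.F Mod K0.N"
  by (simp add: R_C_def K0_relations_eq)

lemma rep_class_eq: "rep_class H V = K0.coset (frag_of V)"
  by (simp add: rep_class_def K0_relations_eq)

sublocale CR: tensor_quotient "R_C H"
  unfolding tensor_quotient_def R_C_eq by (rule K0.comm_group_quotient)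

lemma CR_space_vectorspace: "vectorspace Cfield (CR_space H)"
  unfolding CR_space_def by (rule CR.complex_tensor_vectorspace)

lemma CR_space_module: "Module.module Cfield (CR_space H)"
  using CR_space_vectorspace by (simp add: vectorspace_iff_module)

sublocale CRm: Module.module Cfield "CR_space H"
  by (rule CR_space_module)

lemmas CRv = vectorspaceD[OF CR_space_vectorspace]

lemma rep_class_closed: "V \<in> reps H \<Longrightarrow> rep_class H V \<in> carrier (R_C H)"
  unfolding rep_class_eq R_C_eq K0.carrier_quotient by (intro imageI) simp

lemma CR_class_closed: "V \<in> reps H \<Longrightarrow> CR_class H V \<in> carrier (CR_space H)"
  unfolding CR_class_def CR_space_def by (rule CR.pure_tensor_closed[OF rep_class_closed])

lemma rep_class_short_exact:
  assumes "U \<in> reps H" "V \<in> reps H" "W \<in> reps H" "short_exact H U V W"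
  shows "rep_class H V = rep_class H U \<otimes>\<^bsub>R_C H\<^esub> rep_class H W"
proof -
  have "frag_of V - frag_of U - frag_of W \<in> ses_relators H"
    using assms unfolding ses_relators_def by blast
  then have "frag_of V - (frag_of U + frag_of W) \<in> K0.N"
    using K0.N_generator by (simp add: diff_diff_eq)
  then show ?thesis unfolding rep_class_eq R_C_eq K0.add_quotient K0.coset_eq_iff .
qed

lemma CR_class_short_exact:
  assumes "U \<in> reps H" "V \<in> reps H" "W \<in> reps H" "short_exact H U V W"
  shows "CR_class H V = CR_class H U \<oplus>\<^bsub>CR_space H\<^esub> CR_class H W"
  unfolding CR_class_def CR_space_def rep_class_short_exact[OF assms]
  by (rule CR.pure_tensor_mult[OF rep_class_closed[OF assms(1)] rep_class_closed[OF assms(3)]])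

text \<open>If \<open>V = 0\<close>, then \<open>0 \<rightarrow> V \<rightarrow> V \<rightarrow> V
  \<rightarrow> 0\<close> is exact.\<close>

lemma CR_class_dim_0:
  assumes V: "V \<in> reps H" and 0: "rdim V = 0"
  shows "CR_class H V = \<zero>\<^bsub>CR_space H\<^esub>"
proof -
  have "short_exact H V V V"
    by (rule short_exactI[of "0\<^sub>m 0 0" _ _ _ "0\<^sub>m 0 0" _ "0\<^sub>m 0 0" "0\<^sub>m 0 0"])
      (use 0 in \<open>auto intro!: rep_homsI eq_matI dest: repsD(1)[OF V]\<close>)
  then have "CR_class H V = CR_class H V \<oplus>\<^bsub>CR_space H\<^esub> CR_class H V"
    using CR_class_short_exact V by blast
  then show ?thesis using CR_class_closed[OF V] by (simp add: CRm.M.add.r_cancel_one')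
qed

lemma CR_class_eq_if_same_character:
  assumes V: "brick V" and W: "brick W" and eq: "character H V = character H W"
  shows "CR_class H V = CR_class H W"
proof -
  note s = short_exact_if_same_character[OF assms]
  have "CR_class H W = CR_class H V \<oplus>\<^bsub>CR_space H\<^esub> \<zero>\<^bsub>CR_space H\<^esub>"
    using CR_class_short_exact[OF brickD(1)[OF V] brickD(1)[OF W] s(2,1)] CR_class_dim_0[OF s(2)] by simp
  then show ?thesis using CRm.M.r_zero[OF CR_class_closed[OF brickD(1)[OF V]]] by simp
qed

definition K0_character :: "('a rep \<Rightarrow>\<^sub>0 int) set \<Rightarrow> 'a \<Rightarrow> complex"
  where "K0_character a h = K0.coset_eval (\<lambda>V. character H V h) a"

text \<open>The linear extension of the character, first to the Grothendieck group and then to its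
  extension of scalars.\<close>

definition CR_character :: "'a cr \<Rightarrow> 'a \<Rightarrow> complex"
  where "CR_character x h = CR.Q.coset_eval (\<lambda>(c, a). c * K0_character a h) x"

lemma K0_character_coset: "K0_character (K0.coset x) h = frag_eval (\<lambda>V. character H V h) x"
  unfolding K0_character_def
  by (rule K0.coset_eval) (auto simp: ses_relators_def frag_eval_diff character_short_exact)

lemma K0_character_mult:
  assumes "x \<in> carrier (R_C H)" "y \<in> carrier (R_C H)"
  shows "K0_character (x \<otimes>\<^bsub>R_C H\<^esub> y) h = K0_character x h + K0_character y h"
proof -
  obtain x' y' where "x = K0.coset x'" "y = K0.coset y'"
    using assms unfolding R_C_eq K0.carrier_quotient by blast
  then show ?thesis unfolding R_C_eq by (simp only: K0.add_quotient K0_character_coset frag_eval_add)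
qed

lemma CR_character_coset:
  "CR_character (CR.Q.coset x) h = frag_eval (\<lambda>(c, a). c * K0_character a h) x"
  unfolding CR_character_def
  by (rule CR.Q.coset_eval)
    (auto simp: CR.relators_def frag_eval_diff K0_character_mult distrib_left distrib_right)

lemma CR_character_linear:
  assumes "x \<in> carrier (CR_space H)" "y \<in> carrier (CR_space H)"
  shows "CR_character (x \<oplus>\<^bsub>CR_space H\<^esub> y) h = CR_character x h + CR_character y h"
    and "CR_character (c \<odot>\<^bsub>CR_space H\<^esub> x) h = c * CR_character x h"
proof -
  obtain x' y' where x: "x = CR.Q.coset x'" "x' \<in> carrier CR.Q.F" and y: "y = CR.Q.coset y'"
    using assms unfolding CR_space_def CR.complex_tensor_simps by blast
  show "CR_character (x \<oplus>\<^bsub>CR_space H\<^esub> y) h = CR_character x h + CR_character y h"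
    unfolding CR_space_def x(1) y CR.complex_tensor_simps by (simp only: CR_character_coset frag_eval_add)
  have "frag_eval (\<lambda>(c, a). c * K0_character a h) (CR.scale c x') = c * frag_eval (\<lambda>(c, a). c * K0_character a h) x'"
    using x(2) unfolding carrier_free_Abelian_group_iff
    by (induction x' rule: frag_induction) (auto simp: frag_eval_diff right_diff_distrib)
  then show "CR_character (c \<odot>\<^bsub>CR_space H\<^esub> x) h = c * CR_character x h"
    unfolding CR_space_def x(1) CR.complex_tensor_simps by (simp only: CR_character_coset)
qed

lemma CR_character_zero: "CR_character \<zero>\<^bsub>CR_space H\<^esub> h = 0"
  unfolding CR_space_def CR.complex_tensor_simps CR_character_coset by simp

lemma CR_character_class: "CR_character (CR_class H V) h = character H V h"
  unfolding CR_class_def CR.pure_tensor_eq CR_character_coset frag_eval_of rep_class_eq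
  by (simp add: K0_character_coset)

lemma CR_lincomb_closed: "set xs \<subseteq> UNIV \<times> reps H \<Longrightarrow> CR_lincomb H xs \<in> carrier (CR_space H)"
proof (induction xs)
  case (Cons cv xs)
  obtain c V where "cv = (c, V)" by (cases cv)
  then show ?case using Cons by (simp add: CRv(1,6) CR_class_closed)
qed (simp add: CRv(2))

lemma CR_lincomb_append:
  "\<lbrakk>set xs \<subseteq> UNIV \<times> reps H; set ys \<subseteq> UNIV \<times> reps H\<rbrakk>
    \<Longrightarrow> CR_lincomb H (xs @ ys) = CR_lincomb H xs \<oplus>\<^bsub>CR_space H\<^esub> CR_lincomb H ys"
proof (induction xs)
  case (Cons cv xs)
  obtain c V where cv: "cv = (c, V)" by (cases cv)
  show ?case using Cons CRv(3)[OF CRv(6)[OF CR_class_closed] CR_lincomb_closed CR_lincomb_closed, of V xs ys c]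
    by (simp add: cv)
qed (simp add: CRv CR_lincomb_closed)

lemma CR_lincomb_smult:
  "set xs \<subseteq> UNIV \<times> reps H
    \<Longrightarrow> c \<odot>\<^bsub>CR_space H\<^esub> CR_lincomb H xs = CR_lincomb H (map (\<lambda>(d, V). (c * d, V)) xs)"
proof (induction xs)
  case Nil
  then show ?case using CRv(9)[OF CRv(2), of c 0] CRv(11)[OF CRv(2)] by simp
next
  case (Cons dv xs)
  obtain d V where dv: "dv = (d, V)" by (cases dv)
  show ?case using Cons CRv(8)[OF CRv(6)[OF CR_class_closed] CR_lincomb_closed, of V xs c d]
    by (simp add: dv CRv(9)[OF CR_class_closed])
qed

lemma CR_character_lincomb:
  "set xs \<subseteq> UNIV \<times> reps H \<Longrightarrow> CR_character (CR_lincomb H xs) h = (\<Sum>(c, V)\<leftarrow>xs. c * character H V h)"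
proof (induction xs)
  case (Cons cv xs)
  obtain c V where cv: "cv = (c, V)" by (cases cv)
  show ?case using Cons CR_character_linear(1)[OF CRv(6)[OF CR_class_closed] CR_lincomb_closed, of V xs c h]
      CR_character_linear(2)[OF CR_class_closed CR_class_closed, of V V c h]
    by (simp add: cv CR_character_class)
qed (simp add: CR_character_zero)

text \<open>The elements of the form \<open>CR_lincomb\<close> contain the tensors \<open>c
  \<otimes> [V]\<close> and are closed under addition and scaling, hence under the subtractions
  that produce all of the Grothendieck group.\<close>

lemma CR_spanned:
  assumes "x \<in> carrier (CR_space H)"
  shows "\<exists>xs. set xs \<subseteq> UNIV \<times> reps H \<and> x = CR_lincomb H xs"
  using assms unfolding CR_space_def
proof (induction x rule: CR.complex_tensor_induct)
  case zero
  show ?case by (intro exI[of _ "[]"]) (simp add: CR_space_def)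
next
  case (pure c a)
  have pure_K0: "\<exists>xs. set xs \<subseteq> UNIV \<times> reps H \<and> pure_tensor (R_C H) c (K0.coset x) = CR_lincomb H xs"
    if "Poly_Mapping.keys x \<subseteq> reps H" for x c
    using that
  proof (induction x arbitrary: c rule: free_Abelian_group_induct[consumes 1, case_names zero diff one])
    case zero
    \<comment> \<open>The relator for \<open>0 + 0 = 0\<close> shows that \<open>c \<otimes>
      0\<close> vanishes.\<close>
    have "frag_of (c, K0.coset 0) - frag_of (c, K0.coset 0) - frag_of (c, K0.coset 0) \<in> CR.Q.N"
    proof (rule CR.Q.N_generator)
      have "K0.coset 0 \<in> carrier (R_C H)" "K0.coset 0 \<otimes>\<^bsub>R_C H\<^esub> K0.coset 0 = K0.coset 0"
        unfolding R_C_eq K0.carrier_quotient K0.add_quotient by auto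
      then show "frag_of (c, K0.coset 0) - frag_of (c, K0.coset 0) - frag_of (c, K0.coset 0) \<in> CR.relators"
        unfolding CR.relators_def
        by (intro UnI2 CollectI exI[of _ c] exI[of _ "K0.coset 0"]) simp
    qed
    then have "frag_of (c, K0.coset 0) - 0 \<in> CR.Q.N" using CR.Q.N_minus by fastforce
    then have "pure_tensor (R_C H) c (K0.coset 0) = CR_lincomb H []"
      unfolding CR.pure_tensor_eq CR_lincomb.simps CR_space_def CR.complex_tensor_simps CR.Q.coset_eq_iff .
    then show ?case by (intro exI[of _ "[]"]) simp
  next
    case (diff x y)
    obtain xs ys where xs: "set xs \<subseteq> UNIV \<times> reps H" "pure_tensor (R_C H) c (K0.coset x) = CR_lincomb H xs"
      and ys: "set ys \<subseteq> UNIV \<times> reps H" "pure_tensor (R_C H) c (K0.coset y) = CR_lincomb H ys"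
      using diff(3,4)[of c] by blast
    have cl: "K0.coset (x - y) \<in> carrier (R_C H)" "K0.coset y \<in> carrier (R_C H)"
      using diff(2) subset_trans[OF keys_diff[of x y] Un_least[OF diff(1,2)]]
      unfolding R_C_eq K0.carrier_quotient by (simp_all add: imageI)
    have "K0.coset x = K0.coset (x - y) \<otimes>\<^bsub>R_C H\<^esub> K0.coset y"
      unfolding R_C_eq K0.add_quotient by simp
    then have eq: "CR_lincomb H xs = pure_tensor (R_C H) c (K0.coset (x - y)) \<oplus>\<^bsub>CR_space H\<^esub> CR_lincomb H ys"
      using CR.pure_tensor_mult[OF cl, of c] unfolding xs(2)[symmetric] ys(2)[symmetric] CR_space_def
      by (simp only:)
    let ?zs = "xs @ map (\<lambda>(d, V). (- 1 * d, V)) ys"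
    have p: "pure_tensor (R_C H) c (K0.coset (x - y)) \<in> carrier (CR_space H)"
      unfolding CR_space_def by (rule CR.pure_tensor_closed[OF cl(1)])
    have m: "set (map (\<lambda>(d, V). (- 1 * d, V)) ys) \<subseteq> UNIV \<times> reps H" using ys by auto
    note Y = CR_lincomb_closed[OF ys(1)]
    have "CR_lincomb H ?zs = CR_lincomb H xs \<oplus>\<^bsub>CR_space H\<^esub> (- 1) \<odot>\<^bsub>CR_space H\<^esub> CR_lincomb H ys"
      unfolding CR_lincomb_append[OF xs(1) m] CR_lincomb_smult[OF ys(1)] ..
    also have "\<dots> = pure_tensor (R_C H) c (K0.coset (x - y))
        \<oplus>\<^bsub>CR_space H\<^esub> (CR_lincomb H ys \<oplus>\<^bsub>CR_space H\<^esub> (- 1) \<odot>\<^bsub>CR_space H\<^esub> CR_lincomb H ys)"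
      unfolding eq by (rule CRv(3)[OF p Y CRv(6)[OF Y]])
    also have "CR_lincomb H ys \<oplus>\<^bsub>CR_space H\<^esub> (- 1) \<odot>\<^bsub>CR_space H\<^esub> CR_lincomb H ys = \<zero>\<^bsub>CR_space H\<^esub>"
      using CRv(7)[OF Y, of 1 "- 1"] CRv(10,11)[OF Y] by simp
    finally have "CR_lincomb H ?zs = pure_tensor (R_C H) c (K0.coset (x - y))" using p by simp
    then show ?case using xs(1) m by (intro exI[of _ ?zs]) auto
  next
    case (one V)
    have "pure_tensor (R_C H) c (K0.coset (frag_of V)) = c \<odot>\<^bsub>CR_space H\<^esub> CR_class H V"
      using CR.pure_tensor_scale[OF rep_class_closed[OF one], of c 1]
      by (simp add: CR_space_def CR_class_def rep_class_eq)
    then show ?case using one CRv(6)[OF CR_class_closed[OF one]] by (intro exI[of _ "[(c, V)]"]) simp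
  qed
  obtain x where "Poly_Mapping.keys x \<subseteq> reps H" "a = K0.coset x"
    using pure unfolding R_C_eq K0.carrier_quotient by auto
  then show ?case using pure_K0 by blast
next
  case (add x y)
  then obtain xs ys where "set xs \<subseteq> UNIV \<times> reps H" "x = CR_lincomb H xs" "set ys \<subseteq> UNIV \<times> reps H" "y = CR_lincomb H ys"
    by blast
  then show ?case using CR_lincomb_append[of xs ys]
    by (intro exI[of _ "xs @ ys"]) (simp add: CR_space_def)
next
  case (scale x)
  then obtain xs where xs: "set xs \<subseteq> UNIV \<times> reps H" "x = CR_lincomb H xs" by blast
  then show ?case using CR_lincomb_smult[of xs "- 1"]
    by (intro exI[of _ "map (\<lambda>(d, V). (- 1 * d, V)) xs"]) (auto simp: CR_space_def)
qed

lemma CR_character_class_function: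
  assumes "x \<in> carrier (CR_space H)"
  shows "CR_character x \<in> class_functions"
proof -
  obtain xs where xs: "set xs \<subseteq> UNIV \<times> reps H" "x = CR_lincomb H xs" using CR_spanned[OF assms] by blast
  have "(\<lambda>h. \<Sum>(c, V)\<leftarrow>xs. c * character H V h) \<in> class_functions"
    using xs(1)
  proof (induction xs)
    case (Cons cv xs)
    obtain c V where cv: "cv = (c, V)" by (cases cv)
    then show ?case using Cons character_class_function[of V] by (auto simp: class_functions_def)
  qed (simp add: class_functions_def)
  moreover have "CR_character x = (\<lambda>h. \<Sum>(c, V)\<leftarrow>xs. c * character H V h)"
    unfolding xs(2) by (rule ext) (rule CR_character_lincomb[OF xs(1)])
  ultimately show ?thesis by simp
qed

definition irr_rep :: "('a \<Rightarrow> complex) \<Rightarrow> 'a rep"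
  where "irr_rep \<chi> = (SOME V. brick V \<and> character H V = \<chi>)"

lemma irr_rep: "\<chi> \<in> irr_characters \<Longrightarrow> brick (irr_rep \<chi>) \<and> character H (irr_rep \<chi>) = \<chi>"
  unfolding irr_rep_def by (rule someI_ex) (auto simp: irr_characters_def)

text \<open>The inverse of the character map on class functions: \<open>f\<close> is sent to the
  combination of classes of bricks whose coefficients are those of the expansion of
  \<open>f\<close> in irreducible characters.\<close>

definition CR_of_function :: "('a \<Rightarrow> complex) \<Rightarrow> 'a cr"
  where "CR_of_function f = (\<Oplus>\<^bsub>CR_space H\<^esub>\<chi>\<in>irr_characters. inner_prod f \<chi> \<odot>\<^bsub>CR_space H\<^esub> CR_class H (irr_rep \<chi>))"

lemma irr_class_closed: "\<chi> \<in> irr_characters \<Longrightarrow> CR_class H (irr_rep \<chi>) \<in> carrier (CR_space H)"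
  using irr_rep brickD(1) CR_class_closed by blast

lemma CR_of_function_closed: "CR_of_function f \<in> carrier (CR_space H)"
  unfolding CR_of_function_def by (rule CRm.M.finsum_closed) (auto intro: CRv(6) irr_class_closed)

lemma CR_of_function_add:
  "CR_of_function (\<lambda>h. f h + g h) = CR_of_function f \<oplus>\<^bsub>CR_space H\<^esub> CR_of_function g"
proof -
  have i: "inner_prod (\<lambda>h. f h + g h) \<chi> = inner_prod f \<chi> + inner_prod g \<chi>" for \<chi>
    by (simp add: inner_prod_def sum.distrib algebra_simps)
  have p: "(\<lambda>\<chi>. inner_prod f \<chi> \<odot>\<^bsub>CR_space H\<^esub> CR_class H (irr_rep \<chi>)) \<in> irr_characters \<rightarrow> carrier (CR_space H)" for f
    by (simp add: CRv(6) irr_class_closed)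
  have "CR_of_function (\<lambda>h. f h + g h) = (\<Oplus>\<^bsub>CR_space H\<^esub>\<chi>\<in>irr_characters.
      inner_prod f \<chi> \<odot>\<^bsub>CR_space H\<^esub> CR_class H (irr_rep \<chi>)
      \<oplus>\<^bsub>CR_space H\<^esub> inner_prod g \<chi> \<odot>\<^bsub>CR_space H\<^esub> CR_class H (irr_rep \<chi>))"
    unfolding CR_of_function_def i
    by (rule CRm.M.finsum_cong') (simp_all add: CRv(1,6,7) irr_class_closed)
  also have "\<dots> = CR_of_function f \<oplus>\<^bsub>CR_space H\<^esub> CR_of_function g"
    unfolding CR_of_function_def by (rule CRm.M.finsum_addf[OF p p])
  finally show ?thesis .
qed

lemma CR_of_function_scale: "CR_of_function (\<lambda>h. c * f h) = c \<odot>\<^bsub>CR_space H\<^esub> CR_of_function f"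
proof -
  have "CR_of_function (\<lambda>h. c * f h) = (\<Oplus>\<^bsub>CR_space H\<^esub>\<chi>\<in>irr_characters.
      c \<odot>\<^bsub>CR_space H\<^esub> (inner_prod f \<chi> \<odot>\<^bsub>CR_space H\<^esub> CR_class H (irr_rep \<chi>)))"
    unfolding CR_of_function_def inner_prod_scale_left
    by (rule CRm.M.finsum_cong') (simp_all add: CRv(6,9) irr_class_closed)
  also have "\<dots> = c \<odot>\<^bsub>CR_space H\<^esub> CR_of_function f"
    unfolding CR_of_function_def
    by (rule CRm.finsum_smult_ldistr[symmetric]) (simp_all add: finite_irr_characters CRv(6) irr_class_closed)
  finally show ?thesis .
qed

lemma CR_of_function_irr:
  assumes "brick V"
  shows "CR_of_function (character H V) = CR_class H V"
proof -
  have \<chi>: "character H V \<in> irr_characters" by (rule irrI[OF assms])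
  have "CR_of_function (character H V) = (\<Oplus>\<^bsub>CR_space H\<^esub>\<chi>\<in>irr_characters.
      if character H V = \<chi> then CR_class H (irr_rep \<chi>) else \<zero>\<^bsub>CR_space H\<^esub>)"
    unfolding CR_of_function_def
    by (rule CRm.M.finsum_cong') (auto simp: irr_orthonormal[OF \<chi>] CRv(10,11) irr_class_closed)
  also have "\<dots> = CR_class H (irr_rep (character H V))"
    by (rule CRm.M.finsum_singleton[OF \<chi> finite_irr_characters]) (auto intro: irr_class_closed)
  also have "\<dots> = CR_class H V"
    by (rule CR_class_eq_if_same_character) (use irr_rep[OF \<chi>] assms in auto)
  finally show ?thesis .
qed

text \<open>Both sides are additive on short exact sequences, so it suffices to consider
  bricks.\<close>

lemma CR_of_function_character_class:
  assumes "V \<in> reps H"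
  shows "CR_of_function (character H V) = CR_class H V"
  using assms
proof (induction rule: reps_brick_induct)
  case (zero V)
  have "character H V = (\<lambda>h. 0 * character H V h)" using character_dim_0[OF zero(2,1)] by auto
  then have "CR_of_function (character H V) = 0 \<odot>\<^bsub>CR_space H\<^esub> CR_of_function (character H V)"
    by (metis CR_of_function_scale)
  then show ?case using CRv(11)[OF CR_of_function_closed] CR_class_dim_0[OF zero] by simp
next
  case (brick V)
  then show ?case by (rule CR_of_function_irr)
next
  case (extension U V W)
  have "character H V = (\<lambda>h. character H U h + character H W h)"
    using character_short_exact[OF extension(1-4)] by auto
  then show ?case
    using CR_of_function_add[of "character H U" "character H W"] CR_class_short_exact[OF extension(1-4)] extension(5,6) by simp
qed

lemma CR_of_function_character:
  assumes "x \<in> carrier (CR_space H)"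
  shows "CR_of_function (CR_character x) = x"
proof -
  obtain xs where xs: "set xs \<subseteq> UNIV \<times> reps H" "x = CR_lincomb H xs" using CR_spanned[OF assms] by blast
  have "CR_of_function (\<lambda>h. \<Sum>(c, V)\<leftarrow>xs. c * character H V h) = CR_lincomb H xs"
    using xs(1)
  proof (induction xs)
    case Nil
    then show ?case using CR_of_function_scale[of 0 "\<lambda>_. 0"] CRv(11)[OF CR_of_function_closed] by simp
  next
    case (Cons cv xs)
    obtain c V where cv: "cv = (c, V)" by (cases cv)
    then show ?case using Cons CR_of_function_add[of "\<lambda>h. c * character H V h"]
      by (simp add: CR_of_function_scale CR_of_function_character_class)
  qed
  moreover have "CR_character x = (\<lambda>h. \<Sum>(c, V)\<leftarrow>xs. c * character H V h)"
    unfolding xs(2) by (rule ext) (rule CR_character_lincomb[OF xs(1)])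
  ultimately show ?thesis by (simp add: xs(2))
qed

lemma CR_character_of_function:
  assumes "f \<in> class_functions"
  shows "CR_character (CR_of_function f) = f"
proof (rule ext)
  fix h
  have "CR_character (\<Oplus>\<^bsub>CR_space H\<^esub>\<chi>\<in>I. inner_prod f \<chi> \<odot>\<^bsub>CR_space H\<^esub> CR_class H (irr_rep \<chi>)) h
      = (\<Sum>\<chi>\<in>I. inner_prod f \<chi> * \<chi> h)" if "finite I" "I \<subseteq> irr_characters" for I
    using that
  proof induction
    case empty
    then show ?case by (simp add: CR_character_zero)
  next
    case (insert \<chi> I)
    have c: "(\<lambda>\<chi>. inner_prod f \<chi> \<odot>\<^bsub>CR_space H\<^esub> CR_class H (irr_rep \<chi>)) \<in> I \<rightarrow> carrier (CR_space H)"
      using insert.prems by (auto intro!: CRv(6) irr_class_closed)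
    have \<chi>: "CR_class H (irr_rep \<chi>) \<in> carrier (CR_space H)" using insert.prems by (auto intro!: irr_class_closed)
    show ?case
      using insert c CRv(6)[OF \<chi>] irr_rep[of \<chi>]
      by (simp add: CR_character_linear(1)[OF CRv(6)[OF \<chi>] CRm.M.finsum_closed[OF c]]
          CR_character_linear(2)[OF \<chi> \<chi>] CR_character_class)
  qed
  from this[OF finite_irr_characters subset_refl] show "CR_character (CR_of_function f) h = f h"
    unfolding CR_of_function_def using class_function_expansion[OF assms, of h] by simp
qed

lemma CR_character_inj:
  "\<lbrakk>x \<in> carrier (CR_space H); y \<in> carrier (CR_space H); \<And>h. h \<in> carrier H \<Longrightarrow> CR_character x h = CR_character y h\<rbrakk> \<Longrightarrow> x = y"
proof -
  assume x: "x \<in> carrier (CR_space H)" and y: "y \<in> carrier (CR_space H)"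
    and eq: "\<And>h. h \<in> carrier H \<Longrightarrow> CR_character x h = CR_character y h"
  have "CR_character x = CR_character y"
    using eq class_functionsD(1)[OF CR_character_class_function[OF x]]
      class_functionsD(1)[OF CR_character_class_function[OF y]] by (metis ext)
  then show "x = y" using CR_of_function_character[OF x] CR_of_function_character[OF y] by metis
qed

end

text \<open>If \<open>m\<close> has on characters the effect of a bilinear operation
  \<open>B\<close>, then all choices of linear combinations in the definite description give
  elements with the same character. As characters separate elements, the description
  denotes.\<close>

lemma bilinear_extension_character:
  fixes H :: "'a monoid" and K :: "'b monoid" and L :: "'c monoid"
  assumes H: "finite_group H" and K: "finite_group K" and L: "finite_group L"
    and m: "\<And>V W. \<lbrakk>V \<in> reps H; W \<in> reps K\<rbrakk> \<Longrightarrow> m V W \<in> reps L"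
    and B: "\<And>V W h. \<lbrakk>V \<in> reps H; W \<in> reps K\<rbrakk>
      \<Longrightarrow> character L (m V W) h = B (character H V) (character K W) h"
    and lin1: "\<And>c f f' g h. B (\<lambda>x. c * f x + f' x) g h = c * B f g h + B f' g h"
    and lin2: "\<And>c f g g' h. B f (\<lambda>x. c * g x + g' x) h = c * B f g h + B f g' h"
    and x: "x \<in> carrier (CR_space H)" and y: "y \<in> carrier (CR_space K)"
  shows "bilinear_extension H K L m x y \<in> carrier (CR_space L)"
    and "finite_group.CR_character L (bilinear_extension H K L m x y) h
      = B (finite_group.CR_character H x) (finite_group.CR_character K y) h"
proof -
  interpret H: finite_group H by (rule H)
  interpret K: finite_group K by (rule K)
  interpret L: finite_group L by (rule L)
  let ?z = "\<lambda>xs ys. [(c * d, m V W). (c, V) \<leftarrow> xs, (d, W) \<leftarrow> ys]"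
  have z: "set (?z xs ys) \<subseteq> UNIV \<times> reps L" if "set xs \<subseteq> UNIV \<times> reps H" "set ys \<subseteq> UNIV \<times> reps K" for xs ys
    using that m by fastforce
  have B01: "B (\<lambda>_. 0) g h = 0" for g h using lin1[of "- 1" "\<lambda>_. 0" "\<lambda>_. 0" g h] by simp
  have B02: "B f (\<lambda>_. 0) h = 0" for f h using lin2[of f "- 1" "\<lambda>_. 0" "\<lambda>_. 0" h] by simp
  \<comment> \<open>The character of the double linear combination, first for a single term of
    \<open>xs\<close>.\<close>
  have row: "(\<Sum>(e, U)\<leftarrow>map (\<lambda>(d, W). (c * d, m V W)) ys. e * character L U h)
      = c * B (character H V) (\<lambda>h. \<Sum>(d, W)\<leftarrow>ys. d * character K W h) h"
    if "V \<in> reps H" "set ys \<subseteq> UNIV \<times> reps K" for c V ys h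
    using that(2)
  proof (induction ys)
    case (Cons dw ys)
    obtain d W where dw: "dw = (d, W)" by (cases dw)
    then show ?case using Cons that(1) by (simp add: lin2 B algebra_simps)
  qed (simp add: B02)
  have zch: "(\<Sum>(c, V)\<leftarrow>?z xs ys. c * character L V h)
      = B (\<lambda>h. \<Sum>(c, V)\<leftarrow>xs. c * character H V h) (\<lambda>h. \<Sum>(d, W)\<leftarrow>ys. d * character K W h) h"
    if "set xs \<subseteq> UNIV \<times> reps H" and ys: "set ys \<subseteq> UNIV \<times> reps K" for xs ys h
    using that(1)
  proof (induction xs)
    case (Cons cv xs)
    obtain c V where cv: "cv = (c, V)" by (cases cv)
    have "(\<Sum>(e, U)\<leftarrow>map (\<lambda>(d, W). (c * d, m V W)) ys. e * character L U h)
        = c * B (character H V) (\<lambda>h. \<Sum>(d, W)\<leftarrow>ys. d * character K W h) h"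
      by (rule row) (use Cons.prems cv ys in auto)
    then show ?case using Cons by (simp add: cv lin1)
  qed (simp add: B01)
  have val: "L.CR_character (CR_lincomb L (?z xs ys)) h = B (H.CR_character x) (K.CR_character y) h"
    if xs: "set xs \<subseteq> UNIV \<times> reps H" "x = CR_lincomb H xs" and ys: "set ys \<subseteq> UNIV \<times> reps K" "y = CR_lincomb K ys"
    for xs ys h
  proof -
    have "H.CR_character x = (\<lambda>h. \<Sum>(c, V)\<leftarrow>xs. c * character H V h)"
      "K.CR_character y = (\<lambda>h. \<Sum>(c, V)\<leftarrow>ys. c * character K V h)"
      using H.CR_character_lincomb[OF xs(1)] K.CR_character_lincomb[OF ys(1)] by (auto simp: xs(2) ys(2))
    then show ?thesis unfolding L.CR_character_lincomb[OF z[OF xs(1) ys(1)]] zch[OF xs(1) ys(1)] by simp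
  qed
  obtain xs where xs: "set xs \<subseteq> UNIV \<times> reps H" "x = CR_lincomb H xs" using H.CR_spanned[OF x] by blast
  obtain ys where ys: "set ys \<subseteq> UNIV \<times> reps K" "y = CR_lincomb K ys" using K.CR_spanned[OF y] by blast
  have "bilinear_extension H K L m x y = CR_lincomb L (?z xs ys)"
    unfolding bilinear_extension_def
  proof (rule the_equality)
    show "\<exists>xs' ys'. set xs' \<subseteq> UNIV \<times> reps H \<and> x = CR_lincomb H xs' \<and> set ys' \<subseteq> UNIV \<times> reps K \<and> y = CR_lincomb K ys'
      \<and> CR_lincomb L (?z xs ys) = CR_lincomb L (?z xs' ys')"
      using xs ys by blast
  next
    fix w assume "\<exists>xs ys. set xs \<subseteq> UNIV \<times> reps H \<and> x = CR_lincomb H xs \<and> set ys \<subseteq> UNIV \<times> reps K \<and> y = CR_lincomb K ys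
      \<and> w = CR_lincomb L (?z xs ys)"
    then obtain xs' ys' where xs': "set xs' \<subseteq> UNIV \<times> reps H" "x = CR_lincomb H xs'"
      and ys': "set ys' \<subseteq> UNIV \<times> reps K" "y = CR_lincomb K ys'" and w: "w = CR_lincomb L (?z xs' ys')" by blast
    show "w = CR_lincomb L (?z xs ys)"
      unfolding w
      by (rule L.CR_character_inj[OF L.CR_lincomb_closed[OF z[OF xs'(1) ys'(1)]] L.CR_lincomb_closed[OF z[OF xs(1) ys(1)]]])
        (simp only: val[OF xs' ys'] val[OF xs ys])
  qed
  then show "bilinear_extension H K L m x y \<in> carrier (CR_space L)"
    "L.CR_character (bilinear_extension H K L m x y) h = B (H.CR_character x) (K.CR_character y) h"
    using L.CR_lincomb_closed[OF z[OF xs(1) ys(1)]] val[OF xs ys] by simp_all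
qed

section \<open>The category of the shifted functor in terms of characters\<close>

abbreviation "chi H \<equiv> finite_group.CR_character H"

lemma CR_simps:
  "carrier (CR H) = carrier (CR_space H)"
  "\<zero>\<^bsub>CR H\<^esub> = \<zero>\<^bsub>CR_space H\<^esub>"
  "x \<oplus>\<^bsub>CR H\<^esub> y = x \<oplus>\<^bsub>CR_space H\<^esub> y"
  "c \<odot>\<^bsub>CR H\<^esub> x = c \<odot>\<^bsub>CR_space H\<^esub> x"
  "x \<otimes>\<^bsub>CR H\<^esub> y = bilinear_extension H H H tensor_rep x y"
  "\<one>\<^bsub>CR H\<^esub> = CR_class H trivial_rep"
  by (simp_all add: CR_def)

lemma (in finite_group) CR_vectorspace: "vectorspace Cfield (CR H)"
  by (rule vectorspaceI, simp_all add: CR_simps CRv(1,2,3,5-)) (rule CRv(4))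

lemma (in finite_group) CR_mult:
  assumes "x \<in> carrier (CR_space H)" "y \<in> carrier (CR_space H)"
  shows "x \<otimes>\<^bsub>CR H\<^esub> y \<in> carrier (CR_space H)"
    and "CR_character (x \<otimes>\<^bsub>CR H\<^esub> y) h = CR_character x h * CR_character y h"
  using bilinear_extension_character[of H H H tensor_rep "\<lambda>f g h. f h * g h", OF finite_group_axioms
      finite_group_axioms finite_group_axioms _ _ _ _ assms]
  by (simp_all add: CR_simps tensor_rep_reps algebra_simps)

lemma (in finite_group) CR_algebra: "algebra Cfield (CR H)"
proof -
  interpret V: Module.module Cfield "CR H"
    using CR_vectorspace by (simp add: vectorspace_iff_module)
  note inj = CR_character_inj
  note cl = CR_mult(1) CRv(1,2,6) CR_class_closed[OF trivial_rep_reps(1)]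
  note ev = CR_mult(2) CR_character_linear CR_character_class trivial_rep_reps(2)
  have "abelian_group (CR H)" by (rule V.M.abelian_group_axioms)
  moreover have "comm_monoid (CR H)"
    by (rule comm_monoidI; (unfold CR_simps(1,6))?; (rule inj)?)
      (simp_all only: cl ev CR_simps(6) mult_1 mult.assoc mult.commute, simp_all add: mult.commute)
  moreover have "(x \<oplus>\<^bsub>CR H\<^esub> y) \<otimes>\<^bsub>CR H\<^esub> z = x \<otimes>\<^bsub>CR H\<^esub> z \<oplus>\<^bsub>CR H\<^esub> y \<otimes>\<^bsub>CR H\<^esub> z"
    if "x \<in> carrier (CR H)" "y \<in> carrier (CR H)" "z \<in> carrier (CR H)" for x y z
    using that unfolding CR_simps(1,3) by (intro inj) (simp_all add: cl ev distrib_right)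
  ultimately have "cring (CR H)" by (rule cringI)
  then show ?thesis
  proof (rule algebraI[OF cring_Cfield])
    fix c x y assume "x \<in> carrier (CR H)" "y \<in> carrier (CR H)"
    then show "c \<odot>\<^bsub>CR H\<^esub> x \<otimes>\<^bsub>CR H\<^esub> y = c \<odot>\<^bsub>CR H\<^esub> (x \<otimes>\<^bsub>CR H\<^esub> y)"
      unfolding CR_simps(1,4) by (intro inj) (simp_all add: cl ev)
  qed (use vectorspaceD[OF CR_vectorspace] in simp_all)
qed

lemma (in finite_group) CR_character_finsum:
  assumes "finite I" and "\<And>i. i \<in> I \<Longrightarrow> f i \<in> carrier (CR H)"
  shows "CR_character (finsum (CR H) f I) h = (\<Sum>i\<in>I. CR_character (f i) h)"
proof -
  interpret V: Module.module Cfield "CR H"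
    using CR_vectorspace by (simp add: vectorspace_iff_module)
  from assms show ?thesis
  proof induction
    case empty
    then show ?case by (simp add: CR_simps CR_character_zero)
  next
    case (insert i I)
    have f: "f \<in> I \<rightarrow> carrier (CR H)" using insert by auto
    have i: "f i \<in> carrier (CR_space H)" "finsum (CR H) f I \<in> carrier (CR_space H)"
      using insert.prems[of i] V.M.finsum_closed[OF f] by (simp_all add: CR_simps)
    show ?case
      using insert f CR_character_linear(1)[OF i] by (simp add: CR_simps(3))
  qed
qed

lemma finite_group_DirProd:
  assumes "group L" "finite (carrier L)" "group K" "finite (carrier K)" "group G" "finite (carrier G)"
  shows "finite_group (L \<times>\<times> (K \<times>\<times> G))"
  using assms by (simp add: finite_group_def finite_group_axioms_def DirProd_group)

lemma P_CR_simps: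
  "Ob (P_CR G) = {H. group H \<and> finite (carrier H)}"
  "Hom (P_CR G) H K = CR (K \<times>\<times> (H \<times>\<times> G))"
  "Comp (P_CR G) H K L = bilinear_extension (L \<times>\<times> (K \<times>\<times> G)) (K \<times>\<times> (H \<times>\<times> G)) (L \<times>\<times> (H \<times>\<times> G)) (comp_rep L K H G)"
  "Id (P_CR G) H = CR_class (H \<times>\<times> (H \<times>\<times> G)) (regular_rep H)"
  by (simp_all add: P_CR_def)

locale coefficient_group = G: finite_group G for G :: "'g monoid"
begin

abbreviation "hom_char H K \<equiv> chi (K \<times>\<times> (H \<times>\<times> G))"

lemma finite_group_Hom: "\<lbrakk>K \<in> Ob (P_CR G); H \<in> Ob (P_CR G)\<rbrakk> \<Longrightarrow> finite_group (K \<times>\<times> (H \<times>\<times> G))"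
  unfolding P_CR_simps by (rule finite_group_DirProd) (auto intro: G.is_group G.finite_carrier)

lemma finite_group_Ob: "H \<in> Ob (P_CR G) \<Longrightarrow> finite_group H"
  by (simp add: P_CR_simps finite_group_def finite_group_axioms_def)

lemma P_CR_comp:
  assumes H: "H \<in> Ob (P_CR G)" and K: "K \<in> Ob (P_CR G)" and L: "L \<in> Ob (P_CR G)"
    and x: "x \<in> carrier (Hom (P_CR G) H K)" and y: "y \<in> carrier (Hom (P_CR G) K L)"
  shows "Comp (P_CR G) H K L y x \<in> carrier (Hom (P_CR G) H L)"
    and "\<lbrakk>l \<in> carrier L; h \<in> carrier H; g \<in> carrier G\<rbrakk> \<Longrightarrow>
      hom_char H L (Comp (P_CR G) H K L y x) (l, h, g)
      = inverse (of_nat (card (carrier K))) * (\<Sum>k\<in>carrier K.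
        hom_char K L y (l, k, g) * hom_char H K x (k, h, g))"
proof -
  \<comment> \<open>Composition on the level of functions; the value outside the group matches
    that of characters.\<close>
  let ?B = "\<lambda>f f' (l, h, g). if l \<in> carrier L \<and> h \<in> carrier H \<and> g \<in> carrier G then
    inverse (of_nat (card (carrier K))) * (\<Sum>k\<in>carrier K. f (l, k, g) * f' (k, h, g)) else (0 :: complex)"
  have gr: "group L" "group K" "group H" "group G" "finite (carrier K)"
    using H K L G.is_group by (simp_all add: P_CR_simps)
  have B: "character (L \<times>\<times> (H \<times>\<times> G)) (comp_rep L K H G V W) p
      = ?B (character (L \<times>\<times> (K \<times>\<times> G)) V) (character (K \<times>\<times> (H \<times>\<times> G)) W) p"
    if "V \<in> reps (L \<times>\<times> (K \<times>\<times> G))" "W \<in> reps (K \<times>\<times> (H \<times>\<times> G))" for V W p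
  proof (cases p)
    case (fields l h g)
    then show ?thesis using comp_rep_reps_character(2)[OF gr that, of l h g]
      by (auto simp: character_def[of "L \<times>\<times> (H \<times>\<times> G)"])
  qed
  have l1: "?B (\<lambda>x. c * f x + f' x) g p = c * ?B f g p + ?B f' g p" for c f f' g p
    by (cases p) (simp add: sum.distrib sum_distrib_left algebra_simps)
  have l2: "?B f (\<lambda>x. c * g x + g' x) p = c * ?B f g p + ?B f g' p" for c f g g' p
    by (cases p) (simp add: sum.distrib sum_distrib_left algebra_simps)
  note be = bilinear_extension_character[of "L \<times>\<times> (K \<times>\<times> G)" "K \<times>\<times> (H \<times>\<times> G)" "L \<times>\<times> (H \<times>\<times> G)" "comp_rep L K H G" ?B,
      OF finite_group_Hom[OF L K] finite_group_Hom[OF K H] finite_group_Hom[OF L H] comp_rep_reps_character(1)[OF gr] B l1 l2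
        y[unfolded P_CR_simps CR_simps] x[unfolded P_CR_simps CR_simps]]
  show "Comp (P_CR G) H K L y x \<in> carrier (Hom (P_CR G) H L)"
    unfolding P_CR_simps CR_simps by (rule be(1))
  show "hom_char H L (Comp (P_CR G) H K L y x) (l, h, g)
      = inverse (of_nat (card (carrier K))) * (\<Sum>k\<in>carrier K.
        hom_char K L y (l, k, g) * hom_char H K x (k, h, g))"
    if "l \<in> carrier L" "h \<in> carrier H" "g \<in> carrier G"
  proof -
    have "hom_char H L (Comp (P_CR G) H K L y x) (l, h, g)
        = ?B (hom_char K L y) (hom_char H K x) (l, h, g)"
      unfolding P_CR_simps by (rule be(2))
    then show ?thesis using that by simp
  qed
qed

lemma P_CR_hom_eqI:
  assumes H: "H \<in> Ob (P_CR G)" and K: "K \<in> Ob (P_CR G)"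
    and x: "x \<in> carrier (Hom (P_CR G) H K)" and y: "y \<in> carrier (Hom (P_CR G) H K)"
    and eq: "\<And>k h g. \<lbrakk>k \<in> carrier K; h \<in> carrier H; g \<in> carrier G\<rbrakk>
      \<Longrightarrow> hom_char H K x (k, h, g) = hom_char H K y (k, h, g)"
  shows "x = y"
  by (rule finite_group.CR_character_inj[OF finite_group_Hom[OF K H]]) (use x y eq in \<open>auto simp: P_CR_simps CR_simps\<close>)

lemma P_CR_hom_linear:
  assumes H: "H \<in> Ob (P_CR G)" and K: "K \<in> Ob (P_CR G)" and x: "x \<in> carrier (Hom (P_CR G) H K)"
  shows "y \<in> carrier (Hom (P_CR G) H K) \<Longrightarrow> hom_char H K (x \<oplus>\<^bsub>Hom (P_CR G) H K\<^esub> y) p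
      = hom_char H K x p + hom_char H K y p"
    and "hom_char H K (c \<odot>\<^bsub>Hom (P_CR G) H K\<^esub> x) p = c * hom_char H K x p"
  using finite_group.CR_character_linear[OF finite_group_Hom[OF K H]] x by (simp_all add: P_CR_simps CR_simps)

lemma P_CR_hom_vectorspace:
  "\<lbrakk>H \<in> Ob (P_CR G); K \<in> Ob (P_CR G)\<rbrakk> \<Longrightarrow> vectorspace Cfield (Hom (P_CR G) H K)"
  unfolding P_CR_simps(2) by (rule finite_group.CR_vectorspace[OF finite_group_Hom])

lemma P_CR_conj:
  assumes H: "H \<in> Ob (P_CR G)" and K: "K \<in> Ob (P_CR G)" and x: "x \<in> carrier (Hom (P_CR G) H K)"
    and "a \<in> carrier K" "b \<in> carrier H" "k \<in> carrier K" "h \<in> carrier H" "g \<in> carrier G"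
  shows "hom_char H K x (a \<otimes>\<^bsub>K\<^esub> k \<otimes>\<^bsub>K\<^esub> inv\<^bsub>K\<^esub> a, b \<otimes>\<^bsub>H\<^esub> h \<otimes>\<^bsub>H\<^esub> inv\<^bsub>H\<^esub> b, g) = hom_char H K x (k, h, g)"
proof -
  interpret F: finite_group "K \<times>\<times> (H \<times>\<times> G)" by (rule finite_group_Hom[OF K H])
  interpret K: group K using K by (simp add: P_CR_simps)
  interpret H: group H using H by (simp add: P_CR_simps)
  have "F.CR_character x \<in> F.class_functions"
    using x by (intro F.CR_character_class_function) (simp add: P_CR_simps CR_simps)
  from F.class_functionsD(2)[OF this, of "(a, b, \<one>\<^bsub>G\<^esub>)" "(k, h, g)"] assms
  show ?thesis
    by (simp add: inv_DirProd K.group_axioms H.group_axioms G.is_group DirProd_group)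
qed

lemma P_CR_id:
  assumes H: "H \<in> Ob (P_CR G)"
  shows "Id (P_CR G) H \<in> carrier (Hom (P_CR G) H H)"
    and "\<lbrakk>h1 \<in> carrier H; h2 \<in> carrier H; g \<in> carrier G\<rbrakk> \<Longrightarrow> hom_char H H (Id (P_CR G) H) (h1, h2, g)
      = finite_group.conj_count H h1 h2"
proof -
  have gr: "group H" "finite (carrier H)" using H by (simp_all add: P_CR_simps)
  interpret F: finite_group "H \<times>\<times> (H \<times>\<times> G)" by (rule finite_group_Hom[OF H H])
  show "Id (P_CR G) H \<in> carrier (Hom (P_CR G) H H)"
    unfolding P_CR_simps CR_simps by (rule F.CR_class_closed[OF regular_rep_reps[OF gr G.is_group]])
  show "hom_char H H (Id (P_CR G) H) (h1, h2, g) = finite_group.conj_count H h1 h2"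
    if "h1 \<in> carrier H" "h2 \<in> carrier H" "g \<in> carrier G"
    unfolding P_CR_simps F.CR_character_class character_regular_rep[OF gr G.is_group that]
    using gr(2) by (simp add: finite_group.conj_count_def[OF finite_group_Ob[OF H]] sum.If_cases Int_def conj_commute)
qed

text \<open>By \<open>P_CR_hom_eqI\<close> the axioms are identities between functions:
  associativity is the exchange of two finite sums, and the unit laws are
  \<open>sum_conj_count\<close>.\<close>

lemma linear_category_P_CR: "linear_category (P_CR G :: ('h monoid, ('h \<times> 'h \<times> 'g) cr) lcat)"
proof (rule linear_category.intro)
  fix H K L :: "'h monoid"
  assume H: "H \<in> Ob (P_CR G)" and K: "K \<in> Ob (P_CR G)"
  interpret H: finite_group H by (rule finite_group_Ob[OF H])
  interpret K: finite_group K by (rule finite_group_Ob[OF K])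
  show "vectorspace Cfield (Hom (P_CR G) H K)" by (rule P_CR_hom_vectorspace[OF H K])
  show "Id (P_CR G) H \<in> carrier (Hom (P_CR G) H H)" by (rule P_CR_id(1)[OF H])
  fix x assume x: "x \<in> carrier (Hom (P_CR G) H K)"
  show "Comp (P_CR G) H K K (Id (P_CR G) K) x = x"
  proof (rule P_CR_hom_eqI[OF H K P_CR_comp(1)[OF H K K x P_CR_id(1)[OF K]] x])
    fix k h g assume p: "k \<in> carrier K" "h \<in> carrier H" "g \<in> carrier G"
    let ?x = "hom_char H K x"
    have "(\<Sum>y\<in>carrier K. hom_char K K (Id (P_CR G) K) (k, y, g) * ?x (y, h, g))
      = (\<Sum>y\<in>carrier K. K.conj_count k y * ?x (y, h, g))"
      by (rule sum.cong) (use p in \<open>simp_all add: P_CR_id(2)[OF K]\<close>)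
    also have "\<dots> = of_nat (card (carrier K)) * ?x (k, h, g)"
      by (rule K.sum_conj_count(2)) (use P_CR_conj[OF H K x, of _ "\<one>\<^bsub>H\<^esub>" _ h g] p in auto)
    finally show "hom_char H K (Comp (P_CR G) H K K (Id (P_CR G) K) x) (k, h, g) = ?x (k, h, g)"
      unfolding P_CR_comp(2)[OF H K K x P_CR_id(1)[OF K] p] by simp
  qed
  show "Comp (P_CR G) H H K x (Id (P_CR G) H) = x"
  proof (rule P_CR_hom_eqI[OF H K P_CR_comp(1)[OF H H K P_CR_id(1)[OF H] x] x])
    fix k h g assume p: "k \<in> carrier K" "h \<in> carrier H" "g \<in> carrier G"
    let ?x = "hom_char H K x"
    have "(\<Sum>y\<in>carrier H. ?x (k, y, g) * hom_char H H (Id (P_CR G) H) (y, h, g))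
      = (\<Sum>y\<in>carrier H. H.conj_count y h * ?x (k, y, g))"
      by (rule sum.cong) (use p in \<open>simp_all add: P_CR_id(2)[OF H]\<close>)
    also have "\<dots> = of_nat (card (carrier H)) * ?x (k, h, g)"
      by (rule H.sum_conj_count(1)) (use P_CR_conj[OF H K x, of "\<one>\<^bsub>K\<^esub>" _ k _ g] p in auto)
    finally show "hom_char H K (Comp (P_CR G) H H K x (Id (P_CR G) H)) (k, h, g) = ?x (k, h, g)"
      unfolding P_CR_comp(2)[OF H H K P_CR_id(1)[OF H] x p] by simp
  qed
next
  fix H K L :: "'h monoid" and x
  assume H: "H \<in> Ob (P_CR G)" and K: "K \<in> Ob (P_CR G)" and L: "L \<in> Ob (P_CR G)"
    and x: "x \<in> carrier (Hom (P_CR G) H K)"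
  note Vs = vectorspaceD[OF P_CR_hom_vectorspace]
  show "(\<lambda>y. Comp (P_CR G) H K L y x) \<in> module_hom Cfield (Hom (P_CR G) K L) (Hom (P_CR G) H L)"
    by (rule module_homI; (rule P_CR_hom_eqI[OF H L])?)
      (simp_all add: x H K L P_CR_comp P_CR_hom_linear Vs(1,6) distrib_right sum.distrib distrib_left
        mult.assoc mult.left_commute flip: sum_distrib_left)
next
  fix H K L :: "'h monoid" and y
  assume H: "H \<in> Ob (P_CR G)" and K: "K \<in> Ob (P_CR G)" and L: "L \<in> Ob (P_CR G)"
    and y: "y \<in> carrier (Hom (P_CR G) K L)"
  note Vs = vectorspaceD[OF P_CR_hom_vectorspace]
  show "(\<lambda>x. Comp (P_CR G) H K L y x) \<in> module_hom Cfield (Hom (P_CR G) H K) (Hom (P_CR G) H L)"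
    by (rule module_homI; (rule P_CR_hom_eqI[OF H L])?)
      (simp_all add: y H K L P_CR_comp P_CR_hom_linear Vs(1,6) distrib_right sum.distrib distrib_left
        mult.assoc mult.left_commute flip: sum_distrib_left)
next
  fix J H K L :: "'h monoid" and x y z
  assume J: "J \<in> Ob (P_CR G)" and H: "H \<in> Ob (P_CR G)" and K: "K \<in> Ob (P_CR G)" and L: "L \<in> Ob (P_CR G)"
    and x: "x \<in> carrier (Hom (P_CR G) J H)" and y: "y \<in> carrier (Hom (P_CR G) H K)" and z: "z \<in> carrier (Hom (P_CR G) K L)"
  note yx = P_CR_comp[OF J H K x y] and zy = P_CR_comp[OF H K L y z]
  show "Comp (P_CR G) J K L z (Comp (P_CR G) J H K y x) = Comp (P_CR G) J H L (Comp (P_CR G) H K L z y) x"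
  proof (rule P_CR_hom_eqI[OF J L P_CR_comp(1)[OF J K L yx(1) z] P_CR_comp(1)[OF J H L x zy(1)]])
    fix l j g assume p: "l \<in> carrier L" "j \<in> carrier J" "g \<in> carrier G"
    let ?cK = "inverse (of_nat (card (carrier K))) :: complex" and ?cH = "inverse (of_nat (card (carrier H))) :: complex"
    let ?x = "hom_char J H x" and ?y = "hom_char H K y" and ?z = "hom_char K L z"
    have "hom_char J L (Comp (P_CR G) J K L z (Comp (P_CR G) J H K y x)) (l, j, g)
      = ?cK * (\<Sum>k\<in>carrier K. \<Sum>h\<in>carrier H. ?cH * (?z (l, k, g) * ?y (k, h, g) * ?x (h, j, g)))"
      using p by (simp add: P_CR_comp(2)[OF J K L yx(1) z] yx(2) sum_distrib_left mult_ac)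
    also have "\<dots> = ?cK * (\<Sum>h\<in>carrier H. \<Sum>k\<in>carrier K. ?cH * (?z (l, k, g) * ?y (k, h, g) * ?x (h, j, g)))"
      by (subst sum.swap) simp
    also have "\<dots> = hom_char J L (Comp (P_CR G) J H L (Comp (P_CR G) H K L z y) x) (l, j, g)"
      using p by (simp add: P_CR_comp(2)[OF J H L x zy(1)] zy(2) sum_distrib_left sum_distrib_right mult_ac)
    finally show "hom_char J L (Comp (P_CR G) J K L z (Comp (P_CR G) J H K y x)) (l, j, g)
      = hom_char J L (Comp (P_CR G) J H L (Comp (P_CR G) H K L z y) x) (l, j, g)" .
  qed
qed

end

section \<open>The trivial group as a progenerator\<close>

text \<open>The type of the group elements is arbitrary; \<open>undefined\<close> names an element
  of it.\<close>

definition point_group :: "'h monoid"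
  where "point_group = \<lparr>carrier = {undefined}, monoid.mult = (\<lambda>_ _. undefined), one = undefined\<rparr>"

lemma point_group_simps:
  "carrier point_group = {undefined}" "x \<otimes>\<^bsub>point_group\<^esub> y = undefined" "\<one>\<^bsub>point_group\<^esub> = undefined"
  by (simp_all add: point_group_def)

lemma group_point_group: "group point_group"
  by (rule groupI) (auto simp: point_group_simps)

context coefficient_group begin

lemma point_group_Ob: "point_group \<in> Ob (P_CR G)"
  using group_point_group by (simp add: P_CR_simps point_group_simps)

definition hom_of_function :: "'h monoid \<Rightarrow> 'h monoid \<Rightarrow> ('h \<Rightarrow> 'h \<Rightarrow> 'g \<Rightarrow> complex) \<Rightarrow> ('h \<times> 'h \<times> 'g) cr"
  where "hom_of_function H K f = finite_group.CR_of_function (K \<times>\<times> (H \<times>\<times> G))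
    (\<lambda>(k, h, g). if k \<in> carrier K \<and> h \<in> carrier H \<and> g \<in> carrier G then f k h g else 0)"

lemma hom_of_function:
  assumes H: "H \<in> Ob (P_CR G)" and K: "K \<in> Ob (P_CR G)"
    and conj: "\<And>a b c k h g. \<lbrakk>a \<in> carrier K; b \<in> carrier H; c \<in> carrier G; k \<in> carrier K; h \<in> carrier H; g \<in> carrier G\<rbrakk>
      \<Longrightarrow> f (a \<otimes>\<^bsub>K\<^esub> k \<otimes>\<^bsub>K\<^esub> inv\<^bsub>K\<^esub> a) (b \<otimes>\<^bsub>H\<^esub> h \<otimes>\<^bsub>H\<^esub> inv\<^bsub>H\<^esub> b) (c \<otimes>\<^bsub>G\<^esub> g \<otimes>\<^bsub>G\<^esub> inv\<^bsub>G\<^esub> c) = f k h g"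
  shows "hom_of_function H K f \<in> carrier (Hom (P_CR G) H K)"
    and "\<lbrakk>k \<in> carrier K; h \<in> carrier H; g \<in> carrier G\<rbrakk>
      \<Longrightarrow> hom_char H K (hom_of_function H K f) (k, h, g) = f k h g"
proof -
  interpret F: finite_group "K \<times>\<times> (H \<times>\<times> G)" by (rule finite_group_Hom[OF K H])
  interpret K: finite_group K by (rule finite_group_Ob[OF K])
  interpret H: finite_group H by (rule finite_group_Ob[OF H])
  let ?f = "\<lambda>(k, h, g). if k \<in> carrier K \<and> h \<in> carrier H \<and> g \<in> carrier G then f k h g else 0"
  have cf: "?f \<in> F.class_functions"
    unfolding F.class_functions_def
  proof (intro CollectI conjI ballI allI impI)
    fix x y assume "x \<in> carrier (K \<times>\<times> (H \<times>\<times> G))" "y \<in> carrier (K \<times>\<times> (H \<times>\<times> G))"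
    then obtain a b c k h g where "x = (a, b, c)" "y = (k, h, g)" "a \<in> carrier K" "b \<in> carrier H" "c \<in> carrier G"
      "k \<in> carrier K" "h \<in> carrier H" "g \<in> carrier G" by auto
    then show "?f (x \<otimes>\<^bsub>K \<times>\<times> (H \<times>\<times> G)\<^esub> y \<otimes>\<^bsub>K \<times>\<times> (H \<times>\<times> G)\<^esub> inv\<^bsub>K \<times>\<times> (H \<times>\<times> G)\<^esub> x) = ?f y"
      using conj by (simp add: inv_DirProd K.is_group H.is_group G.is_group DirProd_group)
  qed (auto split: if_splits)
  show "hom_of_function H K f \<in> carrier (Hom (P_CR G) H K)"
    unfolding hom_of_function_def P_CR_simps CR_simps by (rule F.CR_of_function_closed)
  show "hom_char H K (hom_of_function H K f) (k, h, g) = f k h g"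
    if "k \<in> carrier K" "h \<in> carrier H" "g \<in> carrier G"
    unfolding hom_of_function_def F.CR_character_of_function[OF cf] using that by simp
qed

text \<open>The module \<open>S\<close> with character \<open>\<chi>\<close>, and below its dual,
  as arrows between the trivial group and \<open>H\<close>. The group \<open>G\<close> acts
  trivially on them.\<close>

definition irr_in :: "'h monoid \<Rightarrow> ('h \<Rightarrow> complex) \<Rightarrow> ('h \<times> 'h \<times> 'g) cr"
  where "irr_in H \<chi> = hom_of_function point_group H (\<lambda>h _ _. \<chi> h)"

definition irr_out :: "'h monoid \<Rightarrow> ('h \<Rightarrow> complex) \<Rightarrow> ('h \<times> 'h \<times> 'g) cr"
  where "irr_out H \<chi> = hom_of_function H point_group (\<lambda>_ h _. \<chi> (inv\<^bsub>H\<^esub> h))"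

lemma irr_in_out:
  assumes H: "H \<in> Ob (P_CR G)" and \<chi>: "\<chi> \<in> finite_group.irr_characters H"
  shows "irr_in H \<chi> \<in> carrier (Hom (P_CR G) point_group H)"
    and "irr_out H \<chi> \<in> carrier (Hom (P_CR G) H point_group)"
    and "\<lbrakk>h \<in> carrier H; g \<in> carrier G\<rbrakk> \<Longrightarrow> hom_char point_group H (irr_in H \<chi>) (h, undefined, g) = \<chi> h"
    and "\<lbrakk>h \<in> carrier H; g \<in> carrier G\<rbrakk> \<Longrightarrow> hom_char H point_group (irr_out H \<chi>) (undefined, h, g) = \<chi> (inv\<^bsub>H\<^esub> h)"
proof -
  interpret H: finite_group H by (rule finite_group_Ob[OF H])
  note cf = H.class_functionsD(2)[OF H.irr_class_functions[OF \<chi>]]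
  have inv: "\<chi> (inv\<^bsub>H\<^esub> (b \<otimes>\<^bsub>H\<^esub> h \<otimes>\<^bsub>H\<^esub> inv\<^bsub>H\<^esub> b)) = \<chi> (inv\<^bsub>H\<^esub> h)" if "b \<in> carrier H" "h \<in> carrier H" for b h
    using cf[of b "inv\<^bsub>H\<^esub> h"] that by (simp add: H.inv_mult_group H.m_assoc)
  note i = hom_of_function[OF point_group_Ob H, of "\<lambda>h _ _. \<chi> h", folded irr_in_def]
  note o = hom_of_function[OF H point_group_Ob, of "\<lambda>_ h _. \<chi> (inv\<^bsub>H\<^esub> h)", folded irr_out_def]
  show "irr_in H \<chi> \<in> carrier (Hom (P_CR G) point_group H)" by (rule i(1)) (rule cf)
  show "irr_out H \<chi> \<in> carrier (Hom (P_CR G) H point_group)" by (rule o(1)) (rule inv)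
  show "hom_char point_group H (irr_in H \<chi>) (h, undefined, g) = \<chi> h" if "h \<in> carrier H" "g \<in> carrier G"
    by (rule i(2)) (use cf that in \<open>auto simp: point_group_simps\<close>)
  show "hom_char H point_group (irr_out H \<chi>) (undefined, h, g) = \<chi> (inv\<^bsub>H\<^esub> h)" if "h \<in> carrier H" "g \<in> carrier G"
    by (rule o(2)) (use inv that in \<open>auto simp: point_group_simps\<close>)
qed

text \<open>\<open>\<complex>H \<cong> \<Oplus> S \<otimes> S*\<close> over \<open>H \<times>
  H\<close>. On characters this is the second orthogonality relation.\<close>

lemma identity_factors:
  assumes H: "H \<in> Ob (P_CR G)"
  shows "(\<Oplus>\<^bsub>Hom (P_CR G) H H\<^esub>\<chi>\<in>finite_group.irr_characters H.
    Comp (P_CR G) H point_group H (irr_in H \<chi>) (irr_out H \<chi>)) = Id (P_CR G) H" (is "?s = _")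
proof -
  interpret H: finite_group H by (rule finite_group_Ob[OF H])
  note io = irr_in_out[OF H]
  note c = P_CR_comp[OF H point_group_Ob H io(2) io(1)]
  have s: "?s \<in> carrier (Hom (P_CR G) H H)"
    by (rule finsum_in_module) (use P_CR_hom_vectorspace[OF H H] c(1) in \<open>auto simp: vectorspace_iff_module\<close>)
  show ?thesis
  proof (rule P_CR_hom_eqI[OF H H s P_CR_id(1)[OF H]])
    fix h1 h2 g assume p: "h1 \<in> carrier H" "h2 \<in> carrier H" "g \<in> carrier G"
    have "hom_char H H ?s (h1, h2, g) = (\<Sum>\<chi>\<in>H.irr_characters.
        hom_char H H (Comp (P_CR G) H point_group H (irr_in H \<chi>) (irr_out H \<chi>)) (h1, h2, g))"
      unfolding P_CR_simps(2)
      by (rule finite_group.CR_character_finsum[OF finite_group_Hom[OF H H] H.finite_irr_characters])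
        (use c(1) in \<open>simp add: P_CR_simps(2)\<close>)
    also have "\<dots> = (\<Sum>\<chi>\<in>H.irr_characters. \<chi> h1 * \<chi> (inv\<^bsub>H\<^esub> h2))"
      by (rule sum.cong) (use p in \<open>simp_all add: c(2) point_group_simps io(3,4)\<close>)
    also have "\<dots> = H.conj_count h1 h2" by (rule H.sum_irr_characters[OF p(1,2)])
    finally show "hom_char H H ?s (h1, h2, g) = hom_char H H (Id (P_CR G) H) (h1, h2, g)"
      by (simp add: P_CR_id(2)[OF H p])
  qed
qed

text \<open>Pullback along \<open>1 \<times> 1 \<times> G \<rightarrow> G\<close>.\<close>

definition endo :: "'g cr \<Rightarrow> ('h \<times> 'h \<times> 'g) cr"
  where "endo x = hom_of_function point_group point_group (\<lambda>_ _ g. G.CR_character x g)"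

abbreviation "endo_character y g \<equiv> hom_char point_group point_group y (undefined, undefined, g)"

lemma endo:
  assumes "x \<in> carrier (CR G)"
  shows "endo x \<in> carrier (Hom (P_CR G) point_group point_group)"
    and "g \<in> carrier G \<Longrightarrow> endo_character (endo x) g = G.CR_character x g"
proof -
  have cf: "G.CR_character x \<in> G.class_functions"
    using assms by (intro G.CR_character_class_function) (simp add: CR_simps)
  note h = hom_of_function[OF point_group_Ob point_group_Ob, of "\<lambda>_ _ g. G.CR_character x g", folded endo_def]
  show "endo x \<in> carrier (Hom (P_CR G) point_group point_group)"
    by (rule h(1)) (rule G.class_functionsD(2)[OF cf])
  show "endo_character (endo x) g = G.CR_character x g" if "g \<in> carrier G"
    by (rule h(2)) (use G.class_functionsD(2)[OF cf] that in \<open>auto simp: point_group_simps\<close>)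
qed

lemma endo_eqI:
  assumes "y \<in> carrier (Hom (P_CR G) point_group point_group)"
    "z \<in> carrier (Hom (P_CR G) point_group point_group)"
    "\<And>g. g \<in> carrier G \<Longrightarrow> endo_character y g = endo_character z g"
  shows "y = z"
  by (rule P_CR_hom_eqI[OF point_group_Ob point_group_Ob assms(1,2)])
    (use assms(3) in \<open>auto simp: point_group_simps\<close>)

lemma endo_character_class_function:
  assumes "y \<in> carrier (Hom (P_CR G) point_group point_group)"
  shows "(\<lambda>g. endo_character y g) \<in> G.class_functions"
proof -
  interpret F: finite_group "point_group \<times>\<times> (point_group \<times>\<times> G)" by (rule finite_group_Hom[OF point_group_Ob point_group_Ob])
  interpret T: group "point_group :: 'a monoid" by (rule group_point_group)
  have y: "F.CR_character y \<in> F.class_functions"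
    using assms by (intro F.CR_character_class_function) (simp add: P_CR_simps CR_simps)
  show ?thesis
    unfolding G.class_functions_def
  proof (intro CollectI conjI ballI allI impI)
    fix c g assume "c \<in> carrier G" "g \<in> carrier G"
    then show "endo_character y (c \<otimes>\<^bsub>G\<^esub> g \<otimes>\<^bsub>G\<^esub> inv\<^bsub>G\<^esub> c) = endo_character y g"
      using F.class_functionsD(2)[OF y, of "(undefined, undefined, c)" "(undefined, undefined, g)"]
      by (simp add: inv_DirProd T.is_group G.is_group DirProd_group point_group_simps)
  next
    fix g assume "g \<notin> carrier G"
    then show "endo_character y g = 0" by (intro F.class_functionsD(1)[OF y]) simp
  qed
qed

lemma progenerator_point_group:
  "progenerator (P_CR G :: ('h monoid, ('h \<times> 'h \<times> 'g) cr) lcat) point_group finite_group.irr_characters irr_in irr_out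
    (CR G) endo"
proof (rule progenerator.intro)
  show "finitely_generating_object (P_CR G :: ('h monoid, ('h \<times> 'h \<times> 'g) cr) lcat) point_group finite_group.irr_characters irr_in irr_out"
  proof (rule finitely_generating_object.intro[OF linear_category_P_CR], rule finitely_generating_object_axioms.intro)
    show "point_group \<in> Ob (P_CR G :: ('h monoid, ('h \<times> 'h \<times> 'g) cr) lcat)" by (rule point_group_Ob)
  qed (erule finite_group_Ob [THEN finite_group.finite_irr_characters] irr_in_out(1) irr_in_out(2) identity_factors, assumption?)+
  show "algebra Cfield (CR G)" by (rule G.CR_algebra)
  let ?E = "Hom (P_CR G) (point_group :: 'h monoid) point_group"
  note T = point_group_Ob
  note Ev = vectorspaceD[OF P_CR_hom_vectorspace[OF T T]]
  note Ec = P_CR_hom_linear[OF T T]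
  note V = vectorspaceD[OF G.CR_vectorspace]
  have mult: "x \<otimes>\<^bsub>CR G\<^esub> y \<in> carrier (CR G)" "G.CR_character (x \<otimes>\<^bsub>CR G\<^esub> y) g = G.CR_character x g * G.CR_character y g"
    and lin: "G.CR_character (x \<oplus>\<^bsub>CR G\<^esub> y) g = G.CR_character x g + G.CR_character y g"
      "G.CR_character (c \<odot>\<^bsub>CR G\<^esub> x) g = c * G.CR_character x g"
    if "x \<in> carrier (CR G)" "y \<in> carrier (CR G)" for x y g c
    using G.CR_mult[of x y] G.CR_character_linear[of x y] that by (simp_all add: CR_simps(1-4))
  have one: "\<one>\<^bsub>CR G\<^esub> \<in> carrier (CR G)" "g \<in> carrier G \<Longrightarrow> G.CR_character \<one>\<^bsub>CR G\<^esub> g = 1" for g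
    using G.CR_class_closed[OF trivial_rep_reps(1)] by (simp_all add: CR_simps G.CR_character_class trivial_rep_reps)
  have comp: "Comp (P_CR G) point_group point_group point_group y x \<in> carrier ?E"
    "g \<in> carrier G \<Longrightarrow> endo_character (Comp (P_CR G) point_group point_group point_group y x) g = endo_character y g * endo_character x g"
    if "x \<in> carrier ?E" "y \<in> carrier ?E" for x y g
    using P_CR_comp[OF T T T that] by (simp_all add: point_group_simps)
  show "progenerator_axioms (P_CR G :: ('h monoid, ('h \<times> 'h \<times> 'g) cr) lcat) point_group (CR G) endo"
  proof (rule progenerator_axioms.intro)
    show "bij_betw endo (carrier (CR G)) (carrier ?E)"
    proof (rule bij_betw_byWitness[where f' = "\<lambda>y. G.CR_of_function (\<lambda>g. endo_character y g)"])
      have inv_cl: "G.CR_of_function (\<lambda>g. endo_character y g) \<in> carrier (CR G)" for y :: "('h \<times> 'h \<times> 'g) cr"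
        using G.CR_of_function_closed by (simp add: CR_simps)
      show "\<forall>x\<in>carrier (CR G). G.CR_of_function (\<lambda>g. endo_character (endo x :: ('h \<times> 'h \<times> 'g) cr) g) = x"
      proof
        fix x assume x: "x \<in> carrier (CR G)"
        show "G.CR_of_function (\<lambda>g. endo_character (endo x :: ('h \<times> 'h \<times> 'g) cr) g) = x"
          by (rule G.CR_character_inj)
            (use x inv_cl[of "endo x"] in \<open>simp_all add: CR_simps(1) G.CR_character_of_function[OF endo_character_class_function[OF endo(1)[OF x]]] endo(2)[OF x]\<close>)
      qed
      show "\<forall>y\<in>carrier ?E. endo (G.CR_of_function (\<lambda>g. endo_character y g)) = y"
      proof
        fix y assume y: "y \<in> carrier ?E"
        show "endo (G.CR_of_function (\<lambda>g. endo_character y g)) = y"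
          by (rule endo_eqI) (use y in \<open>simp_all add: endo inv_cl G.CR_character_of_function[OF endo_character_class_function[OF y]]\<close>)
      qed
      show "endo ` carrier (CR G) \<subseteq> carrier ?E" using endo(1) by auto
      show "(\<lambda>y. G.CR_of_function (\<lambda>g. endo_character y g)) ` carrier ?E \<subseteq> carrier (CR G)" using inv_cl by auto
    qed
    show "endo \<in> module_hom Cfield (CR G) ?E"
      by (rule module_homI; (rule endo_eqI)?)
        (simp_all add: endo V(1,6) Ev(1,6) Ec lin)
    show "endo (r \<otimes>\<^bsub>CR G\<^esub> s) = Comp (P_CR G) point_group point_group point_group (endo r :: ('h \<times> 'h \<times> 'g) cr) (endo s)"
      if "r \<in> carrier (CR G)" "s \<in> carrier (CR G)" for r s
      by (rule endo_eqI) (simp_all add: that endo mult comp)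
    show "endo \<one>\<^bsub>CR G\<^esub> = Id (P_CR G) (point_group :: 'h monoid)"
    proof (rule endo_eqI)
      fix g assume g: "g \<in> carrier G"
      have u: "undefined \<in> carrier (point_group :: 'h monoid)" by (simp add: point_group_simps)
      show "endo_character (endo \<one>\<^bsub>CR G\<^esub> :: ('h \<times> 'h \<times> 'g) cr) g = endo_character (Id (P_CR G) (point_group :: 'h monoid)) g"
        unfolding P_CR_id(2)[OF T u u g] finite_group.conj_count_def[OF finite_group_Ob[OF T]]
        using g by (simp add: endo one point_group_simps)
    qed (simp_all add: endo one P_CR_id(1)[OF T])
  qed
qed

end

theorem proposition4p3:
  fixes G :: "'g monoid"
  assumes "group G" and "finite (carrier G)"
  shows "linearly_equivalent
    (CRG_modules TYPE('h :: infinite) TYPE('v) G)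
    (module_category (CR G) :: (('g cr, 'v) module, 'v \<Rightarrow> 'v) lcat)"
proof -
  interpret coefficient_group G
    using assms by (simp add: coefficient_group_def finite_group_def finite_group_axioms_def)
  show ?thesis
    unfolding CRG_modules_def
    by (rule progenerator.functor_category_equivalent_module_category[OF progenerator_point_group])
qed

end
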